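(* Let $b$ be an integer with $1 \le b \le 5$ and let $\beta = [0;b,b,b,\ldots]$. Then the limits $\lim_{n\to\infty} P_{q_n}(\beta)$ and $\lim_{n\to\infty} \frac{P_{q_n-1}(\beta)}{q_n-1}$ satisfy $$\liminf_{N \to \infty} P_N(\beta) = \lim_{n \to \infty} P_{q_n}(\beta) = C_b,$$ $$\limsup_{N \to \infty} \frac{P_{N}(\beta)}{N} = \lim_{n \to \infty} \frac{P_{q_n-1}(\beta)}{q_n-1} = \frac{\sqrt{b^2 + 4}}{2\pi}\,C_b,$$ where $$C_b = \frac{2\pi}{\sqrt{b^2 + 4}}\prod_{n=1}^{\infty}\left[\left(1 - \frac{1}{\sqrt{b^2 + 4}}\cdot\frac{\{n\beta\} - \frac{1}{2}}{n}\right)^2 - \frac{\left(\frac{1}{2\sqrt{b^2 +4}}\right)^2}{n^2}\right].$$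
   Context: For $\alpha\in\mathbb{R}$ and $N\ge 1$ the Sudler product is $P_N(\alpha) = \prod_{r=1}^{N} 2|\sin(\pi r\alpha)|$. $[0;b,b,b,\ldots]$ denotes the infinite continued fraction with all partial quotients equal to $b$, i.e. $\beta = \frac12(-b+\sqrt{b^2+4})$. The integers $q_n$ are the denominators of the continued fraction convergents of $\beta$: $q_0=1$, $q_1=b$, $q_{n+1}=bq_n+q_{n-1}$ for $n\ge1$. $\{x\}$ denotes the fractional part of $x$. The infinite product is the limit of its partial products. *)

theory Defs
  imports "HOL-Analysis.Analysis"
begin

definition sudler :: "nat \<Rightarrow> real \<Rightarrow> real" where
  "sudler N \<alpha> = (\<Prod>r=1..N. 2 * \<bar>sin (pi * real r * \<alpha>)\<bar>)"

text \<open>The finite continued fraction \<open>[a 0; a 1, \<dots>, a n]\<close> and its infinite counterpart.\<close>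

fun cfrac_fin :: "(nat \<Rightarrow> real) \<Rightarrow> nat \<Rightarrow> real" where
  "cfrac_fin a 0 = a 0"
| "cfrac_fin a (Suc n) = a 0 + 1 / cfrac_fin (\<lambda>k. a (Suc k)) n"

definition cfrac_inf :: "(nat \<Rightarrow> real) \<Rightarrow> real" where
  "cfrac_inf a = lim (cfrac_fin a)"

definition const_quots :: "nat \<Rightarrow> nat \<Rightarrow> real" where
  "const_quots b k = (if k = 0 then 0 else real b)"

definition beta :: "nat \<Rightarrow> real" where
  "beta b = cfrac_inf (const_quots b)"

fun conv_den :: "nat \<Rightarrow> nat \<Rightarrow> nat" where
  "conv_den b 0 = 1"
| "conv_den b (Suc 0) = b"
| "conv_den b (Suc (Suc n)) = b * conv_den b (Suc n) + conv_den b n"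

definition C_partial :: "nat \<Rightarrow> nat \<Rightarrow> real" where
  "C_partial b M = (\<Prod>n=1..M.
     (1 - 1 / sqrt (real b ^ 2 + 4) * ((frac (real n * beta b) - 1 / 2) / real n))\<^sup>2
       - (1 / (2 * sqrt (real b ^ 2 + 4)))\<^sup>2 / (real n)\<^sup>2)"

text \<open>
  The product is a limit of partial products taken in the natural order (it need not converge
  absolutely), so it is not rendered by \<^const>\<open>prodinf\<close>, whose notion of convergence also
  demands a nonzero limit.  As \<^const>\<open>lim\<close> is total, this value is meaningful only together
  with \<^term>\<open>convergent (C_partial b)\<close>.
\<close>

definition C_const :: "nat \<Rightarrow> real" where
  "C_const b = 2 * pi / sqrt (real b ^ 2 + 4) * lim (C_partial b)"

text \<open>Consistency of \<^const>\<open>beta\<close> and \<^const>\<open>conv_den\<close> with the closed form of the continued fraction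
  and with its convergents.\<close>

lemma cfrac_fin_const_Suc:
  "cfrac_fin (const_quots b) (Suc n) = 1 / (real b + cfrac_fin (const_quots b) n)"
proof -
  have shift: "(\<lambda>k. const_quots b (Suc k)) = (\<lambda>_. real b)"
    by (simp add: const_quots_def)
  have "cfrac_fin (\<lambda>_. real b) n = real b + cfrac_fin (const_quots b) n"
    by (cases n) (simp_all add: shift, simp_all add: const_quots_def)
  then show ?thesis
    by (simp add: shift, simp add: const_quots_def)
qed

lemma q_pos: "b \<ge> 1 \<Longrightarrow> conv_den b n > 0"
  by (induction b n rule: conv_den.induct) auto

lemma cfrac_fin_eq_q:
  assumes "b \<ge> 1"
  shows "cfrac_fin (const_quots b) (Suc n) = real (conv_den b n) / real (conv_den b (Suc n))"
proof (induction n)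
  case 0
  show ?case by (subst cfrac_fin_const_Suc) (simp add: const_quots_def)
next
  case (Suc n)
  have "real (conv_den b (Suc n)) > 0" using q_pos[OF assms] by simp
  then show ?case
    by (subst cfrac_fin_const_Suc, subst Suc) (simp add: field_simps)
qed

lemma coprime_q: "coprime (conv_den b n) (conv_den b (Suc n))"
proof (induction n)
  case (Suc n)
  have "gcd (conv_den b (Suc n)) (b * conv_den b (Suc n) + conv_den b n) = gcd (conv_den b (Suc n)) (conv_den b n)"
    using gcd_add_mult[of "conv_den b (Suc n)" b "conv_den b n"] by (simp add: add.commute)
  with Suc show ?case
    by (simp add: coprime_iff_gcd_eq_1 gcd.commute)
qed simp

lemma cfrac_fin_tendsto:
  assumes "b \<ge> 1"
  shows "cfrac_fin (const_quots b) \<longlonglongrightarrow> (- real b + sqrt (real b ^ 2 + 4)) / 2"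
proof -
  define x where "x = (- real b + sqrt (real b ^ 2 + 4)) / 2"
  define c where "c = cfrac_fin (const_quots b)"
  have b1: "real b \<ge> 1" using assms by simp
  have "sqrt (real b ^ 2 + 4) > sqrt (real b ^ 2)" by (rule real_sqrt_less_mono) simp
  then have x0: "x > 0" by (simp add: x_def)
  have "(sqrt (real b ^ 2 + 4))\<^sup>2 = real b ^ 2 + 4" by simp
  then have "x * (real b + x) = 1"
    by (simp add: x_def field_simps power2_eq_square)
  then have xeq: "x = 1 / (real b + x)" using x0 b1 by (simp add: field_simps)
  have x1: "x < 1" by (subst xeq) (use x0 b1 in \<open>simp add: field_simps\<close>)
  have cS: "c (Suc n) = 1 / (real b + c n)" for n
    unfolding c_def by (rule cfrac_fin_const_Suc)
  have c0: "c n \<ge> 0" for n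
    by (induction n) (auto simp: cS, simp add: c_def const_quots_def)
  have step: "\<bar>c (Suc n) - x\<bar> \<le> x * \<bar>c n - x\<bar>" for n
  proof -
    have pos: "real b + c n \<ge> 1" "real b + x > 0" using c0[of n] x0 b1 by auto
    have "c (Suc n) - x = 1 / (real b + c n) - 1 / (real b + x)"
      using cS xeq by simp
    also have "\<dots> = (x - c n) / (real b + c n) * (1 / (real b + x))"
      using pos by (simp add: field_simps)
    also have "\<dots> = (x - c n) / (real b + c n) * x" using xeq by simp
    finally have "\<bar>c (Suc n) - x\<bar> = \<bar>c n - x\<bar> / (real b + c n) * x"
      using pos x0 by (simp add: abs_mult abs_minus_commute)
    moreover have "\<bar>c n - x\<bar> / (real b + c n) \<le> \<bar>c n - x\<bar>"
      using pos(1) by (simp add: divide_le_eq mult_left_mono[of 1 _ "\<bar>c n - x\<bar>", simplified])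
    ultimately show ?thesis
      using x0 mult_right_mono[of _ _ x] by (metis less_imp_le mult.commute)
  qed
  have bound: "\<bar>c n - x\<bar> \<le> x ^ n * x" for n
  proof (induction n)
    case 0
    then show ?case using x0 by (simp add: c_def const_quots_def)
  next
    case (Suc n)
    have "\<bar>c (Suc n) - x\<bar> \<le> x * \<bar>c n - x\<bar>" by (rule step)
    also have "\<dots> \<le> x * (x ^ n * x)" using Suc x0 by (intro mult_left_mono) auto
    finally show ?case by simp
  qed
  have "(\<lambda>n. x ^ n * x) \<longlonglongrightarrow> 0"
    using tendsto_mult_right[OF LIMSEQ_realpow_zero[of x], of x] x0 x1 by simp
  then have "(\<lambda>n. c n - x) \<longlonglongrightarrow> 0"
    by (rule Lim_null_comparison[rotated]) (use bound in auto)
  then show ?thesis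
    unfolding c_def x_def by (simp add: LIM_zero_iff)
qed

lemma beta_closed_form:
  "b \<ge> 1 \<Longrightarrow> beta b = (- real b + sqrt (real b ^ 2 + 4)) / 2"
  unfolding beta_def cfrac_inf_def by (rule limI, rule cfrac_fin_tendsto)

end

theory Submission
  imports Defs "HOL-Real_Asymp.Real_Asymp"
begin

text \<open>
  Write \<open>bt\<close> for the quadratic irrational, \<open>z = 1 / bt = b + bt\<close>, and \<open>q j\<close> for the denominators of its
  convergents. A product over \<open>c * q j + M\<close> consecutive factors splits into \<open>c\<close> full blocks of length \<open>q j\<close>
  and a rest of length \<open>M\<close>, where each piece is started at a shift \<open>x\<close> that is measured in units of the tiny
  distance \<open>bt ^ (j + 1)\<close> from \<open>q j * bt\<close> to the nearest integer. This is \<open>G j M x\<close>, with \<open>F j x = G j (q j) x\<close>.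
  Because \<open>bt\<close> has constant partial quotients, passing to the next lower level just replaces \<open>x\<close> by \<open>- bt * x\<close>
  (\<open>G_Suc_level\<close>), so that all levels look alike.

  Sorting the points \<open>n * bt\<close> of a full block around the circle gives a product formula for \<open>F j x\<close> whose factors
  are sines at nearly equidistant, exactly symmetric points (\<open>F_eq_prod\<close>, \<open>zm_reflect\<close>). Three consequences carry
  the argument.

  \<^item> Compared with the full sine product \<open>q = (\<Prod>0 < m < q. 2 * sin (pi * m / q))\<close>, the unshifted block
  \<open>p j = F j 0\<close> is a product of correction factors. The one with index \<open>m\<close> tends to
  \<open>zm m * (zm m + 1) / (lam * m)\<^sup>2\<close>, which is the \<open>m\<close>-th factor of \<open>C_partial\<close>, and the tails are uniformly
  small by partial summation, because the sawtooth sums of \<open>n * bt\<close> are \<open>O(sqrt N)\<close>. Hence \<open>p j\<close> converges to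
  \<open>C_const b\<close> (\<open>p_tendsto\<close>). This works for every \<open>b\<close>.

  \<^item> \<open>F j x\<close> is at least \<open>p j * (1 + x)\<close> left of \<open>0\<close>, and at least \<open>p j\<close> between \<open>0\<close> and \<open>z - 1\<close>
  (\<open>F_left\<close>, \<open>F_right_ge_p\<close>): products of sines are log-concave, and the value at the right end is controlled
  by the block one level below.

  \<^item> The numbers \<open>p j\<close> satisfy a two-sided recursion \<open>p (j + 2) \<approx> K * p j * p (j + 1) ^ b\<close>. Its logarithm is an
  unstable linear recursion, so a solution that stays bounded can never cross the fixed point in the wrong
  direction. This turns estimates of \<open>K\<close> into bounds for all \<open>p j\<close> and for their limit
  (\<open>p_threshold_lower\<close>, \<open>p_limit_ge\<close>) without any explicit evaluation of the infinite product.

  Once the blocks are known to be large enough, induction over the digits of \<open>M\<close> in the base \<open>(q j)\<close> shows that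
  no partial block \<open>G j M x\<close> with a shift that can occur falls below a bound depending on \<open>x\<close> only
  (\<open>partial_block_bounds\<close>). For the lower limit this gives \<open>p k \<le> sudler N bt\<close> for \<open>q k \<le> N < q (k + 1)\<close>.
  For the upper limit one reflects: with \<open>Q = q (k + 1)\<close> and \<open>M = Q - 1 - N\<close>, the product up to \<open>Q - 1\<close> is
  \<open>sudler N bt * G k M bt\<close>, and it is enough that \<open>G k M bt * N / Q\<close> is asymptotically at least \<open>1\<close>. This is
  decided by the two leading digits of \<open>M\<close>. Both steps are reduced to finitely many rational inequalities, which
  hold for \<open>b \<le> 5\<close> because there the limit of \<open>p j\<close> is sufficiently larger than \<open>1\<close>.
\<close>

section \<open>The quadratic irrational and its convergents\<close>

locale metallic =
  fixes b :: nat
  assumes b_ge_1: "1 \<le> b"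
begin

text \<open>The slope of the rotation; below it is used only through \<open>bt\<^sup>2 + b * bt = 1\<close> and \<open>0 < bt < 1\<close>.\<close>

definition bt :: real where "bt = beta b"
definition q :: "nat \<Rightarrow> nat" where "q j = conv_den b j"

text \<open>The numerator of the convergent with denominator \<open>q j\<close>: for constant quotients it is the previous denominator.\<close>

definition q' :: "nat \<Rightarrow> nat" where "q' j = (if j = 0 then 0 else q (j - 1))"
definition z :: real where "z = real b + bt"

lemma bt_root: "bt\<^sup>2 = 1 - real b * bt"
proof -
  have "bt = (- real b + sqrt (real b ^ 2 + 4)) / 2"
    unfolding bt_def by (rule beta_closed_form[OF b_ge_1])
  then have "2 * bt + real b = sqrt (real b ^ 2 + 4)" by simp
  then have "(2 * bt + real b)\<^sup>2 = real b ^ 2 + 4" by simp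
  then show ?thesis by (simp add: power2_eq_square algebra_simps)
qed

lemma bt_pos: "0 < bt"
proof -
  have "sqrt (real b ^ 2 + 4) > sqrt (real b ^ 2)" by (rule real_sqrt_less_mono) simp
  then show ?thesis unfolding bt_def beta_closed_form[OF b_ge_1] by simp
qed

lemma bt_z: "bt * z = 1"
  using bt_root by (simp add: z_def power2_eq_square algebra_simps)

lemma z_gt_1: "1 < z"
  using bt_pos b_ge_1 by (simp add: z_def)

lemma bt_less_1: "bt < 1"
proof -
  have "bt * 1 < bt * z" using z_gt_1 bt_pos by (intro mult_strict_left_mono) auto
  then show ?thesis by (simp add: bt_z)
qed

lemma z_eq: "z = 1 / bt"
  using bt_z bt_pos by (simp add: field_simps)

text \<open>\<open>lam = z + bt\<close> is the limit of \<open>1 / (q j * bt ^ (j + 1))\<close>, see \<open>q_closed\<close>: the mean spacing of the points of a block in units of \<open>bt ^ (j + 1)\<close>.\<close>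

definition lam :: real where "lam = sqrt (real b ^ 2 + 4)"

lemma lam_eq: "lam = real b + 2 * bt"
  unfolding lam_def bt_def beta_closed_form[OF b_ge_1] by (simp add: field_simps)

lemma lam_z: "lam = z + bt"
  by (simp add: lam_eq z_def)

lemma lam_pos: "0 < lam"
  using lam_eq bt_pos by simp

lemma q_0 [simp]: "q 0 = 1" and q_1: "q (Suc 0) = b"
  and q_Suc_Suc: "q (Suc (Suc j)) = b * q (Suc j) + q j"
  by (simp_all add: q_def)

lemma q'_0 [simp]: "q' 0 = 0" and q'_Suc [simp]: "q' (Suc j) = q j"
  by (simp_all add: q'_def)

lemma q_Suc: "q (Suc j) = b * q j + q' j"
  by (cases j) (simp_all add: q_1 q_Suc_Suc)

lemma q_positive: "0 < q j"
  unfolding q_def by (rule q_pos[OF b_ge_1])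

lemma q_ge_1: "1 \<le> q j"
  using q_positive[of j] by simp

lemma q_mono_Suc: "q j \<le> q (Suc j)"
proof -
  have "1 * q j \<le> b * q j" using b_ge_1 by (rule mult_le_mono1)
  then show ?thesis using q_Suc[of j] by linarith
qed

lemma q_mono: "i \<le> j \<Longrightarrow> q i \<le> q j"
  by (rule lift_Suc_mono_le[of q, OF q_mono_Suc])

lemma coprime_q_q': "coprime (q j) (q' j)"
  by (cases j) (use coprime_q[of b] in \<open>auto simp: q_def coprime_commute\<close>)

lemma q_bt: "real (q j) * bt = real (q' j) + (-1) ^ j * bt ^ Suc j"
proof (induction j)
  case (Suc j)
  have "real (q (Suc j)) * bt = real b * (real (q j) * bt) + real (q' j) * bt"
    by (simp add: q_Suc algebra_simps)
  also have "\<dots> = real b * real (q j) * bt + real (q' j) * bt" by simp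
  also have "real (q' j) * bt = real (q j) * bt\<^sup>2 - (-1) ^ j * bt ^ Suc (Suc j)"
    using Suc by (simp add: power2_eq_square algebra_simps)
  also have "real (q j) * bt\<^sup>2 = real (q j) - real b * real (q j) * bt"
    by (simp add: bt_root algebra_simps)
  finally show ?case by simp
qed simp

text \<open>This is the determinant identity of the convergents in real form: the gaps of lengths \<open>bt ^ j\<close> and \<open>bt ^ (j + 1)\<close>, taken \<open>q j\<close> and \<open>q' j\<close> times, fill the circle.\<close>

lemma q_unimodular: "real (q j) * bt ^ j + real (q' j) * bt ^ Suc j = 1"
proof (induction j)
  case (Suc j)
  have "real (q (Suc j)) * bt ^ Suc j + real (q' (Suc j)) * bt ^ Suc (Suc j)
      = real (q j) * bt ^ j * (real b * bt + bt\<^sup>2) + real (q' j) * bt ^ Suc j"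
    by (simp add: q_Suc algebra_simps power2_eq_square)
  then show ?case using Suc by (simp add: bt_root)
qed simp

lemma q_bt_le_1: "real (q j) * bt ^ j \<le> 1"
proof -
  have "0 \<le> real (q' j) * bt ^ Suc j" using bt_pos by simp
  then show ?thesis using q_unimodular[of j] by linarith
qed

lemma q_closed: "real (q j) * lam * bt ^ Suc j = 1 + (-1) ^ j * bt ^ (2 * j + 2)"
proof -
  have "real (q' j) = real (q j) * bt - (-1) ^ j * bt ^ Suc j" using q_bt[of j] by simp
  then have "real (q j) * bt ^ j + (real (q j) * bt - (-1) ^ j * bt ^ Suc j) * bt ^ Suc j = 1"
    using q_unimodular[of j] by simp
  moreover have "real (q j) * lam * bt ^ Suc j = real (q j) * bt ^ j * (bt * z) + real (q j) * bt * bt ^ Suc j"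
    by (simp add: lam_z algebra_simps)
  moreover have "bt ^ (2 * j + 2) = bt ^ Suc j * bt ^ Suc j"
    unfolding power_add[symmetric] by (rule arg_cong[where f = "power bt"]) simp
  moreover have "bt ^ (j * 2) = bt ^ j * bt ^ j" by (simp add: power_mult power2_eq_square)
  ultimately show ?thesis by (simp add: bt_z algebra_simps)
qed

lemma bt_pow_tendsto_0: "(\<lambda>j. bt ^ j) \<longlonglongrightarrow> 0"
  using bt_pos bt_less_1 by (intro LIMSEQ_realpow_zero) auto

text \<open>If \<open>n * bt = m\<close>, then the integer \<open>q j * m - n * q' j\<close> equals \<open>n * bt ^ (j + 1)\<close> up to sign, which is nonzero but tends to \<open>0\<close>.\<close>

lemma bt_irrational:
  assumes "0 < n"
  shows "real n * bt \<noteq> real m"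
proof
  assume eq: "real n * bt = real m"
  have "(\<lambda>j. real n * bt ^ Suc j) \<longlonglongrightarrow> real n * 0"
    by (intro tendsto_intros LIMSEQ_Suc[OF bt_pow_tendsto_0])
  then have "\<forall>\<^sub>F j in sequentially. real n * bt ^ Suc j < 1"
    by (intro order_tendstoD) auto
  then obtain j where j: "real n * bt ^ Suc j < 1" by (auto simp: eventually_sequentially)
  have "real (q j) * real m = real n * (real (q j) * bt)" using eq by simp
  also have "\<dots> = real n * real (q' j) + (-1) ^ j * (real n * bt ^ Suc j)"
    unfolding q_bt by (simp add: algebra_simps)
  finally have *: "real_of_int (int (q j) * int m - int n * int (q' j)) = (-1) ^ j * (real n * bt ^ Suc j)"
    by simp
  define k where "k = int (q j) * int m - int n * int (q' j)"
  have "\<bar>real_of_int k\<bar> = real n * bt ^ Suc j"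
    unfolding k_def * using bt_pos by (simp add: abs_mult power_abs)
  moreover have "0 < real n * bt ^ Suc j" using assms bt_pos by simp
  ultimately have "0 < \<bar>real_of_int k\<bar>" "\<bar>real_of_int k\<bar> < 1" using j by auto
  then have "0 < \<bar>k\<bar>" "\<bar>k\<bar> < 1" by (simp_all flip: of_int_abs)
  then show False by linarith
qed

lemma q_Suc_Suc_ge_double: "2 * q j \<le> q (Suc (Suc j))"
proof -
  have "1 * q (Suc j) \<le> b * q (Suc j)" using b_ge_1 by (rule mult_le_mono1)
  then show ?thesis using q_Suc_Suc[of j] q_mono_Suc[of j] by linarith
qed

lemma q_ge_exp: "2 ^ j \<le> q (2 * j)"
proof (induction j)
  case (Suc j) then show ?case using q_Suc_Suc_ge_double[of "2 * j"] by simp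
qed simp

lemma q_unbounded: "\<exists>j. N < q j"
proof -
  have "N < 2 ^ N" by simp
  then show ?thesis using q_ge_exp[of N] by (intro exI[of _ "2 * N"]) linarith
qed

lemma filterlim_q: "filterlim q at_top sequentially"
proof (subst filterlim_at_top, intro allI)
  fix N
  obtain j where "N < q j" using q_unbounded by blast
  then show "\<forall>\<^sub>F n in sequentially. N \<le> q n"
    by (intro eventually_sequentiallyI[of j]) (meson le_trans less_imp_le q_mono)
qed

end

section \<open>Trigonometric inequalities\<close>

text \<open>Concavity of \<open>ln \<circ> sin\<close> on \<open>(0, pi)\<close>, in the form of the tangent line at \<open>x\<close>.\<close>

lemma ln_sin_le_tangent:
  assumes "0 < x" "x < pi" "0 < y" "y < pi"
  shows "ln (sin y) \<le> ln (sin x) + (y - x) * cot x"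
proof -
  have "concave_on {0<..<pi} (\<lambda>x. ln (sin x))"
    unfolding concave_on_def
  proof (rule f''_ge0_imp_convex[where f' = "\<lambda>x. - cot x" and f'' = "\<lambda>x. inverse ((sin x)\<^sup>2)"])
    fix x :: real assume "x \<in> {0<..<pi}"
    then have "sin x > 0" by (simp add: sin_gt_zero)
    then show "DERIV (\<lambda>x. - ln (sin x)) x :> - cot x"
      by (auto intro!: derivative_eq_intros simp: cot_def field_simps)
    show "DERIV (\<lambda>x. - cot x) x :> inverse ((sin x)\<^sup>2)"
      using DERIV_minus[OF DERIV_cot[of x]] \<open>sin x > 0\<close> by simp
  qed auto
  then have "convex_on {0<..<pi} (\<lambda>x. - ln (sin x))" by (simp add: concave_on_def)
  moreover have "((\<lambda>x. - ln (sin x)) has_field_derivative - cot x) (at x within {0<..<pi})"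
  proof -
    have "sin x > 0" using assms by (simp add: sin_gt_zero)
    then show ?thesis
      by (auto intro!: derivative_eq_intros simp: cot_def field_simps)
  qed
  ultimately have "- ln (sin y) - - ln (sin x) \<ge> - cot x * (y - x)"
    using assms by (intro convex_on_imp_above_tangent[where A = "{0<..<pi}"])
      (auto simp: interior_open)
  then show ?thesis by (simp add: algebra_simps)
qed

text \<open>The same concavity along a chord, which is what interpolation of sine products between two shifts needs.\<close>

lemma sin_geo_mean:
  assumes "0 < x" "x < pi" "0 < y" "y < pi" "0 \<le> c" "c \<le> 1"
  shows "sin x powr (1 - c) * sin y powr c \<le> sin ((1 - c) * x + c * y)"
proof -
  define w where "w = (1 - c) * x + c * y"
  have w: "0 < w" "w < pi"
  proof -
    have "convex {0<..<pi}" by (rule convex_real_interval)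
    then have "w \<in> {0<..<pi}"
      using assms convexD[of "{0<..<pi}" x y "1 - c" c] by (simp add: w_def)
    then show "0 < w" "w < pi" by auto
  qed
  have pos: "0 < sin x" "0 < sin y" "0 < sin w" using assms w by (auto intro: sin_gt_zero)
  have "(1 - c) * ln (sin x) + c * ln (sin y)
      \<le> (1 - c) * (ln (sin w) + (x - w) * cot w) + c * (ln (sin w) + (y - w) * cot w)"
    using assms w by (intro add_mono mult_left_mono ln_sin_le_tangent) auto
  also have "\<dots> = ln (sin w) + ((1 - c) * x + c * y - w) * cot w" by (simp add: algebra_simps)
  also have "\<dots> = ln (sin w)" by (simp add: w_def)
  finally have "exp ((1 - c) * ln (sin x) + c * ln (sin y)) \<le> sin w"
    using pos by (metis exp_le_cancel_iff exp_ln)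
  then show ?thesis using pos by (simp add: powr_def exp_add w_def)
qed

text \<open>\<open>sin x / x\<close> decreases on \<open>(0, pi)\<close>; stated without division so that it applies in both directions below.\<close>

lemma sin_div_antimono:
  fixes x y :: real
  assumes "0 < x" "x \<le> y" "y < pi"
  shows "x * sin y \<le> y * sin x"
proof -
  define c where "c = x / y"
  have c: "0 \<le> c" "c \<le> 1" "c * y = x" using assms by (auto simp: c_def)
  have "concave_on {0..pi} sin"
    unfolding concave_on_def
    by (rule f''_ge0_imp_convex[where f' = "\<lambda>x. - cos x" and f'' = sin])
       (auto intro!: derivative_eq_intros sin_ge_zero)
  then have "(1 - c) * sin 0 + c * sin y \<le> sin ((1 - c) *\<^sub>R 0 + c *\<^sub>R y)"
    using assms c by (intro concave_onD) auto
  then have "c * sin y \<le> sin x" using c by simp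
  then show ?thesis using assms by (simp add: c_def field_simps)
qed

lemma sin_ratio_ge:
  fixes t u v :: real
  assumes "0 < t" "0 \<le> u" "u \<le> v" "0 < v" "t * v < pi"
  shows "u / v \<le> sin (t * u) / sin (t * v)"
proof (cases "u = 0")
  case False
  have "0 < sin (t * v)" using assms by (intro sin_gt_zero) auto
  moreover have "(t * u) * sin (t * v) \<le> (t * v) * sin (t * u)"
    using assms False by (intro sin_div_antimono) (auto intro: mult_left_mono)
  ultimately show ?thesis using assms by (simp add: field_simps)
qed simp

lemma sin_ratio_le:
  fixes t u v :: real
  assumes "0 < t" "0 < v" "v \<le> u" "t * u < pi"
  shows "sin (t * u) / sin (t * v) \<le> u / v"
proof -
  have "t * v \<le> t * u" using assms by simp
  then have "t * v < pi" using assms by linarith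
  then have "0 < sin (t * v)" using assms by (intro sin_gt_zero) auto
  moreover have "(t * v) * sin (t * u) \<le> (t * u) * sin (t * v)"
    using assms by (intro sin_div_antimono) (auto intro: mult_left_mono)
  ultimately show ?thesis using assms by (simp add: field_simps)
qed

lemma sin_ge_cubic:
  fixes x :: real
  assumes "0 \<le> x"
  shows "x - x ^ 3 / 6 \<le> sin x"
proof -
  define g where "g = (\<lambda>x::real. sin x - x + x ^ 3 / 6)"
  have "g 0 \<le> g x"
  proof (rule DERIV_nonneg_imp_nondecreasing[OF assms])
    fix y :: real assume "0 \<le> y" "y \<le> x"
    have "(g has_real_derivative cos y - 1 + y\<^sup>2 / 2) (at y)"
      unfolding g_def by (auto intro!: derivative_eq_intros simp: power2_eq_square)
    moreover have "0 \<le> cos y - 1 + y\<^sup>2 / 2"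
    proof -
      have "cos y = 1 - 2 * (sin (y / 2))\<^sup>2" using cos_double_sin[of "y / 2"] by simp
      moreover have "(sin (y / 2))\<^sup>2 \<le> (y / 2)\<^sup>2"
        using abs_sin_x_le_abs_x[of "y / 2"] by (metis abs_le_square_iff)
      ultimately show ?thesis by (simp add: power2_eq_square)
    qed
    ultimately show "\<exists>d. (g has_real_derivative d) (at y) \<and> 0 \<le> d" by blast
  qed
  then show ?thesis by (simp add: g_def)
qed

text \<open>The symmetric product over two points \<open>u\<close> and \<open>- 1 - u\<close>, seen from a moving
  point \<open>x\<close>, depends on \<open>x\<close> only through \<open>sin (t * x) * sin (t * (1 + x))\<close>.\<close>

lemma sin_pair:
  fixes t u x :: real
  shows "sin (t * (1 + u + x)) * sin (t * (u - x))
    = sin (t * (1 + u)) * sin (t * u) - sin (t * x) * sin (t * (1 + x))"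
proof -
  have *: "sin a * sin c = (cos (a - c) - cos (a + c)) / 2" for a c :: real
    by (simp add: cos_diff cos_add)
  have "t * (1 + u + x) - t * (u - x) = t * (1 + x) + t * x"
    "t * (1 + u + x) + t * (u - x) = t * (1 + u) + t * u"
    "t * (1 + u) - t * u = t" "t * (1 + x) - t * x = t"
    by (simp_all add: algebra_simps)
  then have "sin (t * (1 + u + x)) * sin (t * (u - x)) = (cos (t * (1 + x) + t * x) - cos (t * (1 + u) + t * u)) / 2"
    "sin (t * (1 + u)) * sin (t * u) = (cos t - cos (t * (1 + u) + t * u)) / 2"
    "sin (t * (1 + x)) * sin (t * x) = (cos t - cos (t * (1 + x) + t * x)) / 2"
    by (simp_all only: *)
  moreover have "sin (t * x) * sin (t * (1 + x)) = sin (t * (1 + x)) * sin (t * x)" by simp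
  ultimately show ?thesis by (simp add: field_simps)
qed

text \<open>The values \<open>2 * sin (pi * k / n)\<close> are the distances from \<open>1\<close> to the other \<open>n\<close>-th roots of unity, so their product is the derivative of \<open>X ^ n - 1\<close> at \<open>1\<close>.\<close>

lemma prod_two_sin_eq:
  assumes "0 < n"
  shows "(\<Prod>k=1..<n. 2 * sin (pi * real k / real n)) = real n"
proof -
  define w where "w k = cis (2 * pi * real k / real n)" for k
  define P where "P = (\<Prod>k=1..<n. [:- w k, 1:])"
  define Q where "Q = (\<Sum>i<n. monom (1::complex) i)"
  have bij: "bij_betw w {..<n} {z. z ^ n = 1}"
    unfolding w_def by (rule Complex.bij_betw_roots_unity[OF assms])
  have inj: "inj_on w {1..<n}"
    by (rule inj_on_subset[OF bij_betw_imp_inj_on[OF bij]]) auto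
  have w0: "w 0 = 1" by (simp add: w_def)
  have w_ne_1: "w k \<noteq> 1" if "k \<in> {1..<n}" for k
    using inj_onD[OF bij_betw_imp_inj_on[OF bij], of k 0] that w0 by auto
  have degP: "degree P = n - 1"
    unfolding P_def by (subst degree_prod_eq_sum_degree) auto
  have Q_coeff: "coeff Q i = (if i < n then 1 else 0)" for i
    by (simp add: Q_def coeff_sum)
  have degQ: "degree Q = n - 1"
    using assms by (intro antisym degree_le le_degree) (auto simp: Q_coeff)
  have polyQ: "poly Q x = (\<Sum>i<n. x ^ i)" for x
    by (simp add: Q_def poly_sum poly_monom)
  have "P = Q"
  proof (rule poly_eqI_degree_lead_coeff[where A = "w ` {1..<n}" and n = "n - 1"])
    show "card (w ` {1..<n}) \<ge> n - 1" by (subst card_image[OF inj]) simp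
    fix x assume "x \<in> w ` {1..<n}"
    then obtain k where k: "k \<in> {1..<n}" "x = w k" by blast
    have "poly P x = 0" unfolding P_def poly_prod k(2)
      by (rule prod_zero) (use k(1) in auto)
    moreover have "x ^ n = 1" using bij k unfolding bij_betw_def by fastforce
    then have "poly Q x = 0" unfolding polyQ
      using w_ne_1[OF k(1)] k(2) by (simp add: geometric_sum)
    ultimately show "poly P x = poly Q x" by simp
  next
    have "lead_coeff P = 1" unfolding P_def by (simp add: lead_coeff_prod)
    then show "coeff P (n - 1) = coeff Q (n - 1)"
      using degP assms by (simp add: Q_coeff)
  qed (use degP degQ in auto)
  then have "poly P 1 = of_nat n" by (simp add: polyQ)
  then have eq: "cmod (\<Prod>k=1..<n. 1 - w k) = real n" by (simp add: P_def poly_prod)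
  have norm: "cmod (1 - w k) = 2 * sin (pi * real k / real n)" if "k \<in> {1..<n}" for k
  proof -
    define a where "a = pi * real k / real n"
    have "0 \<le> a" "a \<le> pi" using that by (auto simp: a_def field_simps)
    then have s: "0 \<le> sin a" by (rule sin_ge_zero)
    have "w k = cis (2 * a)" by (simp add: w_def a_def mult.assoc)
    then have "(cmod (1 - w k))\<^sup>2 = (1 - cos (2 * a))\<^sup>2 + (sin (2 * a))\<^sup>2"
      by (simp add: cmod_power2)
    also have "\<dots> = 2 - 2 * cos (2 * a)"
      using sin_cos_squared_add[of "2 * a"] by (simp add: power2_eq_square algebra_simps)
    also have "\<dots> = (2 * sin a)\<^sup>2" by (simp add: cos_double_sin power2_eq_square)
    finally have sq: "(cmod (1 - w k))\<^sup>2 = (2 * sin a)\<^sup>2" .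
    have "0 \<le> 2 * sin a" using s by simp
    then have "cmod (1 - w k) = 2 * sin a" by (rule power2_eq_imp_eq[OF sq norm_ge_zero])
    then show ?thesis by (simp add: a_def)
  qed
  have "(\<Prod>k=1..<n. 2 * sin (pi * real k / real n)) = (\<Prod>k=1..<n. cmod (1 - w k))"
    using norm by (intro prod.cong) auto
  also have "\<dots> = cmod (\<Prod>k=1..<n. 1 - w k)" by (rule prod_norm)
  finally show ?thesis using eq by simp
qed

context metallic
begin

section \<open>Shifted products and their splitting\<close>

definition sprod :: "nat \<Rightarrow> real \<Rightarrow> real" where
  "sprod M s = (\<Prod>n=1..M. 2 * \<bar>sin (pi * (real n * bt + s))\<bar>)"

definition gap :: "nat \<Rightarrow> real" where "gap j = bt ^ Suc j"

text \<open>A piece of length \<open>M\<close> at level \<open>j\<close>. The sign \<open>(-1) ^ j\<close> is the side on which \<open>q j * bt\<close> misses the integers, so that advancing by one full block always adds \<open>1\<close> to \<open>x\<close>.\<close>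

definition G :: "nat \<Rightarrow> nat \<Rightarrow> real \<Rightarrow> real" where
  "G j M x = sprod M ((-1) ^ j * x * gap j)"
definition F :: "nat \<Rightarrow> real \<Rightarrow> real" where "F j x = G j (q j) x"
definition p :: "nat \<Rightarrow> real" where "p j = sudler (q j) bt"

text \<open>The distance from \<open>q j * bt\<close> to the nearest integer, as an angle.\<close>

definition t :: "nat \<Rightarrow> real" where "t j = pi * gap j"

text \<open>\<open>1 + zm m\<close> is the position, in units of \<open>gap j\<close>, of the \<open>m\<close>-th point of a full block (see \<open>F_eq_prod\<close>). It is the same number on all levels.\<close>

definition zm :: "nat \<Rightarrow> real" where "zm m = real m * z + of_int \<lfloor>real m * bt\<rfloor>"

lemma abs_sin_int_shift: "\<bar>sin (pi * (x + of_int k))\<bar> = \<bar>sin (pi * x)\<bar>"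
proof -
  have "sin (pi * of_int k) = 0" "\<bar>cos (pi * of_int k)\<bar> = 1"
    using sin_zero_abs_cos_one[of "pi * of_int k"] sin_zero_iff_int2 by auto
  then show ?thesis by (simp add: distrib_left sin_add abs_mult)
qed

lemma abs_sin_sign: "\<bar>sin (pi * ((-1) ^ j * x))\<bar> = \<bar>sin (pi * x)\<bar>"
  by (cases "even j") simp_all

lemma sprod_nonneg: "0 \<le> sprod M s"
  unfolding sprod_def by (intro prod_nonneg) auto

lemma sprod_0 [simp]: "sprod 0 s = 1"
  by (simp add: sprod_def)

lemma sprod_int_shift: "sprod M (s + of_int k) = sprod M s"
  unfolding sprod_def
  by (intro prod.cong refl) (metis abs_sin_int_shift add.assoc)

lemma sprod_add: "sprod (N + M) s = sprod N s * sprod M (s + real N * bt)"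
proof -
  have "sprod (N + M) s = sprod N s * (\<Prod>n=N+1..N+M. 2 * \<bar>sin (pi * (real n * bt + s))\<bar>)"
    unfolding sprod_def by (rule prod.ub_add_nat) simp
  also have "(\<Prod>n=N+1..N+M. 2 * \<bar>sin (pi * (real n * bt + s))\<bar>) = sprod M (s + real N * bt)"
    unfolding sprod_def
    by (rule prod.reindex_bij_witness[of _ "\<lambda>n. n + N" "\<lambda>n. n - N"])
       (auto simp: of_nat_diff algebra_simps)
  finally show ?thesis .
qed

lemma sudler_eq_sprod: "sudler N bt = sprod N 0"
  by (simp add: sudler_def sprod_def mult.assoc)

lemma sudler_eq_G: "sudler N bt = G j N 0"
  by (simp add: sudler_eq_sprod G_def)

lemma p_eq_F: "p j = F j 0"
  by (simp add: p_def F_def sudler_eq_G)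

lemma G_nonneg: "0 \<le> G j M x"
  by (simp add: G_def sprod_nonneg)

lemma G_0 [simp]: "G j 0 x = 1"
  by (simp add: G_def)

text \<open>\<open>gap (j + 1) = bt * gap j\<close> and the side changes: the self-similarity behind all inductions on the level.\<close>

lemma G_Suc_level: "G (Suc j) M x = G j M (- bt * x)"
  by (simp add: G_def gap_def algebra_simps)

lemma q_bt_gap: "real (q j) * bt = real (q' j) + (-1) ^ j * gap j"
  by (simp add: q_bt gap_def)

lemma G_add: "G j (q j + M) x = F j x * G j M (x + 1)"
proof -
  have "G j (q j + M) x = F j x * sprod M ((-1) ^ j * x * gap j + real (q j) * bt)"
    by (simp add: G_def F_def sprod_add)
  also have "(-1) ^ j * x * gap j + real (q j) * bt = (-1) ^ j * (x + 1) * gap j + of_int (int (q' j))"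
    unfolding q_bt_gap by (simp add: algebra_simps)
  also have "sprod M \<dots> = G j M (x + 1)" by (simp only: sprod_int_shift G_def)
  finally show ?thesis .
qed

text \<open>One digit of the expansion of the length in the base of the convergent denominators: \<open>c\<close> full blocks whose shifts increase by \<open>1\<close>, followed by the rest.\<close>

lemma G_mult_add: "G j (c * q j + M) x = (\<Prod>l<c. F j (x + real l)) * G j M (x + real c)"
proof (induction c arbitrary: x)
  case (Suc c)
  have "G j (Suc c * q j + M) x = F j x * G j (c * q j + M) (x + 1)"
    using G_add[of j "c * q j + M" x] by (simp add: add.assoc)
  also have "\<dots> = F j x * (\<Prod>l<c. F j (x + 1 + real l)) * G j M (x + 1 + real c)"
    by (simp add: Suc)
  also have "F j x * (\<Prod>l<c. F j (x + 1 + real l)) = (\<Prod>l<Suc c. F j (x + real l))"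
    by (subst prod.lessThan_Suc_shift) (simp add: add_ac)
  finally show ?case by (simp add: add_ac)
qed simp

lemma G_mult: "G j (c * q j) x = (\<Prod>l<c. F j (x + real l))"
  using G_mult_add[of j c 0 x] by simp

text \<open>Reading the last \<open>M\<close> factors backwards turns them into a shifted product, because \<open>\<bar>sin\<bar>\<close> is even.\<close>

lemma sudler_reflect: "sudler (N + M) bt = sudler N bt * sprod M (- (real (N + M + 1) * bt))"
proof -
  have "sudler (N + M) bt = sudler N bt * (\<Prod>n=N+1..N+M. 2 * \<bar>sin (pi * (real n * bt + 0))\<bar>)"
    unfolding sudler_eq_sprod sprod_def by (rule prod.ub_add_nat) simp
  also have "(\<Prod>n=N+1..N+M. 2 * \<bar>sin (pi * (real n * bt + 0))\<bar>) = sprod M (- (real (N + M + 1) * bt))"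
    unfolding sprod_def
  proof (rule prod.reindex_bij_witness[of _ "\<lambda>n. N + M + 1 - n" "\<lambda>n. N + M + 1 - n"])
    fix n assume "n \<in> {N + 1..N + M}"
    then have "pi * (real (N + M + 1 - n) * bt + - (real (N + M + 1) * bt)) = - (pi * (real n * bt + 0))"
      by (simp add: of_nat_diff algebra_simps)
    then show "2 * \<bar>sin (pi * (real (N + M + 1 - n) * bt + - (real (N + M + 1) * bt)))\<bar>
        = 2 * \<bar>sin (pi * (real n * bt + 0))\<bar>" by (simp only: sin_minus abs_minus_cancel)
  qed auto
  finally show ?thesis .
qed

text \<open>At a convergent denominator the reflected shift is exactly \<open>bt\<close>, one level below. This is how the upper limit is reduced to lower bounds for shifted products.\<close>

lemma sudler_reflect_q:
  assumes "N + M + 1 = q (Suc j)"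
  shows "sudler (q (Suc j) - 1) bt = sudler N bt * G j M bt"
proof -
  have eq: "q (Suc j) - 1 = N + M" using assms by simp
  have "- (real (N + M + 1) * bt) = (-1) ^ j * bt * gap j + of_int (- int (q j))"
    unfolding assms using q_bt_gap[of "Suc j"] by (simp add: gap_def algebra_simps)
  then have "sprod M (- (real (N + M + 1) * bt)) = G j M bt"
    by (simp only: sprod_int_shift G_def)
  then show ?thesis using sudler_reflect[of N M] eq by simp
qed

section \<open>The points of a full block\<close>

lemma gap_pos: "0 < gap j"
  using bt_pos by (simp add: gap_def)

lemma gap_z: "gap j * z = bt ^ j"
  using bt_z by (simp add: gap_def algebra_simps)

lemma t_pos: "0 < t j"
  by (simp add: t_def gap_pos)

lemma t_z: "t j * z = pi * bt ^ j"
  using gap_z[of j] by (simp add: t_def mult.assoc)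

lemma t_Suc_z: "t (Suc j) * z = t j"
  by (simp add: t_z) (simp add: t_def gap_def)

lemma t_z_le_pi: "t j * z \<le> pi"
proof -
  have "bt ^ j \<le> 1" using bt_pos bt_less_1 by (intro power_le_one) auto
  then show ?thesis unfolding t_z using mult_left_mono[of "bt ^ j" 1 pi] by simp
qed

lemma m_dl_less_1:
  assumes "m \<le> q j" shows "real m * gap j < 1"
proof -
  have "real m * gap j \<le> real (q j) * bt ^ j * bt"
    using assms bt_pos by (simp add: gap_def mult_right_mono)
  also have "\<dots> \<le> 1 * bt" using q_bt_le_1 bt_pos by (intro mult_right_mono) auto
  finally show ?thesis using bt_less_1 by simp
qed

lemma mod_nonzero:
  assumes "0 < m" "m < q j" shows "(m * q' j) mod q j \<noteq> 0"
proof
  assume "(m * q' j) mod q j = 0"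
  then have "q j dvd m * q' j" by (simp add: mod_eq_0_iff_dvd)
  then have "q j dvd m" using coprime_q_q'[of j] coprime_dvd_mult_left_iff by blast
  then show False using assms by (auto dest: dvd_imp_le)
qed

text \<open>\<open>q' j / q j\<close> is so close to \<open>bt\<close> that no integer lies between their \<open>m\<close>-fold multiples for \<open>m < q j\<close>.\<close>

lemma floor_m_bt:
  assumes "0 < m" "m < q j"
  shows "\<lfloor>real m * bt\<rfloor> = int ((m * q' j) div q j)"
proof -
  define k I where "k = (m * q' j) div q j" and "I = (m * q' j) mod q j"
  have eq: "m * q' j = k * q j + I" unfolding k_def I_def by (rule div_mult_mod_eq[symmetric])
  have I: "1 \<le> I" "I + 1 \<le> q j"
    using mod_nonzero[OF assms] q_positive[of j] by (auto simp: I_def Suc_le_eq)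
  have "real (q j) * (real m * bt - real k) = real m * (real (q j) * bt) - real (k * q j)"
    by (simp add: algebra_simps)
  also have "\<dots> = real (m * q' j) + (-1) ^ j * (real m * gap j) - real (k * q j)"
    unfolding q_bt_gap by (simp add: algebra_simps)
  also have "\<dots> = real I + (-1) ^ j * (real m * gap j)" by (simp add: eq)
  finally have *: "real (q j) * (real m * bt - real k) = real I + (-1) ^ j * (real m * gap j)" .
  have "\<bar>(-1) ^ j * (real m * gap j)\<bar> < 1"
    using m_dl_less_1[of m j] assms gap_pos[of j] by (simp add: abs_mult power_abs)
  then have "0 < real (q j) * (real m * bt - real k)" "real (q j) * (real m * bt - real k) < real (q j) * 1"
    using I * by linarith+
  then have "0 < real m * bt - real k" "real m * bt - real k < 1"
    using q_positive[of j] by (simp_all add: zero_less_mult_iff)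
  then show ?thesis unfolding k_def[symmetric] by (simp add: floor_eq_iff)
qed

text \<open>The points of a block are symmetric: \<open>1 + zm (q j - m) + zm m\<close> is the length of the circle in units of \<open>gap j\<close>, by \<open>q_unimodular\<close>. This exact symmetry makes squaring products of sines fruitful.\<close>

lemma zm_reflect:
  assumes "0 < m" "m < q j"
  shows "t j * (1 + zm (q j - m)) = pi - t j * zm m"
proof -
  define k I where "k = (m * q' j) div q j" and "I = (m * q' j) mod q j"
  have eq: "m * q' j = k * q j + I" unfolding k_def I_def by (rule div_mult_mod_eq[symmetric])
  have I: "1 \<le> I" "I < q j"
    using mod_nonzero[OF assms] q_positive[of j] by (auto simp: I_def Suc_le_eq)
  have m': "0 < q j - m" "q j - m < q j" using assms by auto
  have "m * q' j \<le> q j * q' j" using assms by (intro mult_le_mono1) auto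
  then have "k * q j < q j * q' j" using eq I by linarith
  then have "k * q j < q' j * q j" by (simp only: mult.commute)
  then have k: "k < q' j" by simp
  have "(q j - m) * q' j = (q' j - 1 - k) * q j + (q j - I)"
  proof -
    obtain r where r: "q' j = Suc (k + r)" using k less_iff_Suc_add by auto
    have "(q j - m) * q' j = q j * q' j - (k * q j + I)"
      unfolding eq[symmetric] by (rule diff_mult_distrib)
    also have "\<dots> = r * q j + (q j - I)" using I by (simp add: r algebra_simps)
    finally show ?thesis by (simp add: r)
  qed
  moreover have div: "(A * q j + R) div q j = A" if "R < q j" for A R using that by simp
  have "((q' j - 1 - k) * q j + (q j - I)) div q j = q' j - 1 - k"
    by (rule div) (use I in linarith)
  ultimately have "((q j - m) * q' j) div q j = q' j - 1 - k" by (simp only:)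
  then have f: "\<lfloor>real (q j - m) * bt\<rfloor> = int (q' j - 1 - k)" "\<lfloor>real m * bt\<rfloor> = int k"
    using floor_m_bt[OF m'] floor_m_bt[OF assms] by (simp_all add: k_def)
  have "1 + zm (q j - m) + zm m = real (q j) * z + real (q' j)"
    unfolding zm_def f using assms k by (simp add: of_nat_diff algebra_simps)
  then have "gap j * (1 + zm (q j - m) + zm m) = real (q j) * (gap j * z) + real (q' j) * gap j"
    by (simp add: algebra_simps)
  also have "\<dots> = 1" using q_unimodular[of j] unfolding gap_z by (simp add: gap_def)
  finally have "pi * (gap j * (1 + zm (q j - m) + zm m)) = pi" by simp
  then show ?thesis by (simp add: t_def algebra_simps)
qed

lemma zm_ge:
  assumes "1 \<le> m" shows "real m * z \<le> zm m" "z \<le> zm m" "1 < zm m" "0 < zm m"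
proof -
  have "0 \<le> \<lfloor>real m * bt\<rfloor>" using bt_pos by simp
  then show *: "real m * z \<le> zm m" by (simp add: zm_def)
  have "1 * z \<le> real m * z" using assms z_gt_1 by (intro mult_right_mono) auto
  then show "z \<le> zm m" "1 < zm m" "0 < zm m" using * z_gt_1 by linarith+
qed

lemma zm_1: "zm (Suc 0) = z"
proof -
  have "\<lfloor>bt\<rfloor> = 0" using bt_pos bt_less_1 by (simp add: floor_eq_iff)
  then show ?thesis by (simp add: zm_def)
qed

text \<open>The multiples of \<open>bt\<close> in a block, sorted by their position on the circle instead of the time of their visit, have the positions \<open>1 + zm m\<close>. The leading factor belongs to \<open>n = q j\<close> itself.\<close>

lemma F_eq_prod:
  "F j x = 2 * \<bar>sin (t j * (1 + x))\<bar> * (\<Prod>m=1..<q j. 2 * \<bar>sin (t j * (1 + zm m + x))\<bar>)"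
proof -
  define h where "h n = 2 * \<bar>sin (pi * (real n * bt + (-1) ^ j * x * gap j))\<bar>" for n :: nat
  \<comment> \<open>\<open>nu m\<close> is the index of the \<open>m\<close>-th point of the block on the circle, counted from \<open>0\<close>.\<close>
  define nu where "nu m = q j - (m * q' j) mod q j" for m
  have "F j x = (\<Prod>n=1..q j. h n)" by (simp add: F_def G_def sprod_def h_def)
  also have "{1..q j} = insert (q j) {1..<q j}" using q_ge_1[of j] by auto
  also have "(\<Prod>n\<in>insert (q j) {1..<q j}. h n) = h (q j) * (\<Prod>n=1..<q j. h n)" by simp
  also have "h (q j) = 2 * \<bar>sin (t j * (1 + x))\<bar>"
  proof -
    have "real (q j) * bt + (-1) ^ j * x * gap j = (-1) ^ j * (gap j * (1 + x)) + of_int (int (q' j))"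
      unfolding q_bt_gap by (simp add: algebra_simps)
    then have "\<bar>sin (pi * (real (q j) * bt + (-1) ^ j * x * gap j))\<bar> = \<bar>sin (pi * (gap j * (1 + x)))\<bar>"
      by (simp only: abs_sin_int_shift abs_sin_sign)
    then show ?thesis by (simp add: h_def t_def mult.assoc)
  qed
  also have "(\<Prod>n=1..<q j. h n) = (\<Prod>m=1..<q j. h (nu m))"
  proof (rule prod.reindex_bij_betw[symmetric])
    have inj: "inj_on nu {1..<q j}"
    proof (rule inj_onI)
      fix m n assume mn: "m \<in> {1..<q j}" "n \<in> {1..<q j}" "nu m = nu n"
      have "(m * q' j) mod q j < q j" "(n * q' j) mod q j < q j" using q_positive[of j] by auto
      then have "(m * q' j) mod q j = (n * q' j) mod q j" using mn(3) unfolding nu_def by linarith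
      then have "(int m * int (q' j)) mod int (q j) = (int n * int (q' j)) mod int (q j)"
        by (metis of_nat_mod of_nat_mult)
      then have "int (q j) dvd int m * int (q' j) - int n * int (q' j)" by (simp add: mod_eq_dvd_iff)
      then have "int (q j) dvd (int m - int n) * int (q' j)" by (simp add: algebra_simps)
      moreover have "coprime (int (q j)) (int (q' j))" using coprime_q_q'[of j] by simp
      ultimately have d: "int (q j) dvd int m - int n" using coprime_dvd_mult_left_iff by blast
      show "m = n"
      proof (rule ccontr)
        assume "m \<noteq> n"
        then have "\<bar>int (q j)\<bar> \<le> \<bar>int m - int n\<bar>" by (intro dvd_imp_le_int d) auto
        then show False using mn by auto
      qed
    qed
    have "nu ` {1..<q j} \<subseteq> {1..<q j}"
      using mod_nonzero by (auto simp: nu_def Suc_le_eq intro!: diff_less)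
    then show "bij_betw nu {1..<q j} {1..<q j}"
      using inj endo_inj_surj[of "{1..<q j}" nu] by (simp add: bij_betw_def)
  qed
  also have "(\<Prod>m=1..<q j. h (nu m)) = (\<Prod>m=1..<q j. 2 * \<bar>sin (t j * (1 + zm m + x))\<bar>)"
  proof (rule prod.cong[OF refl])
    fix m assume "m \<in> {1..<q j}"
    then have m: "0 < m" "m < q j" by auto
    have "j \<noteq> 0" using m by (intro notI) simp
    then obtain i where i: "j = Suc i" by (cases j) auto
    define k I where "k = (m * q' j) div q j" and "I = (m * q' j) mod q j"
    have "m * q' j = k * q j + I" unfolding k_def I_def by (rule div_mult_mod_eq[symmetric])
    then have eq: "real m * real (q' j) = real k * real (q j) + real I"
      by (metis of_nat_add of_nat_mult)
    have "I < q j" using q_positive[of j] by (simp add: I_def)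
    then have "real (nu m) = real (q j) - real I" by (simp add: nu_def I_def[symmetric] of_nat_diff)
    then have nu_m: "real (nu m) = (real k + 1) * real (q j) - real m * real (q' j)"
      using eq by (simp add: algebra_simps)
    have "real (nu m) * bt = (real k + 1) * (real (q j) * bt) - real m * (real (q' j) * bt)"
      unfolding nu_m by (simp only: left_diff_distrib mult.assoc)
    also have "real (q' j) * bt = real (q' i) - (-1) ^ j * bt ^ j"
      using q_bt[of i] by (simp add: i)
    finally have "real (nu m) * bt + (-1) ^ j * x * gap j
        = (-1) ^ j * (gap j * (1 + real k + x) + real m * bt ^ j)
          + of_int (int ((k + 1) * q' j) - int (m * q' i))"
      unfolding q_bt_gap by (simp add: algebra_simps)
    also have "gap j * (1 + real k + x) + real m * bt ^ j = gap j * (1 + zm m + x)"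
      unfolding zm_def floor_m_bt[OF m] k_def gap_z[of j, symmetric] by (simp add: algebra_simps)
    finally have "\<bar>sin (pi * (real (nu m) * bt + (-1) ^ j * x * gap j))\<bar> = \<bar>sin (pi * (gap j * (1 + zm m + x)))\<bar>"
      by (simp only: abs_sin_int_shift abs_sin_sign)
    then show "h (nu m) = 2 * \<bar>sin (t j * (1 + zm m + x))\<bar>" by (simp add: h_def t_def mult.assoc)
  qed
  finally show ?thesis .
qed

text \<open>The block without the factor of \<open>n = q j\<close>, which is the only one that vanishes for \<open>x = - 1\<close>.\<close>

definition S :: "nat \<Rightarrow> real \<Rightarrow> real" where
  "S j x = (\<Prod>m=1..<q j. 2 * sin (t j * (1 + zm m + x)))"

lemma zm_range:
  assumes "m \<in> {1..<q j}" "- 1 - z < x" "x < z"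
  shows "0 < t j * (1 + zm m + x)" "t j * (1 + zm m + x) < pi"
    "0 < t j * (zm m - x)" "t j * (zm m - x) < pi"
proof -
  have m: "0 < m" "m < q j" using assms by auto
  have r: "t j * (1 + zm (q j - m)) = pi - t j * zm m" by (rule zm_reflect[OF m])
  have z: "z \<le> zm m" "z \<le> zm (q j - m)" using m by (auto intro!: zm_ge)
  have pos: "0 < t j * (1 + zm m + x)" "0 < t j * (zm m - x)"
    "0 < t j * (1 + zm (q j - m) + x)" "0 < t j * (zm (q j - m) - x)"
    using z assms t_pos[of j] by (auto intro!: mult_pos_pos)
  have e: "t j * (1 + zm m + x) = pi - t j * (zm (q j - m) - x)"
    "t j * (zm m - x) = pi - t j * (1 + zm (q j - m) + x)"
    using r zm_reflect[of "q j - m" j] m by (auto simp: algebra_simps)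
  have less_pi: "a < pi" if "a = pi - d" "0 < d" for a d :: real using that by simp
  show "0 < t j * (1 + zm m + x)" "0 < t j * (zm m - x)" by (fact pos)+
  show "t j * (1 + zm m + x) < pi" by (rule less_pi[OF e(1) pos(4)])
  show "t j * (zm m - x) < pi" by (rule less_pi[OF e(2) pos(3)])
qed

lemma sin_zm_pos:
  assumes "m \<in> {1..<q j}" "- 1 - z < x" "x < z"
  shows "0 < sin (t j * (1 + zm m + x))" "0 < sin (t j * (zm m - x))"
  using zm_range[OF assms] by (auto intro: sin_gt_zero)

lemma S_pos: "- 1 - z < x \<Longrightarrow> x < z \<Longrightarrow> 0 < S j x"
  unfolding S_def by (intro prod_pos) (use sin_zm_pos in auto)

lemma F_eq_S:
  assumes "- 1 \<le> x" "x < z" "t j * (1 + x) \<le> pi"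
  shows "F j x = 2 * sin (t j * (1 + x)) * S j x"
proof -
  have "0 \<le> sin (t j * (1 + x))" using assms t_pos[of j] by (intro sin_ge_zero) auto
  moreover have "(\<Prod>m=1..<q j. 2 * \<bar>sin (t j * (1 + zm m + x))\<bar>) = S j x"
    unfolding S_def by (intro prod.cong refl) (use assms z_gt_1 in \<open>simp add: less_imp_le[OF sin_zm_pos(1)]\<close>)
  ultimately show ?thesis by (simp add: F_eq_prod)
qed

lemma S_reflect: "S j x = (\<Prod>m=1..<q j. 2 * sin (t j * (zm m - x)))"
  unfolding S_def
proof (rule prod.reindex_bij_witness[of _ "\<lambda>m. q j - m" "\<lambda>m. q j - m"])
  fix m assume "m \<in> {1..<q j}"
  then have m: "0 < m" "m < q j" by auto
  have "t j * (1 + zm m + x) = pi - t j * (zm (q j - m) - x)"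
    using zm_reflect[of "q j - m" j] m by (simp add: algebra_simps)
  then show "2 * sin (t j * (zm (q j - m) - x)) = 2 * sin (t j * (1 + zm m + x))"
    by (simp only: sin_pi_minus)
qed auto

text \<open>The unshifted value of two factors that the symmetry of the block pairs; a shift by \<open>x\<close> lowers each such pair by the same amount \<open>w j x\<close>, see \<open>S_squared\<close>.\<close>

definition V :: "nat \<Rightarrow> nat \<Rightarrow> real" where
  "V j m = sin (t j * (1 + zm m)) * sin (t j * zm m)"
definition w :: "nat \<Rightarrow> real \<Rightarrow> real" where
  "w j x = sin (t j * x) * sin (t j * (1 + x))"

lemma V_pos: "m \<in> {1..<q j} \<Longrightarrow> 0 < V j m"
  using sin_zm_pos[of m j 0] z_gt_1 by (simp add: V_def)

lemma V_reflect:
  assumes "m \<in> {1..<q j}" shows "V j (q j - m) = V j m"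
proof -
  have m: "0 < m" "m < q j" using assms by auto
  have "t j * (1 + zm (q j - m)) = pi - t j * zm m" "t j * zm (q j - m) = pi - t j * (1 + zm m)"
    using zm_reflect[OF m] zm_reflect[of "q j - m" j] m by simp_all
  then show ?thesis by (simp only: V_def sin_pi_minus mult.commute)
qed

text \<open>Multiplying the product by its reflection pairs the factors at \<open>1 + zm m + x\<close> and \<open>zm m - x\<close>. By \<open>sin_pair\<close> the shift then enters every pair through the single number \<open>w j x\<close>.\<close>

lemma S_squared: "(S j x)\<^sup>2 = (\<Prod>m=1..<q j. 4 * (V j m - w j x))"
proof -
  have "(S j x)\<^sup>2 = (\<Prod>m=1..<q j. 2 * sin (t j * (1 + zm m + x))) * (\<Prod>m=1..<q j. 2 * sin (t j * (zm m - x)))"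
    using S_reflect[of j x] by (simp add: power2_eq_square S_def)
  also have "\<dots> = (\<Prod>m=1..<q j. 4 * (sin (t j * (1 + zm m + x)) * sin (t j * (zm m - x))))"
    by (subst prod.distrib[symmetric]) (simp add: mult_ac)
  finally show ?thesis by (simp add: sin_pair V_def w_def)
qed

lemma V_minus_w_pos:
  assumes "m \<in> {1..<q j}" "- 1 - z < x" "x < z" shows "0 < V j m - w j x"
  using sin_zm_pos[OF assms] by (simp add: V_def w_def flip: sin_pair)

lemma S_ratio_squared:
  "(S j x / S j 0)\<^sup>2 = (\<Prod>m=1..<q j. 1 - w j x / V j m)"
proof -
  have "(S j x / S j 0)\<^sup>2 = (\<Prod>m=1..<q j. 4 * (V j m - w j x)) / (\<Prod>m=1..<q j. 4 * (V j m - w j 0))"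
    by (simp add: power_divide S_squared)
  also have "\<dots> = (\<Prod>m=1..<q j. 1 - w j x / V j m)"
    unfolding prod_dividef[symmetric]
  proof (rule prod.cong[OF refl])
    fix m assume "m \<in> {1..<q j}"
    then show "4 * (V j m - w j x) / (4 * (V j m - w j 0)) = 1 - w j x / V j m"
      using V_pos[of m j] by (simp add: w_def field_simps)
  qed
  finally show ?thesis .
qed

end

text \<open>A product of sines is log-concave in a common shift as long as all arguments stay in \<open>(0, pi)\<close>, so a lower bound at both ends of an interval holds inside.\<close>

lemma prod_sin_ge_min:
  fixes k :: "'i \<Rightarrow> real" and r x0 x1 :: real
  assumes fin: "finite I" and x: "x0 \<le> x" "x \<le> x1"
    and pos: "\<And>i. i \<in> I \<Longrightarrow> 0 < r * (k i + x0) \<and> r * (k i + x0) < pi"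
             "\<And>i. i \<in> I \<Longrightarrow> 0 < r * (k i + x1) \<and> r * (k i + x1) < pi"
    and m: "0 < m" "m \<le> (\<Prod>i\<in>I. 2 * sin (r * (k i + x0)))" "m \<le> (\<Prod>i\<in>I. 2 * sin (r * (k i + x1)))"
  shows "m \<le> (\<Prod>i\<in>I. 2 * sin (r * (k i + x)))"
proof (cases "x0 = x1")
  case False
  define c where "c = (x - x0) / (x1 - x0)"
  have c: "0 \<le> c" "c \<le> 1" using x False by (auto simp: c_def field_simps)
  have "c * (x1 - x0) = x - x0" using x False by (simp add: c_def)
  then have x_eq: "x = (1 - c) * x0 + c * x1" by (simp add: algebra_simps)
  define f0 f1 where "f0 = (\<lambda>i. 2 * sin (r * (k i + x0)))" and "f1 = (\<lambda>i. 2 * sin (r * (k i + x1)))"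
  have f: "0 < f0 i" "0 < f1 i" if "i \<in> I" for i
    using pos[OF that] by (auto simp: f0_def f1_def intro: sin_gt_zero)
  have P: "0 < prod f0 I" "0 < prod f1 I" using f by (auto intro: prod_pos)
  have powr_prod: "prod g I powr e = (\<Prod>i\<in>I. g i powr e)" if "\<And>i. i \<in> I \<Longrightarrow> 0 < g i" for g and e :: real
    using fin that
  proof (induction I rule: finite_induct)
    case (insert i A)
    then show ?case by (simp add: powr_mult prod_nonneg less_imp_le)
  qed simp
  have "m = m powr (1 - c) * m powr c" using m by (simp flip: powr_add)
  also have "\<dots> \<le> prod f0 I powr (1 - c) * prod f1 I powr c"
    using m c P by (intro mult_mono powr_mono2) (auto simp: f0_def f1_def)
  also have "\<dots> = (\<Prod>i\<in>I. f0 i powr (1 - c) * f1 i powr c)"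
    using f by (simp add: powr_prod prod.distrib)
  also have "\<dots> \<le> (\<Prod>i\<in>I. 2 * sin (r * (k i + x)))"
  proof (rule prod_mono)
    fix i assume i: "i \<in> I"
    define s0 s1 where "s0 = sin (r * (k i + x0))" and "s1 = sin (r * (k i + x1))"
    have s: "0 < s0" "0 < s1" using pos[OF i] by (auto simp: s0_def s1_def intro: sin_gt_zero)
    have "f0 i powr (1 - c) * f1 i powr c = (2 powr (1 - c) * 2 powr c) * (s0 powr (1 - c) * s1 powr c)"
      using s by (simp add: f0_def f1_def s0_def[symmetric] s1_def[symmetric] powr_mult)
    also have "2 powr (1 - c) * 2 powr c = (2::real)" by (simp flip: powr_add)
    also have "s0 powr (1 - c) * s1 powr c \<le> sin ((1 - c) * (r * (k i + x0)) + c * (r * (k i + x1)))"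
      unfolding s0_def s1_def using pos[OF i] c by (intro sin_geo_mean) auto
    also have "(1 - c) * (r * (k i + x0)) + c * (r * (k i + x1)) = r * (k i + x)"
      unfolding x_eq by (simp add: algebra_simps)
    finally show "0 \<le> f0 i powr (1 - c) * f1 i powr c \<and>
        f0 i powr (1 - c) * f1 i powr c \<le> 2 * sin (r * (k i + x))" by simp
  qed
  finally show ?thesis .
qed (use x m in auto)

context metallic
begin

section \<open>Bounds for shifted full blocks\<close>

lemma t_less_pi: "t j < pi"
proof -
  have "t j * 1 < t j * z" using z_gt_1 t_pos[of j] by (intro mult_strict_left_mono) auto
  then show ?thesis using t_z_le_pi[of j] by linarith
qed

lemma sin_t_pos: "0 < sin (t j)"
  using t_pos t_less_pi by (intro sin_gt_zero) auto

lemma t_Suc_z_less_pi: "t (Suc j) * z < pi"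
  by (simp add: t_Suc_z t_less_pi)

lemma p_eq_S: "p j = 2 * sin (t j) * S j 0"
  using F_eq_S[of 0 j] z_gt_1 t_less_pi[of j] by (simp add: p_eq_F)

lemma p_pos: "0 < p j"
  unfolding p_eq_S using sin_t_pos S_pos[of 0 j] z_gt_1 by simp

lemma w_nonpos: "- 1 \<le> x \<Longrightarrow> x \<le> 0 \<Longrightarrow> w j x \<le> 0"
proof -
  assume x: "- 1 \<le> x" "x \<le> 0"
  have b: "t j * (1 + x) \<le> t j * 1" "t j * (- x) \<le> t j * 1"
    by (rule mult_left_mono; use x t_pos[of j] in simp)+
  then have "t j * (1 + x) \<le> pi" "t j * (- x) \<le> pi" using t_less_pi[of j] by linarith+
  moreover have "0 \<le> t j * (1 + x)" "0 \<le> t j * (- x)"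
    by (rule mult_nonneg_nonneg; use x t_pos[of j] in simp)+
  ultimately have "0 \<le> sin (t j * (1 + x))" "0 \<le> sin (t j * (- x))"
    using sin_ge_zero by blast+
  then show "w j x \<le> 0" by (simp add: w_def mult_nonpos_nonneg)
qed

lemma w_reflect: "w j (- 1 - x) = w j x"
proof -
  have "w j (- 1 - x) = sin (- (t j * (1 + x))) * sin (- (t j * x))"
    unfolding w_def by (simp add: algebra_simps)
  then show ?thesis by (simp add: w_def)
qed

text \<open>\<open>w j\<close> is symmetric about \<open>- 1 / 2\<close>, hence so is \<open>S j\<close> by \<open>S_squared\<close>.\<close>

lemma S_symmetric:
  assumes "- 1 - z < x" "x < z" shows "S j (- 1 - x) = S j x"
proof (rule power2_eq_imp_eq)
  show "(S j (- 1 - x))\<^sup>2 = (S j x)\<^sup>2" by (simp add: S_squared w_reflect)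
qed (use assms in \<open>auto intro!: less_imp_le S_pos\<close>)

text \<open>Between \<open>- 1\<close> and \<open>0\<close> the shift \<open>w j x\<close> is not positive, so no pair decreases.\<close>

lemma S_left:
  assumes "- 1 \<le> x" "x \<le> 0" shows "S j 0 \<le> S j x"
proof (rule power2_le_imp_le)
  show "(S j 0)\<^sup>2 \<le> (S j x)\<^sup>2"
    unfolding S_squared
  proof (rule prod_mono)
    fix m assume m: "m \<in> {1..<q j}"
    show "0 \<le> 4 * (V j m - w j 0) \<and> 4 * (V j m - w j 0) \<le> 4 * (V j m - w j x)"
      using V_pos[OF m] w_nonpos[OF assms, of j] by (simp add: w_def[of _ 0])
  qed
  show "0 \<le> S j x" using S_pos[of x j] assms z_gt_1 by simp
qed

lemma F_left_sin:
  assumes "- 1 \<le> x" "x \<le> 0"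
  shows "p j * (sin (t j * (1 + x)) / sin (t j)) \<le> F j x"
proof -
  have b: "t j * (1 + x) \<le> t j * 1" using assms t_pos[of j] by (intro mult_left_mono) auto
  then have le_pi: "t j * (1 + x) \<le> pi" using t_less_pi[of j] by linarith
  have "0 \<le> sin (t j * (1 + x))" using assms t_pos[of j] le_pi by (intro sin_ge_zero) auto
  then have "2 * sin (t j * (1 + x)) * S j 0 \<le> 2 * sin (t j * (1 + x)) * S j x"
    using S_left[OF assms] by (intro mult_left_mono) auto
  also have "\<dots> = F j x" using F_eq_S[of x j] assms le_pi z_gt_1 by simp
  finally show ?thesis using sin_t_pos[of j] by (simp add: p_eq_S mult_ac)
qed

lemma sin_ratio_unit:
  assumes "- 1 \<le> x" "x \<le> 0"
  shows "1 + x \<le> sin (t j * (1 + x)) / sin (t j)"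
  using sin_ratio_ge[of "t j" "1 + x" 1] assms t_pos[of j] t_less_pi[of j] by simp

text \<open>Only the leading factor shrinks when the block is shifted to the left, and it shrinks at most linearly.\<close>

lemma F_left:
  assumes "- 1 \<le> x" "x \<le> 0"
  shows "p j * (1 + x) \<le> F j x"
proof -
  have "p j * (1 + x) \<le> p j * (sin (t j * (1 + x)) / sin (t j))"
    using sin_ratio_unit[OF assms] p_pos[of j] by (intro mult_left_mono) auto
  then show ?thesis using F_left_sin[OF assms, of j] by linarith
qed

lemma w_div_V_ge:
  assumes "m \<in> {1..<q j}" "0 \<le> x" "x < z"
  shows "x * (1 + x) / (zm m * (zm m + 1)) \<le> w j x / V j m"
proof -
  have zm: "z \<le> zm m" "0 < zm m" using assms by (auto intro!: zm_ge)
  have r: "t j * zm m < pi" "t j * (1 + zm m) < pi"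
    using zm_range[of m j 0] assms z_gt_1 by auto
  have "x / zm m \<le> sin (t j * x) / sin (t j * zm m)"
    using assms zm r t_pos[of j] by (intro sin_ratio_ge) auto
  moreover have "(1 + x) / (1 + zm m) \<le> sin (t j * (1 + x)) / sin (t j * (1 + zm m))"
    using assms zm r t_pos[of j] by (intro sin_ratio_ge) auto
  moreover have "0 \<le> x / zm m" "0 \<le> (1 + x) / (1 + zm m)" using assms zm by auto
  ultimately have "(x / zm m) * ((1 + x) / (1 + zm m))
      \<le> (sin (t j * x) / sin (t j * zm m)) * (sin (t j * (1 + x)) / sin (t j * (1 + zm m)))"
    by (intro mult_mono) auto
  then show ?thesis by (simp add: w_def V_def mult_ac add_ac)
qed

lemma w_div_V_le:
  assumes "m \<in> {1..<q j}" "- 1 \<le> x" "x \<le> 0"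
  shows "w j x / V j m \<le> x * (1 + x) / (zm m * (zm m + 1))"
proof -
  have zm: "z \<le> zm m" "0 < zm m" using assms by (auto intro!: zm_ge)
  have r: "t j * zm m < pi" "t j * (1 + zm m) < pi"
    using zm_range[of m j 0] assms z_gt_1 by auto
  have "(- x) / zm m \<le> sin (t j * (- x)) / sin (t j * zm m)"
    using assms zm r t_pos[of j] z_gt_1 by (intro sin_ratio_ge) auto
  moreover have "(1 + x) / (1 + zm m) \<le> sin (t j * (1 + x)) / sin (t j * (1 + zm m))"
    using assms zm r t_pos[of j] by (intro sin_ratio_ge) auto
  moreover have "0 \<le> (- x) / zm m" "0 \<le> (1 + x) / (1 + zm m)"
    by (rule divide_nonneg_pos; use assms zm in simp)+
  ultimately have "((- x) / zm m) * ((1 + x) / (1 + zm m))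
      \<le> (sin (t j * (- x)) / sin (t j * zm m)) * (sin (t j * (1 + x)) / sin (t j * (1 + zm m)))"
    by (intro mult_mono) auto
  then show ?thesis by (simp add: w_def V_def mult_ac add_ac)
qed

text \<open>The gain of the pair \<open>m = 1\<close> (counted with its mirror image \<open>m = q j - 1\<close>, which is a different one for \<open>q j \<ge> 3\<close>) is kept here. For \<open>b = 1\<close> the bound \<open>F_left\<close> alone is too weak.\<close>

lemma F_left_strong:
  assumes "- 1 \<le> x" "x \<le> 0" "3 \<le> q j"
  shows "p j * (1 + x) * (1 + (- x) * (1 + x) / (z * (z + 1))) \<le> F j x"
proof -
  define d where "d = 1 - w j x / V j 1"
  have m1: "1 \<in> {1..<q j}" "q j - 1 \<in> {1..<q j}" using assms by auto
  have d: "1 + (- x) * (1 + x) / (z * (z + 1)) \<le> d"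
    using w_div_V_le[OF m1(1) assms(1,2)] by (simp add: d_def zm_1)
  have f_ge: "1 \<le> 1 - w j x / V j m" if "m \<in> {1..<q j}" for m
    using w_nonpos[OF assms(1,2), of j] V_pos[OF that] by (simp add: divide_nonpos_pos)
  define X Y where "X = (\<Prod>m\<in>{1, q j - 1}. 1 - w j x / V j m)"
    and "Y = (\<Prod>m\<in>{1..<q j} - {1, q j - 1}. 1 - w j x / V j m)"
  have dX: "d\<^sup>2 = X"
    using assms V_reflect[OF m1(1)] by (simp add: d_def X_def power2_eq_square)
  have "1 \<le> Y" unfolding Y_def by (rule prod_ge_1) (use f_ge in blast)
  then have "X * 1 \<le> X * Y" by (intro mult_left_mono) (simp_all add: dX[symmetric])
  then have "d\<^sup>2 \<le> X * Y" by (simp add: dX)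
  also have "\<dots> = (S j x / S j 0)\<^sup>2"
    unfolding S_ratio_squared X_def Y_def using m1
    by (subst mult.commute, intro prod.subset_diff[symmetric]) auto
  finally have sq: "d\<^sup>2 \<le> (S j x / S j 0)\<^sup>2" .
  have Spos: "0 < S j x" "0 < S j 0" using assms z_gt_1 by (auto intro!: S_pos)
  then have "0 \<le> S j x / S j 0" by simp
  then have "d \<le> S j x / S j 0" by (rule power2_le_imp_le[OF sq])
  then have dS: "d * S j 0 \<le> S j x" using Spos by (simp add: field_simps)
  have b: "t j * (1 + x) \<le> t j * 1" using assms t_pos[of j] by (intro mult_left_mono) auto
  then have le_pi: "t j * (1 + x) \<le> pi" using t_less_pi[of j] by linarith
  have s: "0 \<le> sin (t j * (1 + x))" using assms t_pos[of j] le_pi by (intro sin_ge_zero) auto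
  have nn: "0 \<le> (- x) * (1 + x) / (z * (z + 1))" using assms z_gt_1 by (intro divide_nonneg_nonneg mult_nonneg_nonneg) auto
  have "p j * (1 + x) * (1 + (- x) * (1 + x) / (z * (z + 1)))
      \<le> p j * (sin (t j * (1 + x)) / sin (t j)) * d"
  proof (intro mult_mono mult_left_mono)
    show "0 \<le> p j * (sin (t j * (1 + x)) / sin (t j))"
      using s sin_t_pos[of j] p_pos[of j] by simp
  qed (use sin_ratio_unit[OF assms(1,2)] p_pos[of j] d nn assms in simp_all)
  also have "\<dots> = 2 * sin (t j * (1 + x)) * (d * S j 0)"
    using sin_t_pos[of j] by (simp add: p_eq_S)
  also have "\<dots> \<le> 2 * sin (t j * (1 + x)) * S j x" using dS s by (intro mult_left_mono) auto
  also have "\<dots> = F j x" using F_eq_S[of x j] assms le_pi z_gt_1 by simp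
  finally show ?thesis .
qed

lemma sudler_pred:
  assumes "0 < N" shows "sudler N bt = sudler (N - 1) bt * (2 * \<bar>sin (pi * (real N * bt))\<bar>)"
proof -
  obtain n where "N = Suc n" using assms by (cases N) auto
  then show ?thesis by (simp add: sudler_def mult.assoc)
qed

lemma sudler_pos: "0 < sudler N bt"
  unfolding sudler_def
proof (rule prod_pos)
  fix r assume r: "r \<in> {1..N}"
  have "sin (pi * (real r * bt)) \<noteq> 0"
  proof
    assume "sin (pi * (real r * bt)) = 0"
    then obtain i :: int where i: "pi * (real r * bt) = of_int i * pi" by (auto simp: sin_zero_iff_int2)
    then have eq: "real r * bt = of_int i" by simp
    moreover have "0 < real r * bt" using r bt_pos by simp
    ultimately have "real r * bt = real (nat i)" by simp
    then show False using bt_irrational[of r "nat i"] r by simp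
  qed
  then show "0 < 2 * \<bar>sin (pi * real r * bt)\<bar>" by (simp add: mult.assoc)
qed

text \<open>Compute the product up to \<open>q (j + 1) + q j\<close> twice, once split from the front and once reflected. The comparison expresses the end value \<open>F (j + 1) (z - 1)\<close> by \<open>F j (- bt)\<close>, one level below, and \<open>F_left_sin\<close> at \<open>- bt\<close> loses exactly the sines that appear.\<close>

lemma F_right_end: "p (Suc j) \<le> F (Suc j) (z - 1)"
proof -
  define A B where "A = q (Suc j)" and "B = q j"
  have gap_Suc: "z * gap (Suc j) = gap j" using gap_z[of "Suc j"] by (simp add: mult.commute gap_def)
  have AB: "real (A + B) * bt = (-1) ^ j * (gap j - gap (Suc j)) + of_int (int (q j + q' j))"
    using q_bt_gap[of j] q_bt_gap[of "Suc j"] by (simp add: A_def B_def algebra_simps)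
  have "gap j - gap (Suc j) = gap j * (1 - bt)" by (simp add: gap_def algebra_simps)
  then have sinAB: "\<bar>sin (pi * (real (A + B) * bt))\<bar> = \<bar>sin (t j * (1 - bt))\<bar>"
    unfolding AB by (simp only: abs_sin_int_shift abs_sin_sign) (simp add: t_def mult.assoc)
  have "t j * (1 - bt) \<le> t j * 1" using bt_pos t_pos[of j] by (intro mult_left_mono) auto
  then have "t j * (1 - bt) < pi" using t_less_pi[of j] by linarith
  then have spos: "0 < sin (t j * (1 - bt))"
    using t_pos[of j] bt_less_1 t_less_pi[of j] by (intro sin_gt_zero) simp_all
  have "- (real (B - 1 + A + 1) * bt) = (-1) ^ Suc j * (z - 1) * gap (Suc j) + of_int (- int (q j + q' j))"
  proof -
    have "real (B - 1 + A + 1) = real (A + B)" using q_ge_1[of j] by (simp add: B_def)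
    then have "real (B - 1 + A + 1) * bt = (-1) ^ j * (gap j - gap (Suc j)) + of_int (int (q j + q' j))"
      by (simp only: AB)
    then show ?thesis by (simp add: gap_Suc[symmetric] algebra_simps)
  qed
  then have "sprod A (- (real (B - 1 + A + 1) * bt)) = F (Suc j) (z - 1)"
    by (simp only: sprod_int_shift F_def G_def A_def)
  then have 1: "sudler (B - 1 + A) bt = sudler (B - 1) bt * F (Suc j) (z - 1)"
    using sudler_reflect[of "B - 1" A] by simp
  have AB_pred: "A + B - 1 = B - 1 + A" using q_ge_1[of j] by (simp add: B_def)
  have "sudler (A + B) bt = sudler (A + B - 1) bt * (2 * sin (t j * (1 - bt)))"
  proof -
    have "0 < A + B" using q_ge_1[of j] by (simp add: B_def)
    from sudler_pred[OF this] show ?thesis unfolding sinAB using spos by simp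
  qed
  then have 2: "sudler (A + B) bt = sudler (B - 1) bt * F (Suc j) (z - 1) * (2 * sin (t j * (1 - bt)))"
    unfolding AB_pred 1 .
  have "real B * bt = (-1) ^ j * gap j + of_int (int (q' j))" using q_bt_gap[of j] by (simp add: B_def)
  then have "\<bar>sin (pi * (real B * bt))\<bar> = sin (t j)"
    using sin_t_pos[of j] by (simp only: abs_sin_int_shift abs_sin_sign) (simp add: t_def)
  then have 3: "p j = sudler (B - 1) bt * (2 * sin (t j))"
    using sudler_pred[of B] q_positive[of j] by (simp add: p_def B_def)
  have "sudler (A + B) bt = G (Suc j) (q (Suc j) + q j) 0" by (simp add: A_def B_def sudler_eq_G)
  also have "\<dots> = p (Suc j) * F j (- bt)"
    unfolding G_add by (simp add: p_eq_F G_Suc_level F_def)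
  finally have 4: "sudler (A + B) bt = p (Suc j) * F j (- bt)" .
  have "p j * (sin (t j * (1 + - bt)) / sin (t j)) \<le> F j (- bt)"
    using bt_pos bt_less_1 by (intro F_left_sin) auto
  then have "sudler (B - 1) bt * (2 * sin (t j * (1 - bt))) \<le> F j (- bt)"
    using sin_t_pos[of j] by (simp add: 3)
  then have "p (Suc j) * (sudler (B - 1) bt * (2 * sin (t j * (1 - bt)))) \<le> p (Suc j) * F j (- bt)"
    using p_pos[of "Suc j"] by (intro mult_left_mono) auto
  also have "\<dots> = F (Suc j) (z - 1) * (sudler (B - 1) bt * (2 * sin (t j * (1 - bt))))"
    using 2 4 by simp
  finally show ?thesis using spos sudler_pos[of "B - 1"] by (simp add: mult_le_cancel_right)
qed

lemma zm_0 [simp]: "zm 0 = 0"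
  by (simp add: zm_def)

lemma F_eq_prod_lessThan:
  assumes "- 1 \<le> x" "x < z" "t j * (1 + x) \<le> pi"
  shows "F j x = (\<Prod>m<q j. 2 * sin (t j * (1 + zm m + x)))"
proof -
  have "{..<q j} = insert 0 {1..<q j}" using q_positive[of j] by auto
  then show ?thesis by (simp add: F_eq_S[OF assms] S_def)
qed

lemma zm_range_right:
  assumes "m < q (Suc j)" "0 \<le> x" "x \<le> z - 1"
  shows "0 < t (Suc j) * (1 + zm m + x)" "t (Suc j) * (1 + zm m + x) < pi"
proof -
  have "0 < t (Suc j) * (1 + zm m + x) \<and> t (Suc j) * (1 + zm m + x) < pi"
  proof (cases "m = 0")
    case True
    have "t (Suc j) * (1 + x) \<le> t (Suc j) * z" using assms t_pos[of "Suc j"] by (intro mult_left_mono) auto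
    then have "t (Suc j) * (1 + x) < pi" using t_Suc_z_less_pi[of j] by linarith
    then show ?thesis using True assms t_pos[of "Suc j"] by (auto intro!: mult_pos_pos)
  next
    case False
    then show ?thesis using zm_range[of m "Suc j" x] assms z_gt_1 by auto
  qed
  then show "0 < t (Suc j) * (1 + zm m + x)" "t (Suc j) * (1 + zm m + x) < pi" by auto
qed

lemma t_Suc_le_pi:
  assumes "x \<le> z - 1" shows "t (Suc j) * (1 + x) \<le> pi"
proof -
  have "t (Suc j) * (1 + x) \<le> t (Suc j) * z" using assms t_pos[of "Suc j"] by (intro mult_left_mono) auto
  then show ?thesis using t_Suc_z_less_pi[of j] by linarith
qed

text \<open>Log-concavity between \<open>F (j + 1) 0 = p (j + 1)\<close> and the end point treated in \<open>F_right_end\<close>.\<close>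

lemma F_right_ge_p:
  assumes "0 \<le> x" "x \<le> z - 1"
  shows "p (Suc j) \<le> F (Suc j) x"
proof -
  have eq: "F (Suc j) y = (\<Prod>m<q (Suc j). 2 * sin (t (Suc j) * (1 + zm m + y)))"
    if "0 \<le> y" "y \<le> z - 1" for y
    using that t_Suc_le_pi[of y j] by (intro F_eq_prod_lessThan) auto
  show ?thesis
    unfolding eq[OF assms]
  proof (rule prod_sin_ge_min[OF _ assms])
    show "p (Suc j) \<le> (\<Prod>m<q (Suc j). 2 * sin (t (Suc j) * (1 + zm m + 0)))"
      using eq[of 0] z_gt_1 by (simp add: p_eq_F)
    show "p (Suc j) \<le> (\<Prod>m<q (Suc j). 2 * sin (t (Suc j) * (1 + zm m + (z - 1))))"
      using eq[of "z - 1"] z_gt_1 F_right_end[of j] by simp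
  qed (use zm_range_right[of _ j 0] zm_range_right[of _ j "z - 1"] z_gt_1 p_pos in auto)
qed

text \<open>A sharper form: split off the two factors that vanish at \<open>x = - 1\<close> and \<open>x = z\<close> and apply log-concavity to the others only. The two factors exchange their values between the ends \<open>0\<close> and \<open>z - 1\<close>, so the rest inherits the inequality between the ends.\<close>

lemma F_right_sin:
  assumes "0 \<le> x" "x \<le> z - 1" "2 \<le> q (Suc j)"
  shows "p (Suc j) * (sin (t (Suc j) * (1 + x)) / sin (t (Suc j)))
      * (sin (t (Suc j) * (z - x)) / sin (t (Suc j) * z)) \<le> F (Suc j) x"
proof -
  \<comment> \<open>The factor with \<open>m = q (j + 1) - 1\<close> is the one that vanishes at \<open>z\<close>, by reflection.\<close>
  define r where "r = t (Suc j)"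
  define R where "R y = (\<Prod>m\<in>{1..<q (Suc j) - 1}. 2 * sin (r * (1 + zm m + y)))" for y
  have eq: "F (Suc j) y = 2 * sin (r * (1 + y)) * (2 * sin (r * (z - y))) * R y"
    if "0 \<le> y" "y \<le> z - 1" for y
  proof -
    have m: "q (Suc j) - 1 \<in> {1..<q (Suc j)}" using assms by auto
    have "{1..<q (Suc j)} = insert (q (Suc j) - 1) {1..<q (Suc j) - 1}" using assms by auto
    then have "S (Suc j) y = 2 * sin (r * (1 + zm (q (Suc j) - 1) + y)) * R y"
      by (simp add: S_def R_def r_def)
    also have "r * (1 + zm (q (Suc j) - 1) + y) = pi - r * (z - y)"
      using zm_reflect[of "Suc 0" "Suc j"] assms by (simp add: zm_1 r_def algebra_simps)
    finally have "S (Suc j) y = 2 * sin (r * (z - y)) * R y" by (simp only: sin_pi_minus)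
    then show ?thesis using F_eq_S[of y "Suc j"] that t_Suc_le_pi[of y j] by (simp add: r_def mult.assoc)
  qed
  have rpos: "0 < r" by (simp add: r_def t_pos)
  have s1: "0 < sin r" using sin_t_pos by (simp add: r_def)
  have sz: "0 < sin (r * z)" using t_Suc_z_less_pi[of j] rpos z_gt_1 by (intro sin_gt_zero) (auto simp: r_def)
  have R0: "p (Suc j) = 2 * sin r * (2 * sin (r * z)) * R 0" using eq[of 0] z_gt_1 by (simp add: p_eq_F)
  have "p (Suc j) \<le> 2 * sin (r * z) * (2 * sin r) * R (z - 1)"
    using F_right_end[of j] eq[of "z - 1"] z_gt_1 by simp
  then have "(2 * sin r * (2 * sin (r * z))) * R 0 \<le> (2 * sin r * (2 * sin (r * z))) * R (z - 1)"
    using R0 by (simp add: mult_ac)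
  then have R_end: "R 0 \<le> R (z - 1)" using s1 sz by (subst (asm) mult_le_cancel_left_pos) auto
  have R0_pos: "0 < R 0"
    unfolding R_def r_def using zm_range_right[of _ j 0] z_gt_1
    by (intro prod_pos) (auto intro!: sin_gt_zero)
  have "R 0 \<le> (\<Prod>m\<in>{1..<q (Suc j) - 1}. 2 * sin (r * (1 + zm m + x)))"
  proof (rule prod_sin_ge_min[OF _ assms(1,2)])
    show "R 0 \<le> (\<Prod>m\<in>{1..<q (Suc j) - 1}. 2 * sin (r * (1 + zm m + (z - 1))))"
      using R_end by (simp only: R_def)
    show "R 0 \<le> (\<Prod>m\<in>{1..<q (Suc j) - 1}. 2 * sin (r * (1 + zm m + 0)))" by (simp only: R_def)
    show "0 < R 0" by (fact R0_pos)
  qed (use zm_range_right[of _ j 0] zm_range_right[of _ j "z - 1"] z_gt_1 in \<open>auto simp: r_def\<close>)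
  then have "R 0 \<le> R x" by (simp only: R_def)
  moreover have "0 \<le> sin (r * (1 + x))" "0 \<le> sin (r * (z - x))"
  proof -
    have "r * (z - x) \<le> r * z" using rpos assms by (intro mult_left_mono) auto
    then have "r * (z - x) \<le> pi" using t_Suc_z_less_pi[of j] by (simp add: r_def)
    then show "0 \<le> sin (r * (z - x))" using rpos assms by (intro sin_ge_zero) simp_all
    show "0 \<le> sin (r * (1 + x))" using t_Suc_le_pi[of x j] rpos assms
      by (intro sin_ge_zero) (auto simp: r_def)
  qed
  ultimately have "2 * sin (r * (1 + x)) * (2 * sin (r * (z - x))) * R 0 \<le> F (Suc j) x"
    unfolding eq[OF assms(1,2)] by (intro mult_left_mono) auto
  then show ?thesis using s1 sz by (simp add: R0 r_def mult_ac)
qed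

lemma F_right:
  assumes "0 \<le> x" "x \<le> z - 1" "2 \<le> q (Suc j)"
  shows "p (Suc j) * (sin (t (Suc j) * (1 + x)) / sin (t (Suc j))) * (1 - bt * x) \<le> F (Suc j) x"
proof -
  have "(z - x) / z \<le> sin (t (Suc j) * (z - x)) / sin (t (Suc j) * z)"
    using assms z_gt_1 t_pos[of "Suc j"] t_Suc_z_less_pi[of j] by (intro sin_ratio_ge) auto
  moreover have "(z - x) / z = 1 - bt * x" using z_gt_1 bt_pos by (simp add: z_eq field_simps)
  moreover have "0 \<le> sin (t (Suc j) * (1 + x))"
    using t_Suc_le_pi[of x j] t_pos[of "Suc j"] assms by (intro sin_ge_zero) auto
  ultimately have "p (Suc j) * (sin (t (Suc j) * (1 + x)) / sin (t (Suc j))) * (1 - bt * x)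
    \<le> p (Suc j) * (sin (t (Suc j) * (1 + x)) / sin (t (Suc j))) * (sin (t (Suc j) * (z - x)) / sin (t (Suc j) * z))"
    using p_pos[of "Suc j"] sin_t_pos[of "Suc j"] by (intro mult_left_mono) auto
  then show ?thesis using F_right_sin[OF assms] by linarith
qed

end

section \<open>An unstable linear recursion\<close>

text \<open>In terms of \<open>v i = u (i + 1) + c * u i\<close> the recursion says \<open>v (i + 1) \<le> v i / c\<close>. A negative \<open>v j\<close> would therefore tend to \<open>- \<infinity>\<close> geometrically, which the lower bound for \<open>u\<close> excludes.\<close>

lemma unstable_recursion_nonneg:
  fixes u :: "nat \<Rightarrow> real" and c B C :: real
  assumes c: "0 < c" "c < 1" "B * c + c\<^sup>2 = 1"
    and rec: "\<And>j. J \<le> j \<Longrightarrow> u (Suc (Suc j)) \<le> u j + B * u (Suc j)"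
    and bound: "\<And>j. C \<le> u j"
    and j: "J \<le> j"
  shows "0 \<le> u (Suc j) + c * u j"
proof (rule ccontr)
  define v where "v i = u (Suc i) + c * u i" for i
  assume "\<not> 0 \<le> u (Suc j) + c * u j"
  then have neg: "v j < 0" by (simp add: v_def)
  have step: "c * v (Suc i) \<le> v i" if "J \<le> i" for i
  proof -
    have "c * v (Suc i) \<le> c * (u i + B * u (Suc i) + c * u (Suc i))"
      using rec[OF that] c by (intro mult_left_mono) (auto simp: v_def)
    also have "\<dots> = c * u i + (B * c + c\<^sup>2) * u (Suc i)"
      by (simp add: algebra_simps power2_eq_square)
    finally show ?thesis using c by (simp add: v_def)
  qed
  have iter: "c ^ n * v (j + n) \<le> v j" for n
  proof (induction n)
    case (Suc n)
    have "c ^ Suc n * v (j + Suc n) = c ^ n * (c * v (Suc (j + n)))" by simp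
    also have "\<dots> \<le> c ^ n * v (j + n)" using step[of "j + n"] j c by (intro mult_left_mono) auto
    finally show ?case using Suc by simp
  qed simp
  have low: "(1 + c) * C \<le> v i" for i
  proof -
    have "c * C \<le> c * u i" using bound[of i] c by (intro mult_left_mono) auto
    then show ?thesis using bound[of "Suc i"] by (simp add: v_def algebra_simps)
  qed
  have "(\<lambda>n. c ^ n * ((1 + c) * C)) \<longlonglongrightarrow> 0 * ((1 + c) * C)"
    using c by (intro tendsto_intros LIMSEQ_realpow_zero) auto
  moreover have "c ^ n * ((1 + c) * C) \<le> v j" for n
  proof -
    have "c ^ n * ((1 + c) * C) \<le> c ^ n * v (j + n)" using low[of "j + n"] c by (intro mult_left_mono) auto
    then show ?thesis using iter[of n] by linarith
  qed
  ultimately have "0 \<le> v j" by (intro LIMSEQ_le_const2[of _ 0]) auto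
  then show False using neg by simp
qed

lemma ln_le_tangent:
  fixes x y :: real
  assumes "0 < x" "0 < y" shows "ln x \<le> ln y + (x - y) / y"
  using ln_le_minus_one[of "x / y"] assms by (simp add: ln_div diff_divide_distrib)

text \<open>The weighted inequality of the arithmetic and geometric means, in the logarithmic form in which it is applied to two neighbouring blocks.\<close>

lemma weighted_ln_le:
  fixes x y P c d :: real
  assumes "0 < x" "0 < y" "0 < P" "0 \<le> c" "0 \<le> d" "c * x + d * y \<le> (c + d) * P"
  shows "c * ln x + d * ln y \<le> (c + d) * ln P"
proof -
  have "c * ln x + d * ln y \<le> c * (ln P + (x - P) / P) + d * (ln P + (y - P) / P)"
    using assms by (intro add_mono mult_left_mono ln_le_tangent) auto
  also have "\<dots> = (c + d) * ln P + (c * x + d * y - (c + d) * P) / P"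
    using assms by (simp add: field_simps)
  also have "\<dots> \<le> (c + d) * ln P" using assms by (simp add: divide_nonpos_pos)
  finally show ?thesis .
qed

context metallic
begin

section \<open>A recursion for the values at convergent denominators\<close>

text \<open>A symmetric product is the square of its first half up to the factors dropped in the middle, so a bound for the square needs only the first \<open>M\<close> factors, once each.\<close>

lemma half_product_le:
  fixes g :: "nat \<Rightarrow> real"
  assumes g: "\<And>m. m \<in> {1..<n} \<Longrightarrow> 0 \<le> g m \<and> g m \<le> 1"
    and sym: "\<And>m. m \<in> {1..<n} \<Longrightarrow> g (n - m) = g m" and M: "2 * M < n"
  shows "(\<Prod>m=1..<n. g m) \<le> (\<Prod>m=1..M. g m)\<^sup>2"
proof -
  define A B where "A = {1..M}" and "B = {n - M..<n}"
  have sub: "A \<subseteq> {1..<n}" "B \<subseteq> {1..<n}" "A \<inter> B = {}" using M by (auto simp: A_def B_def)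
  have fin: "finite A" "finite B" by (auto simp: A_def B_def)
  have "prod g B = prod g A"
    by (rule prod.reindex_bij_witness[of _ "\<lambda>m. n - m" "\<lambda>m. n - m"])
       (use M sym in \<open>auto simp: A_def B_def\<close>)
  then have AB: "prod g (A \<union> B) = (prod g A)\<^sup>2"
    using fin sub by (simp add: prod.union_disjoint power2_eq_square)
  have "(\<Prod>m=1..<n. g m) = prod g ({1..<n} - (A \<union> B)) * prod g (A \<union> B)"
    using sub by (intro prod.subset_diff) auto
  also have "\<dots> \<le> 1 * prod g (A \<union> B)"
    using g sub by (intro mult_right_mono prod_le_1 prod_nonneg) auto
  finally show ?thesis unfolding AB by (simp add: A_def)
qed

lemma S_right_le:
  assumes x: "0 \<le> x" "x < z" and M: "2 * M < q j"
  shows "S j x \<le> S j 0 * (\<Prod>m=1..M. 1 - x * (1 + x) / (zm m * (zm m + 1)))"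
proof -
  define g where "g m = 1 - w j x / V j m" for m
  have le: "g m \<le> 1 - x * (1 + x) / (zm m * (zm m + 1))" if "m \<in> {1..<q j}" for m
    using w_div_V_ge[OF that x] by (simp add: g_def)
  have g01: "0 \<le> g m \<and> g m \<le> 1" if m: "m \<in> {1..<q j}" for m
  proof -
    have "0 < zm m" using m by (intro zm_ge) auto
    then have "0 \<le> x * (1 + x) / (zm m * (zm m + 1))" using x by simp
    moreover have "w j x / V j m \<le> 1"
      using V_minus_w_pos[OF m, of x] V_pos[OF m] x z_gt_1 by simp
    ultimately show ?thesis using le[OF m] by (simp add: g_def)
  qed
  have Spos: "0 < S j x" "0 < S j 0" using x z_gt_1 by (auto intro!: S_pos)
  have "(S j x / S j 0)\<^sup>2 \<le> (\<Prod>m=1..M. g m)\<^sup>2"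
    unfolding S_ratio_squared g_def[symmetric]
    by (rule half_product_le[OF g01 _ M]) (auto simp: g_def V_reflect)
  moreover have "0 \<le> (\<Prod>m=1..M. g m)" using g01 M by (intro prod_nonneg) auto
  ultimately have "S j x / S j 0 \<le> (\<Prod>m=1..M. g m)" by (rule power2_le_imp_le)
  also have "\<dots> \<le> (\<Prod>m=1..M. 1 - x * (1 + x) / (zm m * (zm m + 1)))"
    using g01 le M by (intro prod_mono) auto
  finally show ?thesis using Spos by (simp add: field_simps)
qed

lemma F_right_le:
  assumes x: "0 \<le> x" "x + 1 < z" and M: "2 * M < q (Suc j)"
  shows "F (Suc j) x \<le> p (Suc j) * ((1 + x) * (\<Prod>m=1..M. 1 - x * (1 + x) / (zm m * (zm m + 1))))"
proof -
  define r where "r = t (Suc j)"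
  define X where "X = (\<Prod>m=1..M. 1 - x * (1 + x) / (zm m * (zm m + 1)))"
  have rpos: "0 < r" by (simp add: r_def t_pos)
  have "r * (1 + x) < r * z" using x rpos by (intro mult_strict_left_mono) auto
  then have lt: "r * (1 + x) < pi" using t_Suc_z_less_pi[of j] by (simp add: r_def)
  have s: "0 < sin (r * (1 + x))" "0 < sin r"
    using rpos x lt sin_t_pos by (auto intro: sin_gt_zero simp: r_def)
  have "F (Suc j) x = 2 * sin (r * (1 + x)) * S (Suc j) x"
    using x lt by (simp add: F_eq_S r_def)
  also have "\<dots> \<le> 2 * sin (r * (1 + x)) * (S (Suc j) 0 * X)"
    unfolding X_def using s x M by (intro mult_left_mono S_right_le) auto
  also have "\<dots> = p (Suc j) * (sin (r * (1 + x)) / sin r * X)"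
    using s by (simp add: p_eq_S r_def)
  also have "\<dots> \<le> p (Suc j) * ((1 + x) * X)"
  proof (intro mult_left_mono mult_right_mono)
    show "sin (r * (1 + x)) / sin r \<le> 1 + x"
      using sin_ratio_le[of r 1 "1 + x"] rpos x lt by simp
    show "0 \<le> X"
    proof -
      have "0 < S (Suc j) x" "0 < S (Suc j) 0" using x z_gt_1 by (auto intro!: S_pos)
      moreover have "S (Suc j) x \<le> S (Suc j) 0 * X"
        unfolding X_def using x M by (intro S_right_le) auto
      ultimately have "0 < S (Suc j) 0 * X" by linarith
      then show ?thesis using \<open>0 < S (Suc j) 0\<close> by (simp add: zero_less_mult_iff)
    qed
  qed (simp add: p_pos less_imp_le)
  finally show ?thesis by (simp add: X_def)
qed

text \<open>\<open>q (j + 2) = b * q (j + 1) + q j\<close> splits an unshifted block into \<open>b\<close> blocks at the shifts \<open>0, ..., b - 1\<close> and one at \<open>- bt * b = bt\<^sup>2 - 1\<close> one level below.\<close>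

lemma p_rec: "p (Suc (Suc j)) = (\<Prod>l<b. F (Suc j) (real l)) * F j (bt\<^sup>2 - 1)"
proof -
  have "p (Suc (Suc j)) = G (Suc j) (b * q (Suc j) + q j) 0"
    unfolding p_def sudler_eq_G[of _ "Suc j"] q_Suc_Suc ..
  also have "\<dots> = (\<Prod>l<b. F (Suc j) (real l)) * F j (- bt * real b)"
    by (simp add: G_mult_add G_Suc_level F_def)
  finally show ?thesis using bt_root by (simp add: mult.commute)
qed

text \<open>The product of the values at \<open>- h\<close> and \<open>h\<close>: to first order in \<open>h\<close> the pairs move in opposite directions, so only second-order terms remain and each pair decreases.\<close>

lemma S_left_times_right_le:
  assumes h: "0 < h" "h < 1" and tj: "t j \<le> pi / 2" and M: "2 * M < q j"
  shows "S j (- h) * S j h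
    \<le> (S j 0)\<^sup>2 * (\<Prod>m=1..M. 1 - 2 * cos (t j) * h\<^sup>2 / (zm m * (zm m + 1))
                              - h\<^sup>2 * (1 - h\<^sup>2) / (zm m * (zm m + 1))\<^sup>2)"
proof -
  define A where "A m = w j h / V j m" for m
  define B where "B m = - (w j (- h) / V j m)" for m
  define g where "g m = (1 - A m) * (1 + B m)" for m
  define X where "X m = 1 - 2 * cos (t j) * h\<^sup>2 / (zm m * (zm m + 1))
                          - h\<^sup>2 * (1 - h\<^sup>2) / (zm m * (zm m + 1))\<^sup>2" for m
  have cos: "0 \<le> cos (t j)" using tj t_pos[of j] by (intro cos_ge_zero) auto
  have main: "0 \<le> g m \<and> g m \<le> X m \<and> X m \<le> 1" if m: "m \<in> {1..<q j}" for m
  proof -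
    define Z where "Z = zm m * (zm m + 1)"
    have zm: "z \<le> zm m" "0 < zm m" "1 < zm m" using m by (auto intro!: zm_ge)
    have Z: "0 < Z" using zm by (simp add: Z_def)
    have Vp: "0 < V j m" by (rule V_pos[OF m])
    have A: "h * (1 + h) / Z \<le> A m" using w_div_V_ge[OF m, of h] h z_gt_1 by (simp add: A_def Z_def)
    have B: "h * (1 - h) / Z \<le> B m"
      using w_div_V_le[OF m, of "- h"] h by (simp add: B_def Z_def)
    have A1: "A m \<le> 1" using V_minus_w_pos[OF m, of h] Vp h z_gt_1 by (simp add: A_def)
    have r: "t j * zm m < pi" "t j * (1 + zm m) < pi"
      using zm_range[OF m, of 0] z_gt_1 by auto
    have sh: "h / zm m \<le> sin (t j * h) / sin (t j * zm m)"
      "h / (1 + zm m) \<le> sin (t j * h) / sin (t j * (1 + zm m))"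
      using h zm r t_pos[of j] by (auto intro!: sin_ratio_ge)
    have "h\<^sup>2 / Z = (h / zm m) * (h / (1 + zm m))" by (simp add: Z_def power2_eq_square add_ac)
    also have "\<dots> \<le> (sin (t j * h) / sin (t j * zm m)) * (sin (t j * h) / sin (t j * (1 + zm m)))"
    proof (intro mult_mono sh)
      have "0 \<le> h / zm m" using h zm by simp
      then show "0 \<le> sin (t j * h) / sin (t j * zm m)" using sh(1) by linarith
    qed (use h zm in simp)
    also have "\<dots> = (sin (t j * h))\<^sup>2 / V j m" by (simp add: V_def power2_eq_square mult_ac)
    finally have sq: "h\<^sup>2 / Z \<le> (sin (t j * h))\<^sup>2 / V j m" .
    have "t j * (1 + h) = t j + t j * h" "t j * (1 + - h) = t j - t j * h"
      by (simp_all add: algebra_simps)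
    then have "sin (t j * (1 + h)) - sin (t j * (1 + - h)) = 2 * cos (t j) * sin (t j * h)"
      by (simp only: sin_add sin_diff)
    then have "w j h + w j (- h) = 2 * cos (t j) * (sin (t j * h))\<^sup>2"
      unfolding w_def by (simp add: power2_eq_square algebra_simps)
    then have "A m - B m = 2 * cos (t j) * ((sin (t j * h))\<^sup>2 / V j m)"
      by (simp add: A_def B_def flip: add_divide_distrib)
    then have AB: "2 * cos (t j) * (h\<^sup>2 / Z) \<le> A m - B m"
      using mult_left_mono[OF sq, of "2 * cos (t j)"] cos by simp
    have nn: "0 \<le> h * (1 + h) / Z" "0 \<le> h * (1 - h) / Z" using h Z by auto
    have "(h * (1 + h) / Z) * (h * (1 - h) / Z) \<le> A m * B m"
      using A B nn by (intro mult_mono) linarith+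
    moreover have "(h * (1 + h) / Z) * (h * (1 - h) / Z) = h\<^sup>2 * (1 - h\<^sup>2) / Z\<^sup>2"
      by (simp add: power2_eq_square algebra_simps)
    ultimately have "g m \<le> X m"
      using AB unfolding g_def X_def Z_def[symmetric] by (simp add: algebra_simps)
    moreover have "0 \<le> g m" unfolding g_def using A1 B nn by (intro mult_nonneg_nonneg) linarith+
    moreover have "X m \<le> 1"
    proof -
      have "h\<^sup>2 \<le> 1" using h by (simp add: power_le_one)
      then have "0 \<le> 2 * cos (t j) * h\<^sup>2 / Z" "0 \<le> h\<^sup>2 * (1 - h\<^sup>2) / Z\<^sup>2" using cos Z by simp_all
      then show ?thesis unfolding X_def Z_def[symmetric] by linarith
    qed
    ultimately show ?thesis by simp
  qed
  have Spos: "0 < S j (- h)" "0 < S j h" "0 < S j 0" using h z_gt_1 by (auto intro!: S_pos)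
  have "(S j h / S j 0 * (S j (- h) / S j 0))\<^sup>2 = (\<Prod>m=1..<q j. g m)"
    unfolding power_mult_distrib S_ratio_squared prod.distrib[symmetric]
    by (simp add: g_def A_def B_def)
  also have "\<dots> \<le> (\<Prod>m=1..M. g m)\<^sup>2"
    by (rule half_product_le[OF _ _ M])
       (use main in \<open>fastforce simp: g_def A_def B_def V_reflect\<close>)+
  finally have "(S j h / S j 0 * (S j (- h) / S j 0))\<^sup>2 \<le> (\<Prod>m=1..M. g m)\<^sup>2" .
  moreover have "0 \<le> (\<Prod>m=1..M. g m)" using main M by (intro prod_nonneg) auto
  ultimately have "S j h / S j 0 * (S j (- h) / S j 0) \<le> (\<Prod>m=1..M. g m)" by (rule power2_le_imp_le)
  also have "\<dots> \<le> (\<Prod>m=1..M. X m)" using main M by (intro prod_mono) auto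
  finally show ?thesis using Spos by (simp add: X_def field_simps power2_eq_square)
qed

lemma bt_sq: "0 < bt\<^sup>2" "bt\<^sup>2 < bt" "bt\<^sup>2 < 1"
proof -
  have "bt * bt < bt * 1" using bt_pos bt_less_1 by (intro mult_strict_left_mono) auto
  then show "0 < bt\<^sup>2" "bt\<^sup>2 < bt" and "bt\<^sup>2 < 1"
    using bt_pos bt_less_1 unfolding power2_eq_square by (simp, simp, linarith)
qed

lemma z_minus_1_ge: "bt\<^sup>2 \<le> z - 1" "bt \<le> z - 1"
proof -
  show "bt \<le> z - 1" using b_ge_1 by (simp add: z_def)
  then show "bt\<^sup>2 \<le> z - 1" using bt_sq by linarith
qed

text \<open>The last block of \<open>p_rec\<close> sits close to the zero at \<open>- 1\<close>. By symmetry its \<open>S\<close>-part equals the value at \<open>- h\<close>, and the value at \<open>- h\<close> is bounded above by bounding the one at \<open>h\<close> below, with \<open>F_right\<close>.\<close>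

lemma F_low_le:
  assumes q2: "2 \<le> q (Suc j)" and tj: "t (Suc j) \<le> pi / 2" and M: "2 * M < q (Suc j)"
  defines "h \<equiv> bt\<^sup>2"
  shows "F (Suc j) (bt\<^sup>2 - 1) \<le> p (Suc j) * (h * (t (Suc j) / sin (t (Suc j))) / (1 - bt ^ 3)
    * (\<Prod>m=1..M. 1 - 2 * cos (t (Suc j)) * h\<^sup>2 / (zm m * (zm m + 1))
                              - h\<^sup>2 * (1 - h\<^sup>2) / (zm m * (zm m + 1))\<^sup>2))"
proof -
  define r where "r = t (Suc j)"
  define X where "X = (\<Prod>m=1..M. 1 - 2 * cos (t (Suc j)) * h\<^sup>2 / (zm m * (zm m + 1))
                              - h\<^sup>2 * (1 - h\<^sup>2) / (zm m * (zm m + 1))\<^sup>2)"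
  have h: "0 < h" "h < 1" "h \<le> z - 1" using bt_sq z_minus_1_ge by (auto simp: h_def)
  have rpos: "0 < r" by (simp add: r_def t_pos)
  have sr: "0 < sin r" by (simp add: r_def sin_t_pos)
  have b3: "bt * h = bt ^ 3" by (simp add: h_def power2_eq_square power3_eq_cube)
  have "bt ^ 3 < 1" using bt_pos bt_less_1 power_Suc_less_one[of bt 2] by (simp add: eval_nat_numeral)
  then have d: "0 < 1 - bt ^ 3" by simp
  have le_pi: "r * (1 + h) \<le> pi" using t_Suc_le_pi[of h j] h by (simp add: r_def)
  have "r * (1 + h) < r * (1 + z)" using rpos h z_gt_1 by (intro mult_strict_left_mono) auto
  moreover have "r * (1 + z) < pi" using zm_range[of 1 "Suc j" 0] q2 z_gt_1 by (simp add: zm_1 r_def)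
  ultimately have "r * (1 + h) < pi" by linarith
  then have sh: "0 < sin (r * (1 + h))" using rpos h by (intro sin_gt_zero) simp_all
  have "p (Suc j) * (sin (r * (1 + h)) / sin r) * (1 - bt * h) \<le> F (Suc j) h"
    unfolding r_def using h q2 by (intro F_right) auto
  also have "F (Suc j) h = 2 * sin (r * (1 + h)) * S (Suc j) h"
    using h le_pi z_gt_1 by (simp add: F_eq_S r_def)
  finally have "2 * sin (r * (1 + h)) * (S (Suc j) 0 * (1 - bt ^ 3)) \<le> 2 * sin (r * (1 + h)) * S (Suc j) h"
    using sr unfolding b3 by (simp add: p_eq_S r_def mult_ac)
  then have Sh: "S (Suc j) 0 * (1 - bt ^ 3) \<le> S (Suc j) h" using sh by simp
  have Spos: "0 < S (Suc j) (- h)" "0 < S (Suc j) 0" using h z_gt_1 by (auto intro!: S_pos)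
  have "S (Suc j) (- h) * (S (Suc j) 0 * (1 - bt ^ 3)) \<le> S (Suc j) (- h) * S (Suc j) h"
    using Sh Spos by (intro mult_left_mono) auto
  also have "\<dots> \<le> (S (Suc j) 0)\<^sup>2 * X"
    unfolding X_def using h tj M by (intro S_left_times_right_le) auto
  finally have "S (Suc j) 0 * (S (Suc j) (- h) * (1 - bt ^ 3)) \<le> S (Suc j) 0 * (S (Suc j) 0 * X)"
    by (simp add: power2_eq_square mult_ac)
  then have low: "S (Suc j) (- h) * (1 - bt ^ 3) \<le> S (Suc j) 0 * X" using Spos by simp
  then have X0: "0 \<le> X" using Spos d
    by (meson less_imp_le mult_pos_pos order_less_le_trans zero_less_mult_pos)
  have "r * h \<le> r * 1" using rpos h by (intro mult_left_mono) auto
  then have "r * h < pi" using t_less_pi[of "Suc j"] by (simp add: r_def)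
  then have rh: "0 < r * h" "r * h < pi" using rpos h by simp_all
  have "F (Suc j) (h - 1) = 2 * sin (r * h) * S (Suc j) (h - 1)"
    using F_eq_S[of "h - 1" "Suc j"] h rh z_gt_1 by (simp add: r_def)
  also have "S (Suc j) (h - 1) = S (Suc j) (- h)"
    using S_symmetric[of "- h" "Suc j"] h z_gt_1 by simp
  also have "2 * sin (r * h) * S (Suc j) (- h) \<le> 2 * (r * h) * (S (Suc j) 0 * X / (1 - bt ^ 3))"
  proof (intro mult_mono)
    show "sin (r * h) \<le> r * h" using rh by (intro sin_x_le_x) auto
    show "S (Suc j) (- h) \<le> S (Suc j) 0 * X / (1 - bt ^ 3)" using low d by (simp add: field_simps)
  qed (use rh Spos in \<open>auto intro: less_imp_le sin_gt_zero\<close>)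
  also have "\<dots> = p (Suc j) * (h * (r / sin r) / (1 - bt ^ 3) * X)"
    using sr by (simp add: p_eq_S r_def)
  finally show ?thesis by (simp add: h_def X_def r_def)
qed

lemma p_rec_upper:
  assumes q2: "2 \<le> q (Suc j)" and tj: "t (Suc j) \<le> pi / 2"
    and N: "2 * N < q (Suc j)" and M: "2 * M < q (Suc (Suc j))"
  defines "h \<equiv> bt\<^sup>2"
  shows "p (Suc (Suc (Suc j))) \<le> p (Suc j) * p (Suc (Suc j)) ^ b *
    ((h * (t (Suc j) / sin (t (Suc j))) / (1 - bt ^ 3)
    * (\<Prod>m=1..N. 1 - 2 * cos (t (Suc j)) * h\<^sup>2 / (zm m * (zm m + 1))
                              - h\<^sup>2 * (1 - h\<^sup>2) / (zm m * (zm m + 1))\<^sup>2)) *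
     (\<Prod>l<b. (1 + real l) * (\<Prod>m=1..M. 1 - real l * (1 + real l) / (zm m * (zm m + 1)))))"
proof -
  have nn: "0 \<le> F i x" for i x by (simp add: F_def G_nonneg)
  have "p (Suc (Suc (Suc j))) = (\<Prod>l<b. F (Suc (Suc j)) (real l)) * F (Suc j) (bt\<^sup>2 - 1)"
    by (rule p_rec)
  also have "\<dots> \<le> (\<Prod>l<b. p (Suc (Suc j)) * ((1 + real l) * (\<Prod>m=1..M. 1 - real l * (1 + real l) / (zm m * (zm m + 1)))))
     * (p (Suc j) * (h * (t (Suc j) / sin (t (Suc j))) / (1 - bt ^ 3)
    * (\<Prod>m=1..N. 1 - 2 * cos (t (Suc j)) * h\<^sup>2 / (zm m * (zm m + 1))
                              - h\<^sup>2 * (1 - h\<^sup>2) / (zm m * (zm m + 1))\<^sup>2)))"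
  proof (intro mult_mono prod_mono conjI nn prod_nonneg)
    show le: "F (Suc (Suc j)) (real l) \<le> p (Suc (Suc j)) * ((1 + real l) *
        (\<Prod>m=1..M. 1 - real l * (1 + real l) / (zm m * (zm m + 1))))" if "l \<in> {..<b}" for l
    proof (rule F_right_le[OF _ _ M])
      have "real l + 1 \<le> real b" using that by simp
      then show "real l + 1 < z" using bt_pos by (simp add: z_def)
    qed simp
    show "0 \<le> p (Suc (Suc j)) * ((1 + real l) *
        (\<Prod>m=1..M. 1 - real l * (1 + real l) / (zm m * (zm m + 1))))" if "l \<in> {..<b}" for l
      by (rule order_trans[OF nn le[OF that]])
    show "F (Suc j) (bt\<^sup>2 - 1) \<le> p (Suc j) * (h * (t (Suc j) / sin (t (Suc j))) / (1 - bt ^ 3)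
    * (\<Prod>m=1..N. 1 - 2 * cos (t (Suc j)) * h\<^sup>2 / (zm m * (zm m + 1))
                              - h\<^sup>2 * (1 - h\<^sup>2) / (zm m * (zm m + 1))\<^sup>2))"
      unfolding h_def by (rule F_low_le[OF q2 tj N])
  qed
  finally show ?thesis by (simp add: prod.distrib mult_ac)
qed

lemma p_rec_lower:
  assumes q2: "2 \<le> q (Suc j)" and kappa: "0 \<le> \<kappa>" "p j * (bt\<^sup>2 * \<kappa>) \<le> F j (bt\<^sup>2 - 1)"
  shows "p j * p (Suc j) ^ b * (bt\<^sup>2 * \<kappa> *
     (\<Prod>l<b. (sin (t (Suc j) * (1 + real l)) / sin (t (Suc j))) * (1 - bt * real l))) \<le> p (Suc (Suc j))"
proof -
  have nn: "0 \<le> F i x" for i x by (simp add: F_def G_nonneg)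
  define f where "f l = (sin (t (Suc j) * (1 + real l)) / sin (t (Suc j))) * (1 - bt * real l)" for l
  have l: "0 \<le> f l \<and> p (Suc j) * f l \<le> F (Suc j) (real l)" if "l < b" for l
  proof -
    have "real l + 1 \<le> real b" using that by simp
    then have lz: "real l \<le> z - 1" using bt_pos by (simp add: z_def)
    have "0 \<le> sin (t (Suc j) * (1 + real l))"
      using t_Suc_le_pi[OF lz, of j] t_pos[of "Suc j"] by (intro sin_ge_zero) auto
    moreover have "bt * real l \<le> bt * z" using bt_pos lz by (intro mult_left_mono) auto
    ultimately have "0 \<le> f l" using sin_t_pos[of "Suc j"] by (simp add: f_def bt_z)
    moreover have "p (Suc j) * f l \<le> F (Suc j) (real l)"
      using F_right[of "real l" j] lz q2 by (simp add: f_def mult.assoc)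
    ultimately show ?thesis by simp
  qed
  have "p j * p (Suc j) ^ b * (bt\<^sup>2 * \<kappa> * (\<Prod>l<b. f l)) = (\<Prod>l<b. p (Suc j) * f l) * (p j * (bt\<^sup>2 * \<kappa>))"
    by (simp add: prod.distrib mult_ac)
  also have "\<dots> \<le> (\<Prod>l<b. F (Suc j) (real l)) * F j (bt\<^sup>2 - 1)"
    using l kappa p_pos[of j] p_pos[of "Suc j"] nn
    by (intro mult_mono prod_mono conjI prod_nonneg) (auto simp: less_imp_le)
  finally show ?thesis by (simp add: p_rec f_def)
qed

section \<open>Consequences of the recursion for a convergent sequence\<close>

text \<open>If \<open>K * P ^ b \<le> 1\<close> then \<open>P\<close> is at most the fixed point of the recursion, and \<open>u = ln p - ln P\<close> satisfies the hypotheses of \<open>unstable_recursion_nonneg\<close>: because the blocks stay bounded away from \<open>0\<close>, the weighted mean of two consecutive ones can never fall below \<open>P\<close>.\<close>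

lemma p_threshold_lower:
  assumes rec: "\<And>j. J \<le> j \<Longrightarrow> p (Suc (Suc j)) \<le> p j * p (Suc j) ^ b * K"
    and K: "0 < P" "K * P ^ b \<le> 1" and lim: "p \<longlonglongrightarrow> L" "0 < L" and j: "J \<le> j"
  shows "(1 + bt) * ln P \<le> ln (p (Suc j)) + bt * ln (p j)"
proof -
  define u where "u i = ln (p i) - ln P" for i
  have pp: "0 < p i" for i by (rule p_pos)
  have K0: "0 < K"
  proof -
    have "0 < p J * p (Suc J) ^ b * K" using rec[of J] pp[of "Suc (Suc J)"] by simp
    moreover have "0 < p J * p (Suc J) ^ b" using pp by simp
    ultimately show ?thesis using zero_less_mult_pos by blast
  qed
  have lnK: "ln K + real b * ln P \<le> 0"
  proof -
    have "ln (K * P ^ b) \<le> ln 1" using K K0 by (subst ln_le_cancel_iff) auto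
    then show ?thesis using K K0 by (simp add: ln_mult ln_realpow)
  qed
  have "(\<lambda>i. ln (p i)) \<longlonglongrightarrow> ln L" using lim by (intro tendsto_ln) auto
  then have "Bseq (\<lambda>i. ln (p i))" by (intro convergent_imp_Bseq convergentI)
  then obtain C where C: "\<And>i. \<bar>ln (p i)\<bar> \<le> C" by (auto simp: Bseq_def)
  have "0 \<le> u (Suc j) + bt * u j"
  proof (rule unstable_recursion_nonneg[where B = "real b" and C = "- C - ln P" and J = J])
    show "real b * bt + bt\<^sup>2 = 1" using bt_root by simp
    show "- C - ln P \<le> u i" for i using C[of i] by (simp add: u_def abs_le_iff)
    fix i assume "J \<le> i"
    have "ln (p (Suc (Suc i))) \<le> ln (p i * p (Suc i) ^ b * K)"
      using rec[OF \<open>J \<le> i\<close>] pp[of "Suc (Suc i)"] by (subst ln_le_cancel_iff) auto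
    also have "\<dots> = ln (p i) + real b * ln (p (Suc i)) + ln K"
      using pp[of i] pp[of "Suc i"] K0 by (simp add: ln_mult ln_realpow)
    finally show "u (Suc (Suc i)) \<le> u i + real b * u (Suc i)"
      using lnK by (simp add: u_def algebra_simps)
  qed (use bt_pos bt_less_1 j in auto)
  then show ?thesis by (simp add: u_def algebra_simps)
qed

lemma p_threshold_upper:
  assumes rec: "\<And>j. J \<le> j \<Longrightarrow> p j * p (Suc j) ^ b * K \<le> p (Suc (Suc j))"
    and K: "0 < Q" "0 < K" "1 \<le> K * Q ^ b" and lim: "p \<longlonglongrightarrow> L" "0 < L" and j: "J \<le> j"
  shows "ln (p (Suc j)) + bt * ln (p j) \<le> (1 + bt) * ln Q"
proof -
  define u where "u i = ln Q - ln (p i)" for i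
  have pp: "0 < p i" for i by (rule p_pos)
  have lnK: "0 \<le> ln K + real b * ln Q"
  proof -
    have "ln 1 \<le> ln (K * Q ^ b)" using K by (subst ln_le_cancel_iff) auto
    then show ?thesis using K by (simp add: ln_mult ln_realpow)
  qed
  have "(\<lambda>i. ln (p i)) \<longlonglongrightarrow> ln L" using lim by (intro tendsto_ln) auto
  then have "Bseq (\<lambda>i. ln (p i))" by (intro convergent_imp_Bseq convergentI)
  then obtain C where C: "\<And>i. \<bar>ln (p i)\<bar> \<le> C" by (auto simp: Bseq_def)
  have "0 \<le> u (Suc j) + bt * u j"
  proof (rule unstable_recursion_nonneg[where B = "real b" and C = "ln Q - C" and J = J])
    show "real b * bt + bt\<^sup>2 = 1" using bt_root by simp
    show "ln Q - C \<le> u i" for i using C[of i] by (simp add: u_def abs_le_iff)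
    fix i assume "J \<le> i"
    have "ln (p i) + real b * ln (p (Suc i)) + ln K = ln (p i * p (Suc i) ^ b * K)"
      using pp[of i] pp[of "Suc i"] K by (simp add: ln_mult ln_realpow)
    also have "\<dots> \<le> ln (p (Suc (Suc i)))"
      using rec[OF \<open>J \<le> i\<close>] pp[of i] pp[of "Suc i"] pp[of "Suc (Suc i)"] K
      by (subst ln_le_cancel_iff) auto
    finally show "u (Suc (Suc i)) \<le> u i + real b * u (Suc i)"
      using lnK by (simp add: u_def algebra_simps)
  qed (use bt_pos bt_less_1 j in auto)
  then show ?thesis by (simp add: u_def algebra_simps)
qed

lemma p_ge_from_threshold:
  assumes "(1 + bt) * ln P \<le> ln (p (Suc j)) + bt * ln (p j)"
    and "0 < P" "0 < I" "p j \<le> X" "I + bt * X \<le> (1 + bt) * P"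
  shows "I \<le> p (Suc j)"
proof -
  have "0 < X" using p_pos[of j] assms by linarith
  have "1 * ln I + bt * ln X \<le> (1 + bt) * ln P"
    using assms \<open>0 < X\<close> bt_pos by (intro weighted_ln_le) auto
  moreover have "bt * ln (p j) \<le> bt * ln X"
    using assms p_pos[of j] bt_pos by (intro mult_left_mono) auto
  ultimately have "ln I \<le> ln (p (Suc j))" using assms(1) by linarith
  then show ?thesis using ln_le_cancel_iff[OF \<open>0 < I\<close> p_pos[of "Suc j"]] by simp
qed

text \<open>Two consecutive means determine a single block up to the spread between \<open>P\<close> and \<open>Q\<close>; since \<open>bt < 1\<close>, a lower bound \<open>I\<close> then propagates by two levels at a time.\<close>

lemma p_ge_all:
  assumes low: "\<And>j. J \<le> j \<Longrightarrow> (1 + bt) * ln P \<le> ln (p (Suc j)) + bt * ln (p j)"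
    and up: "\<And>j. J \<le> j \<Longrightarrow> ln (p (Suc j)) + bt * ln (p j) \<le> (1 + bt) * ln Q"
    and pos: "0 < P" "0 < Q" "0 < I" and cond: "(1 - bt) * I + bt * Q \<le> P"
    and base: "I \<le> p J" "I \<le> p (Suc J)" and j: "J \<le> j"
  shows "I \<le> p j"
  using j
proof (induction j rule: less_induct)
  case (less j)
  show ?case
  proof (cases "j = J \<or> j = Suc J")
    case False
    then have "Suc (Suc J) \<le> j" using less.prems by simp
    then obtain i where i: "j = Suc (Suc i)" "J \<le> i" by (metis Suc_le_D Suc_le_mono)
    have "I \<le> p i" using less.IH[of i] i by simp
    then have Ii: "ln I \<le> ln (p i)" using pos(3) by (simp add: order_less_le_trans)
    have "(1 - bt) * ln I + bt * ln Q \<le> (1 - bt + bt) * ln P"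
      using pos cond bt_pos bt_less_1 by (intro weighted_ln_le) auto
    then have "(1 + bt) * ((1 - bt) * ln I + bt * ln Q) \<le> (1 + bt) * ln P"
      using bt_pos by (intro mult_left_mono) auto
    moreover have "(1 + bt) * ln P \<le> ln (p j) + bt * ln (p (Suc i))" using low[of "Suc i"] i by simp
    moreover have "bt * (ln (p (Suc i)) + bt * ln (p i)) \<le> bt * ((1 + bt) * ln Q)"
      using up[of i] i bt_pos by (intro mult_left_mono) auto
    moreover have "bt\<^sup>2 * ln I \<le> bt\<^sup>2 * ln (p i)" using Ii by (intro mult_left_mono) auto
    ultimately have "ln I \<le> ln (p j)" by (simp add: algebra_simps power2_eq_square)
    then show ?thesis using ln_le_cancel_iff[OF pos(3) p_pos[of j]] by simp
  qed (use base in auto)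
qed

text \<open>In the limit both terms of the weighted mean agree.\<close>

lemma p_limit_ge:
  assumes low: "\<And>j. J \<le> j \<Longrightarrow> (1 + bt) * ln P \<le> ln (p (Suc j)) + bt * ln (p j)"
    and "0 < P" and lim: "p \<longlonglongrightarrow> L" "0 < L"
  shows "P \<le> L"
proof -
  have "(\<lambda>j. ln (p j)) \<longlonglongrightarrow> ln L" using lim by (intro tendsto_ln) auto
  then have "(\<lambda>j. ln (p (Suc j)) + bt * ln (p j)) \<longlonglongrightarrow> ln L + bt * ln L"
    using LIMSEQ_Suc[of "\<lambda>j. ln (p j)"] by (intro tendsto_add tendsto_mult_left) auto
  then have "(1 + bt) * ln P \<le> ln L + bt * ln L"
    by (rule LIMSEQ_le_const) (use low in blast)
  then have "(1 + bt) * ln P \<le> (1 + bt) * ln L" by (simp add: algebra_simps)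
  then have "ln P \<le> ln L" using bt_pos by simp
  then show ?thesis using ln_le_cancel_iff[OF \<open>0 < P\<close> lim(2)] by simp
qed

end

section \<open>Limits and summation\<close>

text \<open>Exchanging the limits in the level \<open>j\<close> and in the truncation \<open>M\<close>, when the truncation error is uniformly small up to an error that vanishes with \<open>j\<close>.\<close>

lemma double_limit:
  fixes X d e a :: "nat \<Rightarrow> real" and Y :: "nat \<Rightarrow> nat \<Rightarrow> real"
  assumes Y: "\<And>M. (\<lambda>j. Y j M) \<longlonglongrightarrow> a M"
    and close: "\<And>M. mlow \<le> M \<Longrightarrow> \<forall>\<^sub>F j in sequentially. \<bar>X j - Y j M\<bar> \<le> e M + d j"
    and e: "e \<longlonglongrightarrow> 0" and d: "d \<longlonglongrightarrow> 0"
  shows "\<exists>l. X \<longlonglongrightarrow> l \<and> a \<longlonglongrightarrow> l"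
proof -
  have diff: "\<bar>a M - a M'\<bar> \<le> e M + e M'" if "mlow \<le> M" "mlow \<le> M'" for M M'
  proof (rule tendsto_le[of sequentially])
    show "(\<lambda>j. \<bar>Y j M - Y j M'\<bar>) \<longlonglongrightarrow> \<bar>a M - a M'\<bar>" by (intro tendsto_intros Y)
    show "(\<lambda>j. e M + e M' + 2 * d j) \<longlonglongrightarrow> e M + e M'"
      using tendsto_add[OF tendsto_const[of "e M + e M'"] tendsto_mult_left[OF d, of 2]] by simp
    show "\<forall>\<^sub>F j in sequentially. \<bar>Y j M - Y j M'\<bar> \<le> e M + e M' + 2 * d j"
      using close[OF that(1)] close[OF that(2)] by eventually_elim linarith
  qed simp
  have "Cauchy a"
  proof (rule metric_CauchyI)
    fix r :: real assume "0 < r"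
    then have "\<forall>\<^sub>F M in sequentially. e M < r / 2" by (intro order_tendstoD[OF e]) simp
    then obtain N where N: "\<And>M. N \<le> M \<Longrightarrow> e M < r / 2" by (auto simp: eventually_sequentially)
    show "\<exists>N. \<forall>m\<ge>N. \<forall>n\<ge>N. dist (a m) (a n) < r"
    proof (intro exI[of _ "max N mlow"] allI impI)
      fix m n assume "max N mlow \<le> m" "max N mlow \<le> n"
      then show "dist (a m) (a n) < r" using diff[of m n] N[of m] N[of n] by (simp add: dist_real_def)
    qed
  qed
  then obtain l where l: "a \<longlonglongrightarrow> l" using Cauchy_convergent convergent_def by blast
  have "X \<longlonglongrightarrow> l"
  proof (rule tendstoI)
    fix r :: real assume r: "0 < r"
    have "\<forall>\<^sub>F M in sequentially. e M < r / 4 \<and> dist (a M) l < r / 4 \<and> mlow \<le> M"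
      using order_tendstoD(2)[OF e, of "r / 4"] tendstoD[OF l, of "r / 4"] r
      by (intro eventually_conj eventually_ge_at_top) auto
    then obtain M where M: "e M < r / 4" "dist (a M) l < r / 4" "mlow \<le> M"
      by (auto simp: eventually_sequentially)
    have "\<forall>\<^sub>F j in sequentially. d j < r / 4" "\<forall>\<^sub>F j in sequentially. dist (Y j M) (a M) < r / 4"
      using order_tendstoD(2)[OF d, of "r / 4"] tendstoD[OF Y[of M], of "r / 4"] r by auto
    with close[OF M(3)] show "\<forall>\<^sub>F j in sequentially. dist (X j) l < r"
    proof eventually_elim
      case (elim j)
      then show ?case using M unfolding dist_real_def by linarith
    qed
  qed
  then show ?thesis using l by blast
qed

lemma card_filter:
  "finite A \<Longrightarrow> card {x \<in> A. P x} = (\<Sum>x\<in>A. if P x then 1 else 0)"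
  by (simp flip: sum.inter_filter)

lemma jordan_sin:
  fixes x :: real
  assumes "0 \<le> x" "x \<le> pi / 2" shows "2 * x / pi \<le> sin x"
proof (cases "x = 0")
  case False
  then have "x * sin (pi / 2) \<le> pi / 2 * sin x"
    using assms by (intro sin_div_antimono) auto
  then show ?thesis by (simp add: field_simps)
qed simp

text \<open>The second-order term of \<open>ln \<circ> sin\<close> is controlled by applying the tangent inequality at both points; Jordan's inequality bounds the sines from below.\<close>

lemma ln_sin_tangent_error:
  assumes A: "0 < A" "A \<le> pi / 2" and n: "\<bar>\<eta>\<bar> \<le> A / 2"
  shows "\<bar>ln (sin (A + \<eta>)) - ln (sin A) - \<eta> * cot A\<bar> \<le> pi\<^sup>2 / 2 * (\<eta> / A)\<^sup>2"
proof -
  define B where "B = A + \<eta>"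
  have B: "A / 2 \<le> B" "B \<le> 3 * A / 2" using n by (auto simp: B_def abs_le_iff)
  have B': "0 < B" "B < pi" using A B by auto
  have A': "A < pi" using A pi_gt_zero by linarith
  have sA: "2 * A / pi \<le> sin A" using A by (intro jordan_sin) auto
  have sB: "A / pi \<le> sin B"
  proof (cases "B \<le> pi / 2")
    case True
    have "A / pi \<le> 2 * B / pi" using B by (intro divide_right_mono) auto
    then show ?thesis using jordan_sin[of B] True B' by linarith
  next
    case False
    have "2 * (pi - B) / pi \<le> sin (pi - B)" using False B A B' by (intro jordan_sin) auto
    moreover have "1 / 2 \<le> 2 * (pi - B) / pi" using B A by (simp add: field_simps)
    moreover have "A / pi \<le> 1 / 2" using A by (simp add: field_simps)
    ultimately show ?thesis using sin_pi_minus[of B] by linarith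
  qed
  have pos: "0 < sin A" "0 < sin B" using A A' B' by (auto intro: sin_gt_zero)
  have up: "ln (sin B) - ln (sin A) - \<eta> * cot A \<le> 0"
    using ln_sin_le_tangent[of A B] A A' B' by (simp add: B_def)
  have "ln (sin A) \<le> ln (sin B) - \<eta> * cot B"
    using ln_sin_le_tangent[of B A] A A' B' by (simp add: B_def)
  then have "\<eta> * (cot B - cot A) \<le> ln (sin B) - ln (sin A) - \<eta> * cot A" by (simp add: algebra_simps)
  moreover have "\<eta> * (cot B - cot A) = - (\<eta> * sin \<eta> / (sin A * sin B))"
  proof -
    have "sin \<eta> = sin (B - A)" by (simp add: B_def)
    then have "sin \<eta> = sin B * cos A - cos B * sin A" by (simp add: sin_diff)
    moreover have "cot B - cot A = - ((sin B * cos A - cos B * sin A) / (sin A * sin B))"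
      using pos by (simp add: cot_def field_simps)
    ultimately show ?thesis by simp
  qed
  moreover have "\<eta> * sin \<eta> / (sin A * sin B) \<le> \<eta>\<^sup>2 / ((2 * A / pi) * (A / pi))"
  proof (rule frac_le)
    have "\<bar>\<eta>\<bar> * \<bar>sin \<eta>\<bar> \<le> \<bar>\<eta>\<bar> * \<bar>\<eta>\<bar>" by (intro mult_left_mono abs_sin_x_le_abs_x) auto
    then show "\<eta> * sin \<eta> \<le> \<eta>\<^sup>2" by (simp add: power2_eq_square flip: abs_mult)
    show "(2 * A / pi) * (A / pi) \<le> sin A * sin B"
      using sA sB A pos by (intro mult_mono) auto
  qed (use A in auto)
  moreover have "\<eta>\<^sup>2 / ((2 * A / pi) * (A / pi)) = pi\<^sup>2 / 2 * (\<eta> / A)\<^sup>2"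
    by (simp add: power2_eq_square mult_ac)
  ultimately show ?thesis using up unfolding B_def[symmetric] by linarith
qed

lemma summation_by_parts:
  fixes s c :: "nat \<Rightarrow> real"
  assumes "M \<le> R"
  shows "(\<Sum>m\<in>{M<..R}. (s m - s (m - 1)) * c m)
    = s R * c R - s M * c M + (\<Sum>m\<in>{M..<R}. s m * (c m - c (Suc m)))"
  using assms
proof (induction R rule: dec_induct)
  case (step R)
  have "{M<..Suc R} = insert (Suc R) {M<..R}" using step by auto
  then show ?case using step by (simp add: algebra_simps)
qed simp

lemma inverse_sqrt_telescope:
  assumes "0 < m"
  shows "sqrt (real m) / (real m * (real m + 1)) \<le> 2 * (1 / sqrt (real m) - 1 / sqrt (real (Suc m)))"
proof -
  define x y where "x = sqrt (real m)" and "y = sqrt (real (Suc m))"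
  have xy: "0 < x" "x \<le> y" "0 < y" "x * x = real m" "y * y = real m + 1"
    using assms by (auto simp: x_def y_def)
  have "(y - x) * (y + x) = 1" using xy by (simp add: algebra_simps)
  moreover have "(y - x) * (y + x) \<le> (y - x) * (2 * y)" using xy by (intro mult_left_mono) auto
  ultimately have "1 \<le> 2 * y * (y - x)" by (simp add: mult.commute)
  then have "1 / (x * (y * y)) \<le> 2 * y * (y - x) / (x * (y * y))" using xy by (intro divide_right_mono) auto
  also have "\<dots> = 2 * (1 / x - 1 / y)" using xy(1,3) by (simp add: field_simps)
  also have "1 / (x * (y * y)) = x / ((x * x) * (y * y))" using xy(1) by simp
  also have "\<dots> = x / (real m * (real m + 1))" by (simp only: xy(4,5))
  finally show ?thesis by (simp add: x_def y_def)
qed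

lemma sum_inverse_squares_le:
  assumes "0 < M" "M \<le> R"
  shows "(\<Sum>m\<in>{M<..R}. 1 / (real m)\<^sup>2) \<le> 1 / real M - 1 / real R"
  using assms(2)
proof (induction R rule: dec_induct)
  case (step R)
  have R: "0 < R" using step assms by simp
  have "{M<..Suc R} = insert (Suc R) {M<..R}" using step by auto
  then have "(\<Sum>m\<in>{M<..Suc R}. 1 / (real m)\<^sup>2) \<le> 1 / (real (Suc R))\<^sup>2 + (1 / real M - 1 / real R)"
    using step by simp
  also have "1 / (real (Suc R))\<^sup>2 \<le> 1 / (real R * real (Suc R))"
    using R by (intro divide_left_mono) (auto simp: power2_eq_square)
  also have "\<dots> = 1 / real R - 1 / real (Suc R)" using R by (simp add: field_simps)
  finally show ?case by simp
qed simp

context metallic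
begin

section \<open>The sawtooth sums\<close>

definition saw :: "nat \<Rightarrow> real" where "saw n = frac (real n * bt) - 1 / 2"
definition saw_sum :: "nat \<Rightarrow> real" where "saw_sum N = (\<Sum>n=1..N. saw n)"
definition floor_bt :: "nat \<Rightarrow> nat" where "floor_bt n = nat \<lfloor>real n * bt\<rfloor>"

lemma floor_bt: "real (floor_bt n) \<le> real n * bt" "real n * bt < real (floor_bt n) + 1"
  "of_int \<lfloor>real n * bt\<rfloor> = real (floor_bt n)"
proof -
  have "0 \<le> real n * bt" using bt_pos by simp
  then have *: "int (floor_bt n) = \<lfloor>real n * bt\<rfloor>" by (simp add: floor_bt_def)
  then show "of_int \<lfloor>real n * bt\<rfloor> = real (floor_bt n)" by (metis of_int_of_nat_eq)
  then show "real (floor_bt n) \<le> real n * bt" "real n * bt < real (floor_bt n) + 1"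
    using floor_correct[of "real n * bt"] by auto
qed

lemma le_fl_iff: "m \<le> floor_bt n \<longleftrightarrow> real m \<le> real n * bt"
proof
  assume "m \<le> floor_bt n" then show "real m \<le> real n * bt" using floor_bt(1)[of n] by (meson le_trans of_nat_mono order_trans)
next
  assume "real m \<le> real n * bt"
  then have "real m < real (Suc (floor_bt n))" using floor_bt(2)[of n] by simp
  then show "m \<le> floor_bt n" by simp
qed

text \<open>Count the lattice points in an \<open>N\<close> by \<open>\<lfloor>N * bt\<rfloor>\<close> rectangle below and above the line of slope \<open>bt\<close>. Since \<open>1 / bt = b + bt\<close>, the count above is again given by multiples of \<open>bt\<close>.\<close>

lemma lattice_point_reciprocity:
  "(\<Sum>n=1..N. floor_bt n) + (\<Sum>m=1..floor_bt N. m * b + floor_bt m) = N * floor_bt N"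
proof -
  define K where "K = floor_bt N"
  have 1: "floor_bt n = card {m \<in> {1..K}. real m \<le> real n * bt}" if "n \<in> {1..N}" for n
  proof -
    have "real n * bt \<le> real N * bt" using that bt_pos by simp
    then have "floor_bt n \<le> K" unfolding K_def le_fl_iff using floor_bt(1)[of n] by linarith
    then have "{m \<in> {1..K}. real m \<le> real n * bt} = {1..floor_bt n}" by (auto simp: le_fl_iff[symmetric])
    then show ?thesis by simp
  qed
  have 2: "m * b + floor_bt m = card {n \<in> {1..N}. \<not> real m \<le> real n * bt}" if m: "m \<in> {1..K}" for m
  proof -
    have iff: "\<not> real m \<le> real n * bt \<longleftrightarrow> n \<le> m * b + floor_bt m" if "0 < n" for n
    proof -
      have "\<not> real m \<le> real n * bt \<longleftrightarrow> real n * bt < real m" by auto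
      also have "\<dots> \<longleftrightarrow> real n * bt * z < real m * z" using z_gt_1 by simp
      also have "real n * bt * z = real n" using bt_z by (simp add: mult.assoc)
      also have "real n < real m * z \<longleftrightarrow> real n \<le> real m * z"
        using bt_irrational[OF that, of m] bt_z by (auto simp: order_le_less mult.assoc mult.commute)
      also have "real m * z = real (m * b) + real m * bt" by (simp add: z_def algebra_simps)
      also have "real n \<le> real (m * b) + real m * bt \<longleftrightarrow> n \<le> m * b + floor_bt m"
      proof (cases "n \<le> m * b")
        case True
        then have "real n \<le> real (m * b)" by (rule of_nat_mono)
        moreover have "0 \<le> real m * bt" using bt_pos by simp
        ultimately have "real n \<le> real (m * b) + real m * bt" by linarith
        moreover have "n \<le> m * b + floor_bt m" using True by simp
        ultimately show ?thesis by blast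
      next
        case False
        then show ?thesis using le_fl_iff[of "n - m * b" m] by (auto simp: of_nat_diff)
      qed
      finally show ?thesis .
    qed
    have "real m \<le> real N * bt" using m le_fl_iff[of m N] by (simp add: K_def)
    moreover have "real (m * b + floor_bt m) * bt < real m"
    proof -
      have "0 < m * b + floor_bt m" using m b_ge_1 by simp
      then show ?thesis using iff[of "m * b + floor_bt m"] by simp
    qed
    ultimately have "real (m * b + floor_bt m) * bt < real N * bt" by linarith
    then have "real (m * b + floor_bt m) < real N" by (simp only: mult_less_cancel_right_pos[OF bt_pos])
    then have "m * b + floor_bt m \<le> N" by (simp only: of_nat_less_iff less_imp_le)
    then have "{n \<in> {1..N}. \<not> real m \<le> real n * bt} = {1..m * b + floor_bt m}"
    proof (intro set_eqI)
      fix n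
      show "n \<in> {n \<in> {1..N}. \<not> real m \<le> real n * bt} \<longleftrightarrow> n \<in> {1..m * b + floor_bt m}"
        using iff[of n] \<open>m * b + floor_bt m \<le> N\<close> by (cases "n = 0") auto
    qed
    then show ?thesis by simp
  qed
  have "(\<Sum>n=1..N. floor_bt n) + (\<Sum>m=1..K. m * b + floor_bt m)
      = (\<Sum>n=1..N. \<Sum>m=1..K. if real m \<le> real n * bt then 1 else 0)
      + (\<Sum>m=1..K. \<Sum>n=1..N. if real m \<le> real n * bt then 0 else 1)"
  proof -
    have "floor_bt n = (\<Sum>m=1..K. if real m \<le> real n * bt then 1 else 0)" if "n \<in> {1..N}" for n
      unfolding 1[OF that] by (rule card_filter) simp
    moreover have "m * b + floor_bt m = (\<Sum>n=1..N. if real m \<le> real n * bt then 0 else 1)" if "m \<in> {1..K}" for m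
      unfolding 2[OF that] by (subst card_filter) (auto intro!: sum.cong)
    ultimately show ?thesis by (intro arg_cong2[where f = "(+)"] sum.cong) auto
  qed
  also have "\<dots> = (\<Sum>n=1..N. \<Sum>m=1..K. 1)"
    by (subst (2) sum.swap, simp only: sum.distrib[symmetric]) (intro sum.cong refl, simp)
  finally show ?thesis by (simp add: K_def)
qed

lemma saw_eq: "saw n = real n * bt - real (floor_bt n) - 1 / 2"
  by (simp add: saw_def frac_def floor_bt(3))

text \<open>The quadratic terms of the lattice point count cancel: \<open>saw_sum N\<close> and \<open>saw_sum \<lfloor>N * bt\<rfloor>\<close> agree up to sign and a bounded error, which is a quadratic polynomial in the fractional part of \<open>N * bt\<close>.\<close>

lemma saw_sum_reciprocity: "\<bar>saw_sum N + saw_sum (floor_bt N)\<bar> \<le> z / 2"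
proof -
  define K where "K = floor_bt N"
  define th where "th = real N * bt - real K"
  have th: "0 \<le> th" "th \<le> 1" using floor_bt(1,2)[of N] by (auto simp: th_def K_def)
  have gauss: "(\<Sum>n=1..N. real n) = real N * (real N + 1) / 2" for N
    by (induction N) (auto simp: field_simps)
  have saw_sum: "saw_sum N = bt * (real N * (real N + 1) / 2) - (\<Sum>n=1..N. real (floor_bt n)) - real N / 2" for N
    unfolding saw_sum_def saw_eq gauss[symmetric] by (simp add: sum_subtractf sum_distrib_left mult.commute)
  have "real ((\<Sum>n=1..N. floor_bt n) + (\<Sum>m=1..K. m * b + floor_bt m)) = real (N * K)"
    using lattice_point_reciprocity[of N] by (simp only: K_def)
  then have "(\<Sum>n=1..N. real (floor_bt n)) + (\<Sum>m=1..K. real (floor_bt m)) = real N * real K - real b * (real K * (real K + 1) / 2)"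
    unfolding gauss[symmetric] by (simp add: sum.distrib sum_distrib_left mult.commute)
  then have "saw_sum N + saw_sum K = bt * (real N * (real N + 1) / 2) - real N / 2
      + z * (real K * (real K + 1) / 2) - real K / 2 - real N * real K"
    unfolding saw_sum[of N] saw_sum[of K] by (simp add: z_def algebra_simps add_divide_distrib)
  also have "\<dots> = z / 2 * (th * (th - 1 + bt))"
  proof -
    have N: "real N = z * (real K + th)"
      using bt_z by (simp add: th_def algebra_simps)
    have "z / 2 * (th * (th - 1 + bt)) = z / 2 * th\<^sup>2 - z / 2 * th + (bt * z) / 2 * th"
      by (simp add: algebra_simps power2_eq_square)
    moreover have "bt * (real N * (real N + 1) / 2) = (bt * z) * ((real K + th) * (real N + 1) / 2)"
      unfolding N by (simp add: algebra_simps)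
    ultimately show ?thesis unfolding bt_z N by (simp add: field_simps power2_eq_square)
  qed
  finally have eq: "saw_sum N + saw_sum K = z / 2 * (th * (th - 1 + bt))" .
  have "\<bar>th * (th - 1 + bt)\<bar> \<le> 1 * 1"
    unfolding abs_mult using th bt_pos bt_less_1 by (intro mult_mono) (auto simp: abs_le_iff)
  then have "z / 2 * \<bar>th * (th - 1 + bt)\<bar> \<le> z / 2 * 1" using z_gt_1 by (intro mult_left_mono) auto
  then show ?thesis using z_gt_1 unfolding K_def[symmetric] eq by (simp add: abs_mult)
qed

definition saw_const :: real where "saw_const = z / 2 / (1 - sqrt bt)"

lemma saw_const_pos: "0 < saw_const"
  using z_gt_1 bt_less_1 bt_pos by (simp add: saw_const_def)

text \<open>Iterating the reciprocity would even give a logarithmic bound; the square root is enough for the partial summation and follows from a one-line induction with \<open>saw_const * (1 - sqrt bt) = z / 2\<close>.\<close>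

lemma saw_sum_bound: "\<bar>saw_sum N\<bar> \<le> saw_const * sqrt (real N)"
proof (induction N rule: less_induct)
  case (less N)
  show ?case
  proof (cases "N = 0")
    case False
    have "real N * bt < real N * 1" using False bt_less_1 by (intro mult_strict_left_mono) auto
    then have "real (floor_bt N) < real N" using floor_bt(1)[of N] by linarith
    then have "\<bar>saw_sum (floor_bt N)\<bar> \<le> saw_const * sqrt (real (floor_bt N))" by (intro less.IH) simp
    also have "\<dots> \<le> saw_const * (sqrt bt * sqrt (real N))"
      using floor_bt(1)[of N] saw_const_pos by (intro mult_left_mono) (auto simp: mult.commute simp flip: real_sqrt_mult)
    finally have "\<bar>saw_sum N\<bar> \<le> saw_const * (sqrt bt * sqrt (real N)) + z / 2"
      using saw_sum_reciprocity[of N] by linarith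
    also have "z / 2 = saw_const * (1 - sqrt bt)"
    proof -
      have "x = x / d * d" if "d \<noteq> 0" for x d :: real using that by simp
      moreover have "1 - sqrt bt \<noteq> 0" using bt_less_1 bt_pos by simp
      ultimately show ?thesis unfolding saw_const_def by blast
    qed
    also have "\<dots> \<le> saw_const * (1 - sqrt bt) * sqrt (real N)"
      using saw_const_pos bt_less_1 False mult_left_mono[of 1 "sqrt (real N)" "saw_const * (1 - sqrt bt)"] by simp
    finally show ?thesis by (simp add: algebra_simps)
  qed (simp add: saw_sum_def)
qed

lemma saw_sum_diff: "0 < m \<Longrightarrow> saw_sum m - saw_sum (m - 1) = saw m"
  by (cases m) (auto simp: saw_sum_def)

lemma saw_abs: "\<bar>saw n\<bar> \<le> 1 / 2"
  using frac_lt_1[of "real n * bt"] frac_ge_0[of "real n * bt"] unfolding saw_def abs_le_iff by auto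

lemma zm_saw: "zm m = real m * lam - saw m - 1 / 2"
  by (simp add: zm_def saw_def frac_def lam_z algebra_simps)

section \<open>The limit at convergent denominators\<close>

definition ang :: "nat \<Rightarrow> nat \<Rightarrow> real" where "ang j m = pi * real m / real (q j)"

text \<open>The logarithm of the correction factor between a pair of the block and the corresponding pair of the full sine product.\<close>

definition log_ratio :: "nat \<Rightarrow> nat \<Rightarrow> real" where "log_ratio j m = ln (V j m / (sin (ang j m))\<^sup>2)"

lemma ang_range:
  assumes "0 < m" "2 * m \<le> q j" shows "0 < ang j m" "ang j m \<le> pi / 2"
proof -
  have "real (2 * m) \<le> real (q j)" using assms by (intro of_nat_mono)
  then show "ang j m \<le> pi / 2" using q_positive[of j] by (simp add: ang_def field_simps)
  show "0 < ang j m" using assms q_positive[of j] by (simp add: ang_def)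
qed

lemma sin_ang_ge:
  assumes "0 < m" "2 * m \<le> q j" shows "2 * real m / real (q j) \<le> sin (ang j m)"
proof -
  have "2 * ang j m / pi = 2 * real m / real (q j)" by (simp add: ang_def)
  then show ?thesis using jordan_sin[of "ang j m"] ang_range[OF assms] by linarith
qed

lemma cot_ang_bound:
  assumes "0 < m" "2 * m \<le> q j" shows "0 \<le> cot (ang j m)" "cot (ang j m) \<le> real (q j) / (2 * real m)"
proof -
  have s: "0 < 2 * real m / real (q j)" using assms q_positive[of j] by simp
  have c: "0 \<le> cos (ang j m)" using ang_range[OF assms] by (intro cos_ge_zero) auto
  then show "0 \<le> cot (ang j m)" using s sin_ang_ge[OF assms] by (simp add: cot_def)
  have "cot (ang j m) \<le> 1 / (2 * real m / real (q j))"
    unfolding cot_def using c s sin_ang_ge[OF assms] by (intro frac_le) auto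
  then show "cot (ang j m) \<le> real (q j) / (2 * real m)" by simp
qed

lemma cot_ang_diff:
  assumes "0 < m" "2 * Suc m \<le> q j"
  shows "0 \<le> cot (ang j m) - cot (ang j (Suc m))"
    "cot (ang j m) - cot (ang j (Suc m)) \<le> pi * real (q j) / (4 * (real m * (real m + 1)))"
proof -
  have qp: "0 < real (q j)" using q_positive[of j] by simp
  have s: "2 * real m / real (q j) \<le> sin (ang j m)" "2 * real (Suc m) / real (q j) \<le> sin (ang j (Suc m))"
    using assms by (auto intro!: sin_ang_ge simp del: of_nat_Suc)
  moreover have p: "0 < 2 * real m / real (q j)" "0 < 2 * real (Suc m) / real (q j)" using assms qp by auto
  ultimately have sp: "0 < sin (ang j m)" "0 < sin (ang j (Suc m))" by linarith+
  have d: "ang j (Suc m) - ang j m = pi / real (q j)" by (simp add: ang_def algebra_simps add_divide_distrib)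
  have eq: "cot (ang j m) - cot (ang j (Suc m)) = sin (pi / real (q j)) / (sin (ang j m) * sin (ang j (Suc m)))"
    using sp unfolding d[symmetric] by (simp add: cot_def sin_diff field_simps)
  have "1 \<le> real (q j)" using q_ge_1[of j] by simp
  then have "pi / real (q j) \<le> pi" by (simp add: divide_le_eq)
  then have sq: "0 \<le> sin (pi / real (q j))" using qp by (intro sin_ge_zero) auto
  then show "0 \<le> cot (ang j m) - cot (ang j (Suc m))" unfolding eq using sp by simp
  have "cot (ang j m) - cot (ang j (Suc m))
      \<le> (pi / real (q j)) / ((2 * real m / real (q j)) * (2 * real (Suc m) / real (q j)))"
    unfolding eq
  proof (intro frac_le mult_mono sin_x_le_x)
    show "0 < 2 * real m / real (q j) * (2 * real (Suc m) / real (q j))" using p by (rule mult_pos_pos)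
  qed (use s p sp sq qp in auto)
  also have "\<dots> = pi * real (q j) / (4 * (real m * (real m + 1)))"
    using qp assms by (simp add: field_simps)
  finally show "cot (ang j m) - cot (ang j (Suc m)) \<le> pi * real (q j) / (4 * (real m * (real m + 1)))" .
qed

text \<open>Partial summation against the decreasing weights \<open>cot\<close>: the sawtooth sums are \<open>O(sqrt m)\<close> and the weights \<open>O(q j / m)\<close>.\<close>

lemma abel_tail:
  assumes M: "0 < M" "M \<le> R" "2 * R \<le> q j"
  shows "\<bar>\<Sum>m\<in>{M<..R}. saw m * cot (ang j m)\<bar> \<le> 3 * saw_const * real (q j) / sqrt (real M)"
proof -
  define Q where "Q = real (q j)"
  have Q: "0 < Q" using q_positive[of j] by (simp add: Q_def)
  have "(\<Sum>m\<in>{M<..R}. saw m * cot (ang j m)) = (\<Sum>m\<in>{M<..R}. (saw_sum m - saw_sum (m - 1)) * cot (ang j m))"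
    by (intro sum.cong refl) (simp add: saw_sum_diff[symmetric])
  also have "\<dots> = saw_sum R * cot (ang j R) - saw_sum M * cot (ang j M)
      + (\<Sum>m\<in>{M..<R}. saw_sum m * (cot (ang j m) - cot (ang j (Suc m))))"
    by (rule summation_by_parts[OF M(2)])
  finally have eq: "(\<Sum>m\<in>{M<..R}. saw m * cot (ang j m)) = saw_sum R * cot (ang j R) - saw_sum M * cot (ang j M)
      + (\<Sum>m\<in>{M..<R}. saw_sum m * (cot (ang j m) - cot (ang j (Suc m))))" .
  have edge: "\<bar>saw_sum m * cot (ang j m)\<bar> \<le> saw_const * Q / 2 * (1 / sqrt (real M))" if m: "M \<le> m" "m \<le> R" for m
  proof -
    have m0: "0 < m" "2 * m \<le> q j" using m M by auto
    have "\<bar>saw_sum m * cot (ang j m)\<bar> \<le> (saw_const * sqrt (real m)) * (Q / (2 * real m))"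
      unfolding abs_mult using cot_ang_bound[OF m0] saw_sum_bound[of m] saw_const_pos
      by (intro mult_mono) (auto simp: Q_def)
    also have "\<dots> = saw_const * Q / 2 * (sqrt (real m) / real m)" by simp
    also have "sqrt (real m) / real m = 1 / sqrt (real m)" by (simp add: real_div_sqrt sqrt_divide_self_eq inverse_eq_divide)
    also have "1 / sqrt (real m) \<le> 1 / sqrt (real M)" using m M by (intro divide_left_mono) auto
    finally show ?thesis using saw_const_pos Q by (simp add: mult_left_mono)
  qed
  have "\<bar>\<Sum>m\<in>{M..<R}. saw_sum m * (cot (ang j m) - cot (ang j (Suc m)))\<bar>
      \<le> (\<Sum>m\<in>{M..<R}. saw_const * (pi * Q / 4) * (2 * (1 / sqrt (real m) - 1 / sqrt (real (Suc m)))))"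
  proof (rule order_trans[OF sum_abs sum_mono])
    fix m assume "m \<in> {M..<R}"
    then have m: "0 < m" "2 * Suc m \<le> q j" using M by auto
    have "\<bar>saw_sum m * (cot (ang j m) - cot (ang j (Suc m)))\<bar>
        \<le> (saw_const * sqrt (real m)) * (pi * Q / (4 * (real m * (real m + 1))))"
      unfolding abs_mult using cot_ang_diff[OF m] saw_sum_bound[of m] saw_const_pos
      by (intro mult_mono) (auto simp: Q_def)
    also have "\<dots> = saw_const * (pi * Q / 4) * (sqrt (real m) / (real m * (real m + 1)))" by simp
    also have "\<dots> \<le> saw_const * (pi * Q / 4) * (2 * (1 / sqrt (real m) - 1 / sqrt (real (Suc m))))"
      using saw_const_pos Q by (intro mult_left_mono inverse_sqrt_telescope m) auto
    finally show "\<bar>saw_sum m * (cot (ang j m) - cot (ang j (Suc m)))\<bar>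
      \<le> saw_const * (pi * Q / 4) * (2 * (1 / sqrt (real m) - 1 / sqrt (real (Suc m))))" .
  qed
  also have "\<dots> = saw_const * (pi * Q / 2) * (\<Sum>m\<in>{M..<R}. 1 / sqrt (real m) - 1 / sqrt (real (Suc m)))"
  proof -
    have "saw_const * (pi * Q / 4) * (2 * x) = saw_const * (pi * Q / 2) * x" for x by simp
    then show ?thesis by (simp only: sum_distrib_left)
  qed
  also have "(\<Sum>m\<in>{M..<R}. 1 / sqrt (real m) - 1 / sqrt (real (Suc m))) = 1 / sqrt (real M) - 1 / sqrt (real R)"
    using sum_Suc_diff'[OF M(2), of "\<lambda>m. - (1 / sqrt (real m))"] by simp
  also have "saw_const * (pi * Q / 2) * (1 / sqrt (real M) - 1 / sqrt (real R)) \<le> saw_const * (4 * Q / 2) * (1 / sqrt (real M))"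
    using saw_const_pos Q M pi_less_4 by (intro mult_mono) (auto intro!: divide_left_mono)
  finally have "\<bar>\<Sum>m\<in>{M<..R}. saw m * cot (ang j m)\<bar>
      \<le> saw_const * Q / 2 * (1 / sqrt (real M)) + saw_const * Q / 2 * (1 / sqrt (real M)) + saw_const * (4 * Q / 2) * (1 / sqrt (real M))"
    using edge[OF M(2) order_refl] edge[OF order_refl M(2)] unfolding eq by linarith
  also have "\<dots> = 3 * saw_const * Q / sqrt (real M)" by (simp add: field_simps)
  finally show ?thesis by (simp add: Q_def)
qed

text \<open>Both sines of a pair have arguments within \<open>O(t j)\<close> of \<open>ang j m\<close>. Their deviations are opposite up to \<open>2 * t j * saw m\<close> and an error from \<open>q j * lam * bt ^ (j + 1) \<noteq> 1\<close>; the tangent of \<open>ln \<circ> sin\<close> gives the first-order term.\<close>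

lemma log_ratio_approx:
  assumes m: "4 \<le> m" "2 * m \<le> q j" and j: "1 \<le> j"
  shows "\<bar>log_ratio j m + 2 * t j * (saw m * cot (ang j m))\<bar>
    \<le> 2 * pi\<^sup>2 * (1 / (real m)\<^sup>2) + (2 * pi\<^sup>2 + pi) * bt ^ (2 * j + 2)"
proof -
  define A where "A = ang j m"
  define e where "e = bt ^ (2 * j + 2)"
  define s where "s = (-1) ^ j * e"
  have m0: "0 < m" "m \<in> {1..<q j}" using m by auto
  have A: "0 < A" "A \<le> pi / 2" using ang_range[of m j] m by (auto simp: A_def)
  have e: "0 < e" "e \<le> 1 / 4" "e\<^sup>2 \<le> e" and se: "\<bar>s\<bar> = e"
  proof -
    show "0 < e" using bt_pos by (simp add: e_def)
    have "bt ^ (2 * j + 2) \<le> bt ^ 4" using bt_pos bt_less_1 j by (intro power_decreasing) auto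
    moreover have "bt\<^sup>2 \<le> 1 / 2"
    proof -
      have "1 * bt \<le> real b * bt" using bt_pos b_ge_1 by (intro mult_right_mono) auto
      then show ?thesis using bt_root bt_sq by linarith
    qed
    then have "(bt\<^sup>2)\<^sup>2 \<le> (1 / 2)\<^sup>2" by (intro power_mono) auto
    then have "bt ^ 4 \<le> 1 / 4" by (simp add: power2_eq_square power4_eq_xxxx mult.assoc)
    ultimately show "e \<le> 1 / 4" by (simp add: e_def)
    then show "e\<^sup>2 \<le> e" using \<open>0 < e\<close> mult_left_mono[of e 1 e] by (simp add: power2_eq_square)
    show "\<bar>s\<bar> = e" using \<open>0 < e\<close> by (simp add: s_def abs_mult power_abs)
  qed
  have qp: "0 < real (q j)" using q_positive[of j] by simp
  have "t j * (real m * lam) = pi * real m * (real (q j) * lam * bt ^ Suc j) / real (q j)"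
    using qp by (simp add: t_def gap_def)
  also have "\<dots> = A * (1 + s)" unfolding q_closed by (simp add: A_def ang_def s_def e_def)
  finally have tl: "t j * (real m * lam) = A * (1 + s)" .
  define n1 n2 where "n1 = t j * (1 / 2 - saw m) + A * s" and "n2 = t j * (- 1 / 2 - saw m) + A * s"
  have e1: "t j * (1 + zm m) = A + n1" and e2: "t j * zm m = A + n2"
    using tl unfolding zm_saw n1_def n2_def by (simp_all add: algebra_simps)
  have tA: "t j \<le> A / real m"
  proof -
    have "real (q j) * gap j \<le> 1" using m_dl_less_1[of "q j" j] by simp
    then have "pi * (real (q j) * gap j) \<le> pi * 1" by (intro mult_left_mono) auto
    then show ?thesis using qp m0 by (simp add: t_def A_def ang_def field_simps)
  qed
  have sm: "\<bar>1 / 2 - saw m\<bar> \<le> 1" "\<bar>- 1 / 2 - saw m\<bar> \<le> 1"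
    using saw_abs[of m] by (auto simp: abs_le_iff)
  have nb: "\<bar>t j * x + A * s\<bar> \<le> A * (1 / real m + e)" if "\<bar>x\<bar> \<le> 1" for x
  proof -
    have "\<bar>t j * x + A * s\<bar> \<le> \<bar>t j * x\<bar> + \<bar>A * s\<bar>" by (rule abs_triangle_ineq)
    also have "\<bar>t j * x\<bar> = t j * \<bar>x\<bar>" using t_pos[of j] by (simp add: abs_mult)
    also have "\<dots> \<le> A / real m * 1" using that tA t_pos[of j] A by (intro mult_mono) auto
    also have "\<bar>A * s\<bar> = A * e" using A se by (simp add: abs_mult)
    finally show ?thesis by (simp add: algebra_simps)
  qed
  have half: "1 / real m + e \<le> 1 / 2"
  proof -
    have "1 / real m \<le> 1 / 4" using m by (intro divide_left_mono) auto
    then show ?thesis using e by simp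
  qed
  have n: "\<bar>n1\<bar> \<le> A * (1 / real m + e)" "\<bar>n2\<bar> \<le> A * (1 / real m + e)"
    unfolding n1_def n2_def by (intro nb sm)+
  have "A * (1 / real m + e) \<le> A * (1 / 2)" using half A by (intro mult_left_mono) auto
  then have n': "\<bar>n1\<bar> \<le> A / 2" "\<bar>n2\<bar> \<le> A / 2" using n by linarith+
  have sq: "(x / A)\<^sup>2 \<le> 2 * (1 / (real m)\<^sup>2) + 2 * e" if "\<bar>x\<bar> \<le> A * (1 / real m + e)" for x
  proof -
    have "\<bar>x / A\<bar> \<le> 1 / real m + e" using that A by (simp add: divide_le_eq mult.commute)
    then have "\<bar>x / A\<bar>\<^sup>2 \<le> (1 / real m + e)\<^sup>2" by (intro power_mono) auto
    also have "\<dots> \<le> 2 * (1 / real m)\<^sup>2 + 2 * e\<^sup>2"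
      using zero_le_power2[of "1 / real m - e"] by (simp add: power2_eq_square algebra_simps)
    finally show ?thesis using e by (simp add: power_divide)
  qed
  have err: "\<bar>ln (sin (A + x)) - ln (sin A) - x * cot A\<bar> \<le> pi\<^sup>2 / 2 * (2 * (1 / (real m)\<^sup>2) + 2 * e)"
    if "\<bar>x\<bar> \<le> A / 2" "\<bar>x\<bar> \<le> A * (1 / real m + e)" for x
  proof -
    have "pi\<^sup>2 / 2 * (x / A)\<^sup>2 \<le> pi\<^sup>2 / 2 * (2 * (1 / (real m)\<^sup>2) + 2 * e)"
      by (intro mult_left_mono sq[OF that(2)]) simp
    then show ?thesis using ln_sin_tangent_error[OF A that(1)] by linarith
  qed
  have spos: "0 < sin (A + n1)" "0 < sin (A + n2)" "0 < sin A"
  proof -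
    show "0 < sin (A + n1)" "0 < sin (A + n2)"
      using sin_zm_pos[OF m0(2), of 0] z_gt_1 by (auto simp flip: e1 e2)
    show "0 < sin A" using A by (intro sin_gt_zero) auto
  qed
  have "log_ratio j m = ln (sin (A + n1)) + ln (sin (A + n2)) - 2 * ln (sin A)"
    unfolding log_ratio_def V_def e1 e2 A_def[symmetric] using spos by (simp add: ln_div ln_mult ln_realpow)
  then have "\<bar>log_ratio j m - (n1 + n2) * cot A\<bar> \<le> 2 * (pi\<^sup>2 / 2 * (2 * (1 / (real m)\<^sup>2) + 2 * e))"
    using err[OF n'(1) n(1)] err[OF n'(2) n(2)] by (simp add: algebra_simps abs_le_iff)
  moreover have "n1 + n2 = - 2 * t j * saw m + 2 * A * s" by (simp add: n1_def n2_def algebra_simps)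
  moreover have "\<bar>2 * A * s * cot A\<bar> \<le> pi * e"
  proof -
    have "A * cot A \<le> A * (real (q j) / (2 * real m))"
      using cot_ang_bound[of m j] m A by (intro mult_left_mono) (auto simp: A_def)
    also have "\<dots> = pi / 2" using qp m0 by (simp add: A_def ang_def)
    finally have "2 * e * (A * cot A) \<le> 2 * e * (pi / 2)" using e by (intro mult_left_mono) auto
    moreover have "0 \<le> cot A" using cot_ang_bound[of m j] m by (simp add: A_def)
    ultimately show ?thesis using A se by (simp add: abs_mult mult_ac)
  qed
  ultimately show ?thesis
    unfolding A_def[symmetric] e_def[symmetric] by (simp add: algebra_simps abs_le_iff)
qed

definition tail_const :: real where "tail_const = 6 * pi * saw_const + 2 * pi\<^sup>2"
definition phase_const :: real where "phase_const = 2 * pi\<^sup>2 + pi"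

text \<open>The quadratic errors form the tail of a convergent series, the constant errors are \<open>O(bt ^ (2 * j))\<close> each and there are fewer than \<open>q j\<close> of them, and \<open>abel_tail\<close> controls the linear terms, which do not converge absolutely.\<close>

lemma log_ratio_tail:
  assumes M: "4 \<le> M" "M \<le> R" "2 * R \<le> q j" and j: "1 \<le> j"
  shows "\<bar>\<Sum>m\<in>{M<..R}. log_ratio j m\<bar> \<le> tail_const / sqrt (real M) + phase_const * bt ^ j"
proof -
  define e where "e = bt ^ (2 * j + 2)"
  have phase_const: "0 < phase_const" using pi_gt_zero by (simp add: phase_const_def add_nonneg_pos)
  have "(\<Sum>m\<in>{M<..R}. log_ratio j m) = (\<Sum>m\<in>{M<..R}. log_ratio j m + 2 * t j * (saw m * cot (ang j m)))
      - 2 * t j * (\<Sum>m\<in>{M<..R}. saw m * cot (ang j m))"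
    by (simp add: sum.distrib sum_distrib_left)
  then have "\<bar>\<Sum>m\<in>{M<..R}. log_ratio j m\<bar> \<le> \<bar>\<Sum>m\<in>{M<..R}. log_ratio j m + 2 * t j * (saw m * cot (ang j m))\<bar>
      + \<bar>2 * t j * (\<Sum>m\<in>{M<..R}. saw m * cot (ang j m))\<bar>" by linarith
  also have "\<bar>\<Sum>m\<in>{M<..R}. log_ratio j m + 2 * t j * (saw m * cot (ang j m))\<bar>
      \<le> (\<Sum>m\<in>{M<..R}. 2 * pi\<^sup>2 * (1 / (real m)\<^sup>2) + phase_const * e)"
  proof (rule order_trans[OF sum_abs sum_mono])
    fix m assume "m \<in> {M<..R}"
    then show "\<bar>log_ratio j m + 2 * t j * (saw m * cot (ang j m))\<bar> \<le> 2 * pi\<^sup>2 * (1 / (real m)\<^sup>2) + phase_const * e"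
      unfolding phase_const_def e_def using M j by (intro log_ratio_approx) auto
  qed
  also have "\<dots> = 2 * pi\<^sup>2 * (\<Sum>m\<in>{M<..R}. 1 / (real m)\<^sup>2) + real (R - M) * (phase_const * e)"
    by (simp add: sum.distrib sum_distrib_left)
  also have "2 * pi\<^sup>2 * (\<Sum>m\<in>{M<..R}. 1 / (real m)\<^sup>2) \<le> 2 * pi\<^sup>2 * (1 / sqrt (real M))"
  proof (intro mult_left_mono)
    have "(\<Sum>m\<in>{M<..R}. 1 / (real m)\<^sup>2) \<le> 1 / real M - 1 / real R"
      using M by (intro sum_inverse_squares_le) auto
    also have "\<dots> \<le> 1 / real M" by simp
    also have "\<dots> \<le> 1 / sqrt (real M)"
    proof (intro divide_left_mono)
      show "sqrt (real M) \<le> real M" using M by (intro real_le_lsqrt) (auto simp: power2_eq_square)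
    qed (use M in auto)
    finally show "(\<Sum>m\<in>{M<..R}. 1 / (real m)\<^sup>2) \<le> 1 / sqrt (real M)" .
  qed simp
  also have "real (R - M) * (phase_const * e) \<le> phase_const * bt ^ j"
  proof -
    have "real (R - M) * e \<le> real (q j) * (bt ^ j * bt ^ j)"
    proof (intro mult_mono)
      show "e \<le> bt ^ j * bt ^ j" unfolding e_def power_add[symmetric] using bt_pos bt_less_1
        by (intro power_decreasing) auto
    qed (use M bt_pos in \<open>auto simp: e_def\<close>)
    also have "\<dots> \<le> 1 * bt ^ j"
      unfolding mult.assoc[symmetric] using q_bt_le_1 bt_pos by (intro mult_right_mono) auto
    finally have "phase_const * (real (R - M) * e) \<le> phase_const * bt ^ j" using phase_const by (intro mult_left_mono) auto
    then show ?thesis by (simp add: mult_ac)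
  qed
  also have "\<bar>2 * t j * (\<Sum>m\<in>{M<..R}. saw m * cot (ang j m))\<bar> \<le> 6 * pi * saw_const / sqrt (real M)"
  proof -
    have "\<bar>2 * t j * (\<Sum>m\<in>{M<..R}. saw m * cot (ang j m))\<bar>
        = 2 * t j * \<bar>\<Sum>m\<in>{M<..R}. saw m * cot (ang j m)\<bar>" using t_pos[of j] by (simp add: abs_mult)
    also have "\<dots> \<le> 2 * t j * (3 * saw_const * real (q j) / sqrt (real M))"
      using t_pos[of j] M by (intro mult_left_mono abel_tail) auto
    also have "\<dots> = 6 * pi * saw_const / sqrt (real M) * (real (q j) * gap j)" by (simp add: t_def)
    also have "\<dots> \<le> 6 * pi * saw_const / sqrt (real M) * 1"
      using m_dl_less_1[of "q j" j] saw_const_pos by (intro mult_left_mono) auto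
    finally show ?thesis by simp
  qed
  finally show ?thesis by (simp add: tail_const_def add_divide_distrib algebra_simps)
qed

text \<open>The block divided by the full sine product and by its leading factor, on a logarithmic scale.\<close>

definition log_block :: "nat \<Rightarrow> real" where "log_block j = ln (p j / (2 * real (q j) * sin (t j)))"

text \<open>By symmetry the square of the quotient is a product over pairs.\<close>

lemma log_block_eq_sum: "2 * log_block j = (\<Sum>m=1..<q j. log_ratio j m)"
proof -
  define Q where "Q = real (q j)"
  have Q: "0 < Q" using q_positive[of j] by (simp add: Q_def)
  have sp: "0 < sin (ang j m)" if "m \<in> {1..<q j}" for m
    using that q_positive[of j] by (intro sin_gt_zero) (auto simp: ang_def field_simps)
  have Q_eq: "Q = (\<Prod>m=1..<q j. 2 * sin (ang j m))"
    using prod_two_sin_eq[OF q_positive[of j]] by (simp add: ang_def Q_def)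
  have "p j / (2 * Q * sin (t j)) = S j 0 / Q" using sin_t_pos[of j] by (simp add: p_eq_S)
  then have "(p j / (2 * Q * sin (t j)))\<^sup>2 = (\<Prod>m=1..<q j. 4 * (V j m - w j 0)) / (\<Prod>m=1..<q j. (2 * sin (ang j m))\<^sup>2)"
    by (simp add: power_divide S_squared Q_eq prod_power_distrib)
  also have "\<dots> = (\<Prod>m=1..<q j. V j m / (sin (ang j m))\<^sup>2)"
    unfolding prod_dividef[symmetric] by (intro prod.cong refl) (simp add: w_def power_mult_distrib)
  finally have eq: "(p j / (2 * Q * sin (t j)))\<^sup>2 = (\<Prod>m=1..<q j. V j m / (sin (ang j m))\<^sup>2)" .
  have "2 * log_block j = ln ((p j / (2 * Q * sin (t j)))\<^sup>2)"
    using p_pos[of j] Q sin_t_pos[of j] by (simp add: log_block_def Q_def ln_realpow)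
  also have "\<dots> = (\<Sum>m=1..<q j. log_ratio j m)"
    unfolding eq log_ratio_def using sp V_pos by (subst ln_prod) (auto simp: less_imp_neq[THEN not_sym] intro!: divide_pos_pos)
  finally show ?thesis .
qed

lemma log_ratio_reflect:
  assumes "m \<in> {1..<q j}" shows "log_ratio j (q j - m) = log_ratio j m"
proof -
  have "ang j (q j - m) = pi - ang j m" using assms q_positive[of j] by (simp add: ang_def of_nat_diff field_simps)
  then show ?thesis by (simp add: log_ratio_def V_reflect[OF assms])
qed

text \<open>The summands are symmetric in \<open>m\<close>, so the sum is twice its first half, and \<open>log_ratio_tail\<close> truncates the half at \<open>M\<close>. For even \<open>q j\<close> one middle term is left over; it is itself a tail.\<close>

lemma log_block_close:
  assumes M: "4 \<le> M" "2 * M + 2 < q j" and j: "1 \<le> j"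
  shows "\<bar>log_block j - (\<Sum>m=1..M. log_ratio j m)\<bar> \<le> 2 * tail_const / sqrt (real M) + 2 * phase_const * bt ^ j"
proof -
  define h where "h = (q j - 1) div 2"
  have h: "M \<le> h" "2 * h < q j" "q j \<le> 2 * h + 2" using M by (auto simp: h_def)
  have refl: "(\<Sum>m\<in>{q j - h..<q j}. log_ratio j m) = (\<Sum>m=1..h. log_ratio j m)"
    by (rule sum.reindex_bij_witness[of _ "\<lambda>m. q j - m" "\<lambda>m. q j - m"])
       (use h log_ratio_reflect in auto)
  have split: "{1..<q j} = {1..h} \<union> ({h<..<q j - h} \<union> {q j - h..<q j})" using h by auto
  have "(\<Sum>m=1..<q j. log_ratio j m) = 2 * (\<Sum>m=1..h. log_ratio j m) + (\<Sum>m\<in>{h<..<q j - h}. log_ratio j m)"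
    unfolding split using h by (subst sum.union_disjoint, (auto)[3], subst sum.union_disjoint, (auto)[3]) (simp add: refl)
  then have log_block: "log_block j = (\<Sum>m=1..h. log_ratio j m) + (\<Sum>m\<in>{h<..<q j - h}. log_ratio j m) / 2"
    using log_block_eq_sum[of j] by simp
  have tail_const: "0 < tail_const" using saw_const_pos by (simp add: tail_const_def add_pos_nonneg)
  have phase_const: "0 < phase_const" using pi_gt_zero by (simp add: phase_const_def add_nonneg_pos)
  have nn: "0 \<le> tail_const / sqrt (real M) + phase_const * bt ^ j" using tail_const phase_const bt_pos by simp
  have mid: "\<bar>\<Sum>m\<in>{h<..<q j - h}. log_ratio j m\<bar> \<le> tail_const / sqrt (real M) + phase_const * bt ^ j"
  proof (cases "q j = 2 * h + 2")
    case True
    then have "{h<..<q j - h} = {h<..Suc h}" by auto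
    then have "\<bar>\<Sum>m\<in>{h<..<q j - h}. log_ratio j m\<bar> \<le> tail_const / sqrt (real h) + phase_const * bt ^ j"
      using log_ratio_tail[of h "Suc h" j] True h M j by simp
    also have "tail_const / sqrt (real h) \<le> tail_const / sqrt (real M)"
      using h M tail_const by (intro divide_left_mono) auto
    finally show ?thesis by simp
  next
    case False
    then have "{h<..<q j - h} = {}" using h by auto
    then show ?thesis using nn by simp
  qed
  have "{1..h} = {1..M} \<union> {M<..h}" using h by auto
  then have "(\<Sum>m=1..h. log_ratio j m) = (\<Sum>m=1..M. log_ratio j m) + (\<Sum>m\<in>{M<..h}. log_ratio j m)"
    by (simp add: sum.union_disjoint[symmetric] ivl_disj_int)
  moreover have "\<bar>\<Sum>m\<in>{M<..h}. log_ratio j m\<bar> \<le> tail_const / sqrt (real M) + phase_const * bt ^ j"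
    using h M j by (intro log_ratio_tail) auto
  ultimately show ?thesis using mid nn unfolding log_block by (simp add: field_simps abs_le_iff)
qed

lemma q_sin_tendsto: "(\<lambda>j. real (q j) * sin (t j * c)) \<longlonglongrightarrow> pi * c / lam"
proof (cases "c = 0")
  case False
  have t0: "(\<lambda>j. t j * c) \<longlonglongrightarrow> 0"
    using tendsto_mult[OF tendsto_const[of "pi * bt * c"] bt_pow_tendsto_0] by (simp add: t_def gap_def mult_ac)
  have sinc: "((\<lambda>x::real. sin x / x) \<longlongrightarrow> 1) (at 0)"
    using DERIV_sin[of "0::real"] by (simp add: has_field_derivative_iff)
  have "filterlim (\<lambda>j. t j * c) (at 0) sequentially"
    unfolding filterlim_at using t0 False t_pos by (auto simp: less_imp_neq[THEN not_sym])
  then have 1: "(\<lambda>j. sin (t j * c) / (t j * c)) \<longlonglongrightarrow> 1" by (rule filterlim_compose[OF sinc])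
  have "(\<lambda>j. bt ^ (2 * j + 2)) \<longlonglongrightarrow> 0"
  proof -
    have "(\<lambda>j. (bt ^ j) * (bt ^ j) * bt\<^sup>2) \<longlonglongrightarrow> 0 * 0 * bt\<^sup>2" by (intro tendsto_intros bt_pow_tendsto_0)
    moreover have "bt ^ j * bt ^ j * bt\<^sup>2 = bt ^ (2 * j + 2)" for j
      by (simp add: power_add mult_2 power2_eq_square)
    ultimately show ?thesis by simp
  qed
  then have "(\<lambda>j. (-1) ^ j * bt ^ (2 * j + 2)) \<longlonglongrightarrow> 0"
    by (rule Lim_null_comparison[rotated]) (use bt_pos in \<open>simp add: abs_mult power_abs\<close>)
  then have "(\<lambda>j. pi * c / lam * (1 + (-1) ^ j * bt ^ (2 * j + 2))) \<longlonglongrightarrow> pi * c / lam * (1 + 0)"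
    by (intro tendsto_intros)
  moreover have "pi * c / lam * (1 + (-1) ^ j * bt ^ (2 * j + 2)) = real (q j) * (t j * c)" for j
    unfolding q_closed[symmetric] using lam_pos by (simp add: t_def gap_def)
  ultimately have 2: "(\<lambda>j. real (q j) * (t j * c)) \<longlonglongrightarrow> pi * c / lam" by simp
  have "(\<lambda>j. real (q j) * (t j * c) * (sin (t j * c) / (t j * c))) \<longlonglongrightarrow> pi * c / lam * 1"
    by (intro tendsto_mult 1 2)
  moreover have "real (q j) * (t j * c) * (sin (t j * c) / (t j * c)) = real (q j) * sin (t j * c)" for j
    using False t_pos[of j] by simp
  ultimately show ?thesis by simp
qed simp

lemma q_sin_ang_tendsto: "(\<lambda>j. real (q j) * sin (ang j m)) \<longlonglongrightarrow> pi * real m"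
proof (cases "m = 0")
  case False
  have qinf: "filterlim (\<lambda>j. real (q j)) at_top sequentially"
    by (rule filterlim_compose[OF filterlim_real_sequentially filterlim_q])
  have a0: "(\<lambda>j. ang j m) \<longlonglongrightarrow> 0"
    unfolding ang_def by (rule tendsto_divide_0[OF tendsto_const filterlim_at_top_imp_at_infinity[OF qinf]])
  have sinc: "((\<lambda>x::real. sin x / x) \<longlongrightarrow> 1) (at 0)"
    using DERIV_sin[of "0::real"] by (simp add: has_field_derivative_iff)
  have ne: "ang j m \<noteq> 0" for j using False q_positive[of j] by (simp add: ang_def)
  have "filterlim (\<lambda>j. ang j m) (at 0) sequentially"
    unfolding filterlim_at using a0 ne by auto
  then have 1: "(\<lambda>j. sin (ang j m) / ang j m) \<longlonglongrightarrow> 1" by (rule filterlim_compose[OF sinc])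
  have "(\<lambda>j. pi * real m * (sin (ang j m) / ang j m)) \<longlonglongrightarrow> pi * real m * 1"
    by (intro tendsto_intros 1)
  moreover have "pi * real m * (sin (ang j m) / ang j m) = real (q j) * sin (ang j m)" for j
    using False q_positive[of j] by (simp add: ang_def field_simps)
  ultimately show ?thesis by simp
qed (simp add: ang_def)

lemma log_ratio_tendsto:
  assumes "0 < m"
  shows "(\<lambda>j. log_ratio j m) \<longlonglongrightarrow> ln (zm m * (zm m + 1) / (lam * real m)\<^sup>2)"
proof -
  have zm: "0 < zm m" using assms by (intro zm_ge) auto
  have "(\<lambda>j. (real (q j) * sin (t j * (1 + zm m))) * (real (q j) * sin (t j * zm m)) / (real (q j) * sin (ang j m))\<^sup>2)
      \<longlonglongrightarrow> (pi * (1 + zm m) / lam) * (pi * zm m / lam) / (pi * real m)\<^sup>2"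
    using assms by (intro tendsto_intros q_sin_tendsto q_sin_ang_tendsto) auto
  moreover have "(real (q j) * sin (t j * (1 + zm m))) * (real (q j) * sin (t j * zm m)) / (real (q j) * sin (ang j m))\<^sup>2
      = V j m / (sin (ang j m))\<^sup>2" for j
    using q_positive[of j] by (simp add: V_def power2_eq_square)
  moreover have "(pi * (1 + zm m) / lam) * (pi * zm m / lam) / (pi * real m)\<^sup>2 = zm m * (zm m + 1) / (lam * real m)\<^sup>2"
    using lam_pos assms by (simp add: power2_eq_square field_simps)
  ultimately have "(\<lambda>j. V j m / (sin (ang j m))\<^sup>2) \<longlonglongrightarrow> zm m * (zm m + 1) / (lam * real m)\<^sup>2" by simp
  then show ?thesis unfolding log_ratio_def
    using zm assms lam_pos by (intro tendsto_ln) (auto simp: less_imp_neq[THEN not_sym])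
qed

text \<open>With \<open>zm m = m * lam - saw m - 1 / 2\<close> the numerator \<open>zm m * (zm m + 1)\<close> is a difference of squares.\<close>

lemma C_partial_eq: "C_partial b M = (\<Prod>m=1..M. zm m * (zm m + 1) / (lam * real m)\<^sup>2)"
  unfolding C_partial_def
proof (rule prod.cong[OF refl])
  fix m assume "m \<in> {1..M}"
  then have m: "0 < real m" by simp
  have eq: "zm m * (zm m + 1) = (real m * lam - saw m)\<^sup>2 - (1 / 2)\<^sup>2"
    by (simp add: zm_saw power2_eq_square algebra_simps)
  show "(1 - 1 / sqrt ((real b)\<^sup>2 + 4) * ((frac (real m * beta b) - 1 / 2) / real m))\<^sup>2 -
      (1 / (2 * sqrt ((real b)\<^sup>2 + 4)))\<^sup>2 / (real m)\<^sup>2 = zm m * (zm m + 1) / (lam * real m)\<^sup>2"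
    unfolding eq lam_def[symmetric] bt_def[symmetric] saw_def[symmetric]
    using m lam_pos by (simp add: field_simps power2_eq_square)
qed

text \<open>For fixed \<open>M\<close> the first \<open>M\<close> correction factors converge to those of \<open>C_partial\<close>, and \<open>log_block_close\<close> makes the rest uniformly small. Exponentials keep the limit away from \<open>0\<close>, and \<open>q j * sin (t j)\<close> tends to \<open>pi / lam\<close>.\<close>

theorem p_tendsto:
  "convergent (C_partial b)" "0 < C_const b" "p \<longlonglongrightarrow> C_const b"
proof -
  define a where "a m = zm m * (zm m + 1) / (lam * real m)\<^sup>2" for m
  have a: "0 < a m" if "m \<in> {1..M}" for m M
    using zm_ge[of m] that lam_pos by (auto simp: a_def)
  have "\<exists>l. log_block \<longlonglongrightarrow> l \<and> (\<lambda>M. \<Sum>m=1..M. ln (a m)) \<longlonglongrightarrow> l"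
  proof (rule double_limit[where Y = "\<lambda>j M. \<Sum>m=1..M. log_ratio j m" and e = "\<lambda>M. 2 * tail_const / sqrt (real M)" and mlow = 4
        and d = "\<lambda>j. 2 * phase_const * bt ^ j"])
    show "(\<lambda>j. \<Sum>m=1..M. log_ratio j m) \<longlonglongrightarrow> (\<Sum>m=1..M. ln (a m))" for M
      unfolding a_def by (intro tendsto_sum log_ratio_tendsto) auto
    show "\<forall>\<^sub>F j in sequentially. \<bar>log_block j - (\<Sum>m=1..M. log_ratio j m)\<bar> \<le> 2 * tail_const / sqrt (real M) + 2 * phase_const * bt ^ j"
      if "4 \<le> M" for M
    proof -
      have "\<forall>\<^sub>F j in sequentially. 2 * M + 3 \<le> q j" using filterlim_q by (simp add: filterlim_at_top)
      moreover have "\<forall>\<^sub>F j in sequentially. 1 \<le> j" by (rule eventually_ge_at_top)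
      ultimately show ?thesis by eventually_elim (rule log_block_close, use that in auto)
    qed
    have "filterlim (\<lambda>M. sqrt (real M)) at_infinity sequentially"
      by (intro filterlim_at_top_imp_at_infinity filterlim_compose[OF sqrt_at_top] filterlim_real_sequentially)
    then show "(\<lambda>M. 2 * tail_const / sqrt (real M)) \<longlonglongrightarrow> 0" by (rule tendsto_divide_0[OF tendsto_const])
    show "(\<lambda>j. 2 * phase_const * bt ^ j) \<longlonglongrightarrow> 0"
      using tendsto_mult_left[OF bt_pow_tendsto_0, of "2 * phase_const"] by simp
  qed
  then obtain l where l: "log_block \<longlonglongrightarrow> l" "(\<lambda>M. \<Sum>m=1..M. ln (a m)) \<longlonglongrightarrow> l" by blast
  have C_eq: "C_partial b M = exp (\<Sum>m=1..M. ln (a m))" for M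
  proof -
    have "exp (\<Sum>m=1..M. ln (a m)) = (\<Prod>m=1..M. a m)"
      unfolding exp_sum[OF finite_atLeastAtMost] using a[of _ M] by (intro prod.cong) auto
    then show ?thesis by (simp add: C_partial_eq a_def)
  qed
  have "(\<lambda>M. exp (\<Sum>m=1..M. ln (a m))) \<longlonglongrightarrow> exp l" using l by (intro tendsto_intros)
  then have lim: "C_partial b \<longlonglongrightarrow> exp l" by (simp only: C_eq[symmetric])
  then show "convergent (C_partial b)" by (rule convergentI)
  have C: "C_const b = 2 * pi / lam * exp l"
    unfolding C_const_def limI[OF lim] lam_def ..
  then show "0 < C_const b" using lam_pos by simp
  have "(\<lambda>j. 2 * (real (q j) * sin (t j * 1)) * exp (log_block j)) \<longlonglongrightarrow> 2 * (pi * 1 / lam) * exp l"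
    by (intro tendsto_intros q_sin_tendsto l)
  moreover have "2 * (real (q j) * sin (t j * 1)) * exp (log_block j) = p j" for j
    using p_pos[of j] q_positive[of j] sin_t_pos[of j] by (simp add: log_block_def)
  ultimately show "p \<longlonglongrightarrow> C_const b" by (simp add: C)
qed


section \<open>Lower bounds for partial blocks\<close>

text \<open>The second factor of the lower bound for a partial block that starts at a shift close to \<open>- 1\<close>.\<close>

definition step :: "nat \<Rightarrow> real \<Rightarrow> real" where
  "step j y = (if j = 0 then 1 else min 1 (p (j - 1) * (1 - bt * y)))"

text \<open>The guaranteed value of a partial block with shift \<open>y - 1\<close>: either nothing is lost, or one block \<open>p j * y\<close> near the zero at \<open>- 1\<close> and, one level below, a second one.\<close>

definition block_bound :: "nat \<Rightarrow> real \<Rightarrow> real" where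
  "block_bound j y = min 1 (p j * y * step j y)"

lemma block_bound_le: "block_bound j y \<le> 1" by (simp add: block_bound_def)

lemma step_le: "step j y \<le> 1" by (simp add: step_def)

lemma F_nonneg: "0 \<le> F j x"
  by (simp add: F_def G_nonneg)

lemma bt_b: "bt * real b = 1 - bt\<^sup>2"
  using bt_root by (simp add: mult.commute)

text \<open>With a digit \<open>0 < c < b\<close> the shift \<open>- bt * (x + c)\<close> of the rest lies in \<open>[bt - 1, - bt\<^sup>2]\<close> again, whichever of the two ranges \<open>x\<close> was in: these two ranges are closed under splitting off digits.\<close>

lemma shift_range:
  assumes "1 \<le> c" "c < b"
  shows "- bt\<^sup>2 \<le> x \<Longrightarrow> x \<le> bt \<Longrightarrow> bt \<le> 1 - bt * (x + real c) \<and> 1 - bt * (x + real c) \<le> 1 - bt\<^sup>2"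
    and "bt - 1 \<le> x \<Longrightarrow> x \<le> - bt\<^sup>2 \<Longrightarrow> bt \<le> 1 - bt * (x + real c) \<and> 1 - bt * (x + real c) \<le> 1 - bt\<^sup>2"
proof -
  have c: "1 \<le> real c" "real c \<le> real b - 1" using assms by auto
  have b2: "2 \<le> real b" using assms by linarith
  have "2 * bt \<le> real b * bt" using b2 bt_pos by (intro mult_right_mono) auto
  then have half: "2 * bt + bt\<^sup>2 \<le> 1" using bt_root by linarith
  have up: "bt \<le> 1 - bt * u" if "u \<le> real b - 1 + bt" for u
  proof -
    have "bt * u \<le> bt * (real b - 1 + bt)" using that bt_pos by (intro mult_left_mono) auto
    also have "\<dots> = 1 - bt" using bt_b by (simp add: algebra_simps power2_eq_square)
    finally show ?thesis by simp
  qed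
  have low: "1 - bt * u \<le> 1 - bt\<^sup>2" if "bt \<le> u" for u
    using mult_left_mono[OF that, of bt] bt_pos by (simp add: power2_eq_square)
  show "bt \<le> 1 - bt * (x + real c) \<and> 1 - bt * (x + real c) \<le> 1 - bt\<^sup>2" if "- bt\<^sup>2 \<le> x" "x \<le> bt"
    using that c half bt_pos by (intro conjI up low) linarith+
  show "bt \<le> 1 - bt * (x + real c) \<and> 1 - bt * (x + real c) \<le> 1 - bt\<^sup>2" if "bt - 1 \<le> x" "x \<le> - bt\<^sup>2"
    using that c bt_pos zero_le_power2[of bt] by (intro conjI up low) linarith+
qed

text \<open>Induction on the level, splitting off the leading digit \<open>c\<close> of \<open>M\<close>. The hypotheses treat a digit \<open>0 < c < b\<close> at a single level. For \<open>c = 0\<close> the shift just moves to the next level, and for \<open>c = b\<close> the rest is shorter than \<open>q (j - 1)\<close>, so that its own leading digit vanishes and its shift falls into the harmless range \<open>[- bt\<^sup>2, bt]\<close> two levels below.\<close>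

lemma partial_block_bounds:
  assumes H0: "\<And>j x. - bt\<^sup>2 \<le> x \<Longrightarrow> x \<le> 0 \<Longrightarrow> 1 \<le> F j x"
    and H1: "\<And>j c y. 1 \<le> c \<Longrightarrow> c < b \<Longrightarrow> bt \<le> y \<Longrightarrow> y \<le> 1 - bt\<^sup>2 \<Longrightarrow>
      block_bound (Suc j) y \<le> (\<Prod>l<c. F (Suc j) (y - 1 + real l)) * block_bound j (1 - bt * (y - 1 + real c))"
    and H2: "\<And>j c x. 1 \<le> c \<Longrightarrow> c < b \<Longrightarrow> - bt\<^sup>2 \<le> x \<Longrightarrow> x \<le> bt \<Longrightarrow>
      1 \<le> (\<Prod>l<c. F (Suc j) (x + real l)) * block_bound j (1 - bt * (x + real c))"
  shows "M < q (Suc j) \<Longrightarrow> - bt\<^sup>2 \<le> x \<Longrightarrow> x \<le> bt \<Longrightarrow> 1 \<le> G j M x"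
    and "M < q (Suc j) \<Longrightarrow> bt \<le> y \<Longrightarrow> y \<le> 1 - bt\<^sup>2 \<Longrightarrow> block_bound j y \<le> G j M (y - 1)"
proof -
  have p1: "1 \<le> p j" for j using H0[of 0 j] bt_pos by (simp add: p_eq_F)
  have H3: "1 \<le> F (Suc j) x" if "- bt\<^sup>2 \<le> x" "x \<le> z - 1" for j x
  proof (cases "x \<le> 0")
    case False
    then show ?thesis using F_right_ge_p[of x j] p1[of "Suc j"] that by simp
  qed (use H0 that in blast)
  have F0: "F 0 x = 2 * sin (t 0 * (1 + x))" if "- 1 \<le> x" "x \<le> z - 2" for x
  proof -
    have "t 0 * (1 + x) \<le> t 0 * z" using that t_pos[of 0] by (intro mult_left_mono) auto
    then have "t 0 * (1 + x) \<le> pi" using t_z_le_pi[of 0] by linarith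
    then have "0 \<le> sin (t 0 * (1 + x))" using that t_pos[of 0] by (intro sin_ge_zero) auto
    then show ?thesis by (simp add: F_eq_prod)
  qed
  have F0_right: "p 0 \<le> F 0 x" if "0 \<le> x" "x \<le> z - 2" for x
  proof -
    have eq: "t 0 * z = pi" by (simp add: t_z)
    have "p 0 = 2 * sin (t 0)" using F0[of 0] that by (simp add: p_eq_F)
    moreover have "(2 * sin (t 0)) \<le> (\<Prod>i\<in>{0::nat}. 2 * sin (t 0 * (1 + x)))"
    proof (rule prod_sin_ge_min[where ?x0.0 = 0 and ?x1.0 = "z - 2"])
      have e: "t 0 * (1 + (z - 2)) = pi - t 0" by (simp add: algebra_simps eq[symmetric])
      then show "2 * sin (t 0) \<le> (\<Prod>i\<in>{0::nat}. 2 * sin (t 0 * (1 + (z - 2))))" by simp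
      show "0 < t 0 * (1 + (z - 2)) \<and> t 0 * (1 + (z - 2)) < pi" for i :: nat
        unfolding e using t_pos[of 0] t_less_pi[of 0] by simp
    qed (use that t_pos[of 0] t_less_pi[of 0] sin_t_pos[of 0] in auto)
    ultimately show ?thesis using F0[of x] that by simp
  qed
  have G0: "M < b \<Longrightarrow> G 0 M x = (\<Prod>l<M. F 0 (x + real l))" for M x
    using G_mult[of 0 M x] by simp
  have main: "(\<forall>M x. M < q (Suc j) \<longrightarrow> - bt\<^sup>2 \<le> x \<longrightarrow> x \<le> bt \<longrightarrow> 1 \<le> G j M x) \<and>
      (\<forall>M y. M < q (Suc j) \<longrightarrow> bt \<le> y \<longrightarrow> y \<le> 1 - bt\<^sup>2 \<longrightarrow> block_bound j y \<le> G j M (y - 1))" for j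
  proof (induction j rule: less_induct)
    case (less j)
    have IHB: "block_bound k y \<le> G k M (y - 1)" if "k < j" "M < q (Suc k)" "bt \<le> y \<and> y \<le> 1 - bt\<^sup>2" for k M y
      using less.IH that by blast
    \<comment> \<open>A vanishing leading digit: the shift \<open>- bt * x\<close> on the level below is harmless for all \<open>x \<ge> - 1\<close>.\<close>
    have Z: "1 \<le> G i M x" if "i \<le> j" "M < q i" "- 1 \<le> x" "x \<le> bt" for i M x
    proof (cases i)
      case 0
      then show ?thesis using that by simp
    next
      case (Suc k)
      have "- bt\<^sup>2 \<le> - bt * x"
        using mult_left_mono[OF that(4), of bt] bt_pos by (simp add: power2_eq_square)
      moreover have "- bt * x \<le> bt" using mult_left_mono[OF that(3), of bt] bt_pos by simp
      ultimately show ?thesis using less.IH[of k] that Suc by (simp add: G_Suc_level)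
    qed
    have full: "1 \<le> (\<Prod>l<b. F (Suc k) (x + real l)) * G (Suc k) M (x + real b)"
      if k: "j = Suc k" and M: "M < q k" and x: "- bt\<^sup>2 \<le> x" "x \<le> bt" for k M x
    proof -
      have "1 \<le> (\<Prod>l<b. F (Suc k) (x + real l))"
      proof (rule prod_ge_1)
        fix l assume "l \<in> {..<b}"
        then have "real l \<le> real b - 1" by auto
        then show "1 \<le> F (Suc k) (x + real l)" using x by (intro H3) (auto simp: z_def)
      qed
      moreover have "1 \<le> G k M (- bt * (x + real b))"
      proof (rule Z)
        have "bt * (x + real b) \<le> bt * z" using x bt_pos by (intro mult_left_mono) (auto simp: z_def)
        then show "- 1 \<le> - bt * (x + real b)" by (simp add: bt_z)
        have "0 \<le> bt * (x + real b)" using x bt_pos bt_sq b_ge_1 by (intro mult_nonneg_nonneg) auto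
        then show "- bt * (x + real b) \<le> bt" using bt_pos by simp
      qed (use k M in auto)
      ultimately have "1 * 1 \<le> (\<Prod>l<b. F (Suc k) (x + real l)) * G k M (- bt * (x + real b))"
        by (intro mult_mono) auto
      then show ?thesis by (simp add: G_Suc_level)
    qed
    have A: "1 \<le> G j M x" if M: "M < q (Suc j)" and x: "- bt\<^sup>2 \<le> x" "x \<le> bt" for M x
    proof -
      define c M' where "c = M div q j" and "M' = M mod q j"
      have M_eq: "M = c * q j + M'" unfolding c_def M'_def by (rule div_mult_mod_eq[symmetric])
      have M': "M' < q j" using q_positive[of j] by (simp add: M'_def)
      have G_eq: "G j M x = (\<Prod>l<c. F j (x + real l)) * G j M' (x + real c)"
        unfolding M_eq by (rule G_mult_add)
      show ?thesis
      proof (cases "c = 0")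
        case True
        then show ?thesis using Z[of j M x] M' M_eq x bt_sq by simp
      next
        case c0: False
        show ?thesis
        proof (cases j)
          case 0
          have cb: "c < b" using M 0 M_eq M' by (simp add: q_1)
          have "1 \<le> (\<Prod>l<c. F 0 (x + real l))"
          proof (rule prod_ge_1)
            fix l assume l: "l \<in> {..<c}"
            show "1 \<le> F 0 (x + real l)"
            proof (cases "x + real l \<le> 0")
              case False
              have "real l \<le> real b - 2" using l cb by auto
              then have "x + real l \<le> z - 2" using x by (simp add: z_def)
              then show ?thesis using F0_right[of "x + real l"] False p1[of 0] by simp
            qed (use x in \<open>intro H0; simp\<close>)
          qed
          then show ?thesis using G_eq 0 M' by simp
        next
          case (Suc k)
          show ?thesis
          proof (cases "c < b")
            case True
            have "1 \<le> (\<Prod>l<c. F j (x + real l)) * block_bound k (1 - bt * (x + real c))"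
              using H2[of c x k] c0 True x Suc by simp
            also have "\<dots> \<le> (\<Prod>l<c. F j (x + real l)) * G j M' (x + real c)"
            proof (intro mult_left_mono prod_nonneg F_nonneg)
              have "block_bound k (1 - bt * (x + real c)) \<le> G k M' (1 - bt * (x + real c) - 1)"
                using c0 True x M' Suc by (intro IHB shift_range(1)) auto
              then show "block_bound k (1 - bt * (x + real c)) \<le> G j M' (x + real c)" by (simp add: Suc G_Suc_level)
            qed
            finally show ?thesis by (simp add: G_eq)
          next
            case False
            have "c * q j \<le> b * q j + q k" using M M_eq Suc by (simp add: q_Suc_Suc)
            have "c = b \<and> M' < q k"
            proof -
              have lt: "c * q j + M' < b * q j + q k" using M M_eq Suc by (simp add: q_Suc_Suc)
              have "c \<le> b"
              proof (rule ccontr)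
                assume "\<not> c \<le> b"
                then have "Suc b * q j \<le> c * q j" by (intro mult_le_mono1) simp
                then show False using lt q_mono_Suc[of k] Suc by simp
              qed
              then show ?thesis using False lt by auto
            qed
            then show ?thesis using full[of k M' x] x Suc G_eq by simp
          qed
        qed
      qed
    qed
    have B: "block_bound j y \<le> G j M (y - 1)" if M: "M < q (Suc j)" and y: "bt \<le> y" "y \<le> 1 - bt\<^sup>2" for M y
    proof -
      define c M' where "c = M div q j" and "M' = M mod q j"
      have M_eq: "M = c * q j + M'" unfolding c_def M'_def by (rule div_mult_mod_eq[symmetric])
      have M': "M' < q j" using q_positive[of j] by (simp add: M'_def)
      have G_eq: "G j M (y - 1) = (\<Prod>l<c. F j (y - 1 + real l)) * G j M' (y - 1 + real c)"
        unfolding M_eq by (rule G_mult_add)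
      have Fy: "p j * y \<le> F j (y - 1)" using F_left[of "y - 1" j] y bt_pos bt_sq by simp
      have block_bound_y: "block_bound j y \<le> p j * y"
      proof -
        have "p j * y * step j y \<le> p j * y * 1"
          using step_le p_pos[of j] y bt_pos by (intro mult_left_mono) auto
        then show ?thesis by (simp add: block_bound_def min_def)
      qed
      show ?thesis
      proof (cases "c = 0")
        case True
        then have "1 \<le> G j M (y - 1)" using Z[of j M "y - 1"] M' M_eq y bt_pos bt_sq by simp
        then show ?thesis using block_bound_le[of j y] by linarith
      next
        case c0: False
        then have split: "(\<Prod>l<c. F j (y - 1 + real l)) = F j (y - 1) * (\<Prod>l\<in>{1..<c}. F j (y - 1 + real l))"
        proof -
          have "{..<c} = insert 0 {1..<c}" using c0 by auto
          then show ?thesis by simp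
        qed
        show ?thesis
        proof (cases j)
          case 0
          have cb: "c < b" using M 0 M_eq M' by (simp add: q_1)
          have "1 \<le> (\<Prod>l\<in>{1..<c}. F 0 (y - 1 + real l))"
          proof (rule prod_ge_1)
            fix l assume l: "l \<in> {1..<c}"
            have "real l \<le> real b - 2" "1 \<le> real l" using l cb by auto
            then have "0 \<le> y - 1 + real l" "y - 1 + real l \<le> z - 2"
              using y bt_pos bt_sq unfolding z_def by linarith+
            then show "1 \<le> F 0 (y - 1 + real l)" using F0_right[of "y - 1 + real l"] p1[of 0] by linarith
          qed
          then have "F 0 (y - 1) * 1 \<le> F 0 (y - 1) * (\<Prod>l\<in>{1..<c}. F 0 (y - 1 + real l))"
            by (intro mult_left_mono F_nonneg)
          then show ?thesis using block_bound_y Fy G_eq split 0 M' by simp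
        next
          case (Suc k)
          show ?thesis
          proof (cases "c < b")
            case True
            have "block_bound j y \<le> (\<Prod>l<c. F j (y - 1 + real l)) * block_bound k (1 - bt * (y - 1 + real c))"
              using H1[of c y k] c0 True y Suc by simp
            also have "\<dots> \<le> (\<Prod>l<c. F j (y - 1 + real l)) * G j M' (y - 1 + real c)"
            proof (intro mult_left_mono prod_nonneg F_nonneg)
              have "block_bound k (1 - bt * (y - 1 + real c)) \<le> G k M' (1 - bt * (y - 1 + real c) - 1)"
                using c0 True y M' Suc by (intro IHB shift_range(2)) auto
              then show "block_bound k (1 - bt * (y - 1 + real c)) \<le> G j M' (y - 1 + real c)"
                by (simp add: Suc G_Suc_level)
            qed
            finally show ?thesis by (simp add: G_eq)
          next
            case False
            have cM: "c = b \<and> M' < q k"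
            proof -
              have lt: "c * q j + M' < b * q j + q k" using M M_eq Suc by (simp add: q_Suc_Suc)
              have "c \<le> b"
              proof (rule ccontr)
                assume "\<not> c \<le> b"
                then have "Suc b * q j \<le> c * q j" by (intro mult_le_mono1) simp
                then show False using lt q_mono_Suc[of k] Suc by simp
              qed
              then show ?thesis using False lt by auto
            qed
            have P1: "1 \<le> (\<Prod>l\<in>{1..<c}. F j (y - 1 + real l))"
            proof (rule prod_ge_1)
              fix l assume l: "l \<in> {1..<c}"
              have "real l \<le> real b - 1" "1 \<le> real l" using l cM by auto
              then have "0 \<le> y - 1 + real l" "y - 1 + real l \<le> z - 1"
                using y bt_pos bt_sq unfolding z_def by linarith+
              then show "1 \<le> F j (y - 1 + real l)" using H3[of "y - 1 + real l" k] Suc bt_sq(1) by (simp del: zero_less_power2)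
            qed
            have P2: "1 \<le> G k M' (- bt * (y - 1 + real c))"
            proof (rule Z)
              have "y - 1 + real c \<le> z" using y cM bt_pos bt_sq unfolding z_def by linarith
              then have "bt * (y - 1 + real c) \<le> bt * z" using bt_pos by (intro mult_left_mono) auto
              then show "- 1 \<le> - bt * (y - 1 + real c)" by (simp add: bt_z)
              have "0 \<le> y - 1 + real c" using y bt_pos cM b_ge_1 by simp
              then have "0 \<le> bt * (y - 1 + real c)" using bt_pos by (intro mult_nonneg_nonneg) auto
              then show "- bt * (y - 1 + real c) \<le> bt" using bt_pos by simp
            qed (use Suc cM in auto)
            have "F j (y - 1) * (1 * 1) \<le> F j (y - 1) * ((\<Prod>l\<in>{1..<c}. F j (y - 1 + real l)) * G k M' (- bt * (y - 1 + real c)))"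
              using P1 P2 by (intro mult_left_mono mult_mono F_nonneg) auto
            then show ?thesis using block_bound_y Fy G_eq split Suc by (simp add: G_Suc_level mult.assoc)
          qed
        qed
      qed
    qed
    show ?case using A B by blast
  qed
  show "M < q (Suc j) \<Longrightarrow> - bt\<^sup>2 \<le> x \<Longrightarrow> x \<le> bt \<Longrightarrow> 1 \<le> G j M x"
    and "M < q (Suc j) \<Longrightarrow> bt \<le> y \<Longrightarrow> y \<le> 1 - bt\<^sup>2 \<Longrightarrow> block_bound j y \<le> G j M (y - 1)"
    using main by blast+
qed


section \<open>Reducing the hypotheses to numerical inequalities\<close>

text \<open>The loss of \<open>sin (t * (1 + x)) / sin t\<close> against its linear approximation \<open>1 + x\<close> at the far end of the range of shifts; it tends to \<open>1\<close> with the level.\<close>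

definition sinc_ratio :: "nat \<Rightarrow> real" where
  "sinc_ratio j = sin (t j * (z - 1)) / ((z - 1) * sin (t j))"

lemma sinc_ratio_arg: "0 < sin (t (Suc j) * (z - 1))" "t (Suc j) * (z - 1) < pi"
proof -
  have "t (Suc j) * (z - 1) < t (Suc j) * z" using t_pos[of "Suc j"] by (intro mult_strict_left_mono) auto
  then show lt: "t (Suc j) * (z - 1) < pi" using t_Suc_z_less_pi[of j] by linarith
  then show "0 < sin (t (Suc j) * (z - 1))" using t_pos[of "Suc j"] z_gt_1 by (intro sin_gt_zero) auto
qed

lemma sinc_ratio_pos: "0 < sinc_ratio (Suc j)"
  using sinc_ratio_arg(1)[of j] sin_t_pos[of "Suc j"] z_gt_1 by (simp add: sinc_ratio_def)

lemma sinc_ratio_ge: "1 - (t (Suc j) * (z - 1))\<^sup>2 / 6 \<le> sinc_ratio (Suc j)"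
proof -
  define u where "u = t (Suc j) * (z - 1)"
  have u: "0 < u" using t_pos[of "Suc j"] z_gt_1 by (simp add: u_def)
  have "u * (1 - u\<^sup>2 / 6) \<le> sin u"
    using sin_ge_cubic[of u] u by (simp add: algebra_simps power2_eq_square power3_eq_cube)
  then have "1 - u\<^sup>2 / 6 \<le> sin u / u" using u by (simp add: field_simps)
  also have "\<dots> \<le> sin u / ((z - 1) * sin (t (Suc j)))"
  proof (intro divide_left_mono)
    show "(z - 1) * sin (t (Suc j)) \<le> u"
      using sin_x_le_x[of "t (Suc j)"] t_pos[of "Suc j"] z_gt_1
      by (simp add: u_def mult.commute mult_left_mono)
  qed (use sinc_ratio_arg(1)[of j] sin_t_pos[of "Suc j"] z_gt_1 u in \<open>auto simp: u_def\<close>)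
  finally show ?thesis by (simp add: sinc_ratio_def u_def)
qed

lemma sinc_ratio_tendsto: "sinc_ratio \<longlonglongrightarrow> 1"
proof -
  have "(\<lambda>j. (real (q j) * sin (t j * (z - 1))) / ((z - 1) * (real (q j) * sin (t j * 1))))
     \<longlonglongrightarrow> (pi * (z - 1) / lam) / ((z - 1) * (pi * 1 / lam))"
    using z_gt_1 lam_pos by (intro tendsto_intros q_sin_tendsto) auto
  moreover have "(real (q j) * sin (t j * (z - 1))) / ((z - 1) * (real (q j) * sin (t j * 1))) = sinc_ratio j" for j
    using q_positive[of j] by (simp add: sinc_ratio_def)
  moreover have "(pi * (z - 1) / lam) / ((z - 1) * (pi * 1 / lam)) = 1"
    using z_gt_1 lam_pos by (simp add: field_simps)
  ultimately show ?thesis by (simp only:)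
qed

lemma F_ge:
  assumes "0 \<le> u" "u \<le> z - 2" "2 \<le> q (Suc j)"
  shows "p (Suc j) * sinc_ratio (Suc j) * ((1 + u) * (1 - bt * u)) \<le> F (Suc j) u"
proof -
  have lt: "t (Suc j) * (z - 1) < pi" by (rule sinc_ratio_arg)
  have z: "0 < z - 1" using z_gt_1 by simp
  have "(1 + u) / (z - 1) \<le> sin (t (Suc j) * (1 + u)) / sin (t (Suc j) * (z - 1))"
    using assms z lt t_pos[of "Suc j"] by (intro sin_ratio_ge) auto
  then have "sin (t (Suc j) * (z - 1)) / sin (t (Suc j)) * ((1 + u) / (z - 1))
      \<le> sin (t (Suc j) * (z - 1)) / sin (t (Suc j)) * (sin (t (Suc j) * (1 + u)) / sin (t (Suc j) * (z - 1)))"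
    using sinc_ratio_arg(1)[of j] sin_t_pos[of "Suc j"] by (intro mult_left_mono) auto
  then have le: "sinc_ratio (Suc j) * (1 + u) \<le> sin (t (Suc j) * (1 + u)) / sin (t (Suc j))"
    using sinc_ratio_arg(1)[of j] by (simp add: sinc_ratio_def mult_ac)
  have "bt * u \<le> bt * z" using assms bt_pos by (intro mult_left_mono) auto
  then have nn: "0 \<le> 1 - bt * u" by (simp add: bt_z)
  have "p (Suc j) * sinc_ratio (Suc j) * ((1 + u) * (1 - bt * u)) = p (Suc j) * (sinc_ratio (Suc j) * (1 + u)) * (1 - bt * u)"
    by (simp add: mult_ac)
  also have "\<dots> \<le> p (Suc j) * (sin (t (Suc j) * (1 + u)) / sin (t (Suc j))) * (1 - bt * u)"
    using le nn p_pos[of "Suc j"] by (intro mult_right_mono mult_left_mono) auto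
  also have "\<dots> \<le> F (Suc j) u" using assms by (intro F_right) auto
  finally show ?thesis .
qed

text \<open>The factor gained from a digit \<open>c\<close> beyond its first unit, for a shift in \<open>[xl, xh]\<close>.\<close>

definition gain :: "real \<Rightarrow> real \<Rightarrow> real \<Rightarrow> real \<Rightarrow> nat \<Rightarrow> real" where
  "gain a h xl xh c = (\<Prod>l=1..<c. a * ((1 + xl + real l) * (1 - h * (xh + real l))))"

text \<open>Each block at a positive shift is bounded by \<open>F_ge\<close>; \<open>1 + x\<close> is smallest at \<open>xl\<close> and \<open>1 - bt * x\<close> at \<open>xh\<close>.\<close>

lemma gain_le:
  assumes c: "c < b" and q2: "2 \<le> q (Suc j)"
    and x: "- 1 + bt \<le> x" "x \<le> bt" "xl \<le> x" "x \<le> xh" "- 1 \<le> xl"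
    and h: "bt \<le> h" "h * (xh + real c) \<le> 1"
    and a: "0 \<le> a" "a \<le> p (Suc j) * sinc_ratio (Suc j)"
  shows "0 \<le> gain a h xl xh c \<and> gain a h xl xh c \<le> (\<Prod>l=1..<c. F (Suc j) (x + real l))"
proof -
  have main: "0 \<le> a * ((1 + xl + real l) * (1 - h * (xh + real l))) \<and>
      a * ((1 + xl + real l) * (1 - h * (xh + real l))) \<le> F (Suc j) (x + real l)" if l: "l \<in> {1..<c}" for l
  proof -
    have l': "1 \<le> real l" "real l \<le> real b - 2" "real l \<le> real c" using l c by auto
    have h0: "0 \<le> h" using h bt_pos by linarith
    have "h * (xh + real l) \<le> h * (xh + real c)" using l' h0 by (intro mult_left_mono) auto
    then have 1: "0 \<le> 1 - h * (xh + real l)" using h by linarith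
    have "bt * (x + real l) \<le> h * (xh + real l)" using h x l' bt_pos by (intro mult_mono) auto
    then have 2: "1 - h * (xh + real l) \<le> 1 - bt * (x + real l)" by simp
    have 3: "0 \<le> 1 + xl + real l" "1 + xl + real l \<le> 1 + (x + real l)" using x l' by auto
    have 4: "(1 + xl + real l) * (1 - h * (xh + real l)) \<le> (1 + (x + real l)) * (1 - bt * (x + real l))"
      using 1 2 3 by (intro mult_mono) auto
    have 5: "0 \<le> (1 + xl + real l) * (1 - h * (xh + real l))" using 1 3 by simp
    have "a * ((1 + xl + real l) * (1 - h * (xh + real l)))
        \<le> p (Suc j) * sinc_ratio (Suc j) * ((1 + (x + real l)) * (1 - bt * (x + real l)))"
    proof (rule mult_mono[OF a(2) 4 _ 5])
      show "0 \<le> p (Suc j) * sinc_ratio (Suc j)" using a by linarith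
    qed
    also have "\<dots> \<le> F (Suc j) (x + real l)"
      using x l' q2 bt_pos by (intro F_ge) (auto simp: z_def)
    finally show ?thesis using a 5 by simp
  qed
  then show ?thesis unfolding gain_def by (auto intro!: prod_nonneg prod_mono)
qed

text \<open>\<open>block_bound\<close> is a minimum of three expressions, which gives three conditions on a common lower bound \<open>e\<close>, all of them free of \<open>x\<close> and \<open>j\<close>. At level \<open>0\<close> the third alternative does not occur.\<close>

lemma block_gain:
  assumes c: "1 \<le> c" "c < b" and q2: "2 \<le> q (Suc j)"
    and x: "- 1 + bt \<le> x" "x \<le> bt" "xl \<le> x" "x \<le> xh" "- 1 \<le> xl"
    and h: "0 \<le> l" "l \<le> bt" "bt \<le> h" "h * (xh + real c) \<le> 1" "h * (1 - l * (xl + real c)) \<le> 1"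
    and a: "0 \<le> a" "a \<le> p (Suc j) * sinc_ratio (Suc j)"
    and i: "0 \<le> i" "i \<le> p j" and W: "0 \<le> W" "0 < j \<Longrightarrow> W \<le> p j * p (j - 1)" and f: "0 \<le> f"
    and e: "e \<le> f * gain a h xl xh c"
      "e \<le> f * gain a h xl xh c * (i * (1 - h * (xh + real c)))"
      "0 < j \<Longrightarrow> e \<le> f * gain a h xl xh c * (W * ((1 - h * (xh + real c)) * (1 - h * (1 - l * (xl + real c)))))"
  shows "e \<le> f * ((\<Prod>l=1..<c. F (Suc j) (x + real l)) * block_bound j (1 - bt * (x + real c)))"
proof -
  define K where "K = (\<Prod>l=1..<c. F (Suc j) (x + real l))"
  define Y where "Y = 1 - h * (xh + real c)"
  define y where "y = 1 - bt * (x + real c)"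
  define X where "X = 1 - h * (1 - l * (xl + real c))"
  have gK: "0 \<le> gain a h xl xh c" "gain a h xl xh c \<le> K"
    using gain_le[OF c(2) q2 x h(3,4) a] by (auto simp: K_def)
  have K0: "0 \<le> f * gain a h xl xh c" "f * gain a h xl xh c \<le> f * K"
    using gK f by (auto intro!: mult_left_mono)
  have xc: "0 \<le> x + real c" "0 \<le> xl + real c" using x c bt_pos by auto
  have "bt * (x + real c) \<le> h * (xh + real c)" using h x xc bt_pos by (intro mult_mono) auto
  then have Yy: "0 \<le> Y" "Y \<le> y" using h by (auto simp: Y_def y_def)
  have "l * (xl + real c) \<le> bt * (x + real c)" using h x xc bt_pos by (intro mult_mono) auto
  then have "bt * y \<le> h * (1 - l * (xl + real c))" using h Yy bt_pos by (intro mult_mono) (auto simp: y_def)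
  then have Xy: "0 \<le> X" "X \<le> 1 - bt * y" using h by (auto simp: X_def)
  have 1: "e \<le> f * K" using e(1) K0 by linarith
  have "f * gain a h xl xh c * (i * Y) \<le> f * K * (p j * y)"
  proof (rule mult_mono[OF K0(2)])
    show "i * Y \<le> p j * y" using Yy i p_pos[of j] by (intro mult_mono) auto
  qed (use K0 Yy i in auto)
  then have 2: "e \<le> f * K * (p j * y)" using e(2) by (simp add: Y_def)
  have 3: "e \<le> f * K * (p j * y * (p (j - 1) * (1 - bt * y)))" if "0 < j"
  proof -
    have "f * gain a h xl xh c * (W * (Y * X)) \<le> f * K * ((p j * p (j - 1)) * (y * (1 - bt * y)))"
    proof (rule mult_mono[OF K0(2)])
      have "0 \<le> p j * p (j - 1)" using p_pos[of j] p_pos[of "j - 1"] by simp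
      then show "W * (Y * X) \<le> p j * p (j - 1) * (y * (1 - bt * y))"
        using Yy Xy W(1) W(2)[OF that] by (intro mult_mono) auto
    qed (use K0 Yy Xy W in auto)
    then show ?thesis using e(3)[OF that] by (simp add: Y_def X_def mult_ac)
  qed
  have fK: "0 \<le> f * K" using K0 by linarith
  have "e \<le> f * K * block_bound j y"
  proof (cases "j = 0")
    case True
    then show ?thesis using 1 2 by (simp add: block_bound_def step_def min_def)
  next
    case False
    then show ?thesis using 1 2 3 by (simp add: block_bound_def step_def min_def)
  qed
  then show ?thesis by (simp add: K_def y_def mult.assoc)
qed

text \<open>The conditions of \<open>block_gain\<close> with \<open>e = 1\<close>: \<open>l\<close> and \<open>h\<close> enclose \<open>bt\<close>, and \<open>a\<close>, \<open>i\<close>, \<open>W\<close> bound \<open>p * sinc_ratio\<close>, \<open>p\<close> and products of two consecutive \<open>p\<close> from below.\<close>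

definition fits :: "real \<Rightarrow> real \<Rightarrow> real \<Rightarrow> real \<Rightarrow> real \<Rightarrow> real \<Rightarrow> real \<Rightarrow> nat \<Rightarrow> real \<Rightarrow> bool" where
  "fits a i W l h xl xh c f \<longleftrightarrow>
     - 1 \<le> xl \<and> h * (xh + real c) \<le> 1 \<and> h * (1 - l * (xl + real c)) \<le> 1 \<and>
     1 \<le> f * gain a h xl xh c \<and>
     1 \<le> f * gain a h xl xh c * (i * (1 - h * (xh + real c))) \<and>
     1 \<le> f * gain a h xl xh c * (W * ((1 - h * (xh + real c)) * (1 - h * (1 - l * (xl + real c)))))"

lemma fits_bound:
  assumes fits: "fits a i W l h xl xh c f"
    and c: "1 \<le> c" "c < b" and q2: "2 \<le> q (Suc j)"
    and x: "- 1 + bt \<le> x" "x \<le> bt" "xl \<le> x" "x \<le> xh"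
    and lh: "0 \<le> l" "l \<le> bt" "bt \<le> h"
    and a: "0 \<le> a" "a \<le> p (Suc j) * sinc_ratio (Suc j)"
    and i: "0 \<le> i" "i \<le> p j" and W: "0 \<le> W" "0 < j \<Longrightarrow> W \<le> p j * p (j - 1)" and f: "0 \<le> f"
  shows "1 \<le> f * ((\<Prod>l=1..<c. F (Suc j) (x + real l)) * block_bound j (1 - bt * (x + real c)))"
  by (rule block_gain[OF c q2 x _ lh _ _ a i W f]) (use fits in \<open>auto simp: fits_def\<close>)

lemma prod_lessThan_split:
  fixes g :: "nat \<Rightarrow> real"
  assumes "1 \<le> c" shows "(\<Prod>l<c. g l) = g 0 * (\<Prod>l=1..<c. g l)"
proof -
  have "{..<c} = insert 0 {1..<c}" using assms by auto
  then show ?thesis by simp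
qed

text \<open>For two or more blocks the first one already pays for \<open>block_bound (Suc j) y\<close>, and the others only have to compensate the rest.\<close>

lemma H1_from_gain:
  assumes c: "2 \<le> c" and y: "bt \<le> y"  "y \<le> 1 - bt\<^sup>2"
    and g: "1 \<le> 1 * ((\<Prod>l=1..<c. F (Suc j) (y - 1 + real l)) * block_bound j (1 - bt * (y - 1 + real c)))"
  shows "block_bound (Suc j) y \<le> (\<Prod>l<c. F (Suc j) (y - 1 + real l)) * block_bound j (1 - bt * (y - 1 + real c))"
proof -
  have y0: "0 \<le> y" using y bt_pos by linarith
  have "p (Suc j) * y * step (Suc j) y \<le> p (Suc j) * y * 1"
    using step_le p_pos[of "Suc j"] y0 by (intro mult_left_mono) auto
  then have "block_bound (Suc j) y \<le> p (Suc j) * y" by (simp add: block_bound_def min_def)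
  also have "\<dots> \<le> F (Suc j) (y - 1)" using F_left[of "y - 1" "Suc j"] y0 y bt_sq by simp
  finally have "block_bound (Suc j) y * 1 \<le> F (Suc j) (y - 1) *
      ((\<Prod>l=1..<c. F (Suc j) (y - 1 + real l)) * block_bound j (1 - bt * (y - 1 + real c)))"
    using g F_nonneg by (intro mult_mono) auto
  then show ?thesis using prod_lessThan_split[of c "\<lambda>l. F (Suc j) (y - 1 + real l)"] c by (simp add: mult.assoc)
qed

text \<open>With a single block nothing is left to compensate, so the two minima have to be compared directly. The right side is smaller only if its innermost factor \<open>B\<close> is below \<open>1\<close>; then either of the two stated products rescues it.\<close>

lemma H1_one:
  assumes y: "bt \<le> y" "y \<le> 1 - bt\<^sup>2"
    and d: "0 < j \<Longrightarrow> 1 \<le> p j * p (j - 1) * ((1 - bt * y) * (1 - bt * (1 - bt * y))) \<or>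
      1 \<le> p (Suc j) * y * (p j * p (j - 1) * ((1 - bt * y) * (1 - bt * (1 - bt * y))))"
  shows "block_bound (Suc j) y \<le> F (Suc j) (y - 1) * block_bound j (1 - bt * y)"
proof -
  define Y A B where "Y = p (Suc j) * y" and "A = p j * (1 - bt * y)"
    and "B = p (j - 1) * (1 - bt * (1 - bt * y))"
  have y0: "0 \<le> y" using y bt_pos by linarith
  have Y: "0 \<le> Y" "Y \<le> F (Suc j) (y - 1)"
    using F_left[of "y - 1" "Suc j"] y0 y bt_sq mult_nonneg_nonneg[OF less_imp_le[OF p_pos[of "Suc j"]] y0]
    by (auto simp: Y_def)
  have y1: "y \<le> 1" using y bt_sq(1) by linarith
  have "bt * y \<le> 1 * 1" using y0 y1 bt_pos bt_less_1 by (intro mult_mono) auto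
  then have A: "0 \<le> A" using p_pos[of j] by (simp add: A_def)
  have "bt * (1 - bt * y) \<le> 1 * 1" using \<open>bt * y \<le> 1 * 1\<close> y0 bt_pos bt_less_1 by (intro mult_mono) auto
  then have B: "0 \<le> B" using p_pos[of "j - 1"] by (simp add: B_def)
  have L: "block_bound (Suc j) y = min 1 (Y * min 1 A)" by (simp add: block_bound_def step_def Y_def A_def)
  have R: "block_bound j (1 - bt * y) = min 1 (A * (if j = 0 then 1 else min 1 B))"
    by (simp add: block_bound_def step_def A_def B_def)
  have "min 1 (Y * min 1 A) \<le> Y * min 1 (A * (if j = 0 then 1 else min 1 B))"
  proof (cases "j = 0 \<or> 1 \<le> B")
    case True
    then have "(if j = 0 then 1 else min 1 B) = 1" by auto
    then show ?thesis by simp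
  next
    case False
    then have j: "0 < j" and m: "min 1 B = B" by auto
    from d[OF j] have "1 \<le> A * B \<or> 1 \<le> Y * (A * B)" by (simp add: A_def B_def Y_def mult_ac)
    moreover have "Y * min 1 A \<le> Y * 1" using Y by (intro mult_left_mono) auto
    ultimately show ?thesis using j m by (auto simp: min_def)
  qed
  also have "\<dots> \<le> F (Suc j) (y - 1) * block_bound j (1 - bt * y)"
    unfolding R using Y A B by (intro mult_right_mono) auto
  finally show ?thesis by (simp add: L)
qed

lemma H2_from_gain:
  assumes c: "1 \<le> c" and f: "f \<le> F (Suc j) x"
    and g: "1 \<le> f * ((\<Prod>l=1..<c. F (Suc j) (x + real l)) * block_bound j (1 - bt * (x + real c)))"
    and nn: "0 \<le> 1 - bt * (x + real c)" "bt * (1 - bt * (x + real c)) \<le> 1"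
  shows "1 \<le> (\<Prod>l<c. F (Suc j) (x + real l)) * block_bound j (1 - bt * (x + real c))"
proof -
  have "0 \<le> step j (1 - bt * (x + real c))" using nn p_pos[of "j - 1"] by (simp add: step_def)
  then have "0 \<le> block_bound j (1 - bt * (x + real c))" using nn p_pos[of j] by (simp add: block_bound_def)
  then have "f * ((\<Prod>l=1..<c. F (Suc j) (x + real l)) * block_bound j (1 - bt * (x + real c)))
      \<le> F (Suc j) x * ((\<Prod>l=1..<c. F (Suc j) (x + real l)) * block_bound j (1 - bt * (x + real c)))"
    using f F_nonneg by (intro mult_right_mono mult_nonneg_nonneg prod_nonneg) auto
  then show ?thesis using g prod_lessThan_split[OF c, of "\<lambda>l. F (Suc j) (x + real l)"] by (simp add: mult.assoc)
qed


section \<open>The lower limit\<close>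

text \<open>The conclusion of \<open>partial_block_bounds\<close>.\<close>

definition blocks_ok :: bool where
  "blocks_ok \<longleftrightarrow>
    (\<forall>j M x. M < q (Suc j) \<longrightarrow> - bt\<^sup>2 \<le> x \<longrightarrow> x \<le> bt \<longrightarrow> 1 \<le> G j M x) \<and>
    (\<forall>j M y. M < q (Suc j) \<longrightarrow> bt \<le> y \<longrightarrow> y \<le> 1 - bt\<^sup>2 \<longrightarrow> block_bound j y \<le> G j M (y - 1))"

lemma blocks_okD:
  assumes blocks_ok
  shows "M < q (Suc j) \<Longrightarrow> - bt\<^sup>2 \<le> x \<Longrightarrow> x \<le> bt \<Longrightarrow> 1 \<le> G j M x"
    and "M < q (Suc j) \<Longrightarrow> bt \<le> 1 - u \<Longrightarrow> 1 - u \<le> 1 - bt\<^sup>2 \<Longrightarrow> block_bound j (1 - u) \<le> G j M (- u)"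
    and "M < q j \<Longrightarrow> - 1 \<le> x \<Longrightarrow> x \<le> bt \<Longrightarrow> 1 \<le> G j M x"
proof -
  show A: "M < q (Suc j) \<Longrightarrow> - bt\<^sup>2 \<le> x \<Longrightarrow> x \<le> bt \<Longrightarrow> 1 \<le> G j M x" for j M x
    using assms unfolding blocks_ok_def by blast
  show "M < q (Suc j) \<Longrightarrow> bt \<le> 1 - u \<Longrightarrow> 1 - u \<le> 1 - bt\<^sup>2 \<Longrightarrow> block_bound j (1 - u) \<le> G j M (- u)"
  proof -
    assume M: "M < q (Suc j)" and u: "bt \<le> 1 - u" "1 - u \<le> 1 - bt\<^sup>2"
    have "block_bound j (1 - u) \<le> G j M ((1 - u) - 1)" using assms M u unfolding blocks_ok_def by blast
    then show "block_bound j (1 - u) \<le> G j M (- u)" by simp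
  qed
  assume M: "M < q j" and x: "- 1 \<le> x" "x \<le> bt"
  show "1 \<le> G j M x"
  proof (cases j)
    case 0
    then show ?thesis using M by simp
  next
    case (Suc k)
    have "- bt\<^sup>2 \<le> - bt * x"
      using mult_left_mono[OF x(2), of bt] bt_pos by (simp add: power2_eq_square)
    moreover have "- bt * x \<le> bt" using mult_left_mono[OF x(1), of bt] bt_pos by simp
    ultimately show ?thesis using A[of M k "- bt * x"] M Suc by (simp add: G_Suc_level)
  qed
qed

text \<open>From a certain level on, the blocks are at least as large as for a lower bound \<open>\<pi>\<close> of the limit.\<close>

definition good :: "real \<Rightarrow> nat \<Rightarrow> bool" where
  "good \<pi> j \<longleftrightarrow> 0 < j \<and> 2 \<le> q j \<and> \<pi> \<le> p j \<and> \<pi> \<le> p j * sinc_ratio j"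

lemma eventually_good:
  assumes "p \<longlonglongrightarrow> L" "\<pi> < L"
  shows "\<forall>\<^sub>F j in sequentially. \<forall>i\<ge>j. good \<pi> i"
proof -
  have "(\<lambda>j. p j * sinc_ratio j) \<longlonglongrightarrow> L * 1" by (intro tendsto_mult assms sinc_ratio_tendsto)
  then have 1: "\<forall>\<^sub>F j in sequentially. \<pi> < p j * sinc_ratio j" using assms by (intro order_tendstoD) auto
  have 2: "\<forall>\<^sub>F j in sequentially. \<pi> < p j" using assms by (intro order_tendstoD)
  have 3: "\<forall>\<^sub>F j in sequentially. 2 \<le> q j" using filterlim_q by (simp add: filterlim_at_top)
  have "\<forall>\<^sub>F j in sequentially. good \<pi> j"
    using 1 2 3 eventually_gt_at_top[of "0::nat"] by eventually_elim (simp add: good_def)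
  then show ?thesis unfolding eventually_sequentially by (meson le_trans)
qed

text \<open>The strict analogue of \<open>fits\<close> for large levels, where every block is at least \<open>\<pi>\<close>. The factor \<open>D\<close> stands for the ratio \<open>N / Q\<close> that has to be won back in the upper limit.\<close>

definition wins :: "real \<Rightarrow> real \<Rightarrow> real \<Rightarrow> real \<Rightarrow> real \<Rightarrow> nat \<Rightarrow> real \<Rightarrow> real \<Rightarrow> bool" where
  "wins \<pi> l h xl xh c f D \<longleftrightarrow>
     - 1 \<le> xl \<and> h * (xh + real c) \<le> 1 \<and> h * (1 - l * (xl + real c)) \<le> 1 \<and>
     1 < f * gain \<pi> h xl xh c * D \<and>
     1 < f * gain \<pi> h xl xh c * (\<pi> * (1 - h * (xh + real c))) * D \<and>
     1 < f * gain \<pi> h xl xh c * (\<pi> * \<pi> * ((1 - h * (xh + real c)) * (1 - h * (1 - l * (xl + real c))))) * D"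

text \<open>The strict inequalities leave room for a constant \<open>e > 1 / D\<close> that is independent of the level; this slack absorbs the convergence of \<open>q j / q (j + 1)\<close> to \<open>bt\<close>.\<close>

lemma wins_bound:
  assumes w: "wins \<pi> l h xl xh c f D" and D: "0 < D" and c: "1 \<le> c" "c < b"
    and lh: "0 \<le> l" "l \<le> bt" "bt \<le> h" and f: "0 \<le> f" and \<pi>: "0 \<le> \<pi>"
  shows "\<exists>e. 1 < e * D \<and> (\<forall>j x. (\<forall>i\<ge>j - 1. good \<pi> i) \<longrightarrow> 0 < j \<longrightarrow> - 1 + bt \<le> x \<longrightarrow> x \<le> bt \<longrightarrow> xl \<le> x \<longrightarrow> x \<le> xh \<longrightarrow>
    e \<le> f * ((\<Prod>l=1..<c. F (Suc j) (x + real l)) * block_bound j (1 - bt * (x + real c))))"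
proof -
  define e1 where "e1 = f * gain \<pi> h xl xh c"
  define e2 where "e2 = f * gain \<pi> h xl xh c * (\<pi> * (1 - h * (xh + real c)))"
  define e3 where "e3 = f * gain \<pi> h xl xh c * (\<pi> * \<pi> * ((1 - h * (xh + real c)) * (1 - h * (1 - l * (xl + real c)))))"
  define e where "e = min e1 (min e2 e3)"
  have w': "- 1 \<le> xl" "h * (xh + real c) \<le> 1" "h * (1 - l * (xl + real c)) \<le> 1"
    "1 < e1 * D" "1 < e2 * D" "1 < e3 * D"
    using w by (auto simp: wins_def e1_def e2_def e3_def)
  have "1 < e * D" using w'(4-6) by (auto simp: e_def min_def)
  moreover have "e \<le> f * ((\<Prod>l=1..<c. F (Suc j) (x + real l)) * block_bound j (1 - bt * (x + real c)))"
    if g: "\<forall>i\<ge>j - 1. good \<pi> i" and j: "0 < j" and x: "- 1 + bt \<le> x" "x \<le> bt" "xl \<le> x" "x \<le> xh" for j x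
  proof (rule block_gain[OF c _ x w'(1) lh w'(2,3) \<pi> _ \<pi> _ _ _ f])
    have "good \<pi> (Suc j)" "good \<pi> j" "good \<pi> (j - 1)" using g by auto
    then show "2 \<le> q (Suc j)" "\<pi> \<le> p (Suc j) * sinc_ratio (Suc j)" "\<pi> \<le> p j" by (auto simp: good_def)
    show "\<pi> * \<pi> \<le> p j * p (j - 1)"
      using \<open>good \<pi> j\<close> \<open>good \<pi> (j - 1)\<close> \<pi> by (intro mult_mono) (auto simp: good_def less_imp_le[OF p_pos])
  qed (use \<pi> in \<open>auto simp: e_def e1_def e2_def e3_def\<close>)
  ultimately show ?thesis by blast
qed

lemma good_F_right:
  assumes "good \<pi> j" "0 \<le> x" "x \<le> z - 1" shows "\<pi> \<le> F j x"
proof -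
  obtain i where "j = Suc i" using assms by (cases j) (auto simp: good_def)
  then show ?thesis using F_right_ge_p[of x i] assms by (auto simp: good_def)
qed

lemma good_F_left:
  assumes "good \<pi> j" "- 1 \<le> xl" "xl \<le> x" "x \<le> 0" "0 \<le> \<pi>" shows "\<pi> * (1 + xl) \<le> F j x"
proof -
  have "\<pi> * (1 + xl) \<le> p j * (1 + x)" using assms by (intro mult_mono) (auto simp: good_def less_imp_le[OF p_pos])
  also have "\<dots> \<le> F j x" using assms by (intro F_left) auto
  finally show ?thesis .
qed

lemma digit_bounds:
  assumes "M < n * Q + R" "R \<le> Q" "0 < (Q::nat)"
  shows "M div Q \<le> n" "M div Q = n \<Longrightarrow> M mod Q < R"
proof -
  have eq: "M = M div Q * Q + M mod Q" by (rule div_mult_mod_eq[symmetric])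
  show "M div Q \<le> n"
  proof (rule ccontr)
    assume "\<not> M div Q \<le> n"
    then have "Suc n * Q \<le> M div Q * Q" by (intro mult_le_mono1) simp
    then show False using eq assms by simp
  qed
  show "M div Q = n \<Longrightarrow> M mod Q < R" using eq assms by simp
qed

text \<open>With leading digit \<open>a\<close>, the first block is \<open>p (j + 1)\<close>, the further ones are at least \<open>1\<close>, and the rest is bounded by \<open>block_bound\<close> unless \<open>a = b\<close>, where it is at least \<open>1\<close>.\<close>

lemma p_le_sudler:
  assumes ok: blocks_ok and J: "\<And>i. J \<le> i \<Longrightarrow> good \<pi> i" and \<pi>: "1 \<le> \<pi>" and lh: "0 \<le> l" "l \<le> bt" "bt \<le> h"
    and fits: "\<And>a. 1 \<le> a \<Longrightarrow> a < b \<Longrightarrow> fits \<pi> \<pi> (\<pi> * \<pi>) l h 0 0 a 1"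
    and j: "Suc J \<le> j" and N: "q (Suc j) \<le> N" "N < q (Suc (Suc j))"
  shows "p (Suc j) \<le> sudler N bt"
proof -
  define a M where "a = N div q (Suc j)" and "M = N mod q (Suc j)"
  have N_eq: "N = a * q (Suc j) + M" unfolding a_def M_def by (rule div_mult_mod_eq[symmetric])
  have M: "M < q (Suc j)" using q_positive[of "Suc j"] by (simp add: M_def)
  have a1: "1 \<le> a" using N q_positive[of "Suc j"] by (simp add: a_def div_greater_zero_iff Suc_le_eq)
  have ab: "a \<le> b" "a = b \<Longrightarrow> M < q j"
    using digit_bounds[of N b "q (Suc j)" "q j"] N q_mono_Suc[of j] q_positive[of "Suc j"]
    unfolding a_def M_def q_Suc_Suc by auto
  have "sudler N bt = G (Suc j) N 0" by (rule sudler_eq_G)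
  also have "\<dots> = (\<Prod>l<a. F (Suc j) (0 + real l)) * G (Suc j) M (0 + real a)"
    unfolding N_eq by (rule G_mult_add)
  also have "\<dots> = p (Suc j) * ((\<Prod>l=1..<a. F (Suc j) (0 + real l)) * G j M (- (bt * (0 + real a))))"
    using prod_lessThan_split[OF a1, of "\<lambda>l. F (Suc j) (0 + real l)"] by (simp add: G_Suc_level p_eq_F)
  finally have eq: "sudler N bt = p (Suc j) * ((\<Prod>l=1..<a. F (Suc j) (0 + real l)) * G j M (- (bt * (0 + real a))))" .
  have good: "\<forall>i\<ge>j - 1. good \<pi> i" using J j by auto
  have prod1: "1 \<le> (\<Prod>l=1..<a. F (Suc j) (0 + real l))"
  proof (rule prod_ge_1)
    fix l assume "l \<in> {1..<a}"
    then have "real l \<le> z - 1" using ab bt_pos by (auto simp: z_def)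
    then show "1 \<le> F (Suc j) (0 + real l)" using good_F_right[of \<pi> "Suc j" "real l"] good \<pi> by simp
  qed
  have "1 \<le> (\<Prod>l=1..<a. F (Suc j) (0 + real l)) * G j M (- (bt * (0 + real a)))"
  proof (cases "M < q j")
    case True
    have "bt * real a \<le> bt * real b" using ab bt_pos by (intro mult_left_mono) auto
    then have "bt * real a \<le> 1" using bt_b bt_sq(1) by linarith
    then have "- 1 \<le> - (bt * (0 + real a))" by simp
    have "0 \<le> bt * real a" using bt_pos by simp
    then have "- (bt * (0 + real a)) \<le> bt" unfolding add_0 using bt_pos by linarith
    with \<open>- 1 \<le> - (bt * (0 + real a))\<close> have "1 \<le> G j M (- (bt * (0 + real a)))" using blocks_okD(3)[OF ok True] by blast
    then have "1 * 1 \<le> (\<Prod>l=1..<a. F (Suc j) (0 + real l)) * G j M (- (bt * (0 + real a)))"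
      using prod1 by (intro mult_mono) auto
    then show ?thesis by simp
  next
    case False
    then have ab': "a < b" using ab False le_neq_implies_less by blast
    have gd: "good \<pi> (Suc j)" "good \<pi> j" "good \<pi> (j - 1)" using good by auto
    have e: "1 \<le> 1 * ((\<Prod>l=1..<a. F (Suc j) (0 + real l)) * block_bound j (1 - bt * (0 + real a)))"
    proof (rule fits_bound[OF fits[OF a1 ab'] a1 ab' _ _ _ _ _ lh])
      show "2 \<le> q (Suc j)" "\<pi> \<le> p (Suc j) * sinc_ratio (Suc j)" "\<pi> \<le> p j" using gd by (auto simp: good_def)
      show "\<pi> * \<pi> \<le> p j * p (j - 1)"
        using gd \<pi> by (intro mult_mono) (auto simp: good_def less_imp_le[OF p_pos])
    qed (use \<pi> bt_pos bt_less_1 in auto)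
    have "block_bound j (1 - bt * (0 + real a)) \<le> G j M (- (bt * (0 + real a)))"
      using shift_range(1)[OF a1 ab', of 0] bt_pos M by (intro blocks_okD(2)[OF ok]) auto
    then have "(\<Prod>l=1..<a. F (Suc j) (0 + real l)) * block_bound j (1 - bt * (0 + real a))
        \<le> (\<Prod>l=1..<a. F (Suc j) (0 + real l)) * G j M (- (bt * (0 + real a)))"
      using prod1 by (intro mult_left_mono) auto
    then show ?thesis using e by linarith
  qed
  then have "p (Suc j) * 1 \<le> sudler N bt" unfolding eq using p_pos[of "Suc j"] by (intro mult_left_mono) auto
  then show ?thesis by simp
qed

lemma level_exists:
  assumes "q j0 \<le> N" shows "\<exists>j\<ge>j0. q j \<le> N \<and> N < q (Suc j)"
proof -
  define j where "j = (LEAST i. N < q i)"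
  have ex: "\<exists>i. N < q i" by (rule q_unbounded)
  have j: "N < q j" unfolding j_def using ex by (rule LeastI_ex)
  have jn: "j0 < j"
  proof (rule ccontr)
    assume "\<not> j0 < j"
    then have "q j \<le> q j0" by (intro q_mono) simp
    then show False using j assms by simp
  qed
  then obtain i where i: "j = Suc i" by (cases j) auto
  have "\<not> N < q i" using not_less_Least[of i "\<lambda>i. N < q i"] i by (simp add: j_def)
  then show ?thesis using i j jn by (intro exI[of _ i]) auto
qed

text \<open>Below, \<open>sudler N bt\<close> is at least the block \<open>p k\<close> of its own level; the values at the denominators themselves show that nothing larger is true.\<close>

theorem liminf_sudler:
  assumes ok: blocks_ok and lim: "p \<longlonglongrightarrow> L" and \<pi>: "1 \<le> \<pi>" "\<pi> < L" and lh: "0 \<le> l" "l \<le> bt" "bt \<le> h"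
    and fits: "\<And>a. 1 \<le> a \<Longrightarrow> a < b \<Longrightarrow> fits \<pi> \<pi> (\<pi> * \<pi>) l h 0 0 a 1"
  shows "liminf (\<lambda>N. ereal (sudler N bt)) = ereal L"
proof (rule antisym)
  obtain J where J: "\<And>i. J \<le> i \<Longrightarrow> good \<pi> i"
    using eventually_good[OF lim \<pi>(2)] by (auto simp: eventually_sequentially)
  show "ereal L \<le> liminf (\<lambda>N. ereal (sudler N bt))"
  proof (rule le_Liminf_iff[THEN iffD2], intro allI impI)
    fix y assume "y < ereal L"
    then obtain r where r: "y < ereal r" "r < L" using ereal_dense2 by (metis ereal_less(1) less_ereal.simps(1))
    have "\<forall>\<^sub>F j in sequentially. r < p j" using lim r by (intro order_tendstoD)
    then obtain j0 where j0: "\<And>j. j0 \<le> j \<Longrightarrow> r < p j" by (auto simp: eventually_sequentially)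
    define j1 where "j1 = Suc (Suc (max j0 J))"
    show "\<forall>\<^sub>F N in sequentially. y < ereal (sudler N bt)"
    proof (rule eventually_sequentiallyI[of "q j1"])
      fix N assume "q j1 \<le> N"
      then obtain k where k: "j1 \<le> k" "q k \<le> N" "N < q (Suc k)" using level_exists by blast
      then obtain j where j: "k = Suc j" by (cases k) (auto simp: j1_def)
      have "p (Suc j) \<le> sudler N bt"
        using k j by (intro p_le_sudler[OF ok J \<pi>(1) lh fits]) (auto simp: j1_def)
      moreover have "r < p (Suc j)" using k j by (intro j0) (auto simp: j1_def)
      ultimately have "ereal r < ereal (sudler N bt)" by simp
      then show "y < ereal (sudler N bt)" using r by (rule_tac less_trans)
    qed
  qed
  have "strict_mono (\<lambda>j. q (Suc j))"
  proof (rule strict_mono_Suc_iff[THEN iffD2], intro allI)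
    fix j
    have "1 * q (Suc j) \<le> b * q (Suc j)" using b_ge_1 by (rule mult_le_mono1)
    then show "q (Suc j) < q (Suc (Suc j))" using q_positive[of j] q_Suc_Suc[of j] by linarith
  qed
  then have "liminf (\<lambda>N. ereal (sudler N bt)) \<le> liminf ((\<lambda>N. ereal (sudler N bt)) \<circ> (\<lambda>j. q (Suc j)))"
    by (rule liminf_subseq_mono)
  also have "\<dots> = ereal L"
  proof (rule lim_imp_Liminf)
    have "(\<lambda>j. p (Suc j)) \<longlonglongrightarrow> L" using lim by (rule LIMSEQ_Suc)
    then show "((\<lambda>N. ereal (sudler N bt)) \<circ> (\<lambda>j. q (Suc j))) \<longlonglongrightarrow> ereal L"
      by (simp add: o_def p_def)
  qed simp
  finally show "liminf (\<lambda>N. ereal (sudler N bt)) \<le> ereal L" .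
qed


section \<open>The upper limit\<close>

text \<open>A lower bound for the blocks of the leading digit \<open>c\<close> in \<open>G j M bt\<close>.\<close>

definition topg :: "real \<Rightarrow> real \<Rightarrow> real \<Rightarrow> nat \<Rightarrow> real" where
  "topg \<pi> l h c = (\<Prod>k<c. \<pi> * ((1 + l + real k) * (1 - h * (h + real k))))"

lemma topg_le:
  assumes g: "good \<pi> j" "0 \<le> \<pi>" and lh: "0 \<le> l" "l \<le> bt" "bt \<le> h" "h * (h + real c) \<le> 1" and c: "c < b"
  shows "0 \<le> topg \<pi> l h c \<and> topg \<pi> l h c \<le> (\<Prod>k<c. F j (bt + real k))"
proof -
  obtain i where i: "j = Suc i" using g by (cases j) (auto simp: good_def)
  have "0 \<le> \<pi> * ((1 + l + real k) * (1 - h * (h + real k))) \<and>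
      \<pi> * ((1 + l + real k) * (1 - h * (h + real k))) \<le> F j (bt + real k)" if k: "k < c" for k
  proof -
    have k': "real k \<le> real b - 2" "real k \<le> real c" using k c by auto
    have h0: "0 \<le> h" using lh bt_pos by linarith
    have "h * (h + real k) \<le> h * (h + real c)" using k' h0 by (intro mult_left_mono) auto
    then have 1: "0 \<le> 1 - h * (h + real k)" using lh by linarith
    have "bt * (bt + real k) \<le> h * (h + real k)" using lh bt_pos by (intro mult_mono) auto
    then have 4: "(1 + l + real k) * (1 - h * (h + real k)) \<le> (1 + (bt + real k)) * (1 - bt * (bt + real k))"
      using 1 lh by (intro mult_mono) auto
    have 5: "0 \<le> (1 + l + real k) * (1 - h * (h + real k))" using 1 lh by simp
    have "\<pi> * ((1 + l + real k) * (1 - h * (h + real k)))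
        \<le> p j * sinc_ratio j * ((1 + (bt + real k)) * (1 - bt * (bt + real k)))"
    proof (rule mult_mono[OF _ 4 _ 5])
      show "\<pi> \<le> p j * sinc_ratio j" using g by (simp add: good_def)
      then show "0 \<le> p j * sinc_ratio j" using g by linarith
    qed
    also have "\<dots> \<le> F j (bt + real k)"
      unfolding i using k' bt_pos g by (intro F_ge) (auto simp: z_def good_def i)
    finally show ?thesis using g 5 by simp
  qed
  then show ?thesis unfolding topg_def by (auto intro!: prod_nonneg prod_mono)
qed

text \<open>A partial block whose leading digit is known to be \<open>c > 0\<close>; unlike in \<open>partial_block_bounds\<close>, the gain of that digit is kept.\<close>

lemma top_block_bound:
  assumes ok: blocks_ok and g: "good 1 (Suc j)"
    and M: "M < q (Suc (Suc j))" "M div q (Suc j) = c" "1 \<le> c"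
    and x: "- bt\<^sup>2 \<le> x" "x \<le> bt" and f: "0 \<le> f" "f \<le> F (Suc j) x"
    and e: "c = b \<Longrightarrow> e \<le> f"
      "c < b \<Longrightarrow> e \<le> f * ((\<Prod>l=1..<c. F (Suc j) (x + real l)) * block_bound j (1 - bt * (x + real c)))"
  shows "e \<le> G (Suc j) M x"
proof -
  define M' where "M' = M mod q (Suc j)"
  have M_eq: "M = c * q (Suc j) + M'" unfolding M(2)[symmetric] M'_def by (rule div_mult_mod_eq[symmetric])
  have M': "M' < q (Suc j)" using q_positive[of "Suc j"] by (simp add: M'_def)
  have cb: "c \<le> b" "c = b \<Longrightarrow> M' < q j"
    using digit_bounds[of M b "q (Suc j)" "q j"] M q_mono_Suc[of j] q_positive[of "Suc j"]
    unfolding M'_def q_Suc_Suc by auto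
  have F1: "1 \<le> F (Suc j) (x + real l)" if "l \<in> {1..<c}" for l
  proof (rule good_F_right[OF g])
    have "1 \<le> real l" "real l \<le> real b - 1" using that cb by auto
    then show "0 \<le> x + real l" "x + real l \<le> z - 1" using x bt_sq(3) unfolding z_def by linarith+
  qed
  define K where "K = (\<Prod>l=1..<c. F (Suc j) (x + real l))"
  have K1: "1 \<le> K" unfolding K_def by (rule prod_ge_1) (rule F1)
  have G_eq: "G (Suc j) M x = F (Suc j) x * (K * G j M' (- (bt * (x + real c))))"
    unfolding M_eq G_mult_add K_def using prod_lessThan_split[OF M(3), of "\<lambda>l. F (Suc j) (x + real l)"]
    by (simp add: G_Suc_level)
  have "e \<le> f * (K * G j M' (- (bt * (x + real c))))"
  proof (cases "c < b")
    case True
    have "block_bound j (1 - bt * (x + real c)) \<le> G j M' (- (bt * (x + real c)))"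
      using shift_range(1)[OF M(3) True x] M' by (intro blocks_okD(2)[OF ok]) auto
    then have "f * (K * block_bound j (1 - bt * (x + real c))) \<le> f * (K * G j M' (- (bt * (x + real c))))"
      using f K1 by (intro mult_left_mono) auto
    then show ?thesis using e(2)[OF True] by (simp add: K_def)
  next
    case False
    then have c: "c = b" using cb by simp
    have "1 \<le> G j M' (- (bt * (x + real c)))"
    proof (rule blocks_okD(3)[OF ok])
      show "M' < q j" by (rule cb(2)[OF c])
      have "x + real c \<le> z" using x c unfolding z_def by linarith
      then have "bt * (x + real c) \<le> bt * z" using bt_pos by (intro mult_left_mono) auto
      then show "- 1 \<le> - (bt * (x + real c))" by (simp add: bt_z)
      have "0 \<le> x + real c" using x bt_sq(3) M(3) by linarith
      then have "0 \<le> bt * (x + real c)" using bt_pos by simp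
      then show "- (bt * (x + real c)) \<le> bt" using bt_pos by linarith
    qed
    then have "1 * 1 \<le> K * G j M' (- (bt * (x + real c)))" using K1 by (intro mult_mono) auto
    then have "f * 1 \<le> f * (K * G j M' (- (bt * (x + real c))))" using f by (intro mult_left_mono) auto
    then show ?thesis using e(1)[OF c] by simp
  qed
  also have "\<dots> \<le> F (Suc j) x * (K * G j M' (- (bt * (x + real c))))"
    using f K1 G_nonneg by (intro mult_right_mono) auto
  finally show ?thesis by (simp add: G_eq)
qed

lemma good_mono: "good \<pi> j \<Longrightarrow> \<pi>' \<le> \<pi> \<Longrightarrow> good \<pi>' j"
  by (auto simp: good_def)

text \<open>A product with a very small shift and at least \<open>q (J + 2)\<close> factors is larger than \<open>1\<close> by a fixed factor: descend to the level of the leading nonzero digit, which does not increase the size of the shift, and use \<open>top_block_bound\<close> there.\<close>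

lemma small_shift_bound:
  assumes ok: blocks_ok and J: "\<And>i. J \<le> i \<Longrightarrow> good \<pi> i" and \<pi>: "1 \<le> \<pi>"
    and lh: "0 \<le> l" "l \<le> bt" "bt \<le> h" "h \<le> 1" and D: "0 < D"
    and wins: "\<And>c. 1 \<le> c \<Longrightarrow> c < b \<Longrightarrow> wins \<pi> l h (- (h ^ 4)) (h ^ 3) c (\<pi> * (1 - h ^ 4)) D"
    and win_b: "1 < \<pi> * (1 - h ^ 4) * D"
  shows "\<exists>\<gamma>. 1 < \<gamma> * D \<and> (\<forall>i M x. q (Suc (Suc J)) \<le> M \<longrightarrow> M < q (Suc i) \<longrightarrow> - (bt ^ 4) \<le> x \<longrightarrow> x \<le> bt ^ 3
     \<longrightarrow> \<gamma> \<le> G i M x)"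
proof -
  define f where "f = \<pi> * (1 - h ^ 4)"
  have h4: "h ^ 4 \<le> 1" "0 \<le> h ^ 4" "bt ^ 4 \<le> h ^ 4" "bt ^ 3 \<le> h ^ 3" "0 \<le> h"
    using lh bt_pos by (auto intro!: power_le_one power_mono)
  have f0: "0 \<le> f" using h4 \<pi> by (simp add: f_def)
  have "\<forall>c\<in>{1..<b}. \<exists>e. 1 < e * D \<and> (\<forall>j x. (\<forall>i\<ge>j - 1. good \<pi> i) \<longrightarrow> 0 < j \<longrightarrow> - 1 + bt \<le> x \<longrightarrow> x \<le> bt \<longrightarrow>
      - (h ^ 4) \<le> x \<longrightarrow> x \<le> h ^ 3 \<longrightarrow>
    e \<le> f * ((\<Prod>l=1..<c. F (Suc j) (x + real l)) * block_bound j (1 - bt * (x + real c))))"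
  proof
    fix c assume c: "c \<in> {1..<b}"
    show "\<exists>e. 1 < e * D \<and> (\<forall>j x. (\<forall>i\<ge>j - 1. good \<pi> i) \<longrightarrow> 0 < j \<longrightarrow> - 1 + bt \<le> x \<longrightarrow> x \<le> bt \<longrightarrow>
      - (h ^ 4) \<le> x \<longrightarrow> x \<le> h ^ 3 \<longrightarrow>
    e \<le> f * ((\<Prod>l=1..<c. F (Suc j) (x + real l)) * block_bound j (1 - bt * (x + real c))))"
      by (rule wins_bound[OF _ D _ _ lh(1,2,3) f0]) (use c wins \<pi> in \<open>auto simp: f_def\<close>)
  qed
  then obtain e where e: "\<And>c. c \<in> {1..<b} \<Longrightarrow> 1 < e c * D"
    "\<And>c j x. c \<in> {1..<b} \<Longrightarrow> (\<forall>i\<ge>j - 1. good \<pi> i) \<Longrightarrow> 0 < j \<Longrightarrow> - 1 + bt \<le> x \<Longrightarrow> x \<le> bt \<Longrightarrow>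
      - (h ^ 4) \<le> x \<Longrightarrow> x \<le> h ^ 3 \<Longrightarrow>
     e c \<le> f * ((\<Prod>l=1..<c. F (Suc j) (x + real l)) * block_bound j (1 - bt * (x + real c)))"
    by (subst (asm) bchoice_iff) blast
  define \<gamma> where "\<gamma> = Min (insert f (e ` {1..<b}))"
  have \<gamma>_le: "\<gamma> \<le> f" "\<And>c. c \<in> {1..<b} \<Longrightarrow> \<gamma> \<le> e c"
    unfolding \<gamma>_def by (rule Min_le; simp)+
  have "\<gamma> \<in> insert f (e ` {1..<b})" unfolding \<gamma>_def by (rule Min_in) auto
  then have "1 < \<gamma> * D" using e(1) win_b by (auto simp: f_def)
  moreover have "\<gamma> \<le> G i M x" if "q (Suc (Suc J)) \<le> M" "M < q (Suc i)" "- (bt ^ 4) \<le> x" "x \<le> bt ^ 3" for i M x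
    using that
  proof (induction i arbitrary: x)
    case 0
    have "q (Suc 0) \<le> q (Suc (Suc J))" by (rule q_mono) simp
    then show ?case using 0 by simp
  next
    case (Suc j)
    have pw: "bt ^ 3 \<le> bt" "bt ^ 4 \<le> bt\<^sup>2" "bt ^ 5 \<le> bt ^ 3"
    proof -
      show "bt ^ 3 \<le> bt" using power_decreasing[of 1 3 bt] bt_pos bt_less_1 by simp
      show "bt ^ 4 \<le> bt\<^sup>2" "bt ^ 5 \<le> bt ^ 3" using bt_pos bt_less_1 by (auto intro!: power_decreasing)
    qed
    show ?case
    proof (cases "M < q (Suc j)")
      case True
      have "- bt * x \<le> bt ^ 5" using mult_left_mono[OF Suc.prems(3), of bt] bt_pos by (simp add: eval_nat_numeral)
      moreover have "- (bt ^ 4) \<le> - bt * x" using mult_left_mono[OF Suc.prems(4), of bt] bt_pos by (simp add: eval_nat_numeral)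
      ultimately show ?thesis using Suc.IH[of "- bt * x"] True Suc.prems pw by (simp add: G_Suc_level)
    next
      case False
      have "Suc J \<le> j"
      proof (rule ccontr)
        assume "\<not> Suc J \<le> j"
        then have "q (Suc (Suc j)) \<le> q (Suc (Suc J))" by (intro q_mono) simp
        then show False using Suc.prems by simp
      qed
      then have gd: "\<forall>i\<ge>j - 1. good \<pi> i" "good \<pi> (Suc j)" "0 < j" using J by auto
      have x: "- bt\<^sup>2 \<le> x" "x \<le> bt" "- (h ^ 4) \<le> x" "x \<le> h ^ 3" "- 1 + bt \<le> x"
      proof -
        show "- bt\<^sup>2 \<le> x" "x \<le> bt" "- (h ^ 4) \<le> x" "x \<le> h ^ 3" using Suc.prems pw h4 by linarith+
        have "bt ^ 4 \<le> bt ^ 2" by (rule pw)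
        moreover have "bt ^ 4 + bt \<le> 1"
        proof -
          have "1 * bt \<le> real b * bt" using b_ge_1 bt_pos by (intro mult_right_mono) auto
          then have "bt + bt\<^sup>2 \<le> 1" using bt_root by linarith
          then show ?thesis using pw by linarith
        qed
        ultimately show "- 1 + bt \<le> x" using Suc.prems by linarith
      qed
      have fF: "f \<le> F (Suc j) x"
      proof (cases "x \<le> 0")
        case True
        have "\<pi> * (1 + - (h ^ 4)) \<le> F (Suc j) x"
          using True x h4 \<pi> by (intro good_F_left[OF gd(2)]) auto
        then show ?thesis by (simp add: f_def)
      next
        case False
        have "\<pi> \<le> F (Suc j) x" using False x z_minus_1_ge by (intro good_F_right[OF gd(2)]) auto
        moreover have "f \<le> \<pi>" unfolding f_def using h4 \<pi> mult_left_mono[of "1 - h ^ 4" 1 \<pi>] by simp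
        ultimately show ?thesis by simp
      qed
      show ?thesis
      proof (rule top_block_bound[OF ok good_mono[OF gd(2) \<pi>] Suc.prems(2) refl _ x(1,2) f0 fF \<gamma>_le(1)])
        show c1: "1 \<le> M div q (Suc j)"
          using False q_positive[of "Suc j"] by (simp add: div_greater_zero_iff Suc_le_eq)
        show "\<gamma> \<le> f * ((\<Prod>l=1..<M div q (Suc j). F (Suc j) (x + real l)) * block_bound j (1 - bt * (x + real (M div q (Suc j)))))"
          if "M div q (Suc j) < b"
          using \<gamma>_le(2)[of "M div q (Suc j)"] e(2)[of "M div q (Suc j)" j x] c1 that gd x by auto
      qed
    qed
  qed
  ultimately show ?thesis by blast
qed

lemma q_ratio_tendsto: "(\<lambda>j. real (q j) / real (q (Suc j))) \<longlonglongrightarrow> bt"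
proof -
  have lim0: "(\<lambda>j. bt ^ Suc (Suc j)) \<longlonglongrightarrow> 0" by (intro LIMSEQ_Suc bt_pow_tendsto_0)
  have bound: "norm (real (q j) / real (q (Suc j)) - bt) \<le> bt ^ Suc (Suc j)" for j
  proof -
    have Q: "1 \<le> real (q (Suc j))" using q_ge_1[of "Suc j"] by simp
    have "real (q j) / real (q (Suc j)) - bt = - ((-1) ^ Suc j * bt ^ Suc (Suc j)) / real (q (Suc j))"
      using q_bt[of "Suc j"] Q by (simp add: field_simps)
    then have "norm (real (q j) / real (q (Suc j)) - bt) = bt ^ Suc (Suc j) / real (q (Suc j))"
      using bt_pos by (simp add: abs_mult power_abs)
    also have "\<dots> \<le> bt ^ Suc (Suc j) / 1" using Q bt_pos by (intro divide_left_mono) auto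
    finally show ?thesis by simp
  qed
  have "(\<lambda>j. real (q j) / real (q (Suc j)) - bt) \<longlonglongrightarrow> 0"
    by (rule Lim_null_comparison[OF always_eventually[OF allI[OF bound]] lim0])
  then show ?thesis by (rule LIM_zero_cancel)
qed

lemma q_ratios_tendsto:
  "(\<lambda>i. real (q (Suc (Suc i))) / real (q (Suc (Suc (Suc i))))) \<longlonglongrightarrow> bt"
  "(\<lambda>i. real (q (Suc i)) / real (q (Suc (Suc (Suc i))))) \<longlonglongrightarrow> bt\<^sup>2"
  "(\<lambda>i. real (q i) / real (q (Suc (Suc (Suc i))))) \<longlonglongrightarrow> bt ^ 3"
proof -
  note r0 = q_ratio_tendsto
  note r1 = LIMSEQ_Suc[OF r0] note r2 = LIMSEQ_Suc[OF r1]
  have ne: "(q i = 0) = False" for i using q_positive[of i] by simp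
  show "(\<lambda>i. real (q (Suc (Suc i))) / real (q (Suc (Suc (Suc i))))) \<longlonglongrightarrow> bt" by (rule r2)
  have "(\<lambda>i. (real (q (Suc i)) / real (q (Suc (Suc i)))) * (real (q (Suc (Suc i))) / real (q (Suc (Suc (Suc i)))))) \<longlonglongrightarrow> bt * bt"
    by (intro tendsto_mult r1 r2)
  then show r12: "(\<lambda>i. real (q (Suc i)) / real (q (Suc (Suc (Suc i))))) \<longlonglongrightarrow> bt\<^sup>2"
    by (simp add: power2_eq_square ne)
  have "(\<lambda>i. (real (q i) / real (q (Suc i))) * (real (q (Suc i)) / real (q (Suc (Suc (Suc i)))))) \<longlonglongrightarrow> bt * bt\<^sup>2"
    by (intro tendsto_mult r0 r12)
  then show "(\<lambda>i. real (q i) / real (q (Suc (Suc (Suc i))))) \<longlonglongrightarrow> bt ^ 3"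
    by (simp add: eval_nat_numeral ne)
qed

text \<open>\<open>u\<close>, \<open>v\<close>, \<open>r\<close> bound \<open>M + 1\<close> in terms of three consecutive denominators. The ratio \<open>N / Q\<close> with \<open>N = Q - 1 - M\<close> is then eventually close to at least \<open>1 - u * bt - v * bt\<^sup>2 - r * bt ^ 3\<close>.\<close>

lemma eventually_ratio:
  assumes e: "1 < e * D" and D: "0 < D" "D \<le> 1 - u * bt - v * bt\<^sup>2 - r * bt ^ 3"
  shows "\<forall>\<^sub>F i in sequentially. \<forall>M g. real M + 1 \<le> u * real (q (Suc (Suc i))) + v * real (q (Suc i)) + r * real (q i) \<longrightarrow> e \<le> g \<longrightarrow>
     1 \<le> g * ((real (q (Suc (Suc (Suc i)))) - 1 - real M) / real (q (Suc (Suc (Suc i)))))"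
proof -
  have e0: "0 < e" by (rule zero_less_mult_pos2[OF less_trans[OF zero_less_one e] D(1)])
  define X where "X i = 1 - u * (real (q (Suc (Suc i))) / real (q (Suc (Suc (Suc i)))))
     - v * (real (q (Suc i)) / real (q (Suc (Suc (Suc i))))) - r * (real (q i) / real (q (Suc (Suc (Suc i)))))" for i
  have "(\<lambda>i. e * X i) \<longlonglongrightarrow> e * (1 - u * bt - v * bt\<^sup>2 - r * bt ^ 3)"
    unfolding X_def by (intro tendsto_intros q_ratios_tendsto)
  moreover have "1 < e * (1 - u * bt - v * bt\<^sup>2 - r * bt ^ 3)"
    by (rule less_le_trans[OF e mult_left_mono[OF D(2) less_imp_le[OF e0]]])
  ultimately have "\<forall>\<^sub>F i in sequentially. 1 < e * X i" by (intro order_tendstoD) auto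
  then show ?thesis
  proof eventually_elim
    case (elim i)
    show ?case
    proof (intro allI impI)
      fix M g assume M: "real M + 1 \<le> u * real (q (Suc (Suc i))) + v * real (q (Suc i)) + r * real (q i)" and g: "e \<le> g"
      define Q where "Q = real (q (Suc (Suc (Suc i))))"
      have Q: "0 < Q" using q_positive by (simp add: Q_def)
      have "X i = (Q - (u * real (q (Suc (Suc i))) + v * real (q (Suc i)) + r * real (q i))) / Q"
        using Q unfolding X_def Q_def[symmetric] by (simp add: field_simps)
      also have "\<dots> \<le> (Q - 1 - real M) / Q" using M Q by (intro divide_right_mono) auto
      finally have X: "X i \<le> (Q - 1 - real M) / Q" .
      have "0 < X i" by (rule zero_less_mult_pos[OF less_trans[OF zero_less_one elim] e0])
      then have "e * X i \<le> g * ((Q - 1 - real M) / Q)" using X g e0 by (intro mult_mono) auto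
      then show "1 \<le> g * ((real (q (Suc (Suc (Suc i)))) - 1 - real M) / real (q (Suc (Suc (Suc i)))))"
        using elim by (simp add: Q_def)
    qed
  qed
qed

text \<open>The reflected form of \<open>sudler N bt / N \<le> sudler (Q - 1) bt / (r * Q)\<close> with \<open>Q = q (i + 3)\<close>, for all \<open>M = Q - 1 - N\<close> with leading digits \<open>c\<close> and \<open>c'\<close>.\<close>

definition ratio_ok :: "real \<Rightarrow> nat \<Rightarrow> nat \<Rightarrow> nat \<Rightarrow> bool" where
  "ratio_ok r i c c' \<longleftrightarrow> (\<forall>M. M div q (Suc (Suc i)) = c \<longrightarrow> (M mod q (Suc (Suc i))) div q (Suc i) = c' \<longrightarrow>
     r \<le> G (Suc (Suc i)) M bt * ((real (q (Suc (Suc (Suc i)))) - 1 - real M) / real (q (Suc (Suc (Suc i))))))"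

lemma two_digits:
  assumes "M div q (Suc (Suc i)) = c" "(M mod q (Suc (Suc i))) div q (Suc i) = c'"
  obtains M1 M2 where "M = c * q (Suc (Suc i)) + M1" "M1 = c' * q (Suc i) + M2" "M1 < q (Suc (Suc i))" "M2 < q (Suc i)"
    "G (Suc (Suc i)) M bt = (\<Prod>k<c. F (Suc (Suc i)) (bt + real k)) * G (Suc i) M1 (- (bt * (bt + real c)))"
    "c' \<le> b" "c' = b \<Longrightarrow> M2 < q i" "M1 div q (Suc i) = c'"
proof -
  define M1 M2 where "M1 = M mod q (Suc (Suc i))" and "M2 = M1 mod q (Suc i)"
  have 1: "M = c * q (Suc (Suc i)) + M1" unfolding assms(1)[symmetric] M1_def by (rule div_mult_mod_eq[symmetric])
  have 2: "M1 = c' * q (Suc i) + M2" unfolding assms(2)[symmetric] M1_def[symmetric] M2_def by (rule div_mult_mod_eq[symmetric])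
  have 3: "M1 < q (Suc (Suc i))" "M2 < q (Suc i)" using q_positive by (simp_all add: M1_def M2_def)
  have 4: "c' \<le> b" "c' = b \<Longrightarrow> M2 < q i"
    using digit_bounds[of M1 b "q (Suc i)" "q i"] 3 q_mono_Suc[of i] q_positive[of "Suc i"] assms(2)
    unfolding q_Suc_Suc M2_def M1_def by auto
  have 5: "G (Suc (Suc i)) M bt = (\<Prod>k<c. F (Suc (Suc i)) (bt + real k)) * G (Suc i) M1 (- (bt * (bt + real c)))"
    unfolding 1 G_mult_add by (simp add: G_Suc_level)
  show thesis using that[OF 1 2 3 5 4] assms(2) by (simp add: M1_def)
qed

lemma x1_range:
  assumes "c < b"
  shows "- 1 \<le> - (bt * (bt + real c))" "- (bt * (bt + real c)) \<le> - bt\<^sup>2"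
    "c + 2 \<le> b \<Longrightarrow> bt - 1 \<le> - (bt * (bt + real c))"
proof -
  have "real c \<le> real b - 1" using assms by auto
  then have "bt * (bt + real c) \<le> bt * (bt + (real b - 1))" using bt_pos by (intro mult_left_mono) auto
  also have "\<dots> = 1 - bt" using bt_b by (simp add: algebra_simps power2_eq_square)
  finally show "- 1 \<le> - (bt * (bt + real c))" using bt_pos by simp
  have "bt * bt \<le> bt * (bt + real c)" using bt_pos by (intro mult_left_mono) auto
  then show "- (bt * (bt + real c)) \<le> - bt\<^sup>2" by (simp add: power2_eq_square)
  show "bt - 1 \<le> - (bt * (bt + real c))" if "c + 2 \<le> b"
  proof -
    have "real c \<le> real b - 2" using that by auto
    then have "bt * (bt + real c) \<le> bt * (bt + (real b - 2))" using bt_pos by (intro mult_left_mono) auto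
    also have "\<dots> = 1 - 2 * bt" using bt_b by (simp add: algebra_simps power2_eq_square)
    finally show ?thesis using bt_pos by simp
  qed
qed

lemma x1_bounds:
  assumes "0 \<le> l" "l \<le> bt" "bt \<le> h"
  shows "- h\<^sup>2 - real c * h \<le> - (bt * (bt + real c))" "- (bt * (bt + real c)) \<le> - l\<^sup>2 - real c * l"
proof -
  have "bt * (bt + real c) \<le> h * (h + real c)" "l * (l + real c) \<le> bt * (bt + real c)"
    using assms bt_pos by (auto intro!: mult_mono)
  then show "- h\<^sup>2 - real c * h \<le> - (bt * (bt + real c))" "- (bt * (bt + real c)) \<le> - l\<^sup>2 - real c * l"
    by (simp_all add: algebra_simps power2_eq_square)
qed

lemma block_bound_nonneg:
  assumes "bt \<le> y" "y \<le> 1 - bt\<^sup>2" shows "0 \<le> block_bound j y"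
proof -
  have y: "0 \<le> y" "y \<le> 1" using assms bt_pos bt_sq(1) by linarith+
  have "bt * y \<le> 1 * 1" using y bt_pos bt_less_1 by (intro mult_mono) auto
  then have "0 \<le> step j y" using p_pos[of "j - 1"] by (simp add: step_def)
  then show ?thesis using y p_pos[of j] by (simp add: block_bound_def)
qed

text \<open>Both leading digits contribute: the \<open>c\<close> blocks at the shifts \<open>bt, bt + 1, ...\<close>, and, one level below, \<open>c'\<close> blocks from the shift \<open>- bt * (bt + c)\<close> on.\<close>

lemma ratio_ok_middle:
  assumes ok: blocks_ok and J: "\<And>i. J \<le> i \<Longrightarrow> good \<pi> i" and \<pi>: "1 \<le> \<pi>"
    and lh: "0 \<le> l" "l \<le> bt" "bt \<le> h" and c: "c + 2 \<le> b" "1 \<le> c'" "c' < b"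
    and D: "0 < D" "D \<le> 1 - real c * h - (real c' + 1) * h\<^sup>2" and top: "h * (h + real c) \<le> 1"
    and wins: "wins \<pi> l h (- h\<^sup>2 - real c * h) (- l\<^sup>2 - real c * l) c' (topg \<pi> l h c * (\<pi> * (1 + (- h\<^sup>2 - real c * h)))) D"
  shows "\<forall>\<^sub>F i in sequentially. ratio_ok 1 i c c'"
proof -
  define xl xh where "xl = - h\<^sup>2 - real c * h" and "xh = - l\<^sup>2 - real c * l"
  define x where "x = - (bt * (bt + real c))"
  have cb: "c < b" using c by simp
  have x: "xl \<le> x" "x \<le> xh" "bt - 1 \<le> x" "x \<le> - bt\<^sup>2" "x \<le> 0" "x \<le> bt"
    using x1_bounds[OF lh, of c] x1_range(2)[OF cb] x1_range(3)[OF cb c(1)] bt_sq(1) bt_pos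
    unfolding xl_def xh_def x_def by linarith+
  have xl1: "- 1 \<le> xl" using wins by (simp add: wins_def xl_def)
  define f where "f = topg \<pi> l h c * (\<pi> * (1 + xl))"
  have f0: "0 \<le> f" using topg_le[OF J[OF order_refl] _ lh top cb] \<pi> xl1 by (simp add: f_def)
  obtain e where e: "1 < e * D" and eb: "\<And>j. (\<forall>i\<ge>j - 1. good \<pi> i) \<Longrightarrow> 0 < j \<Longrightarrow>
     e \<le> f * ((\<Prod>l=1..<c'. F (Suc j) (x + real l)) * block_bound j (1 - bt * (x + real c')))"
    using wins_bound[OF wins D(1) c(2,3) lh] f0 \<pi> x unfolding f_def xl_def xh_def by force
  have D': "D \<le> 1 - real c * bt - (real c' + 1) * bt\<^sup>2 - 0 * bt ^ 3"
  proof -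
    have "real c * bt \<le> real c * h" "(real c' + 1) * bt\<^sup>2 \<le> (real c' + 1) * h\<^sup>2"
      using lh bt_pos by (auto intro!: mult_left_mono power_mono)
    with D(2) show ?thesis by linarith
  qed
  show ?thesis
    using eventually_ratio[OF e D(1) D'] eventually_gt_at_top[of J]
  proof eventually_elim
    case (elim i)
    have gd: "\<forall>k\<ge>i - 1. good \<pi> k" "0 < i" using J elim by auto
    show ?case
      unfolding ratio_ok_def
    proof (intro allI impI)
      fix M assume M: "M div q (Suc (Suc i)) = c" "(M mod q (Suc (Suc i))) div q (Suc i) = c'"
      obtain M1 M2 where d: "M = c * q (Suc (Suc i)) + M1" "M1 = c' * q (Suc i) + M2" "M2 < q (Suc i)"
        "G (Suc (Suc i)) M bt = (\<Prod>k<c. F (Suc (Suc i)) (bt + real k)) * G (Suc i) M1 (- (bt * (bt + real c)))"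
        using two_digits[OF M] by metis
      define P where "P = (\<Prod>k<c. F (Suc (Suc i)) (bt + real k))"
      have P: "0 \<le> topg \<pi> l h c" "topg \<pi> l h c \<le> P"
        using topg_le[of \<pi> "Suc (Suc i)", OF _ _ lh top cb] gd \<pi> by (auto simp: P_def)
      define K where "K = (\<Prod>l=1..<c'. F (Suc i) (x + real l)) * block_bound i (1 - bt * (x + real c'))"
      have fF: "\<pi> * (1 + xl) \<le> F (Suc i) x"
        using gd xl1 x \<pi> by (intro good_F_left[of \<pi> "Suc i"]) auto
      have split: "G (Suc i) M1 x = F (Suc i) x * ((\<Prod>l=1..<c'. F (Suc i) (x + real l)) * G i M2 (- (bt * (x + real c'))))"
        unfolding d(2) G_mult_add using prod_lessThan_split[OF c(2), of "\<lambda>l. F (Suc i) (x + real l)"]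
        by (simp add: G_Suc_level)
      have r: "bt \<le> 1 - bt * (x + real c') \<and> 1 - bt * (x + real c') \<le> 1 - bt\<^sup>2"
        using x by (intro shift_range(2)[OF c(2,3)]) auto
      have block_bound_le: "block_bound i (1 - bt * (x + real c')) \<le> G i M2 (- (bt * (x + real c')))"
        using r d(3) by (intro blocks_okD(2)[OF ok]) auto
      have Bd0: "0 \<le> block_bound i (1 - bt * (x + real c'))"
        using r by (intro block_bound_nonneg) auto
      have prod0: "0 \<le> (\<Prod>l=1..<c'. F (Suc i) (x + real l))" by (intro prod_nonneg F_nonneg)
      have K: "0 \<le> K" "K \<le> (\<Prod>l=1..<c'. F (Suc i) (x + real l)) * G i M2 (- (bt * (x + real c')))"
        using Bd0 block_bound_le prod0 by (auto simp: K_def intro: mult_left_mono)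
      have "e \<le> topg \<pi> l h c * (\<pi> * (1 + xl) * K)" using eb[OF gd] by (simp add: f_def K_def mult.assoc)
      also have "\<dots> \<le> P * (F (Suc i) x * ((\<Prod>l=1..<c'. F (Suc i) (x + real l)) * G i M2 (- (bt * (x + real c')))))"
      proof (rule mult_mono[OF P(2)])
        show "\<pi> * (1 + xl) * K \<le> F (Suc i) x * ((\<Prod>l=1..<c'. F (Suc i) (x + real l)) * G i M2 (- (bt * (x + real c'))))"
          using fF K F_nonneg by (intro mult_mono) auto
      qed (use P K xl1 \<pi> in auto)
      also have "\<dots> = G (Suc (Suc i)) M bt" unfolding d(4) P_def x_def[symmetric] split ..
      finally have eG: "e \<le> G (Suc (Suc i)) M bt" .
      have "M + 1 \<le> c * q (Suc (Suc i)) + (c' + 1) * q (Suc i)" using d(1,2,3) by simp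
      then have "real (M + 1) \<le> real (c * q (Suc (Suc i)) + (c' + 1) * q (Suc i))" by (rule of_nat_mono)
      then have "real M + 1 \<le> real c * real (q (Suc (Suc i))) + (real c' + 1) * real (q (Suc i)) + 0 * real (q i)"
        by (simp add: algebra_simps)
      then show "1 \<le> G (Suc (Suc i)) M bt * ((real (q (Suc (Suc (Suc i)))) - 1 - real M) / real (q (Suc (Suc (Suc i)))))"
        using elim(1) eG by blast
    qed
  qed
qed

text \<open>The largest second digit \<open>c' = b\<close>. Its last block is bounded by \<open>\<pi>\<close> alone, since its shift may exceed the range of \<open>F_ge\<close>; here \<open>M + 1 \<le> (c + 1) * q (i + 2)\<close> is used for the ratio.\<close>

lemma ratio_ok_full:
  assumes ok: blocks_ok and J: "\<And>i. J \<le> i \<Longrightarrow> good \<pi> i" and \<pi>: "1 \<le> \<pi>"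
    and lh: "0 \<le> l" "l \<le> bt" "bt \<le> h" and c: "c + 2 \<le> b"
    and D: "0 < D" "D \<le> 1 - (real c + 1) * h" and top: "h * (h + real c) \<le> 1"
    and xl: "- 1 \<le> - h\<^sup>2 - real c * h" "h * ((- l\<^sup>2 - real c * l) + real (b - 1)) \<le> 1"
    and win: "1 < topg \<pi> l h c * (\<pi> * (1 + (- h\<^sup>2 - real c * h))) * gain \<pi> h (- h\<^sup>2 - real c * h) (- l\<^sup>2 - real c * l) (b - 1) * \<pi> * D"
  shows "\<forall>\<^sub>F i in sequentially. ratio_ok 1 i c b"
proof -
  define xl xh where "xl = - h\<^sup>2 - real c * h" and "xh = - l\<^sup>2 - real c * l"
  define x where "x = - (bt * (bt + real c))"
  have cb: "c < b" using c by simp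
  have x: "xl \<le> x" "x \<le> xh" "bt - 1 \<le> x" "x \<le> - bt\<^sup>2" "x \<le> 0" "x \<le> bt"
    using x1_bounds[OF lh, of c] x1_range(2)[OF cb] x1_range(3)[OF cb c] bt_sq(1) bt_pos
    unfolding xl_def xh_def x_def by linarith+
  have xl1: "- 1 \<le> xl" using xl by (simp add: xl_def)
  define e where "e = topg \<pi> l h c * (\<pi> * (1 + xl)) * gain \<pi> h xl xh (b - 1) * \<pi>"
  have e: "1 < e * D" using win by (simp add: e_def xl_def xh_def)
  have D': "D \<le> 1 - (real c + 1) * bt - 0 * bt\<^sup>2 - 0 * bt ^ 3"
  proof -
    have "(real c + 1) * bt \<le> (real c + 1) * h" using lh by (intro mult_left_mono) auto
    with D(2) show ?thesis by linarith
  qed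
  show ?thesis
    using eventually_ratio[OF e D(1) D'] eventually_gt_at_top[of J]
  proof eventually_elim
    case (elim i)
    have gd: "\<forall>k\<ge>i - 1. good \<pi> k" "0 < i" using J elim by auto
    show ?case
      unfolding ratio_ok_def
    proof (intro allI impI)
      fix M assume M: "M div q (Suc (Suc i)) = c" "(M mod q (Suc (Suc i))) div q (Suc i) = b"
      obtain M1 M2 where d: "M = c * q (Suc (Suc i)) + M1" "M1 = b * q (Suc i) + M2" "M1 < q (Suc (Suc i))"
        "G (Suc (Suc i)) M bt = (\<Prod>k<c. F (Suc (Suc i)) (bt + real k)) * G (Suc i) M1 (- (bt * (bt + real c)))" "M2 < q i"
        using two_digits[OF M] by metis
      define P where "P = (\<Prod>k<c. F (Suc (Suc i)) (bt + real k))"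
      have P: "0 \<le> topg \<pi> l h c" "topg \<pi> l h c \<le> P"
        using topg_le[of \<pi> "Suc (Suc i)", OF _ _ lh top cb] gd \<pi> by (auto simp: P_def)
      have fF: "\<pi> * (1 + xl) \<le> F (Suc i) x"
        using gd xl1 x \<pi> by (intro good_F_left[of \<pi> "Suc i"]) auto
      have b2: "2 \<le> b" using c by simp
      have gs: "good \<pi> (Suc i)" using gd by simp
      have gn: "0 \<le> gain \<pi> h xl xh (b - 1)" "gain \<pi> h xl xh (b - 1) \<le> (\<Prod>l=1..<b - 1. F (Suc i) (x + real l))"
        using gain_le[of "b - 1" i x xl xh h \<pi>] gs x lh xl1 xl(2) \<pi> b2
        by (auto simp: good_def xh_def)
      have last: "\<pi> \<le> F (Suc i) (x + real (b - 1))"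
      proof (rule good_F_right[OF gs])
        have "1 \<le> real (b - 1)" using b2 by simp
        then show "0 \<le> x + real (b - 1)" using x bt_pos by linarith
        have "real (b - 1) = real b - 1" using b2 by simp
        then show "x + real (b - 1) \<le> z - 1" using x unfolding z_def by linarith
      qed
      have prod_eq: "(\<Prod>l<b. F (Suc i) (x + real l)) = F (Suc i) x * ((\<Prod>l=1..<b - 1. F (Suc i) (x + real l)) * F (Suc i) (x + real (b - 1)))"
      proof -
        have "{1..<b} = insert (b - 1) {1..<b - 1}" using b2 by auto
        then show ?thesis using prod_lessThan_split[of b "\<lambda>l. F (Suc i) (x + real l)"] b2 by simp
      qed
      have Z: "1 \<le> G i M2 (- (bt * (x + real b)))"
      proof (rule blocks_okD(3)[OF ok d(5)])
        have "x + real b \<le> z" "0 \<le> x + real b" using x bt_pos b2 unfolding z_def by linarith+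
        then have "bt * (x + real b) \<le> bt * z" "0 \<le> bt * (x + real b)" using bt_pos by (auto intro: mult_left_mono)
        then show "- 1 \<le> - (bt * (x + real b))" "- (bt * (x + real b)) \<le> bt" using bt_z bt_pos by linarith+
      qed
      have "e = topg \<pi> l h c * ((\<pi> * (1 + xl)) * (gain \<pi> h xl xh (b - 1) * \<pi>)) * 1" by (simp add: e_def)
      also have "\<dots> \<le> P * (F (Suc i) x * ((\<Prod>l=1..<b - 1. F (Suc i) (x + real l)) * F (Suc i) (x + real (b - 1)))) * G i M2 (- (bt * (x + real b)))"
      proof (rule mult_mono[OF _ Z])
        have 1: "gain \<pi> h xl xh (b - 1) * \<pi> \<le> (\<Prod>l=1..<b - 1. F (Suc i) (x + real l)) * F (Suc i) (x + real (b - 1))"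
          using gn last \<pi> by (intro mult_mono) auto
        have 2: "\<pi> * (1 + xl) * (gain \<pi> h xl xh (b - 1) * \<pi>) \<le> F (Suc i) x * ((\<Prod>l=1..<b - 1. F (Suc i) (x + real l)) * F (Suc i) (x + real (b - 1)))"
          using fF gn \<pi> F_nonneg by (intro mult_mono[OF _ 1]) auto
        show "topg \<pi> l h c * ((\<pi> * (1 + xl)) * (gain \<pi> h xl xh (b - 1) * \<pi>))
           \<le> P * (F (Suc i) x * ((\<Prod>l=1..<b - 1. F (Suc i) (x + real l)) * F (Suc i) (x + real (b - 1))))"
          using P gn xl1 \<pi> by (intro mult_mono[OF _ 2]) auto
        show "0 \<le> P * (F (Suc i) x * ((\<Prod>l=1..<b - 1. F (Suc i) (x + real l)) * F (Suc i) (x + real (b - 1))))"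
          using P by (intro mult_nonneg_nonneg F_nonneg prod_nonneg) auto
      qed simp
      also have "\<dots> = G (Suc (Suc i)) M bt"
        unfolding d(4) P_def[symmetric] x_def[symmetric] unfolding d(2) G_mult_add prod_eq[symmetric]
        by (simp add: G_Suc_level)
      finally have eG: "e \<le> G (Suc (Suc i)) M bt" .
      have "M + 1 \<le> (c + 1) * q (Suc (Suc i))" using d(1,3) by simp
      then have "real (M + 1) \<le> real ((c + 1) * q (Suc (Suc i)))" by (rule of_nat_mono)
      then have "real M + 1 \<le> (real c + 1) * real (q (Suc (Suc i))) + 0 * real (q (Suc i)) + 0 * real (q i)"
        by (simp add: algebra_simps)
      then show "1 \<le> G (Suc (Suc i)) M bt * ((real (q (Suc (Suc (Suc i)))) - 1 - real M) / real (q (Suc (Suc (Suc i)))))"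
        using elim(1) eG by blast
    qed
  qed
qed

text \<open>If the second digit vanishes, the rest is at least \<open>1\<close> and the blocks of the first digit have to win alone.\<close>

lemma ratio_ok_zero:
  assumes ok: blocks_ok and J: "\<And>i. J \<le> i \<Longrightarrow> good \<pi> i" and \<pi>: "1 \<le> \<pi>"
    and lh: "0 \<le> l" "l \<le> bt" "bt \<le> h" and c: "c < b"
    and D: "0 < D" "D \<le> 1 - real c * h - h\<^sup>2" and top: "h * (h + real c) \<le> 1"
    and win: "1 < topg \<pi> l h c * D"
  shows "\<forall>\<^sub>F i in sequentially. ratio_ok 1 i c 0"
proof -
  have D': "D \<le> 1 - real c * bt - 1 * bt\<^sup>2 - 0 * bt ^ 3"
  proof -
    have "real c * bt \<le> real c * h" "bt\<^sup>2 \<le> h\<^sup>2"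
      using lh bt_pos by (auto intro!: mult_left_mono power_mono)
    with D(2) show ?thesis by linarith
  qed
  show ?thesis
    using eventually_ratio[OF win D(1) D'] eventually_gt_at_top[of J]
  proof eventually_elim
    case (elim i)
    have gd: "good \<pi> (Suc (Suc i))" using J elim by auto
    show ?case
      unfolding ratio_ok_def
    proof (intro allI impI)
      fix M assume M: "M div q (Suc (Suc i)) = c" "(M mod q (Suc (Suc i))) div q (Suc i) = 0"
      obtain M1 M2 where d: "M = c * q (Suc (Suc i)) + M1" "M1 = 0 * q (Suc i) + M2" "M2 < q (Suc i)"
        "G (Suc (Suc i)) M bt = (\<Prod>k<c. F (Suc (Suc i)) (bt + real k)) * G (Suc i) M1 (- (bt * (bt + real c)))"
        using two_digits[OF M] by metis
      have Z: "1 \<le> G (Suc i) M1 (- (bt * (bt + real c)))"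
        using x1_range[OF c] d(2,3) bt_pos bt_sq(1) by (intro blocks_okD(3)[OF ok]) linarith+
      have P: "0 \<le> topg \<pi> l h c" "topg \<pi> l h c \<le> (\<Prod>k<c. F (Suc (Suc i)) (bt + real k))"
        using topg_le[OF gd _ lh top c] \<pi> by auto
      have "topg \<pi> l h c * 1 \<le> G (Suc (Suc i)) M bt"
        unfolding d(4) using P Z by (intro mult_mono) auto
      then have eG: "topg \<pi> l h c \<le> G (Suc (Suc i)) M bt" by simp
      have "M + 1 \<le> c * q (Suc (Suc i)) + q (Suc i)" using d(1,2,3) by simp
      then have "real (M + 1) \<le> real (c * q (Suc (Suc i)) + q (Suc i))" by (rule of_nat_mono)
      then have "real M + 1 \<le> real c * real (q (Suc (Suc i))) + 1 * real (q (Suc i)) + 0 * real (q i)"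
        by (simp add: algebra_simps)
      then show "1 \<le> G (Suc (Suc i)) M bt * ((real (q (Suc (Suc (Suc i)))) - 1 - real M) / real (q (Suc (Suc (Suc i)))))"
        using elim(1) eG by blast
    qed
  qed
qed


text \<open>If both digits vanish, \<open>G (i + 2) M bt\<close> is a product with the small shift \<open>bt ^ 3\<close>. When it is long, \<open>small_shift_bound\<close> applies; when it is short, it is at least \<open>1\<close> while \<open>N / Q\<close> tends to \<open>1\<close>. This is the case where equality holds in the limit, and the reason why only \<open>r < 1\<close> is reached.\<close>

lemma ratio_ok_low:
  assumes ok: blocks_ok and J: "\<And>i. J \<le> i \<Longrightarrow> good \<pi> i" and \<pi>: "1 \<le> \<pi>"
    and lh: "0 \<le> l" "l \<le> bt" "bt \<le> h" "h \<le> 1" and D: "0 < D" "D \<le> 1 - h\<^sup>2"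
    and wins: "\<And>c. 1 \<le> c \<Longrightarrow> c < b \<Longrightarrow> wins \<pi> l h (- (h ^ 4)) (h ^ 3) c (\<pi> * (1 - h ^ 4)) D"
    and win_b: "1 < \<pi> * (1 - h ^ 4) * D" and r: "r < 1"
  shows "\<forall>\<^sub>F i in sequentially. ratio_ok r i 0 0"
proof -
  obtain \<gamma> where \<gamma>: "1 < \<gamma> * D" and G_ge: "\<And>i M x. q (Suc (Suc J)) \<le> M \<Longrightarrow> M < q (Suc i) \<Longrightarrow> - (bt ^ 4) \<le> x \<Longrightarrow> x \<le> bt ^ 3
     \<Longrightarrow> \<gamma> \<le> G i M x"
    using small_shift_bound[OF ok J \<pi> lh D(1) wins win_b] by blast
  have D': "D \<le> 1 - 0 * bt - 1 * bt\<^sup>2 - 0 * bt ^ 3"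
  proof -
    have "bt\<^sup>2 \<le> h\<^sup>2" using lh bt_pos by (auto intro!: power_mono)
    with D(2) show ?thesis by linarith
  qed
  define K where "K = real (q (Suc (Suc J)))"
  have "(\<lambda>n. (real n - 1 - K) / real n) \<longlonglongrightarrow> 1" by real_asymp
  moreover have "filterlim (\<lambda>i. q (i + 3)) sequentially sequentially"
    by (rule filterlim_compose[OF filterlim_q filterlim_add_const_nat_at_top])
  ultimately have "(\<lambda>i. (real (q (i + 3)) - 1 - K) / real (q (i + 3))) \<longlonglongrightarrow> 1"
    by (rule filterlim_compose)
  then have ev: "\<forall>\<^sub>F i in sequentially. r < (real (q (i + 3)) - 1 - K) / real (q (i + 3))"
    using r by (rule order_tendstoD)
  show ?thesis
    using eventually_ratio[OF \<gamma> D(1) D'] ev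
  proof eventually_elim
    case (elim i)
    have i3: "i + 3 = Suc (Suc (Suc i))" by simp
    show ?case
      unfolding ratio_ok_def
    proof (intro allI impI)
      fix M assume M: "M div q (Suc (Suc i)) = 0" "(M mod q (Suc (Suc i))) div q (Suc i) = 0"
      obtain M1 M2 where d: "M = 0 * q (Suc (Suc i)) + M1" "M1 = 0 * q (Suc i) + M2" "M1 < q (Suc (Suc i))" "M2 < q (Suc i)"
        using two_digits[OF M] by metis
      have Mq: "M < q (Suc i)" "M < q (Suc (Suc i))" using d by auto
      have G_eq: "G (Suc (Suc i)) M bt = G i M (bt ^ 3)"
        using Mq by (simp add: G_Suc_level eval_nat_numeral)
      have x: "- (bt ^ 4) \<le> bt ^ 3" "bt ^ 3 \<le> bt" "- bt\<^sup>2 \<le> bt ^ 3"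
      proof -
        have "0 \<le> bt ^ 4" "0 \<le> bt ^ 3" "0 \<le> bt\<^sup>2" using bt_pos by auto
        then show "- (bt ^ 4) \<le> bt ^ 3" "- bt\<^sup>2 \<le> bt ^ 3" by linarith+
        show "bt ^ 3 \<le> bt" using power_decreasing[of 1 3 bt] bt_pos bt_less_1 by simp
      qed
      define Q where "Q = real (q (Suc (Suc (Suc i))))"
      have Q: "0 < Q" using q_positive by (simp add: Q_def)
      show "r \<le> G (Suc (Suc i)) M bt * ((real (q (Suc (Suc (Suc i)))) - 1 - real M) / real (q (Suc (Suc (Suc i)))))"
      proof (cases "q (Suc (Suc J)) \<le> M")
        case True
        have "\<gamma> \<le> G (Suc (Suc i)) M bt"
          unfolding G_eq using True Mq x by (intro G_ge) auto
        moreover have "real M + 1 \<le> 0 * real (q (Suc (Suc i))) + 1 * real (q (Suc i)) + 0 * real (q i)"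
          using Mq by simp
        ultimately have "1 \<le> G (Suc (Suc i)) M bt * ((real (q (Suc (Suc (Suc i)))) - 1 - real M) / real (q (Suc (Suc (Suc i)))))"
          using elim(1) by blast
        then show ?thesis using r by linarith
      next
        case False
        have G1: "1 \<le> G (Suc (Suc i)) M bt" unfolding G_eq using x Mq by (intro blocks_okD(1)[OF ok]) auto
        have "Suc M \<le> q (Suc (Suc (Suc i)))" using Mq q_mono_Suc[of "Suc (Suc i)"] by linarith
        then have "real (Suc M) \<le> Q" unfolding Q_def by (rule of_nat_mono)
        then have Q2: "0 \<le> (Q - 1 - real M) / Q" using Q by simp
        have "real M \<le> K" using False by (simp add: K_def)
        then have "(Q - 1 - K) / Q \<le> (Q - 1 - real M) / Q" using Q by (intro divide_right_mono) auto
        then have "r \<le> 1 * ((Q - 1 - real M) / Q)" using elim(2) unfolding i3 Q_def by simp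
        also have "\<dots> \<le> G (Suc (Suc i)) M bt * ((Q - 1 - real M) / Q)"
          using G1 Q2 by (rule mult_right_mono)
        finally show ?thesis by (simp add: Q_def)
      qed
    qed
  qed
qed

text \<open>For \<open>b = 2\<close> and the digits \<open>1, 0\<close> the argument of \<open>ratio_ok_zero\<close> just fails, so the third digit is inspected as well: if it vanishes, the ratio \<open>N / Q\<close> is larger, and otherwise its block contributes another factor \<open>\<pi>\<close>.\<close>

lemma ratio_ok_two:
  assumes b2: "b = 2" and ok: blocks_ok and J: "\<And>i. J \<le> i \<Longrightarrow> good \<pi> i" and \<pi>: "1 \<le> \<pi>"
    and lh: "0 \<le> l" "l \<le> bt" "bt \<le> h" and top: "h * (h + 1) \<le> 1" and x: "h\<^sup>2 * (h + 1) \<le> l"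
    and win0: "0 < Dl" "Dl \<le> 1 - h - h ^ 3" "1 < topg \<pi> l h 1 * Dl"
    and D: "0 < D" "D \<le> 1 - h - h\<^sup>2"
    and win1: "wins \<pi> l h (l\<^sup>2 * (l + 1)) (h\<^sup>2 * (h + 1)) 1 (topg \<pi> l h 1 * \<pi>) D"
    and win2: "1 < topg \<pi> l h 1 * \<pi> * D"
  shows "\<forall>\<^sub>F i in sequentially. ratio_ok 1 i 1 0"
proof -
  define T where "T = topg \<pi> l h 1"
  have h0: "0 \<le> h" using lh by simp
  have c1: "(1::nat) < b" using b2 by simp
  have top': "h * (h + real 1) \<le> 1" using top by simp
  have T0: "0 \<le> T" using topg_le[OF J[OF order_refl] _ lh top' c1] \<pi> by (simp add: T_def)
  define X where "X = bt\<^sup>2 * (bt + 1)"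
  have X: "l\<^sup>2 * (l + 1) \<le> X" "X \<le> h\<^sup>2 * (h + 1)" "0 \<le> X"
    unfolding X_def using lh h0 bt_pos by (auto intro!: mult_mono power_mono)
  then have X': "- bt\<^sup>2 \<le> X" "X \<le> bt" "- 1 + bt \<le> X"
    using x lh bt_sq(1) bt_less_1 by linarith+
  obtain e where e: "1 < e * D" and eb: "\<And>j. (\<forall>i\<ge>j - 1. good \<pi> i) \<Longrightarrow> 0 < j \<Longrightarrow>
     e \<le> (T * \<pi>) * ((\<Prod>l=1..<1. F (Suc j) (X + real l)) * block_bound j (1 - bt * (X + real 1)))"
    using wins_bound[OF win1 D(1) order_refl c1 lh] T0 \<pi> X X' unfolding T_def by force
  have Da: "Dl \<le> 1 - 1 * bt - 0 * bt\<^sup>2 - 1 * bt ^ 3"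
  proof -
    have "bt ^ 3 \<le> h ^ 3" using lh bt_pos by (auto intro!: power_mono)
    with win0(2) lh show ?thesis by linarith
  qed
  have Db: "D \<le> 1 - 1 * bt - 1 * bt\<^sup>2 - 0 * bt ^ 3"
  proof -
    have "bt\<^sup>2 \<le> h\<^sup>2" using lh bt_pos by (auto intro!: power_mono)
    with D(2) lh show ?thesis by linarith
  qed
  show ?thesis
    using eventually_ratio[OF win0(3) win0(1) Da] eventually_ratio[OF e D(1) Db] eventually_ratio[OF win2 D(1) Db]
      eventually_gt_at_top[of "Suc (Suc J)"]
  proof eventually_elim
    case (elim i)
    obtain j where ij: "i = Suc j" using elim(4) by (cases i) auto
    have gd: "good \<pi> (Suc (Suc i))" "good \<pi> i" "\<forall>k\<ge>j - 1. good \<pi> k" "0 < j" using J elim(4) by (auto simp: ij)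
    show ?case
      unfolding ratio_ok_def
    proof (intro allI impI)
      fix M assume M: "M div q (Suc (Suc i)) = 1" "(M mod q (Suc (Suc i))) div q (Suc i) = 0"
      obtain M1 M2 where d: "M = 1 * q (Suc (Suc i)) + M1" "M1 = 0 * q (Suc i) + M2" "M2 < q (Suc i)"
        "G (Suc (Suc i)) M bt = (\<Prod>k<1. F (Suc (Suc i)) (bt + real k)) * G (Suc i) M1 (- (bt * (bt + real 1)))"
        using two_digits[OF M] by metis
      have M1: "M1 < q (Suc i)" using d by simp
      have P: "T \<le> (\<Prod>k<1. F (Suc (Suc i)) (bt + real k))"
        using topg_le[OF gd(1) _ lh top' c1] \<pi> by (auto simp: T_def)
      have lower: "T * g \<le> G (Suc (Suc i)) M bt" if "0 \<le> g" "g \<le> G (Suc i) M1 (- (bt * (bt + real 1)))" for g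
        unfolding d(4) using P T0 that by (intro mult_mono) auto
      show "1 \<le> G (Suc (Suc i)) M bt * ((real (q (Suc (Suc (Suc i)))) - 1 - real M) / real (q (Suc (Suc (Suc i)))))"
      proof (cases "M1 < q i")
        case True
        have "1 \<le> G (Suc i) M1 (- (bt * (bt + real 1)))"
          using x1_range[OF c1] M1 bt_pos bt_sq(1) by (intro blocks_okD(3)[OF ok]) linarith+
        then have "T * 1 \<le> G (Suc (Suc i)) M bt" by (intro lower) auto
        then have eG: "topg \<pi> l h 1 \<le> G (Suc (Suc i)) M bt" by (simp add: T_def)
        have "M + 1 \<le> q (Suc (Suc i)) + q i" using d(1) True by simp
        then have "real (M + 1) \<le> real (q (Suc (Suc i)) + q i)" by (rule of_nat_mono)
        then have "real M + 1 \<le> 1 * real (q (Suc (Suc i))) + 0 * real (q (Suc i)) + 1 * real (q i)"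
          by simp
        then show ?thesis using elim(1) eG by blast
      next
        case False
        have "M + 1 \<le> q (Suc (Suc i)) + q (Suc i)" using d(1) M1 by simp
        then have "real (M + 1) \<le> real (q (Suc (Suc i)) + q (Suc i))" by (rule of_nat_mono)
        then have M_le: "real M + 1 \<le> 1 * real (q (Suc (Suc i))) + 1 * real (q (Suc i)) + 0 * real (q i)"
          by simp
        have shift: "G (Suc i) M1 (- (bt * (bt + real 1))) = G (Suc j) M1 X"
          using M1 by (simp add: G_Suc_level ij X_def power2_eq_square algebra_simps)
        define c where "c = M1 div q (Suc j)"
        have "M1 < b * q (Suc j) + q j" using M1 by (simp add: ij q_Suc_Suc)
        then have "c \<le> b" unfolding c_def by (rule digit_bounds(1)[OF _ q_mono_Suc q_positive])
        then have c: "1 \<le> c" "c \<le> 2"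
          using False q_positive[of "Suc j"] b2 by (simp_all add: c_def ij div_greater_zero_iff Suc_le_eq)
        have piF: "\<pi> \<le> F (Suc j) X"
          using X X' z_minus_1_ge gd(2) by (intro good_F_right[OF gd(2)[unfolded ij]]) auto
        have M1': "M1 < q (Suc (Suc j))" using M1 by (simp add: ij)
        have g1: "good 1 (Suc j)" using good_mono[OF gd(2) \<pi>] by (simp add: ij)
        consider "c = 1" | "c = 2" using c by linarith
        then show ?thesis
        proof cases
          case 1
          define g where "g = \<pi> * ((\<Prod>l=1..<c. F (Suc j) (X + real l)) * block_bound j (1 - bt * (X + real c)))"
          have "bt \<le> 1 - bt * (X + real 1)" "1 - bt * (X + real 1) \<le> 1 - bt\<^sup>2"
            using shift_range(1)[OF order_refl c1 X'(1,2)] by auto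
          then have "0 \<le> block_bound j (1 - bt * (X + real 1))" by (intro block_bound_nonneg) auto
          then have g0: "0 \<le> g" using \<pi> by (simp add: g_def 1)
          have "g \<le> G (Suc j) M1 X"
            using \<pi> c c1 1 b2 unfolding g_def
            by (intro top_block_bound[OF ok g1 M1' c_def[symmetric] c(1) X'(1,2) _ piF]) auto
          then have "T * g \<le> G (Suc (Suc i)) M bt" using g0 shift by (intro lower) auto
          moreover have "e \<le> T * g" using eb[OF gd(3,4)] by (simp add: g_def 1 mult.assoc)
          ultimately have "e \<le> G (Suc (Suc i)) M bt" by linarith
          then show ?thesis using elim(2) M_le by blast
        next
          case 2
          have "\<pi> \<le> G (Suc j) M1 X"
            using \<pi> b2 2 by (intro top_block_bound[OF ok g1 M1' c_def[symmetric] c(1) X'(1,2) _ piF]) auto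
          then have "T * \<pi> \<le> G (Suc (Suc i)) M bt" using \<pi> shift by (intro lower) auto
          then show ?thesis using elim(3) M_le unfolding T_def by blast
        qed
      qed
    qed
  qed
qed

lemma p_eq_pred: "p j = sudler (q j - 1) bt * (2 * sin (t j))"
proof -
  have "real (q j) * bt = (-1) ^ j * gap j + of_int (int (q' j))" using q_bt_gap[of j] by simp
  then have "\<bar>sin (pi * (real (q j) * bt))\<bar> = sin (t j)"
    using sin_t_pos[of j] by (simp only: abs_sin_int_shift abs_sin_sign) (simp add: t_def)
  then show ?thesis using sudler_pred[of "q j"] q_positive[of j] by (simp add: p_def)
qed

lemma sudler_pred_tendsto:
  assumes lim: "p \<longlonglongrightarrow> L"
  shows "(\<lambda>j. sudler (q j - 1) bt / real (q j)) \<longlonglongrightarrow> lam / (2 * pi) * L"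
    and "(\<lambda>j. sudler (q j - 1) bt / real (q j - 1)) \<longlonglongrightarrow> lam / (2 * pi) * L"
proof -
  have "(\<lambda>j. real (q j) * sin (t j)) \<longlonglongrightarrow> pi / lam" using q_sin_tendsto[of 1] by simp
  then have "(\<lambda>j. p j / (2 * (real (q j) * sin (t j)))) \<longlonglongrightarrow> L / (2 * (pi / lam))"
    using lam_pos by (intro tendsto_divide tendsto_mult lim tendsto_const) auto
  moreover have "p j / (2 * (real (q j) * sin (t j))) = sudler (q j - 1) bt / real (q j)" for j
    using sin_t_pos[of j] by (simp add: p_eq_pred)
  ultimately show 1: "(\<lambda>j. sudler (q j - 1) bt / real (q j)) \<longlonglongrightarrow> lam / (2 * pi) * L" by (simp add: mult_ac)
  have "(\<lambda>n. real n / real (n - 1)) \<longlonglongrightarrow> 1" 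
  proof (rule Lim_transform_eventually)
    show "(\<lambda>n. real n / (real n - 1)) \<longlonglongrightarrow> 1" by real_asymp
    show "\<forall>\<^sub>F n in sequentially. real n / (real n - 1) = real n / real (n - 1)"
      using eventually_ge_at_top[of 1] by eventually_elim (simp add: of_nat_diff)
  qed
  then have "(\<lambda>j. real (q j) / real (q j - 1)) \<longlonglongrightarrow> 1" using filterlim_q by (rule filterlim_compose)
  then have "(\<lambda>j. sudler (q j - 1) bt / real (q j) * (real (q j) / real (q j - 1))) \<longlonglongrightarrow> lam / (2 * pi) * L * 1"
    by (intro tendsto_mult 1)
  moreover have "sudler (q j - 1) bt / real (q j) * (real (q j) / real (q j - 1)) = sudler (q j - 1) bt / real (q j - 1)" for j
    using q_positive[of j] by (cases "q j") auto
  ultimately show "(\<lambda>j. sudler (q j - 1) bt / real (q j - 1)) \<longlonglongrightarrow> lam / (2 * pi) * L"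
    by (simp only: mult_1_right)
qed

text \<open>\<open>M = Q - 1 - N\<close> is smaller than \<open>(b - 1) * q (i + 2) + q (i + 1)\<close>, which restricts the leading digits of \<open>M\<close> to the pairs in the hypothesis.\<close>

lemma sudler_le_of_ratio_ok:
  assumes r: "0 < r" and N: "q (Suc (Suc i)) \<le> N" "N < q (Suc (Suc (Suc i)))"
    and ratio: "\<And>c c'. c < b \<Longrightarrow> c' \<le> b \<Longrightarrow> (Suc c = b \<Longrightarrow> c' = 0) \<Longrightarrow> ratio_ok r i c c'"
  shows "sudler N bt / real N \<le> sudler (q (Suc (Suc (Suc i))) - 1) bt / real (q (Suc (Suc (Suc i)))) / r"
proof -
  define Q R where "Q = q (Suc (Suc (Suc i)))" and "R = q (Suc (Suc i))"
  define M where "M = Q - 1 - N"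
  have NM: "N + M + 1 = Q" using N by (simp add: M_def Q_def)
  define c c' where "c = M div R" and "c' = (M mod R) div q (Suc i)"
  have R0: "0 < R" "0 < q (Suc i)" "q (Suc i) \<le> R" using q_positive q_mono_Suc[of "Suc i"] by (simp_all add: R_def)
  have Q_eq: "Q = b * R + q (Suc i)" by (simp add: Q_def R_def q_Suc_Suc)
  have "Q = (b - 1) * R + R + q (Suc i)" using b_ge_1 Q_eq by (cases b) auto
  then have M_lt: "M < (b - 1) * R + q (Suc i)" using NM N(1) unfolding R_def[symmetric] by linarith
  have cb: "c \<le> b - 1" "c = b - 1 \<Longrightarrow> M mod R < q (Suc i)"
    using digit_bounds[OF M_lt R0(3,1)] by (simp_all add: c_def)
  have "M mod R < b * q (Suc i) + q i" using R0(1) unfolding R_def q_Suc_Suc by (rule mod_less_divisor)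
  then have c'b: "c' \<le> b" using digit_bounds(1)[OF _ q_mono_Suc R0(2)] by (simp add: c'_def)
  have "ratio_ok r i c c'"
  proof (rule ratio)
    show "c < b" using cb b_ge_1 by linarith
    assume "Suc c = b"
    then have "c = b - 1" by simp
    then show "c' = 0" using cb(2) by (simp add: c'_def)
  qed (rule c'b)
  then have "r \<le> G (Suc (Suc i)) M bt * ((real Q - 1 - real M) / real Q)"
    by (simp add: ratio_ok_def c_def c'_def Q_def R_def)
  moreover have "real Q - 1 - real M = real N" using NM by (simp flip: NM)
  ultimately have r_le: "r \<le> G (Suc (Suc i)) M bt * (real N / real Q)" by simp
  have pos: "0 < real N" "0 < real Q" using N R0 by (simp_all add: R_def Q_def)
  have "sudler N bt / real N * r \<le> sudler N bt / real N * (G (Suc (Suc i)) M bt * (real N / real Q))"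
    using r_le sudler_pos[of N] pos by (intro mult_left_mono) auto
  also have "\<dots> = sudler N bt * G (Suc (Suc i)) M bt / real Q" using pos by simp
  also have "\<dots> = sudler (Q - 1) bt / real Q"
    using sudler_reflect_q[of N M "Suc (Suc i)"] NM by (simp add: Q_def)
  finally show ?thesis unfolding Q_def[symmetric] by (subst pos_le_divide_eq[OF r])
qed

text \<open>There are only finitely many pairs of digits, so all ratio bounds hold simultaneously from some level on.\<close>

theorem limsup_sudler:
  assumes lim: "p \<longlonglongrightarrow> L" "0 < L"
    and ratio: "\<And>r c c'. r < 1 \<Longrightarrow> c < b \<Longrightarrow> c' \<le> b \<Longrightarrow> (Suc c = b \<Longrightarrow> c' = 0) \<Longrightarrow> \<forall>\<^sub>F i in sequentially. ratio_ok r i c c'"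
  shows "limsup (\<lambda>N. ereal (sudler N bt / real N)) = ereal (lam / (2 * pi) * L)"
proof (rule antisym)
  define U where "U = lam / (2 * pi) * L"
  have U0: "0 < U" using lam_pos lim by (simp add: U_def)
  show "limsup (\<lambda>N. ereal (sudler N bt / real N)) \<le> ereal (lam / (2 * pi) * L)"
    unfolding U_def[symmetric]
  proof (rule Limsup_le_iff[THEN iffD2], intro allI impI)
    fix y assume "ereal U < y"
    then obtain s where s: "U < s" "ereal s < y" using ereal_dense2 by (metis ereal_less_ereal_Ex ereal_less(1) less_ereal.simps(1))
    have s0: "0 < s" using s U0 by linarith
    have Us: "U / s < 1" "0 < U / s" using s s0 U0 by simp_all
    obtain r where r: "U / s < r" "r < 1" using dense[OF Us(1)] by blast
    have r0: "0 < r" using Us(2) r(1) by (rule less_trans)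
    have Ur: "U / r < s" using r(1) r0 s0 by (simp add: pos_divide_less_eq mult.commute)
    have "\<forall>\<^sub>F i in sequentially. \<forall>(c, c') \<in> {(c, c'). c < b \<and> c' \<le> b \<and> (Suc c = b \<longrightarrow> c' = 0)}. ratio_ok r i c c'"
    proof (rule eventually_ball_finite)
      have "{(c, c'). c < b \<and> c' \<le> b \<and> (Suc c = b \<longrightarrow> c' = 0)} \<subseteq> {..b} \<times> {..b}" by auto
      then show "finite {(c, c'). c < b \<and> c' \<le> b \<and> (Suc c = b \<longrightarrow> c' = 0)}" by (rule finite_subset) simp
    qed (use ratio[OF r(2)] in auto)
    moreover have "\<forall>\<^sub>F i in sequentially. sudler (q (i + 3) - 1) bt / real (q (i + 3)) / r < s"
    proof -
      have "(\<lambda>i. sudler (q (i + 3) - 1) bt / real (q (i + 3)) / r) \<longlonglongrightarrow> U / r"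
        unfolding U_def using LIMSEQ_ignore_initial_segment[OF sudler_pred_tendsto(1)[OF lim(1)], of 3] r0
        by (intro tendsto_divide tendsto_const) auto
      then show ?thesis using Ur by (rule order_tendstoD)
    qed
    ultimately have "\<forall>\<^sub>F i in sequentially. (\<forall>(c, c') \<in> {(c, c'). c < b \<and> c' \<le> b \<and> (Suc c = b \<longrightarrow> c' = 0)}. ratio_ok r i c c')
        \<and> sudler (q (i + 3) - 1) bt / real (q (i + 3)) / r < s"
      by (rule eventually_conj)
    then obtain i0 where i0: "\<And>i c c'. i0 \<le> i \<Longrightarrow> c < b \<Longrightarrow> c' \<le> b \<Longrightarrow> (Suc c = b \<Longrightarrow> c' = 0) \<Longrightarrow> ratio_ok r i c c'"
      "\<And>i. i0 \<le> i \<Longrightarrow> sudler (q (i + 3) - 1) bt / real (q (i + 3)) / r < s"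
      unfolding eventually_sequentially by auto
    show "\<forall>\<^sub>F N in sequentially. ereal (sudler N bt / real N) < y"
    proof (rule eventually_sequentiallyI[of "q (Suc (Suc i0))"])
      fix N assume "q (Suc (Suc i0)) \<le> N"
      then obtain k where k: "Suc (Suc i0) \<le> k" "q k \<le> N" "N < q (Suc k)" using level_exists by blast
      then obtain i where i: "k = Suc (Suc i)" "i0 \<le> i" by (metis Suc_le_D Suc_le_mono)
      have "sudler N bt / real N \<le> sudler (q (Suc (Suc (Suc i))) - 1) bt / real (q (Suc (Suc (Suc i)))) / r"
        using k i by (intro sudler_le_of_ratio_ok r0 i0(1)) auto
      also have "\<dots> < s" using i0(2)[OF i(2)] by (simp add: eval_nat_numeral)
      finally have "ereal (sudler N bt / real N) < ereal s" by simp
      then show "ereal (sudler N bt / real N) < y" using s(2) by (rule less_trans)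
    qed
  qed
  have mono: "strict_mono (\<lambda>j. q (j + 2) - 1)"
  proof (rule strict_mono_Suc_iff[THEN iffD2], intro allI)
    fix j
    have "1 * q (Suc (Suc j)) \<le> b * q (Suc (Suc j))" using b_ge_1 by (rule mult_le_mono1)
    then have "q (Suc (Suc j)) < q (Suc (Suc (Suc j)))"
      using q_positive[of "Suc j"] q_Suc_Suc[of "Suc j"] by linarith
    then have "q (j + 2) < q (Suc j + 2)" by (simp add: eval_nat_numeral)
    then show "q (j + 2) - 1 < q (Suc j + 2) - 1" using q_positive[of "j + 2"] by linarith
  qed
  have "(\<lambda>j. sudler (q (j + 2) - 1) bt / real (q (j + 2) - 1)) \<longlonglongrightarrow> lam / (2 * pi) * L"
    by (rule LIMSEQ_ignore_initial_segment[OF sudler_pred_tendsto(2)[OF lim(1)]])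
  then have "ereal (lam / (2 * pi) * L) = limsup ((\<lambda>N. ereal (sudler N bt / real N)) \<circ> (\<lambda>j. q (j + 2) - 1))"
    by (intro lim_imp_Limsup[symmetric]) (simp_all add: o_def)
  also have "\<dots> \<le> limsup (\<lambda>N. ereal (sudler N bt / real N))" using mono by (rule limsup_subseq_mono)
  finally show "ereal (lam / (2 * pi) * L) \<le> limsup (\<lambda>N. ereal (sudler N bt / real N))" .
qed

end

section \<open>From bounds for the blocks to the growth rates\<close>

definition growth :: "nat \<Rightarrow> bool" where
  "growth b \<longleftrightarrow> liminf (\<lambda>N. ereal (sudler N (beta b))) = ereal (C_const b) \<and>
     limsup (\<lambda>N. ereal (sudler N (beta b) / real N)) = ereal (sqrt (real b ^ 2 + 4) / (2 * pi) * C_const b)"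

context metallic
begin

lemma q_Suc_ge_2: "2 \<le> b \<Longrightarrow> 2 \<le> q (Suc j)"
  using q_mono[of 1 "Suc j"] q_1 by simp

text \<open>\<open>v * (1 - h * v)\<close> increases for \<open>v \<le> 1 / (2 * h)\<close>.\<close>

lemma two_step_factor_mono:
  assumes h: "bt \<le> h" "h \<le> 1 / 2" and v: "v0 \<le> v" "0 \<le> v" "v \<le> 1"
  shows "v0 * (1 - h * v0) \<le> v * (1 - bt * v)"
proof -
  have "h * (v + v0) \<le> 1 / 2 * 2"
  proof (cases "0 \<le> v + v0")
    case True
    then show ?thesis using h v by (intro mult_mono) auto
  next
    case False
    then have "h * (v + v0) \<le> 0" using h bt_pos by (intro mult_nonneg_nonpos) auto
    then show ?thesis by simp
  qed
  then have "0 \<le> (v - v0) * (1 - h * (v + v0))" using v by simp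
  also have "\<dots> = v * (1 - h * v) - v0 * (1 - h * v0)" by (simp add: algebra_simps)
  finally have "v0 * (1 - h * v0) \<le> v * (1 - h * v)" by simp
  also have "\<dots> \<le> v * (1 - bt * v)"
    using v h by (intro mult_left_mono) (auto intro: mult_right_mono)
  finally show ?thesis .
qed

text \<open>The hypotheses of \<open>partial_block_bounds\<close> from rational inequalities. For a digit \<open>1\<close> the alternative of \<open>H1_one\<close> depends on the shift: the first one is used up to \<open>Y\<close>, the second one beyond.\<close>

theorem blocks_ok_from_bounds:
  assumes b2: "2 \<le> b" and lh: "0 \<le> l" "l \<le> bt" "bt \<le> h" "h \<le> 1 / 2"
    and i: "0 \<le> i" "i \<le> I" "i \<le> p 0" "\<And>j. I \<le> p (Suc j)" and W: "0 \<le> W" "\<And>j. W \<le> p (Suc j) * p j"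
    and a: "0 \<le> a" "\<And>j. a \<le> p (Suc j) * sinc_ratio (Suc j)"
    and unit: "1 \<le> i * (1 - h\<^sup>2)"
    and inner: "\<And>c. 1 \<le> c \<Longrightarrow> c < b \<Longrightarrow> fits a i W l h (- h\<^sup>2) 0 c (I * (1 - h\<^sup>2)) \<and> fits a i W l h 0 h c I"
    and outer: "\<And>c x. 2 \<le> c \<Longrightarrow> c < b \<Longrightarrow> l - 1 \<le> x \<Longrightarrow> x \<le> - l\<^sup>2 \<Longrightarrow>
      \<exists>xl xh. xl \<le> x \<and> x \<le> xh \<and> fits a i W l h xl xh c 1"
    and one: "0 \<le> Y" "Y \<le> 1" "1 \<le> W * ((1 - h * Y) * (1 - h * (1 - h * Y)))"
      "1 \<le> I * Y * (W * ((1 - h * (1 - l\<^sup>2)) * (1 - h * (1 - h * (1 - l\<^sup>2))))) \<or> 1 - l\<^sup>2 \<le> Y"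
  shows blocks_ok
proof -
  have q2: "2 \<le> q (Suc j)" for j using b2 by (rule q_Suc_ge_2)
  have p_ge: "i \<le> p j" for j using i by (cases j) (auto intro: order_trans)
  have W': "0 < j \<Longrightarrow> W \<le> p j * p (j - 1)" for j using W(2)[of "j - 1"] by simp
  have sq: "bt\<^sup>2 \<le> h\<^sup>2" "l\<^sup>2 \<le> bt\<^sup>2" "h\<^sup>2 \<le> 1" using lh bt_pos by (auto intro!: power_mono power_le_one)
  have H0: "1 \<le> F j x" if "- bt\<^sup>2 \<le> x" "x \<le> 0" for j x
  proof -
    have "1 \<le> i * (1 - h\<^sup>2)" by (rule unit)
    also have "\<dots> \<le> p j * (1 + x)" using that p_ge sq i(1) p_pos[of j] by (intro mult_mono) auto
    also have "\<dots> \<le> F j x" using that bt_sq by (intro F_left) auto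
    finally show ?thesis .
  qed
  have H1: "block_bound (Suc j) y \<le> (\<Prod>l<c. F (Suc j) (y - 1 + real l)) * block_bound j (1 - bt * (y - 1 + real c))"
    if c: "1 \<le> c" "c < b" and y: "bt \<le> y" "y \<le> 1 - bt\<^sup>2" for j c y
  proof (cases "2 \<le> c")
    case True
    have "l - 1 \<le> y - 1" "y - 1 \<le> - l\<^sup>2" using y lh sq by linarith+
    then obtain xl xh where x: "xl \<le> y - 1" "y - 1 \<le> xh" and fits: "fits a i W l h xl xh c 1"
      using outer[OF True c(2)] by blast
    show ?thesis
    proof (rule H1_from_gain[OF True y fits_bound[OF fits c q2 _ _ x lh(1,2,3) a i(1) p_ge W(1) W']])
      show "- 1 + bt \<le> y - 1" "y - 1 \<le> bt" using y bt_pos bt_sq(1) by linarith+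
    qed simp_all
  next
    case False
    then have c1: "c = 1" using c by simp
    define v where "v = 1 - bt * y"
    have yb: "0 \<le> bt * y" "bt * y \<le> 1" "0 \<le> y" "y \<le> 1"
    proof -
      show y: "0 \<le> y" "y \<le> 1" using y bt_pos bt_sq(1) by linarith+
      then show "0 \<le> bt * y" using bt_pos by simp
      have "bt * y \<le> 1 * 1" using y bt_pos bt_less_1 by (intro mult_mono) auto
      then show "bt * y \<le> 1" by simp
    qed
    have v: "0 \<le> v" "v \<le> 1" using yb by (auto simp: v_def)
    have v_ge: "1 - h * u \<le> v" if "y \<le> u" for u
    proof -
      have "bt * y \<le> h * u" using that yb lh bt_pos by (intro mult_mono) auto
      then show ?thesis by (simp add: v_def)
    qed
    have vv: "0 \<le> v * (1 - bt * v)"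
      using v bt_pos bt_less_1 mult_mono[of bt 1 v 1] by simp
    have "1 \<le> p j * p (j - 1) * (v * (1 - bt * v)) \<or> 1 \<le> p (Suc j) * y * (p j * p (j - 1) * (v * (1 - bt * v)))"
      if j: "0 < j"
    proof (cases "y \<le> Y")
      case True
      have "1 \<le> W * ((1 - h * Y) * (1 - h * (1 - h * Y)))" by (rule one)
      also have "\<dots> \<le> W * (v * (1 - bt * v))"
        using two_step_factor_mono[OF lh(3,4) v_ge[OF True] v] W(1) by (rule mult_left_mono)
      also have "\<dots> \<le> p j * p (j - 1) * (v * (1 - bt * v))" using W'[OF j] vv by (rule mult_right_mono)
      finally show ?thesis by simp
    next
      case False
      define u where "u = 1 - l\<^sup>2"
      have yu: "y \<le> u" using y sq by (simp add: u_def)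
      have not: "\<not> 1 - l\<^sup>2 \<le> Y" using False yu by (simp add: u_def)
      have "1 \<le> I * Y * (W * ((1 - h * u) * (1 - h * (1 - h * u))))" using one(4) not by (simp add: u_def)
      also have "\<dots> \<le> I * Y * (W * (v * (1 - bt * v)))"
        using two_step_factor_mono[OF lh(3,4) v_ge[OF yu] v] W(1) i one by (intro mult_left_mono) auto
      also have "\<dots> \<le> p (Suc j) * y * (p j * p (j - 1) * (v * (1 - bt * v)))"
      proof (rule mult_mono)
        show "I * Y \<le> p (Suc j) * y" using False i one p_pos[of "Suc j"] by (intro mult_mono) auto
        show "W * (v * (1 - bt * v)) \<le> p j * p (j - 1) * (v * (1 - bt * v))" using W'[OF j] vv by (rule mult_right_mono)
        show "0 \<le> W * (v * (1 - bt * v))" using W(1) vv by (rule mult_nonneg_nonneg)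
        show "0 \<le> p (Suc j) * y" using p_pos[of "Suc j"] yb by simp
      qed
      finally show ?thesis by simp
    qed
    then have "block_bound (Suc j) y \<le> F (Suc j) (y - 1) * block_bound j (1 - bt * y)"
      unfolding v_def by (intro H1_one[OF y]) auto
    then show ?thesis unfolding c1 by simp
  qed
  have H2: "1 \<le> (\<Prod>l<c. F (Suc j) (x + real l)) * block_bound j (1 - bt * (x + real c))"
    if c: "1 \<le> c" "c < b" and x: "- bt\<^sup>2 \<le> x" "x \<le> bt" for j c x
  proof -
    have r: "bt \<le> 1 - bt * (x + real c)" "1 - bt * (x + real c) \<le> 1 - bt\<^sup>2"
      using shift_range(1)[OF c x] by auto
    then have nn: "0 \<le> 1 - bt * (x + real c)" "1 - bt * (x + real c) \<le> 1" using bt_pos bt_sq(1) by linarith+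
    then have nn': "bt * (1 - bt * (x + real c)) \<le> 1 * 1" using bt_pos bt_less_1 by (intro mult_mono) auto
    have half: "- 1 + bt \<le> x"
    proof -
      have "bt * 2 \<le> bt * real b" using b2 bt_pos by (intro mult_left_mono) auto
      then have "2 * bt + bt\<^sup>2 \<le> 1" using bt_b by linarith
      then show ?thesis using x bt_pos by linarith
    qed
    show ?thesis
    proof (cases "x \<le> 0")
      case True
      have f: "I * (1 - h\<^sup>2) \<le> F (Suc j) x"
      proof -
        have "I * (1 - h\<^sup>2) \<le> p (Suc j) * (1 + x)" using x i sq p_pos[of "Suc j"] by (intro mult_mono) auto
        also have "\<dots> \<le> F (Suc j) x" using x True bt_sq by (intro F_left) auto
        finally show ?thesis .
      qed
      have g: "1 \<le> I * (1 - h\<^sup>2) * ((\<Prod>l=1..<c. F (Suc j) (x + real l)) * block_bound j (1 - bt * (x + real c)))"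
      proof (rule fits_bound[OF conjunct1[OF inner[OF c]] c q2 half x(2) _ True lh(1,2,3) a i(1) p_ge W(1) W'])
        show "- h\<^sup>2 \<le> x" using x sq by linarith
        show "0 \<le> I * (1 - h\<^sup>2)" using i sq by simp
      qed
      show ?thesis using nn nn' by (intro H2_from_gain[OF c(1) f g]) auto
    next
      case False
      have f: "I \<le> F (Suc j) x"
      proof -
        have "p (Suc j) \<le> F (Suc j) x" using False x z_minus_1_ge(2) by (intro F_right_ge_p) auto
        then show ?thesis using i(4)[of j] by linarith
      qed
      have g: "1 \<le> I * ((\<Prod>l=1..<c. F (Suc j) (x + real l)) * block_bound j (1 - bt * (x + real c)))"
      proof (rule fits_bound[OF conjunct2[OF inner[OF c]] c q2 half x(2) _ _ lh(1,2,3) a i(1) p_ge W(1) W'])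
        show "0 \<le> x" "x \<le> h" using False x lh by linarith+
        show "0 \<le> I" using i by simp
      qed
      show ?thesis using nn nn' by (intro H2_from_gain[OF c(1) f g]) auto
    qed
  qed
  show ?thesis
    unfolding blocks_ok_def using partial_block_bounds[OF H0 H1 H2] by blast
qed

text \<open>Every admissible pair of leading digits falls under one of the five \<open>ratio_ok\<close> lemmas.\<close>

theorem growth_from_bounds:
  assumes ok: blocks_ok and \<pi>: "1 \<le> \<pi>" "\<pi> < C_const b" and lh: "0 \<le> l" "l \<le> bt" "bt \<le> h" "h \<le> 1"
    and fits: "\<And>a. 1 \<le> a \<Longrightarrow> a < b \<Longrightarrow> fits \<pi> \<pi> (\<pi> * \<pi>) l h 0 0 a 1"
    and low_wins: "\<And>c. 1 \<le> c \<Longrightarrow> c < b \<Longrightarrow> wins \<pi> l h (- (h ^ 4)) (h ^ 3) c (\<pi> * (1 - h ^ 4)) (1 - h\<^sup>2)"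
    and low_b: "0 < 1 - h\<^sup>2" "1 < \<pi> * (1 - h ^ 4) * (1 - h\<^sup>2)"
    and top: "\<And>c. c < b \<Longrightarrow> h * (h + real c) \<le> 1"
    and zero_win: "\<And>c. 1 \<le> c \<Longrightarrow> c < b \<Longrightarrow> b \<noteq> 2 \<Longrightarrow>
      0 < 1 - real c * h - h\<^sup>2 \<and> 1 < topg \<pi> l h c * (1 - real c * h - h\<^sup>2)"
    and two_ok: "b = 2 \<Longrightarrow> \<forall>\<^sub>F i in sequentially. ratio_ok 1 i 1 0"
    and middle_wins: "\<And>c c'. c + 2 \<le> b \<Longrightarrow> 1 \<le> c' \<Longrightarrow> c' < b \<Longrightarrow>
      0 < 1 - real c * h - (real c' + 1) * h\<^sup>2 \<and>
      wins \<pi> l h (- h\<^sup>2 - real c * h) (- l\<^sup>2 - real c * l) c'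
        (topg \<pi> l h c * (\<pi> * (1 + (- h\<^sup>2 - real c * h)))) (1 - real c * h - (real c' + 1) * h\<^sup>2)"
    and full_win: "\<And>c. c + 2 \<le> b \<Longrightarrow>
      0 < 1 - (real c + 1) * h \<and> - 1 \<le> - h\<^sup>2 - real c * h \<and> h * ((- l\<^sup>2 - real c * l) + real (b - 1)) \<le> 1 \<and>
      1 < topg \<pi> l h c * (\<pi> * (1 + (- h\<^sup>2 - real c * h))) *
        gain \<pi> h (- h\<^sup>2 - real c * h) (- l\<^sup>2 - real c * l) (b - 1) * \<pi> * (1 - (real c + 1) * h)"
  shows "growth b"
proof -
  have lower: "liminf (\<lambda>N. ereal (sudler N bt)) = ereal (C_const b)"
    by (rule liminf_sudler[OF ok p_tendsto(3) \<pi> lh(1,2,3) fits])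
  obtain J where J: "\<And>i. J \<le> i \<Longrightarrow> good \<pi> i"
    using eventually_good[OF p_tendsto(3) \<pi>(2)] by (auto simp: eventually_sequentially)
  have weaken: "\<forall>\<^sub>F i in sequentially. ratio_ok r i c c'"
    if "\<forall>\<^sub>F i in sequentially. ratio_ok 1 i c c'" "r < 1" for r c c'
    using that(1) by eventually_elim (use that(2) in \<open>force simp: ratio_ok_def\<close>)
  have "limsup (\<lambda>N. ereal (sudler N bt / real N)) = ereal (lam / (2 * pi) * C_const b)"
  proof (rule limsup_sudler[OF p_tendsto(3,2)])
    fix r :: real and c c' :: nat
    assume r: "r < 1" and c: "c < b" "c' \<le> b" "Suc c = b \<Longrightarrow> c' = 0"
    consider (low) "c = 0" "c' = 0" | (two) "b = 2" "c = 1" "c' = 0" | (zero) "1 \<le> c" "b \<noteq> 2" "c' = 0"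
      | (middle) "c + 2 \<le> b" "1 \<le> c'" "c' < b" | (full) "c + 2 \<le> b" "c' = b"
      using c by (cases "c = 0"; cases "c' = 0"; cases "c' = b"; cases "b = 2"; cases "Suc c = b") auto
    then show "\<forall>\<^sub>F i in sequentially. ratio_ok r i c c'"
    proof cases
      case low
      show ?thesis unfolding low
        by (rule ratio_ok_low[OF ok J \<pi>(1) lh low_b(1) order_refl low_wins low_b(2) r])
    next
      case two
      show ?thesis unfolding two(2,3) by (rule weaken[OF two_ok[OF two(1)] r])
    next
      case zero
      show ?thesis unfolding zero(3)
        by (rule weaken[OF ratio_ok_zero[OF ok J \<pi>(1) lh(1,2,3) c(1)
          conjunct1[OF zero_win[OF zero(1) c(1) zero(2)]] order_refl top[OF c(1)]
          conjunct2[OF zero_win[OF zero(1) c(1) zero(2)]]] r])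
    next
      case middle
      note m = middle_wins[OF middle]
      show ?thesis
        by (rule weaken[OF ratio_ok_middle[OF ok J \<pi>(1) lh(1,2,3) middle
          conjunct1[OF m] order_refl top[OF c(1)] conjunct2[OF m]] r])
    next
      case full
      note m = full_win[OF full(1)]
      show ?thesis unfolding full(2)
        by (rule weaken[OF ratio_ok_full[OF ok J \<pi>(1) lh(1,2,3) full(1) _ order_refl top[OF c(1)]] r])
          (use m in auto)
    qed
  qed
  with lower show ?thesis unfolding growth_def bt_def lam_def by blast
qed

end

section \<open>Numerical estimates\<close>

definition sin_low :: "real \<Rightarrow> real" where "sin_low y = y - y ^ 3 / 6 + y ^ 5 / 120 - y ^ 7 / 5040"
definition sin_up :: "real \<Rightarrow> real" where "sin_up y = y - y ^ 3 / 6 + y ^ 5 / 120"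

lemma sin_taylor:
  assumes "0 \<le> y" shows "sin_low y \<le> sin y" "sin y \<le> sin_up y"
proof -
  have sums: "(\<Sum>m<7. sin_coeff m * y ^ m) = sin_up y" "(\<Sum>m<5. sin_coeff m * y ^ m) = y - y ^ 3 / 6"
  proof -
    have "{..<7::nat} = {0, 1, 2, 3, 4, 5, 6}" "{..<5::nat} = {0, 1, 2, 3, 4}" by auto
    then show "(\<Sum>m<7. sin_coeff m * y ^ m) = sin_up y" "(\<Sum>m<5. sin_coeff m * y ^ m) = y - y ^ 3 / 6"
      by (simp_all add: sin_coeff_def sin_up_def fact_numeral)
  qed
  have "\<bar>sin y - (\<Sum>m<7. sin_coeff m * y ^ m)\<bar> \<le> inverse (fact 7) * \<bar>y\<bar> ^ 7"
    by (rule Maclaurin_sin_bound)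
  then have "\<bar>sin y - sin_up y\<bar> \<le> y ^ 7 / 5040"
    using assms by (simp add: sums fact_numeral)
  then show "sin_low y \<le> sin y" unfolding sin_low_def sin_up_def by linarith
  show "sin y \<le> sin_up y"
  proof (cases "y = 0")
    case False
    then have "0 < y" using assms by simp
    then obtain s where "sin y = (\<Sum>m<5. sin_coeff m * y ^ m) + sin (s + 1 / 2 * real 5 * pi) / fact 5 * y ^ 5"
      using Maclaurin_sin_expansion3[of 5 y] by auto
    moreover have "sin (s + 1 / 2 * real 5 * pi) / fact 5 * y ^ 5 \<le> 1 / fact 5 * y ^ 5"
      using assms by (intro mult_right_mono divide_right_mono) auto
    ultimately show ?thesis unfolding sums(2) sin_up_def by (simp add: fact_numeral)
  qed (simp add: sin_up_def)
qed

lemma pi_bounds: "(314159 / 100000) \<le> pi" "pi \<le> (3927 / 1250)"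
  using pi_approx by simp_all

text \<open>Only the distance of \<open>x\<close> from an integer matters; up to \<open>49 / 100\<close> the sine is still monotone after rounding \<open>pi\<close>.\<close>

lemma abs_sin_pi_bounds:
  fixes x u v :: real and n :: int
  assumes u: "0 \<le> u" "u \<le> \<bar>x - of_int n\<bar>" and v: "\<bar>x - of_int n\<bar> \<le> v" "v \<le> 49 / 100"
  shows "sin_low ((314159 / 100000) * u) \<le> \<bar>sin (pi * x)\<bar>" "\<bar>sin (pi * x)\<bar> \<le> sin_up ((3927 / 1250) * v)"
proof -
  define d where "d = \<bar>x - of_int n\<bar>"
  have d: "0 \<le> d" "u \<le> d" "d \<le> v" using assms by (auto simp: d_def)
  have pid: "0 \<le> pi * d" "pi * d \<le> (3927 / 1250) * v" "(3927 / 1250) * v \<le> 157 / 100" "(314159 / 100000) * u \<le> pi * d"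
  proof -
    show "0 \<le> pi * d" using d by simp
    show "pi * d \<le> (3927 / 1250) * v" using d pi_bounds by (intro mult_mono) auto
    show "(3927 / 1250) * v \<le> 157 / 100" using v by simp
    show "(314159 / 100000) * u \<le> pi * d" using d u pi_bounds by (intro mult_mono) auto
  qed
  have "sin (pi * x) = sin (pi * (x - of_int n) + pi * of_int n)" by (simp add: algebra_simps)
  then have "\<bar>sin (pi * x)\<bar> = \<bar>sin (pi * (x - of_int n))\<bar> * \<bar>cos (pi * of_int n)\<bar>"
    by (simp add: sin_add abs_mult sin_int_times_real)
  also have "\<bar>cos (pi * of_int n)\<bar> = 1" by (simp add: cos_int_times_real abs_power_minus power_abs)
  also have "\<bar>sin (pi * (x - of_int n))\<bar> = \<bar>sin (pi * d)\<bar>"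
  proof (cases "0 \<le> x - of_int n")
    case False
    then have "pi * (x - of_int n) = - (pi * d)" by (simp add: d_def algebra_simps)
    then show ?thesis by simp
  qed (simp add: d_def)
  also have "\<bar>sin (pi * d)\<bar> = sin (pi * d)"
    using pid pi_bounds d(3) v(2) by (intro abs_of_nonneg sin_ge_zero) auto
  finally have eq: "\<bar>sin (pi * x)\<bar> = sin (pi * d)" by simp
  have "sin_low ((314159 / 100000) * u) \<le> sin ((314159 / 100000) * u)" using u by (intro sin_taylor) simp
  also have "\<dots> \<le> sin (pi * d)" by (rule sin_monotone_2pi_le) (use pid u pi_bounds in linarith)+
  finally show "sin_low ((314159 / 100000) * u) \<le> \<bar>sin (pi * x)\<bar>" by (simp only: eq)
  have "sin (pi * d) \<le> sin ((3927 / 1250) * v)" by (rule sin_monotone_2pi_le) (use pid pi_bounds in linarith)+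
  also have "\<dots> \<le> sin_up ((3927 / 1250) * v)" using pid by (intro sin_taylor) linarith
  finally show "\<bar>sin (pi * x)\<bar> \<le> sin_up ((3927 / 1250) * v)" by (simp only: eq)
qed

context metallic
begin

lemma bt_ge: "0 \<le> l \<Longrightarrow> l\<^sup>2 + real b * l \<le> 1 \<Longrightarrow> l \<le> bt"
proof (rule ccontr)
  assume l: "0 \<le> l" "l\<^sup>2 + real b * l \<le> 1" "\<not> l \<le> bt"
  have "bt\<^sup>2 < l\<^sup>2" using l bt_pos by (intro power_strict_mono) auto
  moreover have "real b * bt \<le> real b * l" using l by (intro mult_left_mono) auto
  ultimately show False using bt_root l by linarith
qed

lemma bt_le: "0 \<le> h \<Longrightarrow> 1 \<le> h\<^sup>2 + real b * h \<Longrightarrow> bt \<le> h"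
proof (rule ccontr)
  assume h: "0 \<le> h" "1 \<le> h\<^sup>2 + real b * h" "\<not> bt \<le> h"
  have "h\<^sup>2 < bt\<^sup>2" using h by (intro power_strict_mono) auto
  moreover have "real b * h \<le> real b * bt" using h by (intro mult_left_mono) auto
  ultimately show False using bt_root h by linarith
qed

lemma sudler_step:
  assumes K: "K = Suc N" and A: "0 \<le> A" "A \<le> sudler N bt" "sudler N bt \<le> B"
    and u: "0 \<le> u" "u \<le> \<bar>real K * bt - of_int n\<bar>" and v: "\<bar>real K * bt - of_int n\<bar> \<le> v" "v \<le> 49 / 100"
    and A': "A' \<le> A * (2 * sin_low ((314159 / 100000) * u))" and B': "B * (2 * sin_up ((3927 / 1250) * v)) \<le> B'"
  shows "A' \<le> sudler K bt \<and> sudler K bt \<le> B'"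
proof -
  define S where "S = \<bar>sin (pi * (real K * bt))\<bar>"
  have S: "sin_low ((314159 / 100000) * u) \<le> S" "S \<le> sin_up ((3927 / 1250) * v)" "0 \<le> S"
    unfolding S_def using abs_sin_pi_bounds[OF u v] by auto
  have eq: "sudler K bt = sudler N bt * (2 * S)"
    using sudler_pred[of K] K by (simp add: S_def)
  have "A * (2 * sin_low ((314159 / 100000) * u)) \<le> A * (2 * S)" using A(1) S by (intro mult_left_mono) auto
  also have "\<dots> \<le> sudler N bt * (2 * S)" using A S by (intro mult_right_mono) auto
  finally have 1: "A' \<le> sudler K bt" using A' eq by linarith
  have "sudler N bt * (2 * S) \<le> B * (2 * S)" using A S by (intro mult_right_mono) auto
  also have "\<dots> \<le> B * (2 * sin_up ((3927 / 1250) * v))" using A S by (intro mult_left_mono) auto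
  finally show ?thesis using 1 B' eq by linarith
qed

lemma t_le:
  assumes h: "bt \<le> h" "h \<le> 1" and s: "(3927 / 1250) * h ^ Suc J \<le> s" and j: "J \<le> j"
  shows "t j \<le> s"
proof -
  have "bt ^ Suc j \<le> bt ^ Suc J" using j bt_pos bt_less_1 by (intro power_decreasing) auto
  also have "\<dots> \<le> h ^ Suc J" using h bt_pos by (intro power_mono) auto
  finally have "pi * bt ^ Suc j \<le> (3927 / 1250) * h ^ Suc J"
    using pi_bounds bt_pos by (intro mult_mono) auto
  then show ?thesis using s by (simp add: t_def gap_def)
qed

text \<open>\<open>zm\<close> with \<open>bt\<close> replaced by an upper bound \<open>h\<close>, hence rational for rational \<open>h\<close>.\<close>

definition zm_upper :: "real \<Rightarrow> nat \<Rightarrow> real" where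
  "zm_upper h m = real m * (real b + h) + of_int \<lfloor>real m * h\<rfloor>"

lemma zm_le: "bt \<le> h \<Longrightarrow> zm m \<le> zm_upper h m"
proof -
  assume h: "bt \<le> h"
  have "real m * bt \<le> real m * h" using h by (intro mult_left_mono) auto
  then have "\<lfloor>real m * bt\<rfloor> \<le> \<lfloor>real m * h\<rfloor>" by (rule floor_mono)
  moreover have "real m * z \<le> real m * (real b + h)" unfolding z_def using h by (intro mult_left_mono) auto
  ultimately show ?thesis unfolding zm_def zm_upper_def by (intro add_mono) auto
qed

lemma pair_factor_bounds:
  assumes "l < b" "1 \<le> m"
  shows "0 \<le> 1 - real l * (1 + real l) / (zm m * (zm m + 1))"
    and "zm m \<le> Z \<Longrightarrow> 1 - real l * (1 + real l) / (zm m * (zm m + 1)) \<le> 1 - real l * (1 + real l) / (Z * (Z + 1))"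
proof -
  have zm: "0 < zm m" "real l \<le> zm m" using zm_ge[OF assms(2)] assms(1) bt_pos by (auto simp: z_def)
  then have "real l * (1 + real l) \<le> zm m * (zm m + 1)" by (intro mult_mono) auto
  then show "0 \<le> 1 - real l * (1 + real l) / (zm m * (zm m + 1))" using zm by simp
  assume Z: "zm m \<le> Z"
  have "zm m * (zm m + 1) \<le> Z * (Z + 1)" using zm Z by (intro mult_mono) auto
  then show "1 - real l * (1 + real l) / (zm m * (zm m + 1)) \<le> 1 - real l * (1 + real l) / (Z * (Z + 1))"
    using zm Z by (intro diff_left_mono divide_left_mono) auto
qed

text \<open>The upper bound of \<open>F_right_le\<close> for the \<open>b\<close> blocks of \<open>p_rec\<close>, relative to \<open>p (j + 1) ^ b\<close>.\<close>

definition shifts_prod :: "nat \<Rightarrow> real" where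
  "shifts_prod M = (\<Prod>l<b. (1 + real l) * (\<Prod>m=1..M. 1 - real l * (1 + real l) / (zm m * (zm m + 1))))"

lemma shifts_prod_nonneg: "0 \<le> shifts_prod M"
  unfolding shifts_prod_def by (intro prod_nonneg mult_nonneg_nonneg ballI) (auto intro: pair_factor_bounds[simplified])

lemma shifts_prod_le:
  assumes "bt \<le> h"
  shows "shifts_prod M \<le> (\<Prod>l<b. (1 + real l) * (\<Prod>m=1..M. 1 - real l * (1 + real l) / (zm_upper h m * (zm_upper h m + 1))))"
  unfolding shifts_prod_def
proof (rule prod_mono, rule conjI)
  fix l assume l: "l \<in> {..<b}"
  have "0 \<le> (\<Prod>m=1..M. 1 - real l * (1 + real l) / (zm m * (zm m + 1)))"
    using l by (intro prod_nonneg ballI pair_factor_bounds(1)) auto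
  then show "0 \<le> (1 + real l) * (\<Prod>m=1..M. 1 - real l * (1 + real l) / (zm m * (zm m + 1)))" by simp
  have "(\<Prod>m=1..M. 1 - real l * (1 + real l) / (zm m * (zm m + 1)))
      \<le> (\<Prod>m=1..M. 1 - real l * (1 + real l) / (zm_upper h m * (zm_upper h m + 1)))"
    using l by (intro prod_mono conjI pair_factor_bounds zm_le assms) auto
  then show "(1 + real l) * (\<Prod>m=1..M. 1 - real l * (1 + real l) / (zm m * (zm m + 1)))
      \<le> (1 + real l) * (\<Prod>m=1..M. 1 - real l * (1 + real l) / (zm_upper h m * (zm_upper h m + 1)))"
    by (rule mult_left_mono) simp
qed

text \<open>\<open>p_threshold_lower\<close> with the recursion constant replaced by a bound valid on all levels from \<open>J\<close> on; \<open>s\<close> bounds \<open>t J\<close>, \<open>E\<close> the pair corrections of the last block, and \<open>B\<close> the other \<open>b\<close> blocks.\<close>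

lemma threshold_lower:
  assumes J: "1 \<le> J" and q2: "2 \<le> q J" and h: "bt \<le> h" "h < 1"
    and s: "(3927 / 1250) * h ^ Suc J \<le> s" "s \<le> 157 / 100" and M: "2 * M < q (Suc J)" and N: "2 * N < q J"
    and E: "\<And>j. J \<le> j \<Longrightarrow> (\<Prod>m=1..N. 1 - 2 * cos (t j) * (bt\<^sup>2)\<^sup>2 / (zm m * (zm m + 1))
                              - (bt\<^sup>2)\<^sup>2 * (1 - (bt\<^sup>2)\<^sup>2) / (zm m * (zm m + 1))\<^sup>2) \<le> E" "0 \<le> E"
    and B: "shifts_prod M \<le> B" and P: "0 < P" "h\<^sup>2 / (1 - s\<^sup>2 / 6) / (1 - h ^ 3) * E * B * P ^ b \<le> 1" and j: "J \<le> j"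
  shows "(1 + bt) * ln P \<le> ln (p (Suc j)) + bt * ln (p j)"
proof (rule p_threshold_lower[OF _ P p_tendsto(3,2) j])
  fix i assume i: "J \<le> i"
  then obtain k where k: "i = Suc k" using J by (cases i) auto
  have ti: "0 < t i" "t i \<le> s" "t i < pi" using t_le[OF h(1) _ s(1) i] h bt_pos t_less_pi by (auto simp: t_def gap_def)
  have "t i \<le> pi / 2" using ti s pi_bounds by linarith
  note u = p_rec_upper[of k N M, folded k shifts_prod_def]
  have u: "p (Suc (Suc i)) \<le> p i * p (Suc i) ^ b *
      (bt\<^sup>2 * (t i / sin (t i)) / (1 - bt ^ 3) * (\<Prod>m=1..N. 1 - 2 * cos (t i) * (bt\<^sup>2)\<^sup>2 / (zm m * (zm m + 1))
                              - (bt\<^sup>2)\<^sup>2 * (1 - (bt\<^sup>2)\<^sup>2) / (zm m * (zm m + 1))\<^sup>2) * shifts_prod M)"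
  proof (rule u)
    have "q J \<le> q i" "q (Suc J) \<le> q (Suc i)" using i by (auto intro: q_mono)
    then show "2 \<le> q i" "2 * N < q i" "2 * M < q (Suc i)" using q2 M N by auto
  qed fact
  have s0: "0 < s" using ti by linarith
  have s6: "s\<^sup>2 \<le> (157 / 100)\<^sup>2" using s s0 by (intro power_mono) auto
  then have s6': "0 < 1 - s\<^sup>2 / 6" by (simp add: power2_eq_square)
  have ratio: "t i / sin (t i) \<le> 1 / (1 - s\<^sup>2 / 6)"
  proof -
    have "(t i)\<^sup>2 \<le> s\<^sup>2" using ti by (intro power_mono) auto
    then have "t i * (1 - s\<^sup>2 / 6) \<le> t i * (1 - (t i)\<^sup>2 / 6)" using ti by (intro mult_left_mono) auto
    also have "\<dots> = t i - t i ^ 3 / 6" by (simp add: algebra_simps eval_nat_numeral)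
    also have "\<dots> \<le> sin (t i)" using ti by (intro sin_ge_cubic) simp
    finally have "t i * (1 - s\<^sup>2 / 6) \<le> sin (t i)" .
    then show ?thesis using sin_t_pos[of i] s6' by (simp add: pos_le_divide_eq pos_divide_le_eq)
  qed
  have h3: "bt ^ 3 \<le> h ^ 3" "h ^ 3 < 1" "bt\<^sup>2 \<le> h\<^sup>2" "bt ^ 3 < 1" "0 < h"
  proof -
    show "0 < h" using h bt_pos by linarith
    show "bt ^ 3 \<le> h ^ 3" "bt\<^sup>2 \<le> h\<^sup>2" using h bt_pos by (auto intro!: power_mono)
    show "h ^ 3 < 1" "bt ^ 3 < 1" using h bt_pos bt_less_1 by (auto intro!: power_less_one_iff[THEN iffD2])
  qed
  have A: "bt\<^sup>2 * (t i / sin (t i)) / (1 - bt ^ 3) \<le> h\<^sup>2 * (1 / (1 - s\<^sup>2 / 6)) / (1 - h ^ 3)"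
  proof (rule frac_le)
    show "bt\<^sup>2 * (t i / sin (t i)) \<le> h\<^sup>2 * (1 / (1 - s\<^sup>2 / 6))"
      using h3 ti sin_t_pos[of i] by (intro mult_mono[OF _ ratio]) auto
    show "0 \<le> h\<^sup>2 * (1 / (1 - s\<^sup>2 / 6))" using s6' by simp
  qed (use h3 in auto)
  have A0: "0 \<le> bt\<^sup>2 * (t i / sin (t i)) / (1 - bt ^ 3)" using h3 ti sin_t_pos[of i] by simp
  have A0': "0 \<le> h\<^sup>2 * (1 / (1 - s\<^sup>2 / 6)) / (1 - h ^ 3)" using h3 s6' by simp
  have "bt\<^sup>2 * (t i / sin (t i)) / (1 - bt ^ 3) * (\<Prod>m=1..N. 1 - 2 * cos (t i) * (bt\<^sup>2)\<^sup>2 / (zm m * (zm m + 1))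
                              - (bt\<^sup>2)\<^sup>2 * (1 - (bt\<^sup>2)\<^sup>2) / (zm m * (zm m + 1))\<^sup>2)
      \<le> bt\<^sup>2 * (t i / sin (t i)) / (1 - bt ^ 3) * E"
    using E(1)[OF i] A0 by (rule mult_left_mono)
  also have "\<dots> \<le> h\<^sup>2 * (1 / (1 - s\<^sup>2 / 6)) / (1 - h ^ 3) * E" using A E(2) by (rule mult_right_mono)
  finally have AE: "bt\<^sup>2 * (t i / sin (t i)) / (1 - bt ^ 3) * (\<Prod>m=1..N. 1 - 2 * cos (t i) * (bt\<^sup>2)\<^sup>2 / (zm m * (zm m + 1))
                              - (bt\<^sup>2)\<^sup>2 * (1 - (bt\<^sup>2)\<^sup>2) / (zm m * (zm m + 1))\<^sup>2)
      \<le> h\<^sup>2 * (1 / (1 - s\<^sup>2 / 6)) / (1 - h ^ 3) * E" .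
  have "bt\<^sup>2 * (t i / sin (t i)) / (1 - bt ^ 3) * (\<Prod>m=1..N. 1 - 2 * cos (t i) * (bt\<^sup>2)\<^sup>2 / (zm m * (zm m + 1))
                              - (bt\<^sup>2)\<^sup>2 * (1 - (bt\<^sup>2)\<^sup>2) / (zm m * (zm m + 1))\<^sup>2) * shifts_prod M
     \<le> h\<^sup>2 * (1 / (1 - s\<^sup>2 / 6)) / (1 - h ^ 3) * E * shifts_prod M"
    using AE shifts_prod_nonneg by (rule mult_right_mono)
  also have "\<dots> \<le> h\<^sup>2 * (1 / (1 - s\<^sup>2 / 6)) / (1 - h ^ 3) * E * B"
    by (rule mult_left_mono[OF B mult_nonneg_nonneg[OF A0' E(2)]])
  finally have K: "bt\<^sup>2 * (t i / sin (t i)) / (1 - bt ^ 3) * (\<Prod>m=1..N. 1 - 2 * cos (t i) * (bt\<^sup>2)\<^sup>2 / (zm m * (zm m + 1))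
                              - (bt\<^sup>2)\<^sup>2 * (1 - (bt\<^sup>2)\<^sup>2) / (zm m * (zm m + 1))\<^sup>2) * shifts_prod M
     \<le> h\<^sup>2 / (1 - s\<^sup>2 / 6) / (1 - h ^ 3) * E * B" by simp
  have "0 \<le> p i * p (Suc i) ^ b" using p_pos[of i] p_pos[of "Suc i"] by simp
  from mult_left_mono[OF K this] u
  show "p (Suc (Suc i)) \<le> p i * p (Suc i) ^ b * (h\<^sup>2 / (1 - s\<^sup>2 / 6) / (1 - h ^ 3) * E * B)" by linarith
qed

text \<open>The same for the opposite bound; \<open>\<kappa>\<close> is an optional gain of the last block over \<open>F_left\<close>.\<close>

lemma threshold_upper:
  assumes lh: "0 < l" "l \<le> bt" "bt \<le> h" "h \<le> 1" and q2: "2 \<le> q (Suc J)"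
    and kappa: "0 < \<kappa>" "\<And>j. J \<le> j \<Longrightarrow> p j * (bt\<^sup>2 * \<kappa>) \<le> F j (bt\<^sup>2 - 1)"
    and s: "(3927 / 1250) * h ^ Suc (Suc J) \<le> s" "(s * real b)\<^sup>2 < 6" and hb: "h * (real b - 1) < 1"
    and Q: "0 < Q" "1 \<le> l\<^sup>2 * \<kappa> * (\<Prod>k<b. (1 + real k) * (1 - (s * (1 + real k))\<^sup>2 / 6) * (1 - h * real k)) * Q ^ b"
    and j: "J \<le> j"
  shows "ln (p (Suc j)) + bt * ln (p j) \<le> (1 + bt) * ln Q"
proof -
  have s0: "0 < s"
  proof -
    have "0 < (3927 / 1250) * h ^ Suc (Suc J)" using lh by simp
    then show ?thesis using s by linarith
  qed
  have pos: "0 < (1 + real k) * (1 - (s * (1 + real k))\<^sup>2 / 6) * (1 - h * real k)" if "k < b" for k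
  proof -
    have "(s * (1 + real k))\<^sup>2 \<le> (s * real b)\<^sup>2" using that s0 by (intro power_mono mult_left_mono) auto
    then have 1: "0 < 1 - (s * (1 + real k))\<^sup>2 / 6" using s by simp
    have "h * real k \<le> h * (real b - 1)" using that lh by (intro mult_left_mono) auto
    then show ?thesis using 1 hb by simp
  qed
  define K where "K = l\<^sup>2 * \<kappa> * (\<Prod>k<b. (1 + real k) * (1 - (s * (1 + real k))\<^sup>2 / 6) * (1 - h * real k))"
  have prod_pos: "0 < (\<Prod>k<b. (1 + real k) * (1 - (s * (1 + real k))\<^sup>2 / 6) * (1 - h * real k))"
    by (intro prod_pos ballI pos) simp
  then have K0: "0 < K" unfolding K_def using lh kappa by simp
  have Q': "1 \<le> K * Q ^ b" using Q by (simp add: K_def)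
  show ?thesis
  proof (rule p_threshold_upper[OF _ Q(1) K0 Q' p_tendsto(3,2) j])
    fix i assume i: "J \<le> i"
    have ti: "0 < t (Suc i)" "t (Suc i) \<le> s" using t_le[OF lh(3,4) s(1), of "Suc i"] i bt_pos by (auto simp: t_def gap_def)
    have ge: "(1 + real k) * (1 - (s * (1 + real k))\<^sup>2 / 6) * (1 - h * real k)
        \<le> (sin (t (Suc i) * (1 + real k)) / sin (t (Suc i))) * (1 - bt * real k)" if k: "k < b" for k
    proof -
      define r where "r = 1 + real k"
      have r: "0 \<le> r" by (simp add: r_def)
      have sr: "(t (Suc i) * r)\<^sup>2 \<le> (s * r)\<^sup>2" using ti r by (intro power_mono mult_right_mono) auto
      have "(s * r)\<^sup>2 \<le> (s * real b)\<^sup>2" unfolding r_def using k s0 by (intro power_mono mult_left_mono) auto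
      then have sr6: "(s * r)\<^sup>2 \<le> 6" using s by linarith
      have st: "0 < sin (t (Suc i))" "sin (t (Suc i)) \<le> t (Suc i)" using sin_t_pos ti by (auto intro: sin_x_le_x)
      have "r * (1 - (s * r)\<^sup>2 / 6) * sin (t (Suc i)) \<le> r * (1 - (t (Suc i) * r)\<^sup>2 / 6) * t (Suc i)"
        using r sr sr6 st by (intro mult_mono) auto
      also have "\<dots> = t (Suc i) * r - (t (Suc i) * r) ^ 3 / 6" by (simp add: algebra_simps eval_nat_numeral)
      also have "\<dots> \<le> sin (t (Suc i) * r)" using ti r by (intro sin_ge_cubic) auto
      finally have 1: "r * (1 - (s * r)\<^sup>2 / 6) \<le> sin (t (Suc i) * r) / sin (t (Suc i))"
        using st by (simp add: pos_le_divide_eq)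
      have "h * real k \<le> h * (real b - 1)" using k lh by (intro mult_left_mono) auto
      then have hk: "0 \<le> 1 - h * real k" using hb by linarith
      have bk: "1 - h * real k \<le> 1 - bt * real k" using lh by (simp add: mult_right_mono)
      have 0: "0 \<le> r * (1 - (s * r)\<^sup>2 / 6)" using r sr6 by simp
      show ?thesis unfolding r_def[symmetric]
        using 0 1 hk bk by (intro mult_mono) linarith+
    qed
    have prod_ge: "(\<Prod>k<b. (1 + real k) * (1 - (s * (1 + real k))\<^sup>2 / 6) * (1 - h * real k))
        \<le> (\<Prod>k<b. (sin (t (Suc i) * (1 + real k)) / sin (t (Suc i))) * (1 - bt * real k))"
      by (intro prod_mono conjI ge less_imp_le[OF pos]) simp_all
    have l2: "l\<^sup>2 * \<kappa> \<le> bt\<^sup>2 * \<kappa>" using lh kappa by (intro mult_right_mono power_mono) auto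
    have "K \<le> bt\<^sup>2 * \<kappa> * (\<Prod>k<b. (sin (t (Suc i) * (1 + real k)) / sin (t (Suc i))) * (1 - bt * real k))"
      unfolding K_def using kappa pos by (intro mult_mono[OF l2 prod_ge _ less_imp_le[OF prod_pos]]) simp
    then have "p i * p (Suc i) ^ b * K \<le> p i * p (Suc i) ^ b * (bt\<^sup>2 * \<kappa> * (\<Prod>k<b. (sin (t (Suc i) * (1 + real k)) / sin (t (Suc i))) * (1 - bt * real k)))"
      using p_pos[of i] p_pos[of "Suc i"] by (intro mult_left_mono) auto
    also have "\<dots> \<le> p (Suc (Suc i))"
    proof (rule p_rec_lower)
      have "q (Suc J) \<le> q (Suc i)" using i by (intro q_mono) simp
      then show "2 \<le> q (Suc i)" using q2 by simp
    qed (use kappa i in auto)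
    finally show "p i * p (Suc i) ^ b * K \<le> p (Suc (Suc i))" .
  qed
qed

lemma F_low_ge: "p j * (bt\<^sup>2 * 1) \<le> F j (bt\<^sup>2 - 1)"
  using F_left[of "bt\<^sup>2 - 1" j] bt_sq by simp

lemma sinc_ratio_lower:
  assumes lh: "0 \<le> l" "l \<le> bt" "bt \<le> h" and s: "(3927 / 1250) * (h * (1 - l)) \<le> s"
  shows "1 - s\<^sup>2 / 6 \<le> sinc_ratio (Suc j)"
proof -
  have "t (Suc j) \<le> t 1"
    using power_decreasing[of "Suc 1" "Suc (Suc j)" bt] bt_pos bt_less_1 by (simp add: t_def gap_def)
  then have "t (Suc j) * (z - 1) \<le> t 1 * (z - 1)" using z_gt_1 by (intro mult_right_mono) auto
  also have "\<dots> = pi * (bt * (bt * z - bt))" by (simp add: t_def gap_def algebra_simps power2_eq_square)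
  also have "\<dots> = pi * (bt * (1 - bt))" by (simp add: bt_z)
  also have "\<dots> \<le> (3927 / 1250) * (h * (1 - l))"
    using lh bt_pos bt_less_1 pi_bounds by (intro mult_mono) auto
  finally have "t (Suc j) * (z - 1) \<le> s" using s by linarith
  moreover have "0 \<le> t (Suc j) * (z - 1)" using bt_pos z_gt_1 by (simp add: t_def gap_def)
  ultimately have "(t (Suc j) * (z - 1))\<^sup>2 \<le> s\<^sup>2" by (intro power_mono)
  then show ?thesis using sinc_ratio_ge[of j] by linarith
qed

text \<open>Linear estimates \<open>1 - 1 / x \<le> ln x \<le> x - 1\<close> replace the logarithms by a rational condition.\<close>

lemma p_le_from_threshold:
  assumes "ln (p (Suc j)) + bt * ln (p j) \<le> (1 + bt) * ln Q" and I: "0 < I" "I \<le> p j" and Q: "0 < Q"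
    and X: "0 < X" "bt * (Q / I - 1) \<le> 1 - Q / X"
  shows "p (Suc j) \<le> X"
proof -
  have "ln (Q / I) \<le> Q / I - 1" "ln (Q / X) \<le> Q / X - 1" using I Q X by (auto intro!: ln_le_minus_one)
  then have 1: "ln Q - ln I \<le> Q / I - 1" "ln Q - ln X \<le> Q / X - 1" using I Q X by (auto simp: ln_div)
  have "bt * (ln Q - ln I) \<le> bt * (Q / I - 1)" using 1 bt_pos by (intro mult_left_mono) auto
  also have "\<dots> \<le> ln X - ln Q" using X 1 by linarith
  finally have 2: "ln Q + bt * ln Q \<le> ln X + bt * ln I" by (simp add: algebra_simps)
  have "bt * ln I \<le> bt * ln (p j)" using I bt_pos by (intro mult_left_mono) auto
  moreover have "(1 + bt) * ln Q = ln Q + bt * ln Q" by (simp add: algebra_simps)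
  ultimately have "ln (p (Suc j)) \<le> ln X" using assms(1) 2 by linarith
  then show ?thesis using p_pos[of "Suc j"] X by simp
qed


lemma gain_simps:
  "gain a h xl xh 1 = 1" "gain a h xl xh (Suc 0) = 1"
  "gain a h xl xh 2 = a * ((1 + xl + 1) * (1 - h * (xh + 1)))"
  "gain a h xl xh 3 = a * ((1 + xl + 1) * (1 - h * (xh + 1))) * (a * ((1 + xl + 2) * (1 - h * (xh + 2))))"
  "gain a h xl xh 4 = a * ((1 + xl + 1) * (1 - h * (xh + 1))) * (a * ((1 + xl + 2) * (1 - h * (xh + 2))))
     * (a * ((1 + xl + 3) * (1 - h * (xh + 3))))"
proof -
  have "{1..<2::nat} = {1}" "{1..<3::nat} = {1, 2}" "{1..<4::nat} = {1, 2, 3}" by auto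
  then show "gain a h xl xh 1 = 1" "gain a h xl xh (Suc 0) = 1"
    "gain a h xl xh 2 = a * ((1 + xl + 1) * (1 - h * (xh + 1)))"
    "gain a h xl xh 3 = a * ((1 + xl + 1) * (1 - h * (xh + 1))) * (a * ((1 + xl + 2) * (1 - h * (xh + 2))))"
    "gain a h xl xh 4 = a * ((1 + xl + 1) * (1 - h * (xh + 1))) * (a * ((1 + xl + 2) * (1 - h * (xh + 2))))
       * (a * ((1 + xl + 3) * (1 - h * (xh + 3))))"
    by (simp_all add: gain_def mult.assoc)
qed

lemma topg_simps:
  "topg \<pi> l h 0 = 1"
  "topg \<pi> l h 1 = \<pi> * ((1 + l) * (1 - h * h))" "topg \<pi> l h (Suc 0) = \<pi> * ((1 + l) * (1 - h * h))"
  "topg \<pi> l h 2 = \<pi> * ((1 + l) * (1 - h * h)) * (\<pi> * ((1 + l + 1) * (1 - h * (h + 1))))"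
  "topg \<pi> l h 3 = \<pi> * ((1 + l) * (1 - h * h)) * (\<pi> * ((1 + l + 1) * (1 - h * (h + 1))))
     * (\<pi> * ((1 + l + 2) * (1 - h * (h + 2))))"
  "topg \<pi> l h 4 = \<pi> * ((1 + l) * (1 - h * h)) * (\<pi> * ((1 + l + 1) * (1 - h * (h + 1))))
     * (\<pi> * ((1 + l + 2) * (1 - h * (h + 2)))) * (\<pi> * ((1 + l + 3) * (1 - h * (h + 3))))"
proof -
  have "{..<1::nat} = {0}" "{..<2::nat} = {0, 1}" "{..<3::nat} = {0, 1, 2}" "{..<4::nat} = {0, 1, 2, 3}" by auto
  then show "topg \<pi> l h 0 = 1"
    "topg \<pi> l h 1 = \<pi> * ((1 + l) * (1 - h * h))" "topg \<pi> l h (Suc 0) = \<pi> * ((1 + l) * (1 - h * h))"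
    "topg \<pi> l h 2 = \<pi> * ((1 + l) * (1 - h * h)) * (\<pi> * ((1 + l + 1) * (1 - h * (h + 1))))"
    "topg \<pi> l h 3 = \<pi> * ((1 + l) * (1 - h * h)) * (\<pi> * ((1 + l + 1) * (1 - h * (h + 1))))
       * (\<pi> * ((1 + l + 2) * (1 - h * (h + 2))))"
    "topg \<pi> l h 4 = \<pi> * ((1 + l) * (1 - h * h)) * (\<pi> * ((1 + l + 1) * (1 - h * (h + 1))))
       * (\<pi> * ((1 + l + 2) * (1 - h * (h + 2)))) * (\<pi> * ((1 + l + 3) * (1 - h * (h + 3))))"
    by (simp_all add: topg_def mult.assoc)
qed

text \<open>The base of the induction behind \<open>p_ge_all\<close> needs two consecutive blocks; the second one follows from the first by the mean, so only one block has to be evaluated.\<close>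

lemma p_lower_bound:
  assumes low: "\<And>j. J \<le> j \<Longrightarrow> (1 + bt) * ln P \<le> ln (p (Suc j)) + bt * ln (p j)"
    and up: "\<And>j. J \<le> j \<Longrightarrow> ln (p (Suc j)) + bt * ln (p j) \<le> (1 + bt) * ln Q"
    and pos: "0 < P" "0 < Q" "0 < I" and base: "I \<le> p J" "p J \<le> X"
    and start: "I + bt * (X - P) \<le> P" and cond: "I + bt * (Q - I) \<le> P" and j: "J \<le> j"
  shows "I \<le> p j"
proof (rule p_ge_all[OF low up pos _ base(1) _ j])
  show "(1 - bt) * I + bt * Q \<le> P" using cond by (simp add: algebra_simps)
  show "I \<le> p (Suc J)"
    using start by (intro p_ge_from_threshold[OF low[OF order_refl] pos(1,3) base(2)]) (simp add: algebra_simps)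
qed

lemma p_eq_sudler: "p 0 = sudler 1 bt" "p 1 = sudler b bt"
  by (simp_all add: p_def q_1)

lemma sudler_0: "sudler 0 bt = 1" by (simp add: sudler_def)


lemma zm_le_lam: "zm m \<le> real m * lam"
proof -
  have "of_int \<lfloor>real m * bt\<rfloor> \<le> real m * bt" by (rule of_int_floor_le)
  then show ?thesis by (simp add: zm_def lam_z distrib_left)
qed

text \<open>\<open>x\<close> is chosen slightly below \<open>(d - 1) / 2\<close>: then \<open>(a - x) * (a + d - x)\<close> still dominates \<open>a * (a + 1)\<close>, and the sum over an arithmetic progression of step \<open>d\<close> telescopes almost without loss.\<close>

lemma telescoping_step:
  fixes a d x :: real
  assumes "0 < d" "x < a" "0 < a" "x * (d - x) \<le> a * (d - 2 * x - 1)"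
  shows "1 / d * (1 / (a - x) - 1 / (a + d - x)) \<le> 1 / (a * (a + 1))"
proof -
  have pos: "0 < a - x" "0 < a + d - x" using assms by linarith+
  then have "1 / d * (1 / (a - x) - 1 / (a + d - x)) = 1 / ((a - x) * (a + d - x))"
    using assms(1) by (simp add: field_simps)
  also have "\<dots> \<le> 1 / (a * (a + 1))"
  proof (rule divide_left_mono)
    show "a * (a + 1) \<le> (a - x) * (a + d - x)" using assms(4) by (simp add: algebra_simps)
    show "0 < (a - x) * (a + d - x) * (a * (a + 1))" using pos assms by simp
  qed simp
  finally show ?thesis .
qed

lemma tail_sum_ge:
  assumes d: "lam \<le> d" and x: "0 \<le> x" "2 * x + 1 \<le> d" "x < real (Suc M0) * d"
    and a: "x * (d - x) \<le> real (Suc M0) * d * (d - 2 * x - 1)" and M: "M0 \<le> M"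
  shows "1 / d * (1 / (real (Suc M0) * d - x) - 1 / (real (Suc M) * d - x))
    \<le> (\<Sum>m=Suc M0..M. 1 / (zm m * (zm m + 1)))"
  using M
proof (induction M rule: dec_induct)
  case base
  show ?case by simp
next
  case (step M)
  have d0: "0 < d" using d lam_pos by linarith
  define A where "A = real (Suc M) * d"
  have ge: "real (Suc M0) * d \<le> A" unfolding A_def using step d0 by (intro mult_right_mono) auto
  have "x * (d - x) \<le> A * (d - 2 * x - 1)"
    using a mult_right_mono[OF ge, of "d - 2 * x - 1"] x by linarith
  then have "1 / d * (1 / (A - x) - 1 / (A + d - x)) \<le> 1 / (A * (A + 1))"
    using d0 ge x by (intro telescoping_step) linarith+
  also have "\<dots> \<le> 1 / (zm (Suc M) * (zm (Suc M) + 1))"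
  proof (rule divide_left_mono)
    have z0: "0 < zm (Suc M)" by (rule zm_ge(4)) simp
    have "real (Suc M) * lam \<le> real (Suc M) * d" using d by (intro mult_left_mono) auto
    then have zA: "zm (Suc M) \<le> A" using zm_le_lam[of "Suc M"] unfolding A_def by linarith
    show "zm (Suc M) * (zm (Suc M) + 1) \<le> A * (A + 1)" using z0 zA by (intro mult_mono) auto
    show "0 < A * (A + 1) * (zm (Suc M) * (zm (Suc M) + 1))" using z0 zA by simp
  qed simp
  finally have 1: "1 / d * (1 / (A - x) - 1 / (A + d - x)) \<le> 1 / (zm (Suc M) * (zm (Suc M) + 1))" .
  have "A + d = real (Suc (Suc M)) * d" by (simp add: A_def algebra_simps)
  with 1 have 2: "1 / d * (1 / (real (Suc M) * d - x) - 1 / (real (Suc (Suc M)) * d - x)) \<le> 1 / (zm (Suc M) * (zm (Suc M) + 1))"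
    by (simp only: A_def)
  have "1 / d * (1 / (real (Suc M0) * d - x) - 1 / (real (Suc (Suc M)) * d - x)) =
      1 / d * (1 / (real (Suc M0) * d - x) - 1 / (real (Suc M) * d - x)) +
      1 / d * (1 / (real (Suc M) * d - x) - 1 / (real (Suc (Suc M)) * d - x))"
    by (simp only: right_diff_distrib)
  also have "\<dots> \<le> (\<Sum>m=Suc M0..M. 1 / (zm m * (zm m + 1))) + 1 / (zm (Suc M) * (zm (Suc M) + 1))"
    using step.IH 2 by (rule add_mono)
  also have "\<dots> = (\<Sum>m=Suc M0..Suc M. 1 / (zm m * (zm m + 1)))" using step by simp
  finally show ?case .
qed

text \<open>The factors beyond \<open>M0\<close> are combined by \<open>1 - y \<le> exp (- y)\<close>, so that a long product can be bounded without evaluating it.\<close>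

lemma shifts_prod_tail:
  assumes M: "M0 \<le> M" and y: "0 \<le> y"
    "y \<le> (\<Sum>l<b. real l * (1 + real l)) * (\<Sum>m=Suc M0..M. 1 / (zm m * (zm m + 1)))"
  shows "shifts_prod M \<le> shifts_prod M0 / (1 + y + y\<^sup>2 / 2)"
proof -
  define S where "S = (\<Sum>m=Suc M0..M. 1 / (zm m * (zm m + 1)))"
  define f where "f l m = 1 - real l * (1 + real l) / (zm m * (zm m + 1))" for l m
  have f0: "0 \<le> f l m" if "l < b" "1 \<le> m" for l m unfolding f_def by (rule pair_factor_bounds(1)[OF that])
  have split: "(\<Prod>m=1..M. f l m) = (\<Prod>m=1..M0. f l m) * (\<Prod>m=Suc M0..M. f l m)" for l
    using prod.ub_add_nat[of 1 M0 "f l" "M - M0"] M by simp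
  have tail: "(\<Prod>m=Suc M0..M. f l m) \<le> exp (- (real l * (1 + real l) * S))" if l: "l < b" for l
  proof -
    have "(\<Prod>m=Suc M0..M. f l m) \<le> (\<Prod>m=Suc M0..M. exp (- (real l * (1 + real l) * (1 / (zm m * (zm m + 1))))))"
    proof (rule prod_mono, rule conjI)
      fix m assume "m \<in> {Suc M0..M}"
      then show "0 \<le> f l m" using l by (intro f0) auto
      show "f l m \<le> exp (- (real l * (1 + real l) * (1 / (zm m * (zm m + 1)))))"
        using exp_ge_add_one_self[of "- (real l * (1 + real l) * (1 / (zm m * (zm m + 1))))"] by (simp add: f_def)
    qed
    also have "\<dots> = exp (- (real l * (1 + real l) * S))"
      by (simp add: exp_sum[symmetric] S_def sum_distrib_left sum_negf)
    finally show ?thesis .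
  qed
  have "shifts_prod M = (\<Prod>l<b. ((1 + real l) * (\<Prod>m=1..M0. f l m)) * (\<Prod>m=Suc M0..M. f l m))"
    unfolding shifts_prod_def f_def[symmetric] split by (simp add: mult.assoc)
  also have "\<dots> = shifts_prod M0 * (\<Prod>l<b. \<Prod>m=Suc M0..M. f l m)"
    unfolding shifts_prod_def f_def[symmetric] by (rule prod.distrib)
  also have "\<dots> \<le> shifts_prod M0 * (\<Prod>l<b. exp (- (real l * (1 + real l) * S)))"
  proof (intro mult_left_mono shifts_prod_nonneg prod_mono conjI)
    fix l assume "l \<in> {..<b}"
    then have l: "l < b" by simp
    show "0 \<le> (\<Prod>m=Suc M0..M. f l m)" using l by (intro prod_nonneg ballI f0) auto
    show "(\<Prod>m=Suc M0..M. f l m) \<le> exp (- (real l * (1 + real l) * S))" by (rule tail[OF l])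
  qed
  also have "(\<Prod>l<b. exp (- (real l * (1 + real l) * S))) = exp (- ((\<Sum>l<b. real l * (1 + real l)) * S))"
    by (simp add: exp_sum[symmetric] sum_distrib_right sum_negf)
  also have "shifts_prod M0 * \<dots> \<le> shifts_prod M0 * (1 / (1 + y + y\<^sup>2 / 2))"
  proof (rule mult_left_mono[OF _ shifts_prod_nonneg])
    have "exp (- ((\<Sum>l<b. real l * (1 + real l)) * S)) \<le> exp (- y)" using y(2) by (simp add: S_def)
    also have "\<dots> = 1 / exp y" by (simp add: exp_minus inverse_eq_divide)
    also have "\<dots> \<le> 1 / (1 + y + y\<^sup>2 / 2)"
      using exp_lower_Taylor_quadratic[OF y(1)] y(1) by (intro divide_left_mono) (auto intro!: mult_pos_pos add_pos_nonneg)
    finally show "exp (- ((\<Sum>l<b. real l * (1 + real l)) * S)) \<le> 1 / (1 + y + y\<^sup>2 / 2)" .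
  qed
  finally show ?thesis by simp
qed


section \<open>The five quotients\<close>

text \<open>With \<open>b = 1\<close> there are no digits strictly between \<open>0\<close> and \<open>b\<close>, and only \<open>F \<ge> 1\<close> on \<open>[- bt\<^sup>2, 0]\<close> has to be proved. This is tight: the strong form of \<open>F_left\<close> is needed there, and the recursion is used from level \<open>4\<close> on, where \<open>q 4 = 5\<close> allows two pair corrections in the last block.\<close>

lemma growth_one:
  assumes b1: "b = 1" shows "growth b"
proof -
  define l h :: real where "l = 6180 / 10000" and "h = 6181 / 10000"
  have l: "0 < l" "l \<le> bt" unfolding l_def by (simp, rule bt_ge, simp_all add: b1 power2_eq_square)
  have h: "bt \<le> h" "h < 1" "h \<le> 1" unfolding h_def by (rule bt_le, simp_all add: b1 power2_eq_square)
  have bt: "6180 / 10000 \<le> bt" "bt \<le> 6181 / 10000" using l h by (simp_all add: l_def h_def)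
  have q_rec: "q (Suc (Suc j)) = q (Suc j) + q j" for j using q_Suc_Suc[of j] b1 by simp
  have q1: "q (Suc 0) = 1" using q_1 b1 by (rule trans)
  have q: "q 2 = 2" "q 3 = 3" "q 4 = 5" "q 5 = 8" "q (Suc 4) = 8"
  proof -
    have q2: "q (Suc (Suc 0)) = 2" by (simp add: q_rec q1)
    have q3: "q (Suc (Suc (Suc 0))) = 3" by (simp add: q_rec q1)
    have q4: "q (Suc (Suc (Suc (Suc 0)))) = 5" by (simp add: q_rec q1)
    have q5: "q (Suc (Suc (Suc (Suc (Suc 0))))) = 8" by (simp add: q_rec q1)
    have eq: "2 = Suc (Suc 0)" "3 = Suc (Suc (Suc 0))" "4 = Suc (Suc (Suc (Suc 0)))" "5 = Suc (Suc (Suc (Suc (Suc 0))))"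
      by simp_all
    show "q 2 = 2" unfolding eq(1) using q2 by simp
    show "q 3 = 3" unfolding eq(2) using q3 by simp
    show "q 4 = 5" unfolding eq(3) using q4 by simp
    show "q 5 = 8" unfolding eq(4) using q5 by simp
    then show "q (Suc 4) = 8" by simp
  qed
  have s1: "1863 / 1000 \<le> sudler 1 bt \<and> sudler 1 bt \<le> 1866 / 1000"
    by (rule sudler_step[where N = 0 and A = "1" and B = "1" and u = "3819 / 10000" and v = "3820 / 10000" and n = 1])
       (use bt in \<open>simp_all add: sudler_0 sin_low_def sin_up_def power_divide\<close>)
  have s2: "2516 / 1000 \<le> sudler 2 bt \<and> sudler 2 bt \<le> 2523 / 1000"
    by (rule sudler_step[where N = 1 and A = "1863 / 1000" and B = "1866 / 1000" and u = "2360 / 10000" and v = "2362 / 10000" and n = 1])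
       (use bt s1 in \<open>simp_all add:  sin_low_def sin_up_def power_divide\<close>)
  have s3: "2223 / 1000 \<le> sudler 3 bt \<and> sudler 3 bt \<le> 2235 / 1000"
    by (rule sudler_step[where N = 2 and A = "2516 / 1000" and B = "2523 / 1000" and u = "1457 / 10000" and v = "1460 / 10000" and n = 2])
       (use bt s2 in \<open>simp_all add:  sin_low_def sin_up_def power_divide\<close>)
  have s4: "4428 / 1000 \<le> sudler 4 bt \<and> sudler 4 bt \<le> 4467 / 1000"
    by (rule sudler_step[where N = 3 and A = "2223 / 1000" and B = "2235 / 1000" and u = "4720 / 10000" and v = "4724 / 10000" and n = 2])
       (use bt s3 in \<open>simp_all add:  sin_low_def sin_up_def power_divide\<close>)
  have s5: "2470 / 1000 \<le> sudler 5 bt \<and> sudler 5 bt \<le> 2506 / 1000"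
    by (rule sudler_step[where N = 4 and A = "4428 / 1000" and B = "4467 / 1000" and u = "900 / 10000" and v = "905 / 10000" and n = 3])
       (use bt s4 in \<open>simp_all add:  sin_low_def sin_up_def power_divide\<close>)
  \<comment> \<open>Below level \<open>3\<close>, \<open>F_left\<close> suffices because \<open>1.62 * (1 - bt\<^sup>2) > 1\<close>.\<close>
  have p_low: "162 / 100 \<le> p j" if "j < 3" for j
  proof -
    have "j = 0 \<or> j = 1 \<or> j = 2" using that by auto
    then consider "j = 0" | "j = 1" | "j = 2" by blast
    then show ?thesis
    proof cases
      case 3
      have "p 2 = sudler 2 bt" by (simp add: p_def q)
      then show ?thesis using s2 3 by simp
    next
      case 1
      then show ?thesis using s1 p_eq_sudler(1) by simp
    next
      case 2
      have "p 1 = sudler 1 bt" by (simp add: p_def q1)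
      then show ?thesis using s1 2 by simp
    qed
  qed
  have p3: "154 / 100 \<le> p 3" using s3 by (simp add: p_def q)
  have p4: "154 / 100 \<le> p 4" "p 4 \<le> 308 / 100" using s5 by (simp_all add: p_def q)
  have l2: "3819 / 10000 \<le> bt\<^sup>2" "bt\<^sup>2 \<le> 3821 / 10000"
    using mult_mono[OF bt(1) bt(1)] mult_mono[OF bt(2) bt(2)] bt_pos by (simp_all add: power2_eq_square)
  have z: "z \<le> 16181 / 10000" using bt b1 unfolding z_def by simp
  have B: "shifts_prod 0 \<le> 1" unfolding shifts_prod_def by (simp add: b1)
  have E: "(\<Prod>m=1..2. 1 - 2 * cos (t j) * (bt\<^sup>2)\<^sup>2 / (zm m * (zm m + 1))
        - (bt\<^sup>2)\<^sup>2 * (1 - (bt\<^sup>2)\<^sup>2) / (zm m * (zm m + 1))\<^sup>2) \<le> 9152 / 10000" if j: "4 \<le> j" for j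
  proof -
    have tj: "0 \<le> t j" "t j \<le> 284 / 1000" using t_le[OF h(1,3), of 4 "284 / 1000" j] j bt_pos
      by (simp_all add: h_def power_divide t_def gap_def)
    have "(sin (t j / 2))\<^sup>2 \<le> (t j / 2)\<^sup>2"
      unfolding abs_le_square_iff[symmetric] by (rule abs_sin_x_le_abs_x)
    then have "1 - (t j)\<^sup>2 / 2 \<le> cos (t j)"
      using cos_double_sin[of "t j / 2"] by (simp add: power_divide)
    moreover have "(t j)\<^sup>2 \<le> (284 / 1000)\<^sup>2" using tj by (intro power_mono) auto
    ultimately have cos: "959 / 1000 \<le> cos (t j)" "cos (t j) \<le> 1" by (simp_all add: power2_eq_square)
    define e where "e = (bt\<^sup>2)\<^sup>2"
    have e: "1458 / 10000 \<le> e" "e \<le> 1461 / 10000"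
      using mult_mono[OF l2(1) l2(1)] mult_mono[OF l2(2) l2(2)] by (simp_all add: e_def power2_eq_square)
    have fac: "0 \<le> 1 - 2 * cos (t j) * e / Z - e * (1 - e) / Z\<^sup>2 \<and>
        1 - 2 * cos (t j) * e / Z - e * (1 - e) / Z\<^sup>2
          \<le> 1 - 2 * (959 / 1000) * (1458 / 10000) / Y - (1458 / 10000) * (8539 / 10000) / Y\<^sup>2"
      if Z: "1 \<le> Z" "Z \<le> Y" for Z Y
    proof
      have ce: "2 * (959 / 1000) * (1458 / 10000) \<le> 2 * cos (t j) * e" using cos e by (intro mult_mono) auto
      have ce': "2 * cos (t j) * e \<le> 2 * 1 * (1461 / 10000)" using cos e by (intro mult_mono) auto
      have ee: "(1458 / 10000) * (8539 / 10000) \<le> e * (1 - e)" using e by (intro mult_mono) auto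
      have ee': "e * (1 - e) \<le> (1461 / 10000) * 1" using e by (intro mult_mono) auto
      have ZY: "Z\<^sup>2 \<le> Y\<^sup>2" "1 \<le> Z\<^sup>2" using Z by (auto intro: power_mono one_le_power)
      have "2 * cos (t j) * e / Z \<le> 2 * 1 * (1461 / 10000) / 1"
        by (rule frac_le) (use ce' Z in auto)
      moreover have "e * (1 - e) / Z\<^sup>2 \<le> (1461 / 10000) * 1 / 1"
        by (rule frac_le) (use ee' ZY in auto)
      ultimately show "0 \<le> 1 - 2 * cos (t j) * e / Z - e * (1 - e) / Z\<^sup>2" by linarith
      have "2 * (959 / 1000) * (1458 / 10000) / Y \<le> 2 * cos (t j) * e / Z"
        by (rule frac_le) (use ce cos e Z in auto)
      moreover have "(1458 / 10000) * (8539 / 10000) / Y\<^sup>2 \<le> e * (1 - e) / Z\<^sup>2"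
        by (rule frac_le) (use ee e ZY in auto)
      ultimately show "1 - 2 * cos (t j) * e / Z - e * (1 - e) / Z\<^sup>2
          \<le> 1 - 2 * (959 / 1000) * (1458 / 10000) / Y - (1458 / 10000) * (8539 / 10000) / Y\<^sup>2" by linarith
    qed
    have Z: "1 \<le> zm m * (zm m + 1)" "zm m * (zm m + 1) \<le> zm_upper h m * (zm_upper h m + 1)" if "1 \<le> m" for m
    proof -
      have g: "1 \<le> zm m" "zm m \<le> zm_upper h m" using zm_ge(3)[OF that] zm_le[OF h(1)] by auto
      show "zm m * (zm m + 1) \<le> zm_upper h m * (zm_upper h m + 1)" using g by (intro mult_mono) auto
      have "1 * 1 \<le> zm m * (zm m + 1)" using g by (intro mult_mono) auto
      then show "1 \<le> zm m * (zm m + 1)" by simp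
    qed
    have "(\<Prod>m=1..2. 1 - 2 * cos (t j) * e / (zm m * (zm m + 1)) - e * (1 - e) / (zm m * (zm m + 1))\<^sup>2)
      \<le> (\<Prod>m=1..2. 1 - 2 * (959 / 1000) * (1458 / 10000) / (zm_upper h m * (zm_upper h m + 1))
          - (1458 / 10000) * (8539 / 10000) / (zm_upper h m * (zm_upper h m + 1))\<^sup>2)"
      by (intro prod_mono fac Z) auto
    also have "\<dots> \<le> 9152 / 10000"
    proof -
      have zm_upper: "zm_upper h m = real m * (1 + h) + of_int \<lfloor>real m * h\<rfloor>" for m
        unfolding zm_upper_def using b1 by simp
      have "{1..2::nat} = {1, 2}" by auto
      then show ?thesis unfolding zm_upper by (simp add: h_def power_divide)
    qed
    finally show ?thesis by (simp only: e_def)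
  qed
  have low: "(1 + bt) * ln (215 / 100) \<le> ln (p (Suc j)) + bt * ln (p j)" if "4 \<le> j" for j
  proof (rule threshold_lower[where J = 4 and N = 2 and M = 0 and E = "9152 / 10000" and B = 1 and s = "284 / 1000", OF _ _ h(1,2) _ _ _ _ E _ B])
  qed (use that q in \<open>simp_all add: h_def b1 power_divide\<close>)
  \<comment> \<open>\<open>236 / 1000\<close> is a lower bound for \<open>1 / (z * (z + 1))\<close>.\<close>
  have strong: "p j * (1 + x) * (1 + 236 / 1000 * (- x * (1 + x))) \<le> F j x" if "- 1 \<le> x" "x \<le> 0" "3 \<le> q j" for j x
  proof -
    have z1: "0 < z" using z_gt_1 by simp
    have "z * (z + 1) \<le> (16181 / 10000) * (26181 / 10000)" using z z1 by (intro mult_mono) auto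
    then have zz: "236 / 1000 * (z * (z + 1)) \<le> 1" by simp
    have "236 / 1000 \<le> 1 / (z * (z + 1))" using zz z1 by (subst pos_le_divide_eq) auto
    then have "236 / 1000 * (- x * (1 + x)) \<le> 1 / (z * (z + 1)) * (- x * (1 + x))"
      using that by (intro mult_right_mono mult_nonneg_nonneg) auto
    then have "p j * (1 + x) * (1 + 236 / 1000 * (- x * (1 + x))) \<le> p j * (1 + x) * (1 + (- x) * (1 + x) / (z * (z + 1)))"
      using that p_pos[of j] by (intro mult_left_mono mult_nonneg_nonneg) auto
    then show ?thesis using F_left_strong[OF that] by linarith
  qed
  have q3: "3 \<le> q j" if "3 \<le> j" for j
    using q_mono[OF that] q by simp
  have F_low: "p j * (bt\<^sup>2 * (1055 / 1000)) \<le> F j (bt\<^sup>2 - 1)" if "4 \<le> j" for j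
  proof -
    have "(3819 / 10000) * (6179 / 10000) \<le> bt\<^sup>2 * (1 - bt\<^sup>2)" using l2 by (intro mult_mono) auto
    moreover have "- (bt\<^sup>2 - 1) * (1 + (bt\<^sup>2 - 1)) = bt\<^sup>2 * (1 - bt\<^sup>2)" by (simp add: algebra_simps)
    ultimately have "1055 / 1000 \<le> 1 + 236 / 1000 * (- (bt\<^sup>2 - 1) * (1 + (bt\<^sup>2 - 1)))" by linarith
    then have "p j * bt\<^sup>2 * (1055 / 1000) \<le> p j * bt\<^sup>2 * (1 + 236 / 1000 * (- (bt\<^sup>2 - 1) * (1 + (bt\<^sup>2 - 1))))"
      using p_pos[of j] by (intro mult_left_mono) auto
    also have "\<dots> \<le> F j (bt\<^sup>2 - 1)"
      using strong[of "bt\<^sup>2 - 1" j] q3[of j] that l2 by simp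
    finally show ?thesis by (simp add: mult.assoc)
  qed
  have up: "ln (p (Suc j)) + bt * ln (p j) \<le> (1 + bt) * ln (25 / 10)" if "4 \<le> j" for j
  proof (rule threshold_upper[where J = 4 and \<kappa> = "1055 / 1000" and s = "176 / 1000", OF l h(1,3) _ _ F_low])
  qed (use that q in \<open>simp_all add: l_def h_def b1 power_divide\<close>)
  have p_tail: "154 / 100 \<le> p j" if "3 \<le> j" for j
  proof (cases "j = 3")
    case False
    then have "4 \<le> j" using that by simp
    show ?thesis
    proof (rule p_lower_bound[where X = "308 / 100", OF low up _ _ _ p4 _ _ \<open>4 \<le> j\<close>])
    qed (use bt in simp_all)
  qed (use p3 in simp)
  have H0: "1 \<le> F j x" if x: "- bt\<^sup>2 \<le> x" "x \<le> 0" for j x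
  proof (cases "j < 3")
    case True
    have "(162 / 100) * (6179 / 10000) \<le> p j * (1 + x)" using p_low[OF True] x l2 by (intro mult_mono) auto
    also have "\<dots> \<le> F j x" using x l2 by (intro F_left) auto
    finally show ?thesis by simp
  next
    case False
    then have j: "3 \<le> j" by simp
    have sq: "(6179 / 10000)\<^sup>2 \<le> (1 + x)\<^sup>2" using x l2 by (intro power_mono) auto
    have "- x * (38 / 100) \<le> - x * (1 + x)\<^sup>2" using sq x by (intro mult_left_mono) (auto simp: power2_eq_square)
    moreover have "(1 + x) * (1 + 236 / 1000 * (- x * (1 + x))) = 1 + x + 236 / 1000 * (- x * (1 + x)\<^sup>2)"
      by (simp add: power2_eq_square algebra_simps)
    ultimately have "652 / 1000 \<le> (1 + x) * (1 + 236 / 1000 * (- x * (1 + x)))" using x l2 by simp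
    then have "(154 / 100) * (652 / 1000) \<le> p j * ((1 + x) * (1 + 236 / 1000 * (- x * (1 + x))))"
      using p_tail[OF j] by (intro mult_mono) auto
    also have "\<dots> \<le> F j x" using strong[of x j] x l2 q3[OF j] by (simp add: mult.assoc)
    finally show ?thesis by simp
  qed
  have ok: blocks_ok
    unfolding blocks_ok_def
    by (intro conjI allI impI; rule partial_block_bounds[OF H0]) (auto simp: b1)
  have C: "215 / 100 \<le> C_const b"
    by (rule p_limit_ge[OF low _ p_tendsto(3,2)]) simp_all
  show ?thesis
    by (rule growth_from_bounds[where \<pi> = "21 / 10" and l = l and h = h, OF ok])
       (use C l h in \<open>simp_all add: b1 l_def h_def power_divide\<close>)
qed

end

lemma growth_1: "growth 1"
proof -
  interpret metallic 1 by unfold_locales simp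
  show ?thesis by (rule growth_one) simp
qed

text \<open>\<open>191 / 100\<close> and \<open>228 / 100\<close> bound the fixed point of the recursion for the blocks from both sides; all later inequalities use the slightly smaller \<open>19 / 10\<close> for the limit.\<close>

lemma growth_2: "growth 2"
proof -
  interpret metallic 2 by unfold_locales simp
  define l h :: real where "l = 4142 / 10000" and "h = 4143 / 10000"
  have l: "0 < l" "l \<le> bt" unfolding l_def by (simp, rule bt_ge, simp_all add: power2_eq_square)
  have h: "bt \<le> h" "h < 1" "h \<le> 1" "h \<le> 1 / 2" unfolding h_def by (rule bt_le, simp_all add: power2_eq_square)
  have bt: "4142 / 10000 \<le> bt" "bt \<le> 4143 / 10000" using l h by (simp_all add: l_def h_def)
  have q1: "q (Suc 0) = 2" by (rule q_1)
  have q2: "q (Suc (Suc 0)) = 5" using q_Suc_Suc[of 0] q1 by simp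
  note q = q1 q2
  have s1: "19 / 10 \<le> sudler 1 bt \<and> sudler 1 bt \<le> 2"
    by (rule sudler_step[where N = 0 and A = 1 and B = 1 and u = "4142 / 10000" and v = "4143 / 10000" and n = 0])
       (use bt in \<open>simp_all add: sudler_0 sin_low_def sin_up_def power_divide\<close>)
  have s2: "19 / 10 \<le> sudler 2 bt \<and> sudler 2 bt \<le> 22 / 10"
    by (rule sudler_step[where N = 1 and A = "19 / 10" and B = 2 and u = "1714 / 10000" and v = "1716 / 10000" and n = 1])
       (use bt s1 in \<open>simp_all add: sin_low_def sin_up_def power_divide\<close>)
  have p01: "19 / 10 \<le> p 0" "19 / 10 \<le> p 1" "p 1 \<le> 22 / 10"
    unfolding p_eq_sudler using s1 s2 by simp_all
  have B: "shifts_prod 2 \<le> 1408 / 1000"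
  proof (rule order_trans[OF shifts_prod_le[OF h(1)]])
    have "{..<2::nat} = {0, 1}" "{1..2::nat} = {1, 2}" by auto
    then show "(\<Prod>l<2. (1 + real l) * (\<Prod>m=1..2. 1 - real l * (1 + real l) / (zm_upper h m * (zm_upper h m + 1)))) \<le> 1408 / 1000"
      by (simp add: zm_upper_def h_def)
  qed
  have low: "(1 + bt) * ln (191 / 100) \<le> ln (p (Suc j)) + bt * ln (p j)" if "1 \<le> j" for j
  proof (rule threshold_lower[where J = 1 and N = 0 and M = 2 and E = 1 and B = "1408 / 1000" and s = "54 / 100", OF _ _ h(1,2) _ _ _ _ _ _ B])
  qed (use that q in \<open>simp_all add: h_def power_divide\<close>)
  have up: "ln (p (Suc j)) + bt * ln (p j) \<le> (1 + bt) * ln (228 / 100)" if "1 \<le> j" for j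
  proof (rule threshold_upper[where J = 1 and \<kappa> = 1 and s = "2235 / 10000", OF l h(1,3) _ _ F_low_ge])
    have "{..<2::nat} = {0, 1}" by auto
    then show "1 \<le> l\<^sup>2 * 1 * (\<Prod>k<2. (1 + real k) * (1 - (2235 / 10000 * (1 + real k))\<^sup>2 / 6) * (1 - h * real k)) * (228 / 100) ^ 2"
      by (simp add: l_def h_def power2_eq_square)
  qed (use that q in \<open>simp_all add: h_def power_divide\<close>)
  have p_Suc_ge: "16 / 10 \<le> p (Suc j)" for j
    by (rule p_lower_bound[where J = 1 and X = "22 / 10", OF low up]) (use p01 bt in simp_all)
  have p_ge: "16 / 10 \<le> p j" for j
    using p_Suc_ge[of "j - 1"] p01 by (cases j) simp_all
  have C: "191 / 100 \<le> C_const 2"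
    by (rule p_limit_ge[OF low _ p_tendsto(3,2)]) simp_all
  have ok: blocks_ok
  proof (rule blocks_ok_from_bounds[where i = "16 / 10" and I = "16 / 10" and W = "256 / 100" and a = 0 and Y = 1,
      OF _ less_imp_le[OF l(1)] l(2) h(1) h(4)])
    show "256 / 100 \<le> p (Suc j) * p j" for j
      using mult_mono[OF p_ge[of "Suc j"] p_ge[of j]] p_pos[of "Suc j"] by simp
    show "0 \<le> p (Suc j) * sinc_ratio (Suc j)" for j using p_pos[of "Suc j"] sinc_ratio_pos[of j] by simp
    fix c :: nat assume c: "1 \<le> c" "c < 2"
    then have "c = 1" by simp
    then show "fits 0 (16 / 10) (256 / 100) l h (- h\<^sup>2) 0 c (16 / 10 * (1 - h\<^sup>2)) \<and> fits 0 (16 / 10) (256 / 100) l h 0 h c (16 / 10)"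
      by (simp add: fits_def gain_simps l_def h_def power_divide)
  qed (use p_ge in \<open>auto simp: l_def h_def power_divide\<close>)
  have two: "\<forall>\<^sub>F i in sequentially. ratio_ok 1 i 1 0"
  proof -
    have "19 / 10 < C_const 2" using C by simp
    from eventually_good[OF p_tendsto(3) this]
    obtain J where J: "\<And>i. J \<le> i \<Longrightarrow> good (19 / 10) i" by (auto simp: eventually_sequentially)
    show ?thesis
      by (rule ratio_ok_two[OF refl ok J _ less_imp_le[OF l(1)] l(2) h(1), where Dl = "1 - h - h ^ 3" and D = "1 - h - h\<^sup>2"])
         (simp_all add: wins_def gain_simps topg_simps l_def h_def power_divide)
  qed
  have c1: "c = 1" if "1 \<le> c" "c < 2" for c :: nat using that by simp
  have c0: "c = 0" if "c + 2 \<le> 2" for c :: nat using that by simp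
  show ?thesis
  proof (rule growth_from_bounds[where \<pi> = "19 / 10" and l = l and h = h, OF ok])
    show "fits (19 / 10) (19 / 10) (19 / 10 * (19 / 10)) l h 0 0 c 1" if "1 \<le> c" "c < 2" for c
      using c1[OF that] by (simp add: fits_def gain_simps l_def h_def power_divide)
    show "wins (19 / 10) l h (- (h ^ 4)) (h ^ 3) c (19 / 10 * (1 - h ^ 4)) (1 - h\<^sup>2)" if "1 \<le> c" "c < 2" for c
      using c1[OF that] by (simp add: wins_def gain_simps l_def h_def power_divide)
    show "h * (h + real c) \<le> 1" if "c < 2" for c
    proof -
      have "h * (h + real c) \<le> h * (h + 1)" using that h_def by (intro mult_left_mono) auto
      then show ?thesis by (simp add: h_def)
    qed
    show "0 < 1 - real c * h - (real c' + 1) * h\<^sup>2 \<and>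
      wins (19 / 10) l h (- h\<^sup>2 - real c * h) (- l\<^sup>2 - real c * l) c'
        (topg (19 / 10) l h c * (19 / 10 * (1 + (- h\<^sup>2 - real c * h)))) (1 - real c * h - (real c' + 1) * h\<^sup>2)"
      if "c + 2 \<le> 2" "1 \<le> c'" "c' < 2" for c c'
      using c0[OF that(1)] c1[OF that(2,3)] by (simp add: wins_def gain_simps topg_simps l_def h_def power_divide)
    show "0 < 1 - (real c + 1) * h \<and> - 1 \<le> - h\<^sup>2 - real c * h \<and> h * ((- l\<^sup>2 - real c * l) + real (2 - 1)) \<le> 1 \<and>
      1 < topg (19 / 10) l h c * (19 / 10 * (1 + (- h\<^sup>2 - real c * h))) *
        gain (19 / 10) h (- h\<^sup>2 - real c * h) (- l\<^sup>2 - real c * l) (2 - 1) * (19 / 10) * (1 - (real c + 1) * h)"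
      if "c + 2 \<le> 2" for c
      using c0[OF that] by (simp add: gain_simps topg_simps l_def h_def power_divide)
  qed (use C l h two in \<open>simp_all add: l_def h_def power_divide\<close>)
qed

text \<open>The shifts to the left of \<open>- bt\<^sup>2\<close> are divided at \<open>- 39 / 100\<close>; on the whole interval at once, the rational bounds for the digit \<open>2\<close> would be too coarse.\<close>

lemma growth_3: "growth 3"
proof -
  interpret metallic 3 by unfold_locales simp
  define l h :: real where "l = 3027 / 10000" and "h = 3028 / 10000"
  have l: "0 < l" "l \<le> bt" unfolding l_def by (simp, rule bt_ge, simp_all add: power2_eq_square)
  have h: "bt \<le> h" "h < 1" "h \<le> 1" unfolding h_def by (rule bt_le, simp_all add: power2_eq_square)
  have bt: "3027 / 10000 \<le> bt" "bt \<le> 3028 / 10000" using l h by (simp_all add: l_def h_def)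
  have q1: "q (Suc 0) = 3" by (rule q_1)
  have q2: "q (Suc (Suc 0)) = 10" using q_Suc_Suc[of 0] q1 by simp
  note q = q1 q2
  have s1: "1627 / 1000 \<le> sudler 1 bt \<and> sudler 1 bt \<le> 1629 / 1000"
    by (rule sudler_step[where N = 0 and A = "1" and B = "1" and u = "3027 / 10000" and v = "3028 / 10000" and n = 0])
       (use bt in \<open>simp_all add: sudler_0 sin_low_def sin_up_def power_divide\<close>)
  have s2: "3076 / 1000 \<le> sudler 2 bt \<and> sudler 2 bt \<le> 3084 / 1000"
    by (rule sudler_step[where N = 1 and A = "1627 / 1000" and B = "1629 / 1000" and u = "3944 / 10000" and v = "3946 / 10000" and n = 1])
       (use bt s1 in \<open>simp_all add:  sin_low_def sin_up_def power_divide\<close>)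
  have s3: "1746 / 1000 \<le> sudler 3 bt \<and> sudler 3 bt \<le> 1757 / 1000"
    by (rule sudler_step[where N = 2 and A = "3076 / 1000" and B = "3084 / 1000" and u = "916 / 10000" and v = "919 / 10000" and n = 1])
       (use bt s2 in \<open>simp_all add:  sin_low_def sin_up_def power_divide\<close>)
  have p0: "15 / 10 \<le> p 0" unfolding p_eq_sudler using s1 by simp
  have p1: "15 / 10 \<le> p 1" "p 1 \<le> 18 / 10" unfolding p_eq_sudler using s3 by simp_all
  have B: "shifts_prod 4 \<le> 22491 / 10000"
  proof (rule order_trans[OF shifts_prod_le[OF h(1)]])
    have "{..<3::nat} = {0, 1, 2}" "{1..4::nat} = {1, 2, 3, 4}" by auto
    then show "(\<Prod>l<3. (1 + real l) * (\<Prod>m=1..4. 1 - real l * (1 + real l) / (zm_upper h m * (zm_upper h m + 1)))) \<le> 22491 / 10000"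
      by (simp add: zm_upper_def h_def)
  qed
  have low: "(1 + bt) * ln (1668 / 1000) \<le> ln (p (Suc j)) + bt * ln (p j)" if "1 \<le> j" for j
  proof (rule threshold_lower[where J = 1 and N = 0 and M = 4 and E = 1 and B = "22491 / 10000" and s = "289 / 1000", OF _ _ h(1,2) _ _ _ _ _ _ B])
  qed (use that q in \<open>simp_all add: h_def power_divide\<close>)
  have up: "ln (p (Suc j)) + bt * ln (p j) \<le> (1 + bt) * ln (189 / 100)" if "1 \<le> j" for j
  proof (rule threshold_upper[where J = 1 and \<kappa> = 1 and s = "88 / 1000", OF l h(1,3) _ _ F_low_ge])
    have "{..<3::nat} = {0, 1, 2}" by auto
    then show "1 \<le> l\<^sup>2 * 1 * (\<Prod>k<3. (1 + real k) * (1 - (88 / 1000 * (1 + real k))\<^sup>2 / 6) * (1 - h * real k)) * (189 / 100) ^ 3"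
      by (simp add: l_def h_def power2_eq_square power_divide)
  qed (use that q in \<open>simp_all add: h_def power_divide\<close>)
  have p_Suc_ge: "15 / 10 \<le> p (Suc j)" for j
    by (rule p_lower_bound[where J = 1 and X = "18 / 10", OF low up]) (use p1 bt in simp_all)
  have p_ge: "15 / 10 \<le> p j" for j
    using p_Suc_ge[of "j - 1"] p0 by (cases j) simp_all
  have W: "225 / 100 \<le> p (Suc j) * p j" for j
    using mult_mono[OF p_ge[of "Suc j"] p_ge[of j]] p_pos[of "Suc j"] by simp
  have C: "1668 / 1000 \<le> C_const 3"
    by (rule p_limit_ge[OF low _ p_tendsto(3,2)]) simp_all
  have c1: "c = 1 \<or> c = 2" if "1 \<le> c" "c < 3" for c :: nat using that by arith
  have c0: "c = 0 \<or> c = 1" if "c + 2 \<le> 3" for c :: nat using that by arith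
  have ok: blocks_ok
  proof (rule blocks_ok_from_bounds[where i = "15 / 10" and I = "15 / 10" and W = "225 / 100" and a = "1389 / 1000" and Y = "1",
      OF _ less_imp_le[OF l(1)] l(2) h(1)])
    show "225 / 100 \<le> p (Suc j) * p j" for j by (rule W)
    have "926 / 1000 \<le> sinc_ratio (Suc j)" for j
      by (rule order_trans[OF _ sinc_ratio_lower[OF less_imp_le[OF l(1)] l(2) h(1), of "664 / 1000"]]) (simp_all add: l_def h_def power_divide)
    then show "1389 / 1000 \<le> p (Suc j) * sinc_ratio (Suc j)" for j
      using mult_mono[OF p_Suc_ge[of j], of "926 / 1000" "sinc_ratio (Suc j)"] p_pos[of "Suc j"] by simp
    show "fits (1389 / 1000) (15 / 10) (225 / 100) l h (- h\<^sup>2) 0 c (15 / 10 * (1 - h\<^sup>2)) \<and> fits (1389 / 1000) (15 / 10) (225 / 100) l h 0 h c (15 / 10)"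
      if "1 \<le> c" "c < 3" for c
      using c1[OF that] by (elim disjE) (simp_all add: fits_def gain_simps l_def h_def power_divide)
    show "\<exists>xl xh. xl \<le> x \<and> x \<le> xh \<and> fits (1389 / 1000) (15 / 10) (225 / 100) l h xl xh c 1"
      if c: "2 \<le> c" "c < 3" and x: "l - 1 \<le> x" "x \<le> - l\<^sup>2" for c x
    proof -
      have c': "c = 2" using c by arith
      have f0: "fits (1389 / 1000) (15 / 10) (225 / 100) l h (l - 1) (- (39 / 100)) c 1"
        using c' by (simp add: fits_def gain_simps l_def h_def power_divide)
      have f1: "fits (1389 / 1000) (15 / 10) (225 / 100) l h (- (39 / 100)) (- l\<^sup>2) c 1"
        using c' by (simp add: fits_def gain_simps l_def h_def power_divide)
      show ?thesis using x f0 f1 by (meson linear)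
    qed
  qed (use p_Suc_ge p0 in \<open>auto simp: l_def h_def power_divide\<close>)
  show ?thesis
  proof (rule growth_from_bounds[where \<pi> = "1665 / 1000" and l = l and h = h, OF ok])
    show "fits (1665 / 1000) (1665 / 1000) (1665 / 1000 * (1665 / 1000)) l h 0 0 c 1" if "1 \<le> c" "c < 3" for c
      using c1[OF that] by (elim disjE) (simp_all add: fits_def gain_simps l_def h_def power_divide)
    show "wins (1665 / 1000) l h (- (h ^ 4)) (h ^ 3) c (1665 / 1000 * (1 - h ^ 4)) (1 - h\<^sup>2)" if "1 \<le> c" "c < 3" for c
      using c1[OF that] by (elim disjE) (simp_all add: wins_def gain_simps l_def h_def power_divide)
    show "h * (h + real c) \<le> 1" if "c < 3" for c
    proof -
      have "h * (h + real c) \<le> h * (h + 2)" using that h_def by (intro mult_left_mono) auto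
      then show ?thesis by (simp add: h_def)
    qed
    show "0 < 1 - real c * h - h\<^sup>2 \<and> 1 < topg (1665 / 1000) l h c * (1 - real c * h - h\<^sup>2)"
      if "1 \<le> c" "c < 3" for c
      using c1[OF that] by (elim disjE) (simp_all add: topg_simps l_def h_def power_divide)
    show "0 < 1 - real c * h - (real c' + 1) * h\<^sup>2 \<and>
      wins (1665 / 1000) l h (- h\<^sup>2 - real c * h) (- l\<^sup>2 - real c * l) c'
        (topg (1665 / 1000) l h c * (1665 / 1000 * (1 + (- h\<^sup>2 - real c * h)))) (1 - real c * h - (real c' + 1) * h\<^sup>2)"
      if "c + 2 \<le> 3" "1 \<le> c'" "c' < 3" for c c'
      using c0[OF that(1)] c1[OF that(2,3)] by (elim disjE) (simp_all add: wins_def gain_simps topg_simps l_def h_def power_divide)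
    show "0 < 1 - (real c + 1) * h \<and> - 1 \<le> - h\<^sup>2 - real c * h \<and> h * ((- l\<^sup>2 - real c * l) + real (3 - 1)) \<le> 1 \<and>
      1 < topg (1665 / 1000) l h c * (1665 / 1000 * (1 + (- h\<^sup>2 - real c * h))) *
        gain (1665 / 1000) h (- h\<^sup>2 - real c * h) (- l\<^sup>2 - real c * l) (3 - 1) * (1665 / 1000) * (1 - (real c + 1) * h)"
      if "c + 2 \<le> 3" for c
      using c0[OF that] by (elim disjE) (simp_all add: gain_simps topg_simps l_def h_def power_divide)
  qed (use C l h  in \<open>simp_all add: l_def h_def power_divide\<close>)
qed

text \<open>As for \<open>b = 3\<close>, with the dividing point \<open>- 41 / 100\<close>.\<close>

lemma growth_4: "growth 4"
proof -
  interpret metallic 4 by unfold_locales simp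
  define l h :: real where "l = 2360 / 10000" and "h = 2361 / 10000"
  have l: "0 < l" "l \<le> bt" unfolding l_def by (simp, rule bt_ge, simp_all add: power2_eq_square)
  have h: "bt \<le> h" "h < 1" "h \<le> 1" unfolding h_def by (rule bt_le, simp_all add: power2_eq_square)
  have bt: "2360 / 10000 \<le> bt" "bt \<le> 2361 / 10000" using l h by (simp_all add: l_def h_def)
  have q1: "q (Suc 0) = 4" by (rule q_1)
  have q2: "q (Suc (Suc 0)) = 17" using q_Suc_Suc[of 0] q1 by simp
  note q = q1 q2
  have s1: "1350 / 1000 \<le> sudler 1 bt \<and> sudler 1 bt \<le> 1352 / 1000"
    by (rule sudler_step[where N = 0 and A = "1" and B = "1" and u = "2360 / 10000" and v = "2361 / 10000" and n = 0])
       (use bt in \<open>simp_all add: sudler_0 sin_low_def sin_up_def power_divide\<close>)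
  have s2: "2689 / 1000 \<le> sudler 2 bt \<and> sudler 2 bt \<le> 2702 / 1000"
    by (rule sudler_step[where N = 1 and A = "1350 / 1000" and B = "1352 / 1000" and u = "4720 / 10000" and v = "4722 / 10000" and n = 0])
       (use bt s1 in \<open>simp_all add:  sin_low_def sin_up_def power_divide\<close>)
  have s3: "4266 / 1000 \<le> sudler 3 bt \<and> sudler 3 bt \<le> 4292 / 1000"
    by (rule sudler_step[where N = 2 and A = "2689 / 1000" and B = "2702 / 1000" and u = "2917 / 10000" and v = "2920 / 10000" and n = 1])
       (use bt s2 in \<open>simp_all add:  sin_low_def sin_up_def power_divide\<close>)
  have s4: "1482 / 1000 \<le> sudler 4 bt \<and> sudler 4 bt \<le> 1503 / 1000"
    by (rule sudler_step[where N = 3 and A = "4266 / 1000" and B = "4292 / 1000" and u = "556 / 10000" and v = "560 / 10000" and n = 1])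
       (use bt s3 in \<open>simp_all add:  sin_low_def sin_up_def power_divide\<close>)
  have p0: "134 / 100 \<le> p 0" unfolding p_eq_sudler using s1 by simp
  have p1: "134 / 100 \<le> p 1" "p 1 \<le> 16 / 10" unfolding p_eq_sudler using s4 by simp_all
  have B: "shifts_prod 8 \<le> 42037 / 10000"
  proof (rule order_trans[OF shifts_prod_le[OF h(1)]])
    have "{..<4::nat} = {0, 1, 2, 3}" "{1..8::nat} = {1, 2, 3, 4, 5, 6, 7, 8}" by auto
    then show "(\<Prod>l<4. (1 + real l) * (\<Prod>m=1..8. 1 - real l * (1 + real l) / (zm_upper h m * (zm_upper h m + 1)))) \<le> 42037 / 10000"
      by (simp add: zm_upper_def h_def)
  qed
  have low: "(1 + bt) * ln (143 / 100) \<le> ln (p (Suc j)) + bt * ln (p j)" if "1 \<le> j" for j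
  proof (rule threshold_lower[where J = 1 and N = 0 and M = 8 and E = 1 and B = "42037 / 10000" and s = "176 / 1000", OF _ _ h(1,2) _ _ _ _ _ _ B])
  qed (use that q in \<open>simp_all add: h_def power_divide\<close>)
  have up: "ln (p (Suc j)) + bt * ln (p j) \<le> (1 + bt) * ln (1592 / 1000)" if "1 \<le> j" for j
  proof (rule threshold_upper[where J = 1 and \<kappa> = 1 and s = "42 / 1000", OF l h(1,3) _ _ F_low_ge])
    have "{..<4::nat} = {0, 1, 2, 3}" by auto
    then show "1 \<le> l\<^sup>2 * 1 * (\<Prod>k<4. (1 + real k) * (1 - (42 / 1000 * (1 + real k))\<^sup>2 / 6) * (1 - h * real k)) * (1592 / 1000) ^ 4"
      by (simp add: l_def h_def power2_eq_square power_divide)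
  qed (use that q in \<open>simp_all add: h_def power_divide\<close>)
  have p_Suc_ge: "134 / 100 \<le> p (Suc j)" for j
    by (rule p_lower_bound[where J = 1 and X = "16 / 10", OF low up]) (use p1 bt in simp_all)
  have p_ge: "134 / 100 \<le> p j" for j
    using p_Suc_ge[of "j - 1"] p0 by (cases j) simp_all
  have W: "1795 / 1000 \<le> p (Suc j) * p j" for j
    using mult_mono[OF p_ge[of "Suc j"] p_ge[of j]] p_pos[of "Suc j"] by simp
  have C: "143 / 100 \<le> C_const 4"
    by (rule p_limit_ge[OF low _ p_tendsto(3,2)]) simp_all
  have c1: "c = 1 \<or> c = 2 \<or> c = 3" if "1 \<le> c" "c < 4" for c :: nat using that by arith
  have c0: "c = 0 \<or> c = 1 \<or> c = 2" if "c + 2 \<le> 4" for c :: nat using that by arith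
  have ok: blocks_ok
  proof (rule blocks_ok_from_bounds[where i = "134 / 100" and I = "134 / 100" and W = "1795 / 1000" and a = "12676 / 10000" and Y = "1",
      OF _ less_imp_le[OF l(1)] l(2) h(1)])
    show "1795 / 1000 \<le> p (Suc j) * p j" for j by (rule W)
    have "946 / 1000 \<le> sinc_ratio (Suc j)" for j
      by (rule order_trans[OF _ sinc_ratio_lower[OF less_imp_le[OF l(1)] l(2) h(1), of "567 / 1000"]]) (simp_all add: l_def h_def power_divide)
    then show "12676 / 10000 \<le> p (Suc j) * sinc_ratio (Suc j)" for j
      using mult_mono[OF p_Suc_ge[of j], of "946 / 1000" "sinc_ratio (Suc j)"] p_pos[of "Suc j"] by simp
    show "fits (12676 / 10000) (134 / 100) (1795 / 1000) l h (- h\<^sup>2) 0 c (134 / 100 * (1 - h\<^sup>2)) \<and> fits (12676 / 10000) (134 / 100) (1795 / 1000) l h 0 h c (134 / 100)"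
      if "1 \<le> c" "c < 4" for c
      using c1[OF that] by (elim disjE) (simp_all add: fits_def gain_simps l_def h_def power_divide)
    show "\<exists>xl xh. xl \<le> x \<and> x \<le> xh \<and> fits (12676 / 10000) (134 / 100) (1795 / 1000) l h xl xh c 1"
      if c: "2 \<le> c" "c < 4" and x: "l - 1 \<le> x" "x \<le> - l\<^sup>2" for c x
    proof -
      have c': "c = 2 \<or> c = 3" using c by arith
      have f0: "fits (12676 / 10000) (134 / 100) (1795 / 1000) l h (l - 1) (- (41 / 100)) c 1"
        using c' by (elim disjE) (simp_all add: fits_def gain_simps l_def h_def power_divide)
      have f1: "fits (12676 / 10000) (134 / 100) (1795 / 1000) l h (- (41 / 100)) (- l\<^sup>2) c 1"
        using c' by (elim disjE) (simp_all add: fits_def gain_simps l_def h_def power_divide)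
      show ?thesis using x f0 f1 by (meson linear)
    qed
  qed (use p_Suc_ge p0 in \<open>auto simp: l_def h_def power_divide\<close>)
  show ?thesis
  proof (rule growth_from_bounds[where \<pi> = "1425 / 1000" and l = l and h = h, OF ok])
    show "fits (1425 / 1000) (1425 / 1000) (1425 / 1000 * (1425 / 1000)) l h 0 0 c 1" if "1 \<le> c" "c < 4" for c
      using c1[OF that] by (elim disjE) (simp_all add: fits_def gain_simps l_def h_def power_divide)
    show "wins (1425 / 1000) l h (- (h ^ 4)) (h ^ 3) c (1425 / 1000 * (1 - h ^ 4)) (1 - h\<^sup>2)" if "1 \<le> c" "c < 4" for c
      using c1[OF that] by (elim disjE) (simp_all add: wins_def gain_simps l_def h_def power_divide)
    show "h * (h + real c) \<le> 1" if "c < 4" for c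
    proof -
      have "h * (h + real c) \<le> h * (h + 3)" using that h_def by (intro mult_left_mono) auto
      then show ?thesis by (simp add: h_def)
    qed
    show "0 < 1 - real c * h - h\<^sup>2 \<and> 1 < topg (1425 / 1000) l h c * (1 - real c * h - h\<^sup>2)"
      if "1 \<le> c" "c < 4" for c
      using c1[OF that] by (elim disjE) (simp_all add: topg_simps l_def h_def power_divide)
    show "0 < 1 - real c * h - (real c' + 1) * h\<^sup>2 \<and>
      wins (1425 / 1000) l h (- h\<^sup>2 - real c * h) (- l\<^sup>2 - real c * l) c'
        (topg (1425 / 1000) l h c * (1425 / 1000 * (1 + (- h\<^sup>2 - real c * h)))) (1 - real c * h - (real c' + 1) * h\<^sup>2)"
      if "c + 2 \<le> 4" "1 \<le> c'" "c' < 4" for c c'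
      using c0[OF that(1)] c1[OF that(2,3)] by (elim disjE) (simp_all add: wins_def gain_simps topg_simps l_def h_def power_divide)
    show "0 < 1 - (real c + 1) * h \<and> - 1 \<le> - h\<^sup>2 - real c * h \<and> h * ((- l\<^sup>2 - real c * l) + real (4 - 1)) \<le> 1 \<and>
      1 < topg (1425 / 1000) l h c * (1425 / 1000 * (1 + (- h\<^sup>2 - real c * h))) *
        gain (1425 / 1000) h (- h\<^sup>2 - real c * h) (- l\<^sup>2 - real c * l) (4 - 1) * (1425 / 1000) * (1 - (real c + 1) * h)"
      if "c + 2 \<le> 4" for c
      using c0[OF that] by (elim disjE) (simp_all add: gain_simps topg_simps l_def h_def power_divide)
  qed (use C l h  in \<open>simp_all add: l_def h_def power_divide\<close>)
qed

text \<open>Here the digits \<open>1, 1\<close> force the bound for the limit to exceed \<open>1.2417\<close>. The recursion is therefore used twice: from level \<open>1\<close> on, with ten factors, to bound \<open>p 2\<close>, and then from level \<open>2\<close> on, with \<open>67\<close> factors, the largest number with \<open>2 * 67 < q 3 = 135\<close>.\<close>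

lemma growth_5: "growth 5"
proof -
  interpret metallic 5 by unfold_locales simp
  define l h :: real where "l = 1925 / 10000" and "h = 1926 / 10000"
  have l: "0 < l" "l \<le> bt" unfolding l_def by (simp, rule bt_ge, simp_all add: power2_eq_square)
  have h: "bt \<le> h" "h < 1" "h \<le> 1" unfolding h_def by (rule bt_le, simp_all add: power2_eq_square)
  have bt: "1925 / 10000 \<le> bt" "bt \<le> 1926 / 10000" using l h by (simp_all add: l_def h_def)
  have q1: "q (Suc 0) = 5" by (rule q_1)
  have q2: "q (Suc (Suc 0)) = 26" using q_Suc_Suc[of 0] q1 by simp
  have q3: "q (Suc (Suc (Suc 0))) = 135" using q_Suc_Suc[of 1] q1 q2 by simp
  note q = q1 q2 q3
  have s1: "1137 / 1000 \<le> sudler 1 bt \<and> sudler 1 bt \<le> 1138 / 1000"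
    by (rule sudler_step[where N = 0 and A = "1" and B = "1" and u = "1925 / 10000" and v = "1926 / 10000" and n = 0])
       (use bt in \<open>simp_all add: sudler_0 sin_low_def sin_up_def power_divide\<close>)
  have s2: "2127 / 1000 \<le> sudler 2 bt \<and> sudler 2 bt \<le> 2132 / 1000"
    by (rule sudler_step[where N = 1 and A = "1137 / 1000" and B = "1138 / 1000" and u = "3850 / 10000" and v = "3852 / 10000" and n = 0])
       (use bt s1 in \<open>simp_all add:  sin_low_def sin_up_def power_divide\<close>)
  have s3: "4127 / 1000 \<le> sudler 3 bt \<and> sudler 3 bt \<le> 4145 / 1000"
    by (rule sudler_step[where N = 2 and A = "2127 / 1000" and B = "2132 / 1000" and u = "4222 / 10000" and v = "4225 / 10000" and n = 1])
       (use bt s2 in \<open>simp_all add:  sin_low_def sin_up_def power_divide\<close>)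
  have s4: "5450 / 1000 \<le> sudler 4 bt \<and> sudler 4 bt \<le> 5483 / 1000"
    by (rule sudler_step[where N = 3 and A = "4127 / 1000" and B = "4145 / 1000" and u = "2296 / 10000" and v = "2300 / 10000" and n = 1])
       (use bt s3 in \<open>simp_all add:  sin_low_def sin_up_def power_divide\<close>)
  have s5: "1264 / 1000 \<le> sudler 5 bt \<and> sudler 5 bt \<le> 1289 / 1000"
    by (rule sudler_step[where N = 4 and A = "5450 / 1000" and B = "5483 / 1000" and u = "370 / 10000" and v = "375 / 10000" and n = 1])
       (use bt s4 in \<open>simp_all add:  sin_low_def sin_up_def power_divide\<close>)
  have p0: "1137 / 1000 \<le> p 0" unfolding p_eq_sudler using s1 by simp
  have p1: "126 / 100 \<le> p 1" "p 1 \<le> 129 / 100" unfolding p_eq_sudler using s5 by simp_all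
  have B: "shifts_prod 10 \<le> 98693 / 10000"
  proof (rule order_trans[OF shifts_prod_le[OF h(1)]])
    have "{..<5::nat} = {0, 1, 2, 3, 4}" by auto
    moreover have "{1..10::nat} = {1, 2, 3, 4, 5, 6, 7, 8, 9, 10}" by (rule set_eqI) (simp, presburger)
    ultimately show "(\<Prod>l<5. (1 + real l) * (\<Prod>m=1..10. 1 - real l * (1 + real l) / (zm_upper h m * (zm_upper h m + 1)))) \<le> 98693 / 10000"
      by (simp add: zm_upper_def h_def)
  qed
  have low1: "(1 + bt) * ln (122 / 100) \<le> ln (p (Suc j)) + bt * ln (p j)" if "1 \<le> j" for j
  proof (rule threshold_lower[where J = 1 and N = 0 and M = 10 and E = 1 and B = "98693 / 10000" and s = "117 / 1000", OF _ _ h(1,2) _ _ _ _ _ _ B])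
  qed (use that q in \<open>simp_all add: h_def power_divide\<close>)
  have up: "ln (p (Suc j)) + bt * ln (p j) \<le> (1 + bt) * ln (1363 / 1000)" if "1 \<le> j" for j
  proof (rule threshold_upper[where J = 1 and \<kappa> = 1 and s = "23 / 1000", OF l h(1,3) _ _ F_low_ge])
    have "{..<5::nat} = {0, 1, 2, 3, 4}" by auto
    then show "1 \<le> l\<^sup>2 * 1 * (\<Prod>k<5. (1 + real k) * (1 - (23 / 1000 * (1 + real k))\<^sup>2 / 6) * (1 - h * real k)) * (1363 / 1000) ^ 5"
      by (simp add: l_def h_def power2_eq_square power_divide)
  qed (use that q in \<open>simp_all add: h_def power_divide\<close>)
  have B': "shifts_prod 67 \<le> 885 / 100"
  proof -
    \<comment> \<open>\<open>40\<close> is the sum of \<open>l * (l + 1)\<close> over \<open>l < 5\<close>, and \<open>d\<close> an upper bound for \<open>lam\<close>.\<close>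
    define d :: real where "d = 53852 / 10000"
    have "lam \<le> d" using bt by (simp add: lam_eq d_def)
    then have "1 / d * (1 / (real (Suc 10) * d - 21 / 10) - 1 / (real (Suc 67) * d - 21 / 10))
        \<le> (\<Sum>m=Suc 10..67. 1 / (zm m * (zm m + 1)))"
      by (rule tail_sum_ge) (simp_all add: d_def)
    then have "2739 / 1000000 \<le> (\<Sum>m=Suc 10..67. 1 / (zm m * (zm m + 1)))"
      by (rule order_trans[rotated]) (simp add: d_def)
    then have "40 * (2739 / 1000000) \<le> 40 * (\<Sum>m=Suc 10..67. 1 / (zm m * (zm m + 1)))"
      by (rule mult_left_mono) simp
    moreover have "(\<Sum>l<5. real l * (1 + real l)) = 40"
    proof -
      have "{..<5::nat} = {0, 1, 2, 3, 4}" by auto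
      then show ?thesis by simp
    qed
    ultimately have "1095 / 10000 \<le> (\<Sum>l<5. real l * (1 + real l)) * (\<Sum>m=Suc 10..67. 1 / (zm m * (zm m + 1)))"
      by simp
    then have "shifts_prod 67 \<le> shifts_prod 10 / (1 + 1095 / 10000 + (1095 / 10000)\<^sup>2 / 2)"
      by (intro shifts_prod_tail) simp_all
    also have "\<dots> \<le> (98693 / 10000) / (1 + 1095 / 10000 + (1095 / 10000)\<^sup>2 / 2)"
      using B by (intro divide_right_mono) (simp_all add: power2_eq_square)
    also have "\<dots> \<le> 885 / 100" by (simp add: power2_eq_square)
    finally show ?thesis .
  qed
  have low2: "(1 + bt) * ln (12465 / 10000) \<le> ln (p (Suc j)) + bt * ln (p j)" if "Suc (Suc 0) \<le> j" for j
  proof (rule threshold_lower[where J = "Suc (Suc 0)" and N = 0 and M = 67 and E = 1 and B = "885 / 100" and s = "23 / 1000", OF _ _ h(1,2) _ _ _ _ _ _ B'])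
  qed (use that q in \<open>simp_all add: h_def power_divide\<close>)
  have p2: "12 / 10 \<le> p (Suc (Suc 0))" "p (Suc (Suc 0)) \<le> 142 / 100"
  proof -
    have "(12 / 10) + bt * (129 / 100 - 122 / 100) \<le> 122 / 100" using bt by simp
    then have start: "12 / 10 + bt * (129 / 100) \<le> (1 + bt) * (122 / 100)" by (simp add: algebra_simps)
    have "12 / 10 \<le> p (Suc 1)"
      by (rule p_ge_from_threshold[OF low1[OF order_refl] _ _ p1(2) start]) simp_all
    then show "12 / 10 \<le> p (Suc (Suc 0))" by simp
    have upper: "bt * ((1363 / 1000) / (126 / 100) - 1) \<le> 1 - (1363 / 1000) / (142 / 100)" using bt by simp
    have "p (Suc 1) \<le> 142 / 100"
      by (rule p_le_from_threshold[OF up[OF order_refl] _ p1(1) _ _ upper]) simp_all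
    then show "p (Suc (Suc 0)) \<le> 142 / 100" by simp
  qed
  have p_tail: "12 / 10 \<le> p j" if "Suc (Suc 0) \<le> j" for j
  proof (rule p_lower_bound[where X = "142 / 100", OF low2 up _ _ _ p2 _ _ that])
  qed (use bt in simp_all)
  have p_Suc_ge: "12 / 10 \<le> p (Suc j)" for j
    using p_tail[of "Suc j"] p1 by (cases j) simp_all
  have W: "143 / 100 \<le> p (Suc j) * p j" for j
  proof (cases j)
    case 0
    then show ?thesis using mult_mono[OF p1(1) p0] p_pos[of 1] by simp
  next
    case (Suc k)
    then show ?thesis using mult_mono[OF p_Suc_ge[of j] p_Suc_ge[of k]] p_pos[of "Suc j"] by simp
  qed
  have C: "12465 / 10000 \<le> C_const 5"
    by (rule p_limit_ge[OF low2 _ p_tendsto(3,2)]) simp_all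
  have c1: "c = 1 \<or> c = 2 \<or> c = 3 \<or> c = 4" if "1 \<le> c" "c < 5" for c :: nat using that by arith
  have c0: "c = 0 \<or> c = 1 \<or> c = 2 \<or> c = 3" if "c + 2 \<le> 5" for c :: nat using that by arith
  have ok: blocks_ok
  proof (rule blocks_ok_from_bounds[where i = "1137 / 1000" and I = "12 / 10" and W = "143 / 100" and a = "1152 / 1000" and Y = "86 / 100",
      OF _ less_imp_le[OF l(1)] l(2) h(1)])
    show "143 / 100 \<le> p (Suc j) * p j" for j by (rule W)
    have "96 / 100 \<le> sinc_ratio (Suc j)" for j
      by (rule order_trans[OF _ sinc_ratio_lower[OF less_imp_le[OF l(1)] l(2) h(1), of "489 / 1000"]]) (simp_all add: l_def h_def power_divide)
    then show "1152 / 1000 \<le> p (Suc j) * sinc_ratio (Suc j)" for j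
      using mult_mono[OF p_Suc_ge[of j], of "96 / 100" "sinc_ratio (Suc j)"] p_pos[of "Suc j"] by simp
    show "fits (1152 / 1000) (1137 / 1000) (143 / 100) l h (- h\<^sup>2) 0 c (12 / 10 * (1 - h\<^sup>2)) \<and> fits (1152 / 1000) (1137 / 1000) (143 / 100) l h 0 h c (12 / 10)"
      if "1 \<le> c" "c < 5" for c
      using c1[OF that] by (elim disjE) (simp_all add: fits_def gain_simps l_def h_def power_divide)
    show "\<exists>xl xh. xl \<le> x \<and> x \<le> xh \<and> fits (1152 / 1000) (1137 / 1000) (143 / 100) l h xl xh c 1"
      if c: "2 \<le> c" "c < 5" and x: "l - 1 \<le> x" "x \<le> - l\<^sup>2" for c x
    proof -
      have c': "c = 2 \<or> c = 3 \<or> c = 4" using c by arith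
      have f0: "fits (1152 / 1000) (1137 / 1000) (143 / 100) l h (l - 1) (- (55 / 100)) c 1"
        using c' by (elim disjE) (simp_all add: fits_def gain_simps l_def h_def power_divide)
      have f1: "fits (1152 / 1000) (1137 / 1000) (143 / 100) l h (- (55 / 100)) (- (29 / 100)) c 1"
        using c' by (elim disjE) (simp_all add: fits_def gain_simps l_def h_def power_divide)
      have f2: "fits (1152 / 1000) (1137 / 1000) (143 / 100) l h (- (29 / 100)) (- l\<^sup>2) c 1"
        using c' by (elim disjE) (simp_all add: fits_def gain_simps l_def h_def power_divide)
      show ?thesis using x f0 f1 f2 by (meson linear)
    qed
  qed (use p_Suc_ge p0 in \<open>auto simp: l_def h_def power_divide\<close>)
  show ?thesis
  proof (rule growth_from_bounds[where \<pi> = "1245 / 1000" and l = l and h = h, OF ok])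
    show "fits (1245 / 1000) (1245 / 1000) (1245 / 1000 * (1245 / 1000)) l h 0 0 c 1" if "1 \<le> c" "c < 5" for c
      using c1[OF that] by (elim disjE) (simp_all add: fits_def gain_simps l_def h_def power_divide)
    show "wins (1245 / 1000) l h (- (h ^ 4)) (h ^ 3) c (1245 / 1000 * (1 - h ^ 4)) (1 - h\<^sup>2)" if "1 \<le> c" "c < 5" for c
      using c1[OF that] by (elim disjE) (simp_all add: wins_def gain_simps l_def h_def power_divide)
    show "h * (h + real c) \<le> 1" if "c < 5" for c
    proof -
      have "h * (h + real c) \<le> h * (h + 4)" using that h_def by (intro mult_left_mono) auto
      then show ?thesis by (simp add: h_def)
    qed
    show "0 < 1 - real c * h - h\<^sup>2 \<and> 1 < topg (1245 / 1000) l h c * (1 - real c * h - h\<^sup>2)"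
      if "1 \<le> c" "c < 5" for c
      using c1[OF that] by (elim disjE) (simp_all add: topg_simps l_def h_def power_divide)
    show "0 < 1 - real c * h - (real c' + 1) * h\<^sup>2 \<and>
      wins (1245 / 1000) l h (- h\<^sup>2 - real c * h) (- l\<^sup>2 - real c * l) c'
        (topg (1245 / 1000) l h c * (1245 / 1000 * (1 + (- h\<^sup>2 - real c * h)))) (1 - real c * h - (real c' + 1) * h\<^sup>2)"
      if "c + 2 \<le> 5" "1 \<le> c'" "c' < 5" for c c'
      using c0[OF that(1)] c1[OF that(2,3)] by (elim disjE) (simp_all add: wins_def gain_simps topg_simps l_def h_def power_divide)
    show "0 < 1 - (real c + 1) * h \<and> - 1 \<le> - h\<^sup>2 - real c * h \<and> h * ((- l\<^sup>2 - real c * l) + real (5 - 1)) \<le> 1 \<and>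
      1 < topg (1245 / 1000) l h c * (1245 / 1000 * (1 + (- h\<^sup>2 - real c * h))) *
        gain (1245 / 1000) h (- h\<^sup>2 - real c * h) (- l\<^sup>2 - real c * l) (5 - 1) * (1245 / 1000) * (1 - (real c + 1) * h)"
      if "c + 2 \<le> 5" for c
      using c0[OF that] by (elim disjE) (simp_all add: gain_simps topg_simps l_def h_def power_divide)
  qed (use C l h  in \<open>simp_all add: l_def h_def power_divide\<close>)
qed

theorem theorem1:
  fixes b :: nat
  assumes "1 \<le> b" and "b \<le> 5"
  shows "convergent (C_partial b)
    \<and> liminf (\<lambda>N. ereal (sudler N (beta b))) = ereal (C_const b)
    \<and> (\<lambda>n. sudler (conv_den b n) (beta b)) \<longlonglongrightarrow> C_const b
    \<and> limsup (\<lambda>N. ereal (sudler N (beta b) / real N))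
          = ereal (sqrt (real b ^ 2 + 4) / (2 * pi) * C_const b)
    \<and> (\<lambda>n. sudler (conv_den b n - 1) (beta b) / real (conv_den b n - 1))
          \<longlonglongrightarrow> sqrt (real b ^ 2 + 4) / (2 * pi) * C_const b"
proof -
  interpret metallic b by unfold_locales (rule assms(1))
  have "b = 1 \<or> b = 2 \<or> b = 3 \<or> b = 4 \<or> b = 5" using assms by arith
  then have "growth b" using growth_1 growth_2 growth_3 growth_4 growth_5 by (elim disjE) simp_all
  moreover have "(\<lambda>n. sudler (conv_den b n) (beta b)) \<longlonglongrightarrow> C_const b"
    using p_tendsto(3) unfolding p_def bt_def q_def .
  moreover have "(\<lambda>n. sudler (conv_den b n - 1) (beta b) / real (conv_den b n - 1))
      \<longlonglongrightarrow> sqrt (real b ^ 2 + 4) / (2 * pi) * C_const b"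
    using sudler_pred_tendsto(2)[OF p_tendsto(3)] unfolding lam_def bt_def q_def .
  ultimately show ?thesis using p_tendsto(1) unfolding growth_def by blast
qed

end
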